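(* Let $T$ be an interval exchange map of restricted Roth type (in particular without connection), let $\Gamma_u(T)$ be a subspace of $\Gamma_\partial(T)$ supplementing $\Gamma_s(T)$ in $\Gamma_\partial(T)$ (i.e. $\Gamma_\partial(T)=\Gamma_s(T)\oplus\Gamma_u(T)$), and let $r>1$ be a real number. Let $L_0: C^r_0(\mathbf u(T))\to C^0([u_0(T),u_d(T)])$, $\varphi\mapsto\psi$, and $L_1: C^r_0(\mathbf u(T))\to \Gamma_u(T)$, $\varphi\mapsto\chi$, be the (uniquely determined) bounded linear operators such that every $\varphi\in C^r_0(\mathbf u(T))$ satisfies $$\varphi=\chi+\psi\circ T-\psi,\qquad \int_{u_0(T)}^{u_d(T)}\psi(x)\,dx=0 .$$ Then there exists $\bar\delta>0$, depending only on $r$ and on the constants $\theta$ and $\sigma$ attached to $T$, such that $L_0$ takes its values in the space $C^{\bar\delta}([u_0(T),u_d(T)])$ of Hölder continuous functions of exponent $\bar\delta$, and $L_0$ is bounded from $C^r_0(\mathbf u(T))$ to $C^{\bar\delta}([u_0(T),u_d(T)])$.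
   Context: **Interval exchange maps.** Let $\mathcal A$ be an alphabet with $d\ge 2$ symbols. An interval exchange map (i.e.m.) $T$ on a bounded open interval $I(T)$ is given by two partitions mod $0$, $I(T)=\bigsqcup_\alpha I^t_\alpha(T)=\bigsqcup_\alpha I^b_\alpha(T)$, into open intervals indexed by $\mathcal A$ with $|I^t_\alpha(T)|=|I^b_\alpha(T)|$; $T$ maps each $I^t_\alpha(T)$ onto $I^b_\alpha(T)$ by translation. Write $I(T)=(u_0(T),u_d(T))=(v_0(T),v_d(T))$; the points $u_1(T)<\dots<u_{d-1}(T)$ separating the $I^t_\alpha$ are the singularities of $T$, the points $v_1(T)<\dots<v_{d-1}(T)$ separating the $I^b_\alpha$ are those of $T^{-1}$. The combinatorial data $\pi=(\pi_t,\pi_b)$ are the bijections $\mathcal A\to\{1,\dots,d\}$ with $I^t_\alpha=(u_{\pi_t(\alpha)-1},u_{\pi_t(\alpha)})$, $I^b_\alpha=(v_{\pi_b(\alpha)-1},v_{\pi_b(\alpha)})$. They are always assumed irreducible: $\pi_t^{-1}(\{1,\dots,k\})\neq\pi_b^{-1}(\{1,\dots,k\})$ for $1\le k<d$. A connection is a triple $(u_i,v_j,m)$, $0<i,j<d$, $m\ge0$, with $T^m(v_j)=u_i$. Let $\Omega(\pi)$ be the antisymmetric matrix with $\Omega_{\alpha\beta}=+1$ if $\pi_t(\alpha)<\pi_t(\beta),\ \pi_b(\alpha)>\pi_b(\beta)$, $-1$ if $\pi_t(\alpha)>\pi_t(\beta),\ \pi_b(\alpha)<\pi_b(\beta)$,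 and $0$ otherwise; its rank is $2g$, where $g$ is called the genus. **Rauzy–Veech algorithm.** Let $T$ have no connection, and let $\pi_t(\alpha_t)=\pi_b(\alpha_b)=d$. The elementary step replaces $T$ by its first return map $\widehat T$ to $(u_0(T),\max(u_{d-1}(T),v_{d-1}(T)))$, again an i.e.m. without connection, labeled by $\mathcal A$ as follows. If $u_{d-1}<v_{d-1}$: $\widehat I^t_\alpha=I^t_\alpha$ for $\alpha\ne\alpha_t$, and $\widehat I^t_{\alpha_t}=I^t_{\alpha_t}\cap(u_0,v_{d-1})$. If $u_{d-1}>v_{d-1}$: $\widehat I^t_\alpha=I^t_\alpha$ for $\alpha\neq\alpha_t,\alpha_b$; $\widehat I^t_{\alpha_t}=T^{-1}(I^t_{\alpha_t})$ (the right part of $I^t_{\alpha_b}$), and $\widehat I^t_{\alpha_b}$ is the remaining left part of $I^t_{\alpha_b}$. Iterating from $T(0)=T$ gives i.e.m.'s $T(n)$, $n\ge0$, on decreasing intervals $I(n)=I(T(n))$ with the same left endpoint; for $n\ge m$, $T(n)$ is the first return map of $T(m)$ to $I(n)$. **Function spaces, special Birkhoff sums, cocycle.** For $r\ge0$, $C^r(\mathbf u(T))=\prod_{i=1}^dC^r([u_{i-1}(T),u_i(T)])$ with its product norm (for non-integer $r$, $C^r$ means $C^{\lfloor r\rfloor}$ with $\lfloor r\rfloor$-th derivative Hölder of exponent $r-\lfloor r\rfloor$). $\Gamma(T)\simeq\mathbb R^{\mathcal A}$ is the space of functions constant on each $I^t_\alpha(T)$. For $0\le m\le n$ and $\varphi\in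 C^0(\mathbf u(T(m)))$, the special Birkhoff sum is $S(m,n)\varphi(x)=\sum_{0\le j<r(x)}\varphi(T(m)^j(x))$, where $r(x)$ is the return time of $x$ to $I(n)$ under $T(m)$ (extended continuously to each closed interval), an element of $C^0(\mathbf u(T(n)))$. $S(m,n)$ maps $\Gamma(T(m))$ to $\Gamma(T(n))$; $B(m,n)$ is its matrix there: $B_{\alpha\beta}(m,n)$ is the number of visits of $I^t_\alpha(T(n))$ to $I^t_\beta(T(m))$ under $T(m)$ before returning to $I(n)$. Put $n_0=0$ and let $n_{k+1}$ be the smallest integer such that all coefficients of $B(n_k,n_{k+1})$ are positive. Norms: $\ell_\infty$ norm on $\mathbb R^{\mathcal A}$ and $\|B\|=\max_\alpha\sum_\beta|B_{\alpha\beta}|$. **Boundary operator.** On the $2d$-element set of symbols $\{U_0=V_0,U_1,V_1,\dots,U_{d-1},V_{d-1},U_d=V_d\}$ define the permutation $\sigma_\pi$ by $\sigma_\pi(U_i)=V_j$ with $\pi_b^{-1}(j+1)=\pi_t^{-1}(i+1)$ for $0\le i<d$, and $\sigma_\pi(V_{j'})=U_{i'}$ with $\pi_t^{-1}(i')=\pi_b^{-1}(j')$ for $0<j'\le d$. Let $\Sigma$ be the set of its cycles. For $\varphi\in C^0(\mathbf u(T))$ let $\varphi(u_i-0)$, $\varphi(u_i+0)$ be its values at $u_i$ seen in $[u_{i-1},u_i]$, resp. $[u_i,u_{i+1}]$, with $\varphi(u_0-0)=\varphi(u_d+0)=0$. The boundary operator $\partial:C^0(\mathbf u(T))\to\mathbb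 R^\Sigma$ is $(\partial\varphi)_C=\sum_{0\le i\le d,\,U_i\in C}(\varphi(u_i-0)-\varphi(u_i+0))$. $C^r_0(\mathbf u(T))$ is the kernel of $\partial$ in $C^r(\mathbf u(T))$, and $\Gamma_\partial(T)$ is the kernel of $\partial$ in $\Gamma(T)$ (it equals $\operatorname{Im}\Omega(\pi)$). **Restricted Roth type.** Let $T$ have no connection. $\Gamma_0(T)=\{\chi\in\Gamma(T):\int\chi=0\}$; $\Gamma_s(T)=\{\chi\in\Gamma(T):\exists\sigma>0,\ \|B(0,n)\chi\|=O(\|B(0,n)\|^{-\sigma})\}$, a subspace of $\Gamma_\partial(T)$; one fixes an exponent $\sigma>0$ which works for all $\chi\in\Gamma_s(T)$. $B(m,n)$ maps $\Gamma_s(T(m))$ onto $\Gamma_s(T(n))$; let $B_s(m,n):\Gamma_s(T(m))\to\Gamma_s(T(n))$ and $B_\flat(m,n):\Gamma(T(m))/\Gamma_s(T(m))\to\Gamma(T(n))/\Gamma_s(T(n))$ be the induced operators (induced and quotient norms). $T$ is of restricted Roth type if it has no connection and: (a) for all $\tau>0$, $\|B(n_k,n_{k+1})\|=O(\|B(0,n_k)\|^\tau)$; (b) there is $\theta>0$ with $\|B(0,n)|_{\Gamma_0(T)}\|=O(\|B(0,n)\|^{1-\theta})$ (such a $\theta$ is fixed); (c) for all $\tau>0$, $\|B_s(m,n)\|=O(\|B(0,n)\|^\tau)$ and $\|B_\flat(m,n)^{-1}\|=O(\|B(0,n)\|^\tau)$, uniformly in $0\le m\le n$; (d) $\dim\Gamma_s(T)=g$.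 **Known fact (Marmi–Moussa–Yoccoz).** For $T$ of restricted Roth type, $r>1$ and $\Gamma_u(T)$ as in the claim, bounded linear operators $L_0,L_1$ with the properties listed in the claim exist and are unique. *)

theory Defs
  imports
    "HOL-Analysis.Analysis"
    "HOL-Library.Function_Algebras"
    "HOL-Library.Landau_Symbols"
    "HOL-Combinatorics.Orbits"
begin

section \<open>Interval exchange maps\<close>

text \<open>
  The alphabet is a finite set \<^term>\<open>alphabet T\<close> of symbols. The intervals of the letter
  \<open>\<alpha>\<close> are given by their left endpoints and their common length: they are
  \<open>(top_left T \<alpha>, top_left T \<alpha> + width T \<alpha>)\<close> and \<open>(bot_left T \<alpha>, bot_left T \<alpha> + width T \<alpha>)\<close>.
  The values of these fields outside the alphabet are irrelevant.
\<close>

record 'a iem =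
  alphabet :: "'a set"
  left_end :: real
  right_end :: real
  top_left :: "'a \<Rightarrow> real"
  bot_left :: "'a \<Rightarrow> real"
  width :: "'a \<Rightarrow> real"

definition interval :: "('a \<Rightarrow> real) \<Rightarrow> ('a \<Rightarrow> real) \<Rightarrow> 'a \<Rightarrow> real set" where
  "interval l w \<alpha> = {l \<alpha><..<l \<alpha> + w \<alpha>}"

definition interval_partition ::
    "'a set \<Rightarrow> ('a \<Rightarrow> real) \<Rightarrow> ('a \<Rightarrow> real) \<Rightarrow> real \<Rightarrow> real \<Rightarrow> bool" where
  "interval_partition A l w a b \<longleftrightarrow>
     disjoint_family_on (interval l w) A \<and>
     (\<Union>\<alpha>\<in>A. interval l w \<alpha>) \<subseteq> {a<..<b} \<and>
     negligible ({a<..<b} - (\<Union>\<alpha>\<in>A. interval l w \<alpha>))"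

text \<open>Rank from left to right of the interval of a letter; this gives the bijections \<open>\<pi>\<^sub>t\<close>, \<open>\<pi>\<^sub>b\<close>.\<close>

definition position :: "'a set \<Rightarrow> ('a \<Rightarrow> real) \<Rightarrow> 'a \<Rightarrow> nat" where
  "position A l \<alpha> = card {\<beta> \<in> A. l \<beta> \<le> l \<alpha>}"

abbreviation nsym :: "'a iem \<Rightarrow> nat" where
  "nsym T \<equiv> card (alphabet T)"

definition pi_t :: "'a iem \<Rightarrow> 'a \<Rightarrow> nat" where
  "pi_t T = position (alphabet T) (top_left T)"

definition pi_b :: "'a iem \<Rightarrow> 'a \<Rightarrow> nat" where
  "pi_b T = position (alphabet T) (bot_left T)"

definition top_letter :: "'a iem \<Rightarrow> nat \<Rightarrow> 'a" where
  "top_letter T = inv_into (alphabet T) (pi_t T)"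

definition bot_letter :: "'a iem \<Rightarrow> nat \<Rightarrow> 'a" where
  "bot_letter T = inv_into (alphabet T) (pi_b T)"

definition u_pt :: "'a iem \<Rightarrow> nat \<Rightarrow> real" where
  "u_pt T i = (if i < nsym T then top_left T (top_letter T (Suc i)) else right_end T)"

definition v_pt :: "'a iem \<Rightarrow> nat \<Rightarrow> real" where
  "v_pt T j = (if j < nsym T then bot_left T (bot_letter T (Suc j)) else right_end T)"

abbreviation I_top :: "'a iem \<Rightarrow> 'a \<Rightarrow> real set" where
  "I_top T \<equiv> interval (top_left T) (width T)"

abbreviation I_bot :: "'a iem \<Rightarrow> 'a \<Rightarrow> real set" where
  "I_bot T \<equiv> interval (bot_left T) (width T)"

abbreviation base :: "'a iem \<Rightarrow> real set" where
  "base T \<equiv> {left_end T<..<right_end T}"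

definition partition_data :: "'a iem \<Rightarrow> bool" where
  "partition_data T \<longleftrightarrow>
     finite (alphabet T) \<and> 2 \<le> nsym T \<and> (\<forall>\<alpha>\<in>alphabet T. 0 < width T \<alpha>) \<and>
     interval_partition (alphabet T) (top_left T) (width T) (left_end T) (right_end T) \<and>
     interval_partition (alphabet T) (bot_left T) (width T) (left_end T) (right_end T)"

definition irreducible_data :: "'a iem \<Rightarrow> bool" where
  "irreducible_data T \<longleftrightarrow>
     (\<forall>k. 1 \<le> k \<and> k < nsym T \<longrightarrow>
        {\<alpha> \<in> alphabet T. pi_t T \<alpha> \<le> k} \<noteq> {\<alpha> \<in> alphabet T. pi_b T \<alpha> \<le> k})"

definition is_iem :: "'a iem \<Rightarrow> bool" where
  "is_iem T \<longleftrightarrow> partition_data T \<and> irreducible_data T"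

definition shift :: "'a iem \<Rightarrow> 'a \<Rightarrow> real" where
  "shift T \<alpha> = bot_left T \<alpha> - top_left T \<alpha>"

text \<open>
  The map is only defined on the open top intervals; as a total function it is the identity
  elsewhere. In particular it fixes the singularities \<open>u\<^sub>i\<close>, so an orbit that meets a singularity
  stays there and the connections are those of the partial map: if \<open>T\<^sup>m (v\<^sub>j) = u\<^sub>i\<close> for the total
  function, then \<open>T\<^sup>n (v\<^sub>j) = u\<^sub>i\<close> for the partial map with some \<open>n \<le> m\<close>.
\<close>

definition iem_map :: "'a iem \<Rightarrow> real \<Rightarrow> real" where
  "iem_map T x =
     (if \<exists>\<alpha>\<in>alphabet T. x \<in> I_top T \<alpha>
      then x + shift T (THE \<alpha>. \<alpha> \<in> alphabet T \<and> x \<in> I_top T \<alpha>) else x)"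

definition no_connection :: "'a iem \<Rightarrow> bool" where
  "no_connection T \<longleftrightarrow>
     \<not> (\<exists>i j m. 0 < i \<and> i < nsym T \<and> 0 < j \<and> j < nsym T \<and> (iem_map T ^^ m) (v_pt T j) = u_pt T i)"

section \<open>Rauzy--Veech algorithm\<close>

definition return_time :: "(real \<Rightarrow> real) \<Rightarrow> real set \<Rightarrow> real \<Rightarrow> nat" where
  "return_time f J x = (LEAST n. 0 < n \<and> (f ^^ n) x \<in> J)"

definition first_return :: "(real \<Rightarrow> real) \<Rightarrow> real set \<Rightarrow> real \<Rightarrow> real" where
  "first_return f J x = (f ^^ return_time f J x) x"

text \<open>
  Written on the endpoints and lengths; that this is the first return map to
  \<open>(u\<^sub>0, max u\<^sub>d\<^sub>-\<^sub>1 v\<^sub>d\<^sub>-\<^sub>1)\<close> with the usual labelling of its intervals is proved in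
  \<open>rauzy_step_spec\<close> below. The value in the case \<open>u\<^sub>d\<^sub>-\<^sub>1 = v\<^sub>d\<^sub>-\<^sub>1\<close> (a connection) is irrelevant.
\<close>

definition rauzy_step :: "'a iem \<Rightarrow> 'a iem" where
  "rauzy_step T =
     (let a\<^sub>t = top_letter T (nsym T); a\<^sub>b = bot_letter T (nsym T);
          u' = u_pt T (nsym T - 1); v' = v_pt T (nsym T - 1)
      in if u' < v'
         then T\<lparr>right_end := v',
                width := (width T)(a\<^sub>t := v' - top_left T a\<^sub>t),
                bot_left := (bot_left T)(a\<^sub>b := bot_left T a\<^sub>b + shift T a\<^sub>t)\<rparr>
         else T\<lparr>right_end := u',
                width := (width T)(a\<^sub>b := width T a\<^sub>b - width T a\<^sub>t),
                top_left := (top_left T)(a\<^sub>t := top_left T a\<^sub>t - shift T a\<^sub>b)\<rparr>)"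

definition rv :: "'a iem \<Rightarrow> nat \<Rightarrow> 'a iem" where
  "rv T n = (rauzy_step ^^ n) T"

text \<open>
  The remaining lemmas of this section verify the elementary step against its description by
  intervals and first returns.
\<close>

lemma last_interval:
  assumes P: "interval_partition A l w a b" and fin: "finite A" and ne: "A \<noteq> {}"
    and pos: "\<forall>\<alpha>\<in>A. 0 < w \<alpha>"
  defines "z \<equiv> inv_into A (position A l) (card A)"
  shows "z \<in> A" "position A l z = card A" "l z + w z = b"
    "\<And>\<alpha>. \<alpha> \<in> A \<Longrightarrow> \<alpha> \<noteq> z \<Longrightarrow> l \<alpha> + w \<alpha> \<le> l z"
    "\<And>\<alpha>. \<alpha> \<in> A \<Longrightarrow> \<alpha> \<noteq> z \<Longrightarrow> position A l \<alpha> < card A"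
proof -
  have w: "0 < w \<alpha>" if "\<alpha> \<in> A" for \<alpha> using pos that by blast
  obtain m where m: "m \<in> A" "\<And>\<beta>. \<beta> \<in> A \<Longrightarrow> l \<beta> \<le> l m"
  proof -
    have "Max (l ` A) \<in> l ` A" using fin ne by simp
    then obtain m where "m \<in> A" "Max (l ` A) = l m" by (rule imageE)
    then show ?thesis using that[of m] Max_ge[of "l ` A"] fin by auto
  qed
  then have "position A l m = card A"
    unfolding position_def by (intro arg_cong[where f = card]) auto
  then have img: "card A \<in> position A l ` A" using m(1) by force
  show zA: "z \<in> A" unfolding z_def by (rule inv_into_into[OF img])
  show posz: "position A l z = card A" unfolding z_def by (rule f_inv_into_f[OF img])
  have "{\<beta> \<in> A. l \<beta> \<le> l z} = A"
    using posz fin unfolding position_def by (intro card_subset_eq) auto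
  then have zmax: "l \<beta> \<le> l z" if "\<beta> \<in> A" for \<beta> using that by blast
  show le: "l \<alpha> + w \<alpha> \<le> l z" if "\<alpha> \<in> A" "\<alpha> \<noteq> z" for \<alpha>
  proof (rule ccontr)
    assume "\<not> ?thesis"
    then have "l z < min (l \<alpha> + w \<alpha>) (l z + w z)" using w[OF zA] by auto
    then obtain x where "l z < x" "x < min (l \<alpha> + w \<alpha>) (l z + w z)" using dense by blast
    then have "x \<in> interval l w \<alpha> \<inter> interval l w z"
      using zmax[OF that(1)] by (auto simp: interval_def)
    with P that zA show False by (auto simp: interval_partition_def disjoint_family_on_def)
  qed
  show "position A l \<alpha> < card A" if "\<alpha> \<in> A" "\<alpha> \<noteq> z" for \<alpha>
  proof -
    have "z \<notin> {\<beta> \<in> A. l \<beta> \<le> l \<alpha>}" using le[OF that] w[OF that(1)] by auto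
    then have "{\<beta> \<in> A. l \<beta> \<le> l \<alpha>} \<subset> A" using zA by auto
    then show ?thesis unfolding position_def using fin by (intro psubset_card_mono)
  qed
  have "l z + w z \<le> b"
  proof -
    have "{l z<..<l z + w z} \<subseteq> {a<..<b}"
      using P zA by (auto simp: interval_partition_def interval_def)
    then show ?thesis using w[OF zA] by (subst (asm) greaterThanLessThan_subseteq_greaterThanLessThan) auto
  qed
  moreover have "\<not> l z + w z < b"
  proof
    assume lt: "l z + w z < b"
    have "a \<le> l z"
    proof -
      have "{l z<..<l z + w z} \<subseteq> {a<..<b}"
        using P zA by (auto simp: interval_partition_def interval_def)
      then show ?thesis using w[OF zA] by (subst (asm) greaterThanLessThan_subseteq_greaterThanLessThan) auto
    qed
    have "{l z + w z<..<b} \<subseteq> {a<..<b} - (\<Union>\<alpha>\<in>A. interval l w \<alpha>)"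
    proof
      fix x assume x: "x \<in> {l z + w z<..<b}"
      have "x \<notin> interval l w \<alpha>" if "\<alpha> \<in> A" for \<alpha>
      proof (cases "\<alpha> = z")
        case True then show ?thesis using x by (auto simp: interval_def)
      next
        case False
        then show ?thesis using le[OF that] x w[OF zA] by (auto simp: interval_def)
      qed
      then show "x \<in> {a<..<b} - (\<Union>\<alpha>\<in>A. interval l w \<alpha>)"
        using x \<open>a \<le> l z\<close> w[OF zA] by auto
    qed
    then have "negligible {l z + w z<..<b}"
      using P negligible_subset unfolding interval_partition_def by blast
    then show False using lt open_not_negligible[of "{l z + w z<..<b}"] by auto
  qed
  ultimately show "l z + w z = b" by simp
qed

lemma interval_partition_left:
  assumes "interval_partition A l w a b" "\<alpha> \<in> A" "0 < w \<alpha>"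
  shows "a \<le> l \<alpha>"
proof -
  have "{l \<alpha><..<l \<alpha> + w \<alpha>} \<subseteq> {a<..<b}"
    using assms by (auto simp: interval_partition_def interval_def)
  then show ?thesis using assms(3)
    by (subst (asm) greaterThanLessThan_subseteq_greaterThanLessThan) auto
qed

text \<open>
  The letters \<open>z\<close> and \<open>y\<close> are those of the last intervals of two partitions, and the last
  interval of the first one is the longer one.
\<close>

lemma step_partition:
  assumes fin: "finite A" and pos: "\<forall>\<alpha>\<in>A. 0 < w \<alpha>"
    and P: "interval_partition A l w a b" and Q: "interval_partition A m w a b"
    and zy: "z \<in> A" "y \<in> A" "z \<noteq> y"
    and z': "l z + w z = b" "\<forall>\<alpha>\<in>A. \<alpha> \<noteq> z \<longrightarrow> l \<alpha> + w \<alpha> \<le> l z"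
    and y': "m y + w y = b" "\<forall>\<alpha>\<in>A. \<alpha> \<noteq> y \<longrightarrow> m \<alpha> + w \<alpha> \<le> m y"
    and lt: "l z < m y"
  defines "w' \<equiv> w(z := m y - l z)" and "m' \<equiv> m(y := m y + (m z - l z))"
  shows "interval_partition A l w' a (m y)" "interval_partition A m' w' a (m y)"
    "\<And>\<alpha>. \<alpha> \<in> A \<Longrightarrow> 0 < w' \<alpha>"
proof -
  have w: "0 < w \<alpha>" if "\<alpha> \<in> A" for \<alpha> using pos that by blast
  have z: "l z + w z = b" "\<And>\<alpha>. \<alpha> \<in> A \<Longrightarrow> \<alpha> \<noteq> z \<Longrightarrow> l \<alpha> + w \<alpha> \<le> l z"
    using z' by auto
  have y: "m y + w y = b" "\<And>\<alpha>. \<alpha> \<in> A \<Longrightarrow> \<alpha> \<noteq> y \<Longrightarrow> m \<alpha> + w \<alpha> \<le> m y"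
    using y' by auto
  have dP: "interval l w \<alpha> \<inter> interval l w \<beta> = {}" if "\<alpha> \<in> A" "\<beta> \<in> A" "\<alpha> \<noteq> \<beta>" for \<alpha> \<beta>
    using P that by (auto simp: interval_partition_def disjoint_family_on_def)
  have dQ: "interval m w \<alpha> \<inter> interval m w \<beta> = {}" if "\<alpha> \<in> A" "\<beta> \<in> A" "\<alpha> \<noteq> \<beta>" for \<alpha> \<beta>
    using Q that by (auto simp: interval_partition_def disjoint_family_on_def)
  have aP: "a \<le> l \<alpha>" and aQ: "a \<le> m \<alpha>" if "\<alpha> \<in> A" for \<alpha>
    using interval_partition_left[OF P that w[OF that]] interval_partition_left[OF Q that w[OF that]]
    by auto
  have wy: "w y > 0" and wz: "w z > 0" using w zy by auto
  have w'z: "w' z = w z - w y" using z(1) y(1) by (simp add: w'_def)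
  show "0 < w' \<alpha>" if "\<alpha> \<in> A" for \<alpha> using that w lt by (auto simp: w'_def)
  have sub: "interval l w' \<alpha> \<subseteq> interval l w \<alpha>" for \<alpha>
    using w'z wy by (auto simp: interval_def w'_def)
  show "interval_partition A l w' a (m y)"
    unfolding interval_partition_def
  proof (intro conjI)
    show "disjoint_family_on (interval l w') A"
      unfolding disjoint_family_on_def using dP sub by blast
    show "(\<Union>\<alpha>\<in>A. interval l w' \<alpha>) \<subseteq> {a<..<m y}"
    proof safe
      fix \<alpha> x assume "\<alpha> \<in> A" "x \<in> interval l w' \<alpha>"
      then show "x \<in> {a<..<m y}"
        using aP[of \<alpha>] z(2)[of \<alpha>] lt by (cases "\<alpha> = z") (auto simp: interval_def w'_def)
    qed
    have "{a<..<m y} - (\<Union>\<alpha>\<in>A. interval l w' \<alpha>) \<subseteq> {a<..<b} - (\<Union>\<alpha>\<in>A. interval l w \<alpha>)"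
    proof
      fix x assume x: "x \<in> {a<..<m y} - (\<Union>\<alpha>\<in>A. interval l w' \<alpha>)"
      have "x \<notin> interval l w \<alpha>" if "\<alpha> \<in> A" for \<alpha>
      proof
        assume "x \<in> interval l w \<alpha>"
        then have "x \<in> interval l w' \<alpha>"
          using x by (cases "\<alpha> = z") (auto simp: interval_def w'_def)
        with x that show False by auto
      qed
      then show "x \<in> {a<..<b} - (\<Union>\<alpha>\<in>A. interval l w \<alpha>)" using x y(1) wy by auto
    qed
    then show "negligible ({a<..<m y} - (\<Union>\<alpha>\<in>A. interval l w' \<alpha>))"
      using P negligible_subset unfolding interval_partition_def by blast
  qed
  let ?c = "m z + (m y - l z)"
  have iy: "interval m' w' y = {?c<..<m z + w z}"
    using zy(3) z(1) y(1) by (auto simp: interval_def m'_def w'_def)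
  have iz: "interval m' w' z = {m z<..<?c}"
    using zy(3) by (auto simp: interval_def m'_def w'_def)
  have io: "interval m' w' \<alpha> = interval m w \<alpha>" if "\<alpha> \<noteq> z" "\<alpha> \<noteq> y" for \<alpha>
    using that by (auto simp: interval_def m'_def w'_def)
  have c: "m z < ?c" "?c < m z + w z" using lt w'z wy by (auto simp: w'_def)
  have suby: "interval m' w' y \<subseteq> interval m w z" and subz: "interval m' w' z \<subseteq> interval m w z"
    unfolding iy iz using c by (auto simp: interval_def)
  define f where "f \<alpha> = (if \<alpha> = y then z else \<alpha>)" for \<alpha>
  have subf: "interval m' w' \<alpha> \<subseteq> interval m w (f \<alpha>)" for \<alpha>
    using suby subz io[of \<alpha>] by (auto simp: f_def)
  show "interval_partition A m' w' a (m y)"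
    unfolding interval_partition_def
  proof (intro conjI)
    show "disjoint_family_on (interval m' w') A"
      unfolding disjoint_family_on_def
    proof (intro ballI impI)
      fix \<alpha> \<beta> assume *: "\<alpha> \<in> A" "\<beta> \<in> A" "\<alpha> \<noteq> \<beta>"
      show "interval m' w' \<alpha> \<inter> interval m' w' \<beta> = {}"
      proof (cases "f \<alpha> = f \<beta>")
        case True
        then have "{\<alpha>, \<beta>} = {y, z}" using *(3) by (auto simp: f_def split: if_splits)
        then have "(\<alpha> = y \<and> \<beta> = z) \<or> (\<alpha> = z \<and> \<beta> = y)" by (auto simp: doubleton_eq_iff)
        then show ?thesis using iy iz by auto
      next
        case False
        have "f \<alpha> \<in> A" "f \<beta> \<in> A" using * zy by (auto simp: f_def)
        then show ?thesis using dQ[of "f \<alpha>" "f \<beta>"] False subf[of \<alpha>] subf[of \<beta>] by blast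
      qed
    qed
    have fy: "f \<alpha> \<noteq> y" for \<alpha> using zy by (auto simp: f_def)
    show "(\<Union>\<alpha>\<in>A. interval m' w' \<alpha>) \<subseteq> {a<..<m y}"
    proof safe
      fix \<alpha> x assume "\<alpha> \<in> A" "x \<in> interval m' w' \<alpha>"
      then have "f \<alpha> \<in> A" "x \<in> interval m w (f \<alpha>)" using subf[of \<alpha>] zy by (auto simp: f_def split: if_splits)
      then show "x \<in> {a<..<m y}"
        using aQ[of "f \<alpha>"] y(2)[of "f \<alpha>"] fy by (auto simp: interval_def)
    qed
    have "{a<..<m y} - (\<Union>\<alpha>\<in>A. interval m' w' \<alpha>)
        \<subseteq> ({a<..<b} - (\<Union>\<alpha>\<in>A. interval m w \<alpha>)) \<union> {?c}"
    proof
      fix x assume x: "x \<in> {a<..<m y} - (\<Union>\<alpha>\<in>A. interval m' w' \<alpha>)"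
      have "x \<notin> interval m w \<alpha>" if "\<alpha> \<in> A" "x \<noteq> ?c" for \<alpha>
      proof
        assume al: "x \<in> interval m w \<alpha>"
        have "\<alpha> \<noteq> y" using x al by (auto simp: interval_def)
        then have "\<alpha> = z" using io[of \<alpha>] al x that by auto
        then have "x \<in> {m z<..<m z + w z}" using al by (simp add: interval_def)
        then have "x \<in> interval m' w' y \<or> x \<in> interval m' w' z"
          using that(2) unfolding iy iz by auto
        then show False using x zy by auto
      qed
      then show "x \<in> ({a<..<b} - (\<Union>\<alpha>\<in>A. interval m w \<alpha>)) \<union> {?c}"
        using x y(1) wy by auto
    qed
    moreover have "negligible (({a<..<b} - (\<Union>\<alpha>\<in>A. interval m w \<alpha>)) \<union> {?c})"
      using Q unfolding interval_partition_def by (intro negligible_Un) auto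
    ultimately show "negligible ({a<..<m y} - (\<Union>\<alpha>\<in>A. interval m' w' \<alpha>))"
      using negligible_subset by blast
  qed
qed

lemma iem_map_eq:
  assumes "partition_data T" "\<alpha> \<in> alphabet T" "x \<in> I_top T \<alpha>"
  shows "iem_map T x = x + shift T \<alpha>"
proof -
  have "(THE \<alpha>. \<alpha> \<in> alphabet T \<and> x \<in> I_top T \<alpha>) = \<alpha>"
    using assms
    by (intro the_equality)
       (auto simp: partition_data_def interval_partition_def disjoint_family_on_def)
  then show ?thesis using assms by (auto simp: iem_map_def)
qed

lemma first_return_1:
  assumes "f x \<in> J" shows "first_return f J x = f x"
proof -
  have "return_time f J x = 1"
    unfolding return_time_def using assms by (intro Least_equality) auto
  then show ?thesis by (simp add: first_return_def)
qed

lemma first_return_2: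
  assumes "f x \<notin> J" "f (f x) \<in> J" shows "first_return f J x = f (f x)"
proof -
  have "return_time f J x = 2"
    unfolding return_time_def
  proof (rule Least_equality)
    show "0 < (2::nat) \<and> (f ^^ 2) x \<in> J" using assms(2) by (simp add: numeral_2_eq_2)
    fix n assume n: "0 < n \<and> (f ^^ n) x \<in> J"
    show "2 \<le> n"
    proof (rule ccontr)
      assume "\<not> 2 \<le> n"
      with n have "n = 1" by auto
      with n assms(1) show False by simp
    qed
  qed
  then show ?thesis by (simp add: first_return_def numeral_2_eq_2)
qed

lemma rauzy_step_spec:
  fixes T :: "'a iem"
  defines "T' \<equiv> rauzy_step T"
    and "a\<^sub>t \<equiv> top_letter T (nsym T)" and "a\<^sub>b \<equiv> bot_letter T (nsym T)"
    and "u' \<equiv> u_pt T (nsym T - 1)" and "v' \<equiv> v_pt T (nsym T - 1)"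
  assumes T: "is_iem T" and ne: "u' \<noteq> v'"
  shows "partition_data T'" "alphabet T' = alphabet T"
    "base T' = {left_end T<..<max u' v'}"
    "\<And>\<alpha>. u' < v' \<Longrightarrow> \<alpha> \<noteq> a\<^sub>t \<Longrightarrow> I_top T' \<alpha> = I_top T \<alpha>"
    "u' < v' \<Longrightarrow> I_top T' a\<^sub>t = I_top T a\<^sub>t \<inter> {left_end T<..<v'}"
    "\<And>\<alpha>. u' > v' \<Longrightarrow> \<alpha> \<noteq> a\<^sub>t \<Longrightarrow> \<alpha> \<noteq> a\<^sub>b \<Longrightarrow> I_top T' \<alpha> = I_top T \<alpha>"
    "u' > v' \<Longrightarrow> I_top T' a\<^sub>t = {x \<in> I_top T a\<^sub>b. iem_map T x \<in> I_top T a\<^sub>t}"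
    "u' > v' \<Longrightarrow> I_top T' a\<^sub>b = {top_left T a\<^sub>b<..<top_left T' a\<^sub>t}"
    "\<And>\<alpha> x. \<alpha> \<in> alphabet T \<Longrightarrow> x \<in> I_top T' \<alpha> \<Longrightarrow>
       iem_map T' x = first_return (iem_map T) (base T') x"
proof -
  let ?A = "alphabet T"
  let ?l = "top_left T" and ?m = "bot_left T" and ?w = "width T"
  have PD: "partition_data T" and irr: "irreducible_data T" using T by (auto simp: is_iem_def)
  have fin: "finite ?A" and d2: "2 \<le> nsym T" and w: "\<And>\<alpha>. \<alpha> \<in> ?A \<Longrightarrow> 0 < ?w \<alpha>"
    and P: "interval_partition ?A ?l ?w (left_end T) (right_end T)"
    and Q: "interval_partition ?A ?m ?w (left_end T) (right_end T)"
    using PD by (auto simp: partition_data_def)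
  have w': "\<forall>\<alpha>\<in>?A. 0 < ?w \<alpha>" using w by blast
  have neA: "?A \<noteq> {}" using d2 by auto
  note lt = last_interval[OF P fin neA w', folded pi_t_def top_letter_def, folded a\<^sub>t_def]
  note lb = last_interval[OF Q fin neA w', folded pi_b_def bot_letter_def, folded a\<^sub>b_def]
  have u': "u' = ?l a\<^sub>t" using d2 by (simp add: u'_def u_pt_def a\<^sub>t_def)
  have v': "v' = ?m a\<^sub>b" using d2 by (simp add: v'_def v_pt_def a\<^sub>b_def)
  have lt4: "\<forall>\<alpha>\<in>?A. \<alpha> \<noteq> a\<^sub>t \<longrightarrow> ?l \<alpha> + ?w \<alpha> \<le> ?l a\<^sub>t" using lt(4) by blast
  have lb4: "\<forall>\<alpha>\<in>?A. \<alpha> \<noteq> a\<^sub>b \<longrightarrow> ?m \<alpha> + ?w \<alpha> \<le> ?m a\<^sub>b" using lb(4) by blast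
  have neq: "a\<^sub>t \<noteq> a\<^sub>b"
  proof
    assume eq: "a\<^sub>t = a\<^sub>b"
    have "pi_t T \<alpha> \<le> nsym T - 1 \<longleftrightarrow> pi_b T \<alpha> \<le> nsym T - 1" if "\<alpha> \<in> ?A" for \<alpha>
      using lt(2) lb(2) lt(5)[OF that] lb(5)[OF that] d2 eq by (cases "\<alpha> = a\<^sub>t") auto
    then have "{\<alpha> \<in> ?A. pi_t T \<alpha> \<le> nsym T - 1} = {\<alpha> \<in> ?A. pi_b T \<alpha> \<le> nsym T - 1}" by auto
    moreover have "1 \<le> nsym T - 1 \<and> nsym T - 1 < nsym T" using d2 by auto
    ultimately show False using irr unfolding irreducible_data_def by blast
  qed
  have wt: "?w a\<^sub>t > 0" and wb: "?w a\<^sub>b > 0" using w lt(1) lb(1) by auto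
  have al: "left_end T \<le> ?l \<alpha>" if "\<alpha> \<in> ?A" for \<alpha>
    by (rule interval_partition_left[OF P that w[OF that]])
  have *: "partition_data T' \<and> alphabet T' = alphabet T \<and> base T' = {left_end T<..<max u' v'} \<and>
    (\<forall>\<alpha>. u' < v' \<longrightarrow> \<alpha> \<noteq> a\<^sub>t \<longrightarrow> I_top T' \<alpha> = I_top T \<alpha>) \<and>
    (u' < v' \<longrightarrow> I_top T' a\<^sub>t = I_top T a\<^sub>t \<inter> {left_end T<..<v'}) \<and>
    (\<forall>\<alpha>. u' > v' \<longrightarrow> \<alpha> \<noteq> a\<^sub>t \<longrightarrow> \<alpha> \<noteq> a\<^sub>b \<longrightarrow> I_top T' \<alpha> = I_top T \<alpha>) \<and>
    (u' > v' \<longrightarrow> I_top T' a\<^sub>t = {x \<in> I_top T a\<^sub>b. iem_map T x \<in> I_top T a\<^sub>t}) \<and>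
    (u' > v' \<longrightarrow> I_top T' a\<^sub>b = {top_left T a\<^sub>b<..<top_left T' a\<^sub>t}) \<and>
    (\<forall>\<alpha> x. \<alpha> \<in> alphabet T \<longrightarrow> x \<in> I_top T' \<alpha> \<longrightarrow>
       iem_map T' x = first_return (iem_map T) (base T') x)"
  proof (cases "u' < v'")
    case True
    then have lm: "?l a\<^sub>t < ?m a\<^sub>b" by (simp add: u' v')
    have T': "T' = T\<lparr>right_end := v', width := ?w(a\<^sub>t := v' - ?l a\<^sub>t),
                bot_left := ?m(a\<^sub>b := ?m a\<^sub>b + shift T a\<^sub>t)\<rparr>"
      using True unfolding T'_def rauzy_step_def Let_def u'_def v'_def a\<^sub>t_def a\<^sub>b_def by simp
    note sp = step_partition[OF fin w' P Q lt(1) lb(1) neq lt(3) lt4 lb(3) lb4 lm]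
    have PD': "partition_data T'"
      unfolding partition_data_def using sp fin d2 by (simp add: T' v' shift_def)
    have tops: "I_top T' \<alpha> \<subseteq> I_top T \<alpha>" for \<alpha>
      using lm lt(3) lb(3) wb by (auto simp: T' v' interval_def)
    have ret: "iem_map T' x = first_return (iem_map T) (base T') x"
      if a: "\<alpha> \<in> ?A" and x: "x \<in> I_top T' \<alpha>" for \<alpha> x
    proof -
      have e': "iem_map T' x = x + shift T' \<alpha>" using iem_map_eq[OF PD' _ x] a by (simp add: T')
      have e: "iem_map T x = x + shift T \<alpha>" using iem_map_eq[OF PD a] tops x by blast
      have "x + shift T' \<alpha> \<in> I_bot T' \<alpha>" using x by (auto simp: interval_def shift_def)
      then have inb: "iem_map T' x \<in> base T'"
        using PD' a e' unfolding partition_data_def interval_partition_def by (auto simp: T')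
      show ?thesis
      proof (cases "\<alpha> = a\<^sub>b")
        case False
        then have "shift T' \<alpha> = shift T \<alpha>" by (simp add: T' shift_def)
        then show ?thesis using first_return_1[of "iem_map T" x "base T'"] e e' inb by simp
      next
        case True
        have "iem_map T x \<in> I_bot T a\<^sub>b"
          using subsetD[OF tops x] True unfolding e by (auto simp: interval_def shift_def)
        then have b: "v' < iem_map T x" "iem_map T x < right_end T"
          using lb(3) by (auto simp: interval_def v')
        then have "iem_map T x \<in> I_top T a\<^sub>t" using lm lt(3) v' by (auto simp: interval_def)
        then have "iem_map T (iem_map T x) = iem_map T x + shift T a\<^sub>t"
          by (rule iem_map_eq[OF PD lt(1)])
        also have "\<dots> = iem_map T' x" unfolding e e' using True by (simp add: T' shift_def)
        finally have e2: "iem_map T (iem_map T x) = iem_map T' x" .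
        have "iem_map T x \<notin> base T'" using b by (simp add: T')
        then show ?thesis using first_return_2[of "iem_map T" x "base T'"] e2 inb by simp
      qed
    qed
    have i2: "I_top T' a\<^sub>t = I_top T a\<^sub>t \<inter> {left_end T<..<v'}"
      using lt(3) lb(3) wb al[OF lt(1)] by (auto simp: T' interval_def v')
    show ?thesis
      using PD' ret i2 True by (auto simp: T' interval_def)
  next
    case False
    then have vu: "v' < u'" using ne by simp
    then have lm: "?m a\<^sub>b < ?l a\<^sub>t" by (simp add: u' v')
    have wd: "?w a\<^sub>b - ?w a\<^sub>t = ?l a\<^sub>t - ?m a\<^sub>b" using lt(3) lb(3) by simp
    have T': "T' = T\<lparr>right_end := u', width := ?w(a\<^sub>b := ?l a\<^sub>t - ?m a\<^sub>b),
                top_left := ?l(a\<^sub>t := ?l a\<^sub>t + (?l a\<^sub>b - ?m a\<^sub>b))\<rparr>"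
      using False unfolding T'_def rauzy_step_def Let_def u'_def v'_def
      by (simp add: a\<^sub>t_def[symmetric] a\<^sub>b_def[symmetric] wd shift_def algebra_simps)
    note sp = step_partition[OF fin w' Q P lb(1) lt(1) neq[symmetric] lb(3) lb4 lt(3) lt4 lm]
    have PD': "partition_data T'"
      unfolding partition_data_def using sp fin d2 by (simp add: T' u')
    have tops: "I_top T' \<alpha> \<subseteq> I_top T \<alpha>" if "\<alpha> \<noteq> a\<^sub>t" for \<alpha>
      using that lm wd wt by (auto simp: T' interval_def)
    have topt: "I_top T' a\<^sub>t = {?l a\<^sub>t - shift T a\<^sub>b<..<?l a\<^sub>b + ?w a\<^sub>b}"
      using neq wd by (auto simp: T' interval_def shift_def)
    have topt_sub: "I_top T' a\<^sub>t \<subseteq> I_top T a\<^sub>b"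
      unfolding topt using lm by (auto simp: interval_def shift_def)
    have img: "iem_map T x = x + shift T a\<^sub>b" if "x \<in> I_top T a\<^sub>b" for x
      using iem_map_eq[OF PD lb(1) that] .
    have ret: "iem_map T' x = first_return (iem_map T) (base T') x"
      if a: "\<alpha> \<in> ?A" and x: "x \<in> I_top T' \<alpha>" for \<alpha> x
    proof -
      have e': "iem_map T' x = x + shift T' \<alpha>" using iem_map_eq[OF PD' _ x] a by (simp add: T')
      have "x + shift T' \<alpha> \<in> I_bot T' \<alpha>" using x by (auto simp: interval_def shift_def)
      then have inb: "iem_map T' x \<in> base T'"
        using PD' a e' unfolding partition_data_def interval_partition_def by (auto simp: T')
      show ?thesis
      proof (cases "\<alpha> = a\<^sub>t")
        case False
        then have "x \<in> I_top T \<alpha>" using tops x by blast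
        then have e: "iem_map T x = x + shift T \<alpha>" by (rule iem_map_eq[OF PD a])
        from False have "shift T' \<alpha> = shift T \<alpha>" by (simp add: T' shift_def)
        then show ?thesis using first_return_1[of "iem_map T" x "base T'"] e e' inb by simp
      next
        case True
        then have xb: "x \<in> I_top T' a\<^sub>t" using x by simp
        then have e: "iem_map T x = x + shift T a\<^sub>b" using img topt_sub by blast
        have b: "iem_map T x \<in> I_top T a\<^sub>t"
          using xb lt(3) lb(3) unfolding topt e by (auto simp: interval_def shift_def)
        then have "iem_map T (iem_map T x) = iem_map T x + shift T a\<^sub>t"
          by (rule iem_map_eq[OF PD lt(1)])
        also have "\<dots> = iem_map T' x" unfolding e e' using True neq by (simp add: T' shift_def)
        finally have e2: "iem_map T (iem_map T x) = iem_map T' x" .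
        have "iem_map T x \<notin> base T'" using b by (simp add: T' u' interval_def)
        then show ?thesis using first_return_2[of "iem_map T" x "base T'"] e2 inb by simp
      qed
    qed
    have i3: "I_top T' a\<^sub>t = {x \<in> I_top T a\<^sub>b. iem_map T x \<in> I_top T a\<^sub>t}"
    proof safe
      fix x assume x: "x \<in> I_top T' a\<^sub>t"
      show "x \<in> I_top T a\<^sub>b" using x topt_sub by blast
      then show "iem_map T x \<in> I_top T a\<^sub>t"
        using x lt(3) lb(3) img unfolding topt by (auto simp: interval_def shift_def)
    next
      fix x assume "x \<in> I_top T a\<^sub>b" "iem_map T x \<in> I_top T a\<^sub>t"
      then show "x \<in> I_top T' a\<^sub>t" unfolding topt using img by (auto simp: interval_def)
    qed
    have i4: "I_top T' a\<^sub>b = {?l a\<^sub>b<..<top_left T' a\<^sub>t}"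
      using neq by (auto simp: T' interval_def)
    have i1: "I_top T' \<alpha> = I_top T \<alpha>" if "\<alpha> \<noteq> a\<^sub>t" "\<alpha> \<noteq> a\<^sub>b" for \<alpha>
      using that by (auto simp: T' interval_def)
    have bs: "alphabet T' = ?A" "base T' = {left_end T<..<max u' v'}"
      using vu by (auto simp: T')
    show ?thesis using PD' ret i1 i3 i4 bs False by simp
  qed
  show "partition_data T'" "alphabet T' = alphabet T" "base T' = {left_end T<..<max u' v'}"
    "\<And>\<alpha>. u' < v' \<Longrightarrow> \<alpha> \<noteq> a\<^sub>t \<Longrightarrow> I_top T' \<alpha> = I_top T \<alpha>"
    "u' < v' \<Longrightarrow> I_top T' a\<^sub>t = I_top T a\<^sub>t \<inter> {left_end T<..<v'}"
    "\<And>\<alpha>. u' > v' \<Longrightarrow> \<alpha> \<noteq> a\<^sub>t \<Longrightarrow> \<alpha> \<noteq> a\<^sub>b \<Longrightarrow> I_top T' \<alpha> = I_top T \<alpha>"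
    "u' > v' \<Longrightarrow> I_top T' a\<^sub>t = {x \<in> I_top T a\<^sub>b. iem_map T x \<in> I_top T a\<^sub>t}"
    "u' > v' \<Longrightarrow> I_top T' a\<^sub>b = {top_left T a\<^sub>b<..<top_left T' a\<^sub>t}"
    "\<And>\<alpha> x. \<alpha> \<in> alphabet T \<Longrightarrow> x \<in> I_top T' \<alpha> \<Longrightarrow>
       iem_map T' x = first_return (iem_map T) (base T') x"
    using * by blast+
qed

section \<open>The cocycle\<close>

text \<open>
  \<open>\<Gamma>(T) \<simeq> \<real>\<^sup>\<A>\<close>: vectors are functions on symbols that vanish outside the alphabet.
\<close>

definition fscale :: "real \<Rightarrow> ('a \<Rightarrow> real) \<Rightarrow> 'a \<Rightarrow> real" where
  "fscale c \<xi> = (\<lambda>\<alpha>. c * \<xi> \<alpha>)"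

interpretation fvec: vector_space fscale
  by unfold_locales (auto simp: fscale_def fun_eq_iff algebra_simps)

definition Gam :: "'a iem \<Rightarrow> ('a \<Rightarrow> real) set" where
  "Gam T = {\<xi>. \<forall>\<alpha>. \<alpha> \<notin> alphabet T \<longrightarrow> \<xi> \<alpha> = 0}"

definition vnorm :: "'a set \<Rightarrow> ('a \<Rightarrow> real) \<Rightarrow> real" where
  "vnorm A \<xi> = Max ((\<lambda>\<alpha>. \<bar>\<xi> \<alpha>\<bar>) ` A)"

definition mnorm :: "'a set \<Rightarrow> ('a \<Rightarrow> 'a \<Rightarrow> real) \<Rightarrow> real" where
  "mnorm A B = Max ((\<lambda>\<alpha>. \<Sum>\<beta>\<in>A. \<bar>B \<alpha> \<beta>\<bar>) ` A)"

definition mat_vec :: "'a set \<Rightarrow> ('a \<Rightarrow> 'a \<Rightarrow> real) \<Rightarrow> ('a \<Rightarrow> real) \<Rightarrow> 'a \<Rightarrow> real" where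
  "mat_vec A B \<xi> = (\<lambda>\<alpha>. if \<alpha> \<in> A then \<Sum>\<beta>\<in>A. B \<alpha> \<beta> * \<xi> \<beta> else 0)"

text \<open>
  Number of visits of \<open>I\<^sup>t\<^sub>\<alpha>(T')\<close> to \<open>I\<^sup>t\<^sub>\<beta>(T)\<close> under \<open>T\<close> before the return to \<open>I(T')\<close>; it does not
  depend on the point of \<open>I\<^sup>t\<^sub>\<alpha>(T')\<close> when \<open>T'\<close> is obtained from \<open>T\<close> by the algorithm.
\<close>

definition visits :: "'a iem \<Rightarrow> 'a iem \<Rightarrow> 'a \<Rightarrow> 'a \<Rightarrow> nat" where
  "visits T T' \<alpha> \<beta> =
     (THE N. \<forall>x\<in>I_top T' \<alpha>.
        N = card {j. j < return_time (iem_map T) (base T') x \<and> (iem_map T ^^ j) x \<in> I_top T \<beta>})"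

definition Bmat :: "'a iem \<Rightarrow> nat \<Rightarrow> nat \<Rightarrow> 'a \<Rightarrow> 'a \<Rightarrow> real" where
  "Bmat T m n \<alpha> \<beta> = real (visits (rv T m) (rv T n) \<alpha> \<beta>)"

definition B_norm :: "'a iem \<Rightarrow> nat \<Rightarrow> nat \<Rightarrow> real" where
  "B_norm T m n = mnorm (alphabet T) (Bmat T m n)"

definition B_op :: "'a iem \<Rightarrow> nat \<Rightarrow> nat \<Rightarrow> ('a \<Rightarrow> real) \<Rightarrow> 'a \<Rightarrow> real" where
  "B_op T m n = mat_vec (alphabet T) (Bmat T m n)"

primrec n_seq :: "'a iem \<Rightarrow> nat \<Rightarrow> nat" where
  "n_seq T 0 = 0"
| "n_seq T (Suc k) =
     (LEAST n. n_seq T k \<le> n \<and> (\<forall>\<alpha>\<in>alphabet T. \<forall>\<beta>\<in>alphabet T. 0 < Bmat T (n_seq T k) n \<alpha> \<beta>))"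

section \<open>Function spaces\<close>

text \<open>Iterated derivatives on \<open>[a,b]\<close>, one-sided at the endpoints.\<close>

primrec nth_deriv :: "real \<Rightarrow> real \<Rightarrow> nat \<Rightarrow> (real \<Rightarrow> real) \<Rightarrow> real \<Rightarrow> real" where
  "nth_deriv a b 0 f = f"
| "nth_deriv a b (Suc k) f = (\<lambda>x. vector_derivative (nth_deriv a b k f) (at x within {a..b}))"

definition Ck_on :: "nat \<Rightarrow> real \<Rightarrow> real \<Rightarrow> (real \<Rightarrow> real) set" where
  "Ck_on k a b = {f.
     (\<forall>j<k. \<forall>x\<in>{a..b}.
        (nth_deriv a b j f has_real_derivative nth_deriv a b (Suc j) f x) (at x within {a..b})) \<and>
     continuous_on {a..b} (nth_deriv a b k f)}"

definition holder_on :: "real \<Rightarrow> real \<Rightarrow> real \<Rightarrow> (real \<Rightarrow> real) \<Rightarrow> bool" where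
  "holder_on s a b f \<longleftrightarrow> (\<exists>M. \<forall>x\<in>{a..b}. \<forall>y\<in>{a..b}. \<bar>f x - f y\<bar> \<le> M * \<bar>x - y\<bar> powr s)"

definition holder_seminorm :: "real \<Rightarrow> real \<Rightarrow> real \<Rightarrow> (real \<Rightarrow> real) \<Rightarrow> real" where
  "holder_seminorm s a b f =
     Sup {\<bar>f x - f y\<bar> / \<bar>x - y\<bar> powr s | x y. x \<in> {a..b} \<and> y \<in> {a..b} \<and> x \<noteq> y}"

definition Cr_on :: "real \<Rightarrow> real \<Rightarrow> real \<Rightarrow> (real \<Rightarrow> real) set" where
  "Cr_on r a b = {f \<in> Ck_on (nat \<lfloor>r\<rfloor>) a b.
     r \<notin> \<int> \<longrightarrow> holder_on (frac r) a b (nth_deriv a b (nat \<lfloor>r\<rfloor>) f)}"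

definition Cr_norm :: "real \<Rightarrow> real \<Rightarrow> real \<Rightarrow> (real \<Rightarrow> real) \<Rightarrow> real" where
  "Cr_norm r a b f =
     (\<Sum>j\<le>nat \<lfloor>r\<rfloor>. Sup ((\<lambda>x. \<bar>nth_deriv a b j f x\<bar>) ` {a..b})) +
     (if r \<in> \<int> then 0 else holder_seminorm (frac r) a b (nth_deriv a b (nat \<lfloor>r\<rfloor>) f))"

text \<open>
  An element of \<open>C\<^sup>r(\<^bold>u(T)) = \<Prod>\<^sub>i C\<^sup>r([u\<^sub>i\<^sub>-\<^sub>1, u\<^sub>i])\<close> is a family \<open>\<phi>\<close> whose \<open>i\<close>-th component matters
  only on \<open>[u\<^sub>i\<^sub>-\<^sub>1, u\<^sub>i]\<close>, \<open>1 \<le> i \<le> d\<close>. Families with the same restrictions are not identified,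
  so \<open>Cr_u_norm\<close> below is a seminorm; a linear operator that is bounded for it depends only
  on the restrictions.
\<close>

type_synonym family = "nat \<Rightarrow> real \<Rightarrow> real"

definition Cr_u :: "'a iem \<Rightarrow> real \<Rightarrow> family set" where
  "Cr_u T r = {\<phi>. \<forall>i\<in>{1..nsym T}. \<phi> i \<in> Cr_on r (u_pt T (i - 1)) (u_pt T i)}"

definition Cr_u_norm :: "'a iem \<Rightarrow> real \<Rightarrow> family \<Rightarrow> real" where
  "Cr_u_norm T r \<phi> = Max ((\<lambda>i. Cr_norm r (u_pt T (i - 1)) (u_pt T i) (\<phi> i)) ` {1..nsym T})"

definition const_family :: "'a iem \<Rightarrow> ('a \<Rightarrow> real) \<Rightarrow> family" where
  "const_family T \<xi> = (\<lambda>i x. \<xi> (top_letter T i))"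

section \<open>Boundary operator\<close>

text \<open>
  The identifications \<open>U\<^sub>0 = V\<^sub>0\<close> and \<open>U\<^sub>d = V\<^sub>d\<close> are made by always writing these two symbols
  as \<open>SU 0\<close> and \<open>SU d\<close>; \<open>V_sym T j\<close> stands for \<open>V\<^sub>j\<close>.
\<close>

datatype symbol = SU nat | SV nat

definition V_sym :: "'a iem \<Rightarrow> nat \<Rightarrow> symbol" where
  "V_sym T j = (if j = 0 \<or> j = nsym T then SU j else SV j)"

definition symbols :: "'a iem \<Rightarrow> symbol set" where
  "symbols T = SU ` {0..nsym T} \<union> V_sym T ` {0..nsym T}"

fun sigma_perm :: "'a iem \<Rightarrow> symbol \<Rightarrow> symbol" where
  "sigma_perm T (SU i) =
     (if i < nsym T then V_sym T (pi_b T (top_letter T (i + 1)) - 1)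
      else SU (pi_t T (bot_letter T (nsym T))))"
| "sigma_perm T (SV j) = SU (pi_t T (bot_letter T j))"

definition cycles :: "'a iem \<Rightarrow> symbol set set" where
  "cycles T = orbit (sigma_perm T) ` symbols T"

definition boundary :: "'a iem \<Rightarrow> family \<Rightarrow> symbol set \<Rightarrow> real" where
  "boundary T \<phi> C =
     (\<Sum>i | i \<le> nsym T \<and> SU i \<in> C.
        (if i = 0 then 0 else \<phi> i (u_pt T i)) - (if i = nsym T then 0 else \<phi> (i + 1) (u_pt T i)))"

definition Cr_0 :: "'a iem \<Rightarrow> real \<Rightarrow> family set" where
  "Cr_0 T r = {\<phi> \<in> Cr_u T r. \<forall>C\<in>cycles T. boundary T \<phi> C = 0}"

definition Gam_bd :: "'a iem \<Rightarrow> ('a \<Rightarrow> real) set" where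
  "Gam_bd T = {\<xi> \<in> Gam T. \<forall>C\<in>cycles T. boundary T (const_family T \<xi>) C = 0}"

section \<open>Restricted Roth type\<close>

definition Omega :: "'a iem \<Rightarrow> 'a \<Rightarrow> 'a \<Rightarrow> real" where
  "Omega T \<alpha> \<beta> =
     (if pi_t T \<alpha> < pi_t T \<beta> \<and> pi_b T \<alpha> > pi_b T \<beta> then 1
      else if pi_t T \<alpha> > pi_t T \<beta> \<and> pi_b T \<alpha> < pi_b T \<beta> then -1 else 0)"

text \<open>The rank of \<open>\<Omega>\<close> is the dimension of the range of the operator it defines.\<close>

definition genus :: "'a iem \<Rightarrow> nat" where
  "genus T = fvec.dim (mat_vec (alphabet T) (Omega T) ` Gam T) div 2"

definition step_function :: "'a iem \<Rightarrow> ('a \<Rightarrow> real) \<Rightarrow> real \<Rightarrow> real" where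
  "step_function T \<xi> x = (\<Sum>\<alpha>\<in>alphabet T. \<xi> \<alpha> * indicat_real (I_top T \<alpha>) x)"

definition Gam_0 :: "'a iem \<Rightarrow> ('a \<Rightarrow> real) set" where
  "Gam_0 T = {\<xi> \<in> Gam T. integral {left_end T..right_end T} (step_function T \<xi>) = 0}"

definition Gam_s :: "'a iem \<Rightarrow> ('a \<Rightarrow> real) set" where
  "Gam_s T = {\<xi> \<in> Gam T. \<exists>\<sigma>>0.
     (\<lambda>n. vnorm (alphabet T) (B_op T 0 n \<xi>)) \<in> O(\<lambda>n. B_norm T 0 n powr (- \<sigma>))}"

definition restr_norm :: "'a set \<Rightarrow> ('a \<Rightarrow> real) set \<Rightarrow> (('a \<Rightarrow> real) \<Rightarrow> 'a \<Rightarrow> real) \<Rightarrow> real" where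
  "restr_norm A W L = Sup {vnorm A (L \<xi>) | \<xi>. \<xi> \<in> W \<and> vnorm A \<xi> \<le> 1}"

text \<open>The elements of \<open>\<Gamma>(T) / \<Gamma>\<^sub>s(T)\<close> are the cosets.\<close>

definition coset_s :: "'a iem \<Rightarrow> ('a \<Rightarrow> real) \<Rightarrow> ('a \<Rightarrow> real) set" where
  "coset_s T \<xi> = {\<xi> + \<eta> | \<eta>. \<eta> \<in> Gam_s T}"

definition quot_s :: "'a iem \<Rightarrow> ('a \<Rightarrow> real) set set" where
  "quot_s T = coset_s T ` Gam T"

definition quot_norm :: "'a set \<Rightarrow> ('a \<Rightarrow> real) set \<Rightarrow> real" where
  "quot_norm A C = Inf (vnorm A ` C)"

definition B_flat :: "'a iem \<Rightarrow> nat \<Rightarrow> nat \<Rightarrow> ('a \<Rightarrow> real) set \<Rightarrow> ('a \<Rightarrow> real) set" where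
  "B_flat T m n C = (\<Union>\<xi>\<in>C. coset_s (rv T n) (B_op T m n \<xi>))"

definition B_s_norm :: "'a iem \<Rightarrow> nat \<Rightarrow> nat \<Rightarrow> real" where
  "B_s_norm T m n = restr_norm (alphabet T) (Gam_s (rv T m)) (B_op T m n)"

definition B_flat_inv_norm :: "'a iem \<Rightarrow> nat \<Rightarrow> nat \<Rightarrow> real" where
  "B_flat_inv_norm T m n =
     Sup {quot_norm (alphabet T) (inv_into (quot_s (rv T m)) (B_flat T m n) D) | D.
            D \<in> quot_s (rv T n) \<and> quot_norm (alphabet T) D \<le> 1}"

definition theta_const :: "'a iem \<Rightarrow> real \<Rightarrow> bool" where
  "theta_const T \<theta> \<longleftrightarrow> 0 < \<theta> \<and>
     (\<lambda>n. restr_norm (alphabet T) (Gam_0 T) (B_op T 0 n)) \<in> O(\<lambda>n. B_norm T 0 n powr (1 - \<theta>))"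

definition sigma_const :: "'a iem \<Rightarrow> real \<Rightarrow> bool" where
  "sigma_const T \<sigma> \<longleftrightarrow> 0 < \<sigma> \<and>
     (\<forall>\<xi>\<in>Gam_s T.
        (\<lambda>n. vnorm (alphabet T) (B_op T 0 n \<xi>)) \<in> O(\<lambda>n. B_norm T 0 n powr (- \<sigma>)))"

definition restricted_Roth :: "'a iem \<Rightarrow> bool" where
  "restricted_Roth T \<longleftrightarrow>
     is_iem T \<and> no_connection T \<and>
     (\<forall>\<tau>>0. (\<lambda>k. B_norm T (n_seq T k) (n_seq T (Suc k))) \<in> O(\<lambda>k. B_norm T 0 (n_seq T k) powr \<tau>)) \<and>
     (\<exists>\<theta>. theta_const T \<theta>) \<and>
     (\<forall>\<tau>>0. \<exists>K. \<forall>m n. m \<le> n \<longrightarrow>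
        B_s_norm T m n \<le> K * B_norm T 0 n powr \<tau> \<and>
        B_flat_inv_norm T m n \<le> K * B_norm T 0 n powr \<tau>) \<and>
     fvec.dim (Gam_s T) = genus T"

section \<open>Bounded operators and the cohomological equation\<close>

text \<open>
  Linear operators from \<open>X\<close> (seminorm \<open>N\<close>) to \<open>Y\<close> (norm \<open>M\<close>), where the elements of \<open>Y\<close> are
  functions that matter only on \<open>D\<close>.
\<close>

definition bounded_op ::
    "family set \<Rightarrow> (family \<Rightarrow> real) \<Rightarrow> 'p set \<Rightarrow> ('p \<Rightarrow> real) set \<Rightarrow> (('p \<Rightarrow> real) \<Rightarrow> real) \<Rightarrow>
     (family \<Rightarrow> 'p \<Rightarrow> real) \<Rightarrow> bool" where
  "bounded_op X N D Y M L \<longleftrightarrow>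
     (\<forall>\<phi>\<in>X. L \<phi> \<in> Y) \<and>
     (\<forall>\<phi>\<in>X. \<forall>\<phi>'\<in>X. \<forall>a b. \<forall>p\<in>D.
        L (\<lambda>i x. a * \<phi> i x + b * \<phi>' i x) p = a * L \<phi> p + b * L \<phi>' p) \<and>
     (\<exists>K. \<forall>\<phi>\<in>X. M (L \<phi>) \<le> K * N \<phi>)"

text \<open>
  \<open>\<phi> = \<xi> + \<psi> \<circ> T - \<psi>\<close> in \<open>C\<^sup>0(\<^bold>u(T))\<close>, with \<open>T\<close> extended continuously to each closed interval.
\<close>

definition cohomological_eq :: "'a iem \<Rightarrow> family \<Rightarrow> ('a \<Rightarrow> real) \<Rightarrow> (real \<Rightarrow> real) \<Rightarrow> bool" where
  "cohomological_eq T \<phi> \<xi> \<psi> \<longleftrightarrow>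
     (\<forall>i\<in>{1..nsym T}. \<forall>x\<in>{u_pt T (i - 1)..u_pt T i}.
        \<phi> i x = const_family T \<xi> i x + \<psi> (x + shift T (top_letter T i)) - \<psi> x)"

definition direct_sum :: "('a \<Rightarrow> real) set \<Rightarrow> ('a \<Rightarrow> real) set \<Rightarrow> ('a \<Rightarrow> real) set \<Rightarrow> bool" where
  "direct_sum W W\<^sub>1 W\<^sub>2 \<longleftrightarrow> W = {\<xi> + \<eta> | \<xi> \<eta>. \<xi> \<in> W\<^sub>1 \<and> \<eta> \<in> W\<^sub>2} \<and> W\<^sub>1 \<inter> W\<^sub>2 = {0}"

end

theory Submission
  imports Defs
begin

text \<open>
  Let \<open>f = \<phi> - \<chi>\<close>, so that the special Birkhoff sums \<open>f\<^sub>n = S(0,n) f = \<psi> \<circ> T(n) - \<psi>\<close> tend to \<open>0\<close>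
  by continuity of \<open>\<psi>\<close> at the left end point. Everything follows from a polynomial rate
  \<open>f\<^sub>n = O(N\<^sub>k\<^sup>-\<^sup>\<gamma>)\<close> at \<open>n = n\<^sub>k\<close>, where \<open>N\<^sub>k = \<parallel>B(0,n\<^sub>k)\<parallel>\<close>.

  The derivative \<open>D\<phi>\<close> is H\<ouml>lder with mean zero on every level (its integrals telescope through
  \<open>\<psi>\<close>), and comparing with its averages at an intermediate level gives
  \<open>S(0,n\<^sub>k) D\<phi> = O(N\<^sub>k\<^sup>1\<^sup>-\<^sup>\<delta>)\<close> by condition (b). Hence \<open>f\<^sub>n\<close> is constant on each interval up to a small
  error: its values \<open>c\<^sub>k\<close> satisfy \<open>c\<^sub>k\<^sub>+\<^sub>1 = B(n\<^sub>k,n\<^sub>k\<^sub>+\<^sub>1) c\<^sub>k + e\<^sub>k\<close> with \<open>e\<^sub>k\<close> small. The symplectic form of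
  \<open>Im \<Omega>\<close> is invariant and \<open>\<Gamma>\<^sub>s\<close> is Lagrangian by the dimension condition (d), so a vector orthogonal to
  \<open>\<Gamma>\<^sub>s\<close> has a bounded orbit under the inverse transpose of the cocycle. Pairing \<open>c\<^sub>k\<close> with such vectors
  bounds its component transverse to \<open>\<Gamma>\<^sub>s\<close>; the stable component is contracted.

  Finally \<open>\<psi>\<close> oscillates little on \<open>I(n\<^sub>k)\<close>, hence on every floor of the towers over \<open>I(n\<^sub>k)\<close>, and the
  floors are not shorter than a power of \<open>N\<^sub>k\<close>.

  The alphabet is not bounded, so no exponent may depend on the number of symbols. Therefore the
  inverse of \<open>B(0,n\<^sub>k)\<close> is not estimated by its determinant but by displacements, which gives \<open>O(N\<^sub>k\<^sup>2)\<close>.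
\<close>

section \<open>Interval partitions and the elementary step\<close>

text \<open>The quantitative gains are only \<theta> and \<sigma>; the other conditions cost powers
  N_k^\<tau> with \<tau> as small as one likes. Both gains are stated for the cocycle started at
  level 0, whereas averages and errors arise at some level j, and pulling them back to level 0 costs
  a fixed power of N_j. For the derivative this is balanced by choosing j with N_j between about
  N_k^(t/12) and N_k^(t/6), t = min \<theta> 1: small enough for \<theta> to pay for the inverse,
  large enough for the oscillation over the cells of level j to be small. For the stable errors all
  j occur, so no choice is possible and an interpolated bound takes its place. In the transverse
  directions a vector cannot be estimated forwards, since the cocycle may expand it. It is estimated
  backwards from infinity: c_k tends to 0 without any known rate, which makes the boundary term
  vanish, while the errors that remain are summable with a rate. Dual vectors are bounded through
  their displacements, which evolve by the cocycle itself and here lie in the stable space.\<close>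

lemma interval_partition_separated:
  assumes P: "interval_partition A l w a b" and pos: "\<forall>\<alpha>\<in>A. 0 < w \<alpha>"
    and "\<alpha> \<in> A" "\<beta> \<in> A" "l \<alpha> \<le> l \<beta>" "\<alpha> \<noteq> \<beta>"
  shows "l \<alpha> + w \<alpha> \<le> l \<beta>"
proof (rule ccontr)
  assume "\<not> ?thesis"
  then have "l \<beta> < min (l \<alpha> + w \<alpha>) (l \<beta> + w \<beta>)" using assms by auto
  then obtain x where "l \<beta> < x" "x < min (l \<alpha> + w \<alpha>) (l \<beta> + w \<beta>)" using dense by blast
  then have "x \<in> interval l w \<alpha> \<inter> interval l w \<beta>"
    using assms(5) by (auto simp: interval_def)
  with P assms(3,4,6) show False by (auto simp: interval_partition_def disjoint_family_on_def)
qed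

lemma interval_partition_right:
  assumes "interval_partition A l w a b" "\<alpha> \<in> A" "0 < w \<alpha>"
  shows "l \<alpha> + w \<alpha> \<le> b"
proof -
  have "{l \<alpha><..<l \<alpha> + w \<alpha>} \<subseteq> {a<..<b}"
    using assms by (auto simp: interval_partition_def interval_def)
  then show ?thesis using assms(3)
    by (subst (asm) greaterThanLessThan_subseteq_greaterThanLessThan) auto
qed

lemma interval_partition_initial:
  assumes P: "interval_partition A l w a b" and pos: "\<forall>\<alpha>\<in>A. 0 < w \<alpha>" and "\<alpha> \<in> A"
  shows "interval_partition {\<beta> \<in> A. l \<beta> < l \<alpha>} l w a (l \<alpha>)"
  unfolding interval_partition_def
proof (intro conjI)
  let ?B = "{\<beta> \<in> A. l \<beta> < l \<alpha>}"
  show "disjoint_family_on (interval l w) ?B"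
    using P unfolding interval_partition_def disjoint_family_on_def by blast
  show "(\<Union>\<beta>\<in>?B. interval l w \<beta>) \<subseteq> {a<..<l \<alpha>}"
  proof safe
    fix \<beta> x assume *: "\<beta> \<in> A" "l \<beta> < l \<alpha>" "x \<in> interval l w \<beta>"
    then have "l \<beta> + w \<beta> \<le> l \<alpha>"
      using interval_partition_separated[OF P pos] assms(3) by fastforce
    then show "x \<in> {a<..<l \<alpha>}"
      using * pos interval_partition_left[OF P, of \<beta>] by (auto simp: interval_def)
  qed
  have "{a<..<l \<alpha>} - (\<Union>\<beta>\<in>?B. interval l w \<beta>) \<subseteq> {a<..<b} - (\<Union>\<beta>\<in>A. interval l w \<beta>)"
    using interval_partition_right[OF P assms(3)] pos assms(3)
    by (force simp: interval_def)
  then show "negligible ({a<..<l \<alpha>} - (\<Union>\<beta>\<in>?B. interval l w \<beta>))"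
    using P negligible_subset unfolding interval_partition_def by blast
qed

text \<open>Induction on the number of intervals, removing the rightmost one. The function
  \<open>h\<close> is arbitrary because two are used: the identity, which sums widths, and \<psi>,
  which shows that integrals of the derivative vanish.\<close>

lemma interval_partition_telescope:
  fixes h :: "real \<Rightarrow> 'b::ab_group_add"
  assumes "finite A" "interval_partition A l w a b" "\<forall>\<alpha>\<in>A. 0 < w \<alpha>" "a \<le> b"
  shows "(\<Sum>\<alpha>\<in>A. h (l \<alpha> + w \<alpha>) - h (l \<alpha>)) = h b - h a"
  using assms
proof (induction "card A" arbitrary: A b)
  case 0
  then have "A = {}" by simp
  with 0 have "negligible {a<..<b}" by (simp add: interval_partition_def)
  then have "\<not> a < b" using open_not_negligible[of "{a<..<b}"] by auto
  with 0 \<open>A = {}\<close> show ?case by simp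
next
  case (Suc n)
  then have ne: "A \<noteq> {}" by auto
  define z where "z = inv_into A (position A l) (card A)"
  note z = last_interval[OF Suc.prems(2,1) ne Suc.prems(3), folded z_def]
  have "{\<beta> \<in> A. l \<beta> < l z} = A - {z}"
    using z Suc.prems(3) by force
  then have P: "interval_partition (A - {z}) l w a (l z)"
    using interval_partition_initial[OF Suc.prems(2,3) z(1)] by simp
  have "a \<le> l z" using interval_partition_left[OF Suc.prems(2) z(1)] z(1) Suc.prems(3) by blast
  moreover have "n = card (A - {z})" using Suc.hyps(2) Suc.prems(1) z(1) by simp
  ultimately have "(\<Sum>\<alpha>\<in>A - {z}. h (l \<alpha> + w \<alpha>) - h (l \<alpha>)) = h (l z) - h a"
    using Suc.hyps(1)[OF _ _ P] Suc.prems by auto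
  then show ?case
    using sum.remove[OF Suc.prems(1) z(1), of "\<lambda>\<alpha>. h (l \<alpha> + w \<alpha>) - h (l \<alpha>)"] z(3) by simp
qed

lemma interval_partition_left_eq:
  fixes w :: "'a \<Rightarrow> real"
  assumes "finite A" "interval_partition A l w a b" "\<forall>\<alpha>\<in>A. 0 < w \<alpha>" "\<alpha> \<in> A"
  shows "l \<alpha> = a + (\<Sum>\<beta> | \<beta> \<in> A \<and> l \<beta> < l \<alpha>. w \<beta>)"
proof -
  have "(\<Sum>\<beta> | \<beta> \<in> A \<and> l \<beta> < l \<alpha>. id (l \<beta> + w \<beta>) - id (l \<beta>)) = id (l \<alpha>) - id a"
    by (rule interval_partition_telescope)
      (use interval_partition_initial[OF assms(2,3,4)] interval_partition_left[OF assms(2,4)] assms in auto)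
  then show ?thesis by (simp add: algebra_simps)
qed

section \<open>Ranks of intervals and connections\<close>

lemma position_less:
  assumes "finite A" "\<alpha> \<in> A" "\<beta> \<in> A" "l \<alpha> < (l \<beta> :: real)"
  shows "position A l \<alpha> < position A l \<beta>"
proof -
  have "{\<gamma> \<in> A. l \<gamma> \<le> l \<alpha>} \<subseteq> {\<gamma> \<in> A. l \<gamma> \<le> l \<beta>}" using assms(4) by auto
  moreover have "\<beta> \<in> {\<gamma> \<in> A. l \<gamma> \<le> l \<beta>} - {\<gamma> \<in> A. l \<gamma> \<le> l \<alpha>}" using assms by auto
  ultimately show ?thesis
    unfolding position_def using assms(1) by (intro psubset_card_mono) auto
qed

lemma position_le:
  assumes "finite A" "\<alpha> \<in> A" "\<beta> \<in> A" "l \<alpha> \<le> (l \<beta> :: real)"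
  shows "position A l \<alpha> \<le> position A l \<beta>"
  unfolding position_def using assms by (intro card_mono) auto

text \<open>Connections are expressed by left endpoints of letters instead of the numbered points
  u_i and v_j. In this form the condition can be followed through the elementary step without
  tracking how ranks change.\<close>

definition no_conn :: "'a iem \<Rightarrow> bool" where
  "no_conn T \<longleftrightarrow> (\<forall>\<alpha>\<in>alphabet T. \<forall>\<beta>\<in>alphabet T.
     top_left T \<alpha> \<noteq> left_end T \<longrightarrow> bot_left T \<beta> \<noteq> left_end T \<longrightarrow>
     (\<forall>m. (iem_map T ^^ m) (bot_left T \<beta>) \<noteq> top_left T \<alpha>))"

text \<open>The invariant carried along the algorithm. Irreducibility is recovered from it in
  \<open>good_is_iem\<close>.\<close>

definition good :: "'a iem \<Rightarrow> bool" where
  "good T \<longleftrightarrow> partition_data T \<and> no_conn T"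

text \<open>An interval that does not start at \<open>a\<close> has another one to its left, so its
  rank is at least 2 and its left endpoint is an interior division point; the index \<open>i\<close>
  is the rank minus 1.\<close>

lemma position_interior:
  assumes fin: "finite A" and P: "interval_partition A l w a b" and pos: "\<forall>\<alpha>\<in>A. 0 < w \<alpha>"
    and al: "\<alpha> \<in> A" "l \<alpha> \<noteq> a"
  obtains i where "0 < i" "i < card A" "inv_into A (position A l) (Suc i) = \<alpha>"
proof -
  have inj: "inj_on (position A l) A"
  proof (rule inj_onI)
    fix x y assume *: "x \<in> A" "y \<in> A" "position A l x = position A l y"
    then have "l x = l y" using position_less[OF fin] by (metis less_irrefl linorder_neqE)
    then show "x = y" using interval_partition_separated[OF P pos *(1,2)] pos * by force
  qed
  have "{\<beta> \<in> A. l \<beta> < l \<alpha>} \<noteq> {}"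
    using interval_partition_left_eq[OF fin P pos al(1)] al(2) by force
  then obtain \<beta> where \<beta>: "\<beta> \<in> A" "l \<beta> < l \<alpha>" by blast
  have "{\<alpha>, \<beta>} \<subseteq> {\<beta> \<in> A. l \<beta> \<le> l \<alpha>}" using \<beta> al by auto
  then have "card {\<alpha>, \<beta>} \<le> position A l \<alpha>"
    unfolding position_def using fin by (intro card_mono) auto
  then have 1: "2 \<le> position A l \<alpha>" using \<beta> by (auto simp: card_insert_if split: if_splits)
  have 2: "position A l \<alpha> \<le> card A"
    unfolding position_def using fin by (intro card_mono) auto
  show ?thesis
  proof (rule that[of "position A l \<alpha> - 1"])
    show "inv_into A (position A l) (Suc (position A l \<alpha> - 1)) = \<alpha>"
      using 1 inv_into_f_f[OF inj al(1)] by simp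
  qed (use 1 2 in auto)
qed

lemma no_connection_imp_no_conn:
  assumes "partition_data T" "no_connection T"
  shows "no_conn T"
  unfolding no_conn_def
proof (intro ballI allI impI)
  fix \<alpha> \<beta> m assume *: "\<alpha> \<in> alphabet T" "\<beta> \<in> alphabet T" "top_left T \<alpha> \<noteq> left_end T" "bot_left T \<beta> \<noteq> left_end T"
  have fin: "finite (alphabet T)" and w: "\<forall>\<alpha>\<in>alphabet T. 0 < width T \<alpha>"
    and P: "interval_partition (alphabet T) (top_left T) (width T) (left_end T) (right_end T)"
    and Q: "interval_partition (alphabet T) (bot_left T) (width T) (left_end T) (right_end T)"
    using assms(1) by (auto simp: partition_data_def)
  obtain i where i: "0 < i" "i < nsym T" "top_letter T (Suc i) = \<alpha>"
    unfolding top_letter_def pi_t_def by (rule position_interior[OF fin P w *(1,3)])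
  obtain j where j: "0 < j" "j < nsym T" "bot_letter T (Suc j) = \<beta>"
    unfolding bot_letter_def pi_b_def by (rule position_interior[OF fin Q w *(2,4)])
  show "(iem_map T ^^ m) (bot_left T \<beta>) \<noteq> top_left T \<alpha>"
  proof
    assume "(iem_map T ^^ m) (bot_left T \<beta>) = top_left T \<alpha>"
    then have "(iem_map T ^^ m) (v_pt T j) = u_pt T i" using i j by (simp add: u_pt_def v_pt_def)
    with assms(2) i(1,2) j(1,2) show False unfolding no_connection_def by blast
  qed
qed

text \<open>The leftmost letter outside \<open>K\<close> works: the letters to its left are exactly
  those of \<open>K\<close>.\<close>

lemma initial_cut:
  fixes l :: "'a \<Rightarrow> real"
  assumes fin: "finite A" and P: "interval_partition A l w a b" and pos: "\<forall>\<alpha>\<in>A. 0 < w \<alpha>"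
    and K: "K \<subseteq> A" "K \<noteq> A" "\<And>\<alpha> \<beta>. \<alpha> \<in> A \<Longrightarrow> \<beta> \<in> K \<Longrightarrow> l \<alpha> \<le> l \<beta> \<Longrightarrow> \<alpha> \<in> K"
  obtains \<alpha> where "\<alpha> \<in> A" "l \<alpha> = a + sum w K"
proof -
  have "finite (A - K)" "A - K \<noteq> {}" using fin K by auto
  then obtain \<alpha> where al: "\<alpha> \<in> A - K" "\<And>\<beta>. \<beta> \<in> A - K \<Longrightarrow> l \<alpha> \<le> l \<beta>"
    using ex_min_if_finite[of "l ` (A - K)"] by (metis (no_types, lifting) arg_min_least arg_min_if_finite(1))
  have "\<beta> \<in> K \<longleftrightarrow> l \<beta> < l \<alpha>" if "\<beta> \<in> A" for \<beta>
    using al(1) al(2)[of \<beta>] K(3)[of \<alpha> \<beta>] that by fastforce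
  then have "{\<beta> \<in> A. l \<beta> < l \<alpha>} = K" using K(1) by blast
  then show ?thesis using interval_partition_left_eq[OF fin P pos, of \<alpha>] al that by auto
qed

text \<open>If \<open>K\<close> were an initial segment on both lines, the first intervals after
  \<open>K\<close> would start at the same point on the two lines, since corresponding intervals
  have equal widths. That point would be a connection with m = 0.\<close>

lemma good_cut_free:
  assumes "good T" "K \<subseteq> alphabet T" "K \<noteq> {}" "K \<noteq> alphabet T"
    and "\<And>\<alpha> \<beta>. \<alpha> \<in> alphabet T \<Longrightarrow> \<beta> \<in> K \<Longrightarrow> top_left T \<alpha> \<le> top_left T \<beta> \<Longrightarrow> \<alpha> \<in> K"
    and "\<And>\<alpha> \<beta>. \<alpha> \<in> alphabet T \<Longrightarrow> \<beta> \<in> K \<Longrightarrow> bot_left T \<alpha> \<le> bot_left T \<beta> \<Longrightarrow> \<alpha> \<in> K"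
  shows False
proof -
  let ?A = "alphabet T"
  have fin: "finite ?A" and w: "\<forall>\<alpha>\<in>?A. 0 < width T \<alpha>"
    and P: "interval_partition ?A (top_left T) (width T) (left_end T) (right_end T)"
    and Q: "interval_partition ?A (bot_left T) (width T) (left_end T) (right_end T)"
    using assms(1) by (auto simp: good_def partition_data_def)
  obtain \<alpha> where \<alpha>: "\<alpha> \<in> ?A" "top_left T \<alpha> = left_end T + sum (width T) K"
    by (rule initial_cut[OF fin P w assms(2,4)]) (use assms(5) in blast)+
  obtain \<beta> where \<beta>: "\<beta> \<in> ?A" "bot_left T \<beta> = left_end T + sum (width T) K"
    by (rule initial_cut[OF fin Q w assms(2,4)]) (use assms(6) in blast)+
  have "0 < sum (width T) K" using w assms(2,3) fin by (intro sum_pos) (auto intro: finite_subset)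
  then show False
    using assms(1) \<alpha> \<beta> unfolding good_def no_conn_def by (metis add_cancel_right_right funpow_0 less_irrefl)
qed

text \<open>The letters of rank at most k form an initial segment of their line, so reducibility is
  a common cut of both lines.\<close>

lemma good_is_iem:
  assumes "good T" shows "is_iem T"
  unfolding is_iem_def irreducible_data_def
proof (intro conjI allI impI notI)
  let ?A = "alphabet T"
  show "partition_data T" using assms by (simp add: good_def)
  fix k assume k: "1 \<le> k \<and> k < nsym T"
    and eq: "{\<alpha> \<in> ?A. pi_t T \<alpha> \<le> k} = {\<alpha> \<in> ?A. pi_b T \<alpha> \<le> k}"
  have fin: "finite ?A" and w: "\<forall>\<alpha>\<in>?A. 0 < width T \<alpha>"
    and P: "interval_partition ?A (top_left T) (width T) (left_end T) (right_end T)"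
    using assms(1) by (auto simp: good_def partition_data_def)
  have ne: "?A \<noteq> {}" using k by auto
  note la = last_interval[OF P fin ne w]
  show False
  proof (rule good_cut_free[OF assms, of "{\<alpha> \<in> ?A. pi_t T \<alpha> \<le> k}"])
    show "{\<alpha> \<in> ?A. pi_t T \<alpha> \<le> k} \<noteq> ?A" using la(1,2) k unfolding pi_t_def by force
    obtain m where m: "m \<in> ?A" "\<And>\<beta>. \<beta> \<in> ?A \<Longrightarrow> top_left T m \<le> top_left T \<beta>"
      using arg_min_if_finite(1)[OF fin ne] arg_min_least[OF fin ne] by metis
    have "{\<beta> \<in> ?A. top_left T \<beta> \<le> top_left T m} \<subseteq> {m}"
      using interval_partition_separated[OF P w _ m(1)] m w by force
    then have "pi_t T m \<le> 1"
      unfolding pi_t_def position_def using card_mono[of "{m}"] by fastforce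
    then show "{\<alpha> \<in> ?A. pi_t T \<alpha> \<le> k} \<noteq> {}" using m(1) k by force
    show "\<alpha> \<in> ?A \<Longrightarrow> \<beta> \<in> {\<alpha> \<in> ?A. pi_t T \<alpha> \<le> k} \<Longrightarrow> top_left T \<alpha> \<le> top_left T \<beta> \<Longrightarrow>
        \<alpha> \<in> {\<alpha> \<in> ?A. pi_t T \<alpha> \<le> k}" for \<alpha> \<beta>
      unfolding pi_t_def using position_le[OF fin, of \<alpha> \<beta> "top_left T"] by auto
    show "\<alpha> \<in> ?A \<Longrightarrow> \<beta> \<in> {\<alpha> \<in> ?A. pi_t T \<alpha> \<le> k} \<Longrightarrow> bot_left T \<alpha> \<le> bot_left T \<beta> \<Longrightarrow>
        \<alpha> \<in> {\<alpha> \<in> ?A. pi_t T \<alpha> \<le> k}" for \<alpha> \<beta>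
      unfolding eq unfolding pi_b_def using position_le[OF fin, of \<alpha> \<beta> "bot_left T"] by auto
  qed auto
qed

section \<open>Winner and loser of the elementary step\<close>

definition top_last :: "'a iem \<Rightarrow> 'a" where "top_last T = top_letter T (nsym T)"
definition bot_last :: "'a iem \<Rightarrow> 'a" where "bot_last T = bot_letter T (nsym T)"
definition top_wins :: "'a iem \<Rightarrow> bool" where
  "top_wins T \<longleftrightarrow> top_left T (top_last T) < bot_left T (bot_last T)"
text \<open>The winner has the longer of the two last intervals. In these terms the two types of
  step act by one and the same formula on widths, translations and vectors.\<close>

definition winner :: "'a iem \<Rightarrow> 'a" where
  "winner T = (if top_wins T then top_last T else bot_last T)"
definition loser :: "'a iem \<Rightarrow> 'a" where
  "loser T = (if top_wins T then bot_last T else top_last T)"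

lemma good_facts:
  assumes "good T"
  shows "finite (alphabet T)" "2 \<le> nsym T" "\<forall>\<alpha>\<in>alphabet T. 0 < width T \<alpha>"
    "interval_partition (alphabet T) (top_left T) (width T) (left_end T) (right_end T)"
    "interval_partition (alphabet T) (bot_left T) (width T) (left_end T) (right_end T)"
    "alphabet T \<noteq> {}" "left_end T < right_end T"
proof -
  show fin: "finite (alphabet T)" and d: "2 \<le> nsym T" and w: "\<forall>\<alpha>\<in>alphabet T. 0 < width T \<alpha>"
    and P: "interval_partition (alphabet T) (top_left T) (width T) (left_end T) (right_end T)"
    and "interval_partition (alphabet T) (bot_left T) (width T) (left_end T) (right_end T)"
    using assms by (auto simp: good_def partition_data_def)
  show ne: "alphabet T \<noteq> {}" using d by auto
  then obtain \<alpha> where "\<alpha> \<in> alphabet T" by blast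
  then show "left_end T < right_end T"
    using interval_partition_left[OF P, of \<alpha>] interval_partition_right[OF P, of \<alpha>] w by force
qed

lemma good_last:
  assumes "good T"
  shows "top_last T \<in> alphabet T" "bot_last T \<in> alphabet T"
    "top_left T (top_last T) + width T (top_last T) = right_end T"
    "bot_left T (bot_last T) + width T (bot_last T) = right_end T"
    "\<And>\<alpha>. \<alpha> \<in> alphabet T \<Longrightarrow> \<alpha> \<noteq> top_last T \<Longrightarrow> top_left T \<alpha> + width T \<alpha> \<le> top_left T (top_last T)"
    "\<And>\<alpha>. \<alpha> \<in> alphabet T \<Longrightarrow> \<alpha> \<noteq> bot_last T \<Longrightarrow> bot_left T \<alpha> + width T \<alpha> \<le> bot_left T (bot_last T)"
    "left_end T < top_left T (top_last T)" "left_end T < bot_left T (bot_last T)"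
    "top_left T (top_last T) \<noteq> bot_left T (bot_last T)" "top_last T \<noteq> bot_last T"
proof -
  note g = good_facts[OF assms]
  note lt = last_interval[OF g(4,1,6,3), folded pi_t_def top_letter_def, folded top_last_def]
  note lb = last_interval[OF g(5,1,6,3), folded pi_b_def bot_letter_def, folded bot_last_def]
  show t: "top_last T \<in> alphabet T" "bot_last T \<in> alphabet T"
    "top_left T (top_last T) + width T (top_last T) = right_end T"
    "bot_left T (bot_last T) + width T (bot_last T) = right_end T"
    "\<And>\<alpha>. \<alpha> \<in> alphabet T \<Longrightarrow> \<alpha> \<noteq> top_last T \<Longrightarrow> top_left T \<alpha> + width T \<alpha> \<le> top_left T (top_last T)"
    "\<And>\<alpha>. \<alpha> \<in> alphabet T \<Longrightarrow> \<alpha> \<noteq> bot_last T \<Longrightarrow> bot_left T \<alpha> + width T \<alpha> \<le> bot_left T (bot_last T)"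
    using lt lb by auto
  have ex: "\<exists>\<alpha>\<in>alphabet T. \<alpha> \<noteq> z" for z
  proof (rule ccontr)
    assume "\<not> ?thesis"
    then have "alphabet T \<subseteq> {z}" by auto
    then show False using card_mono[of "{z}" "alphabet T"] g(2) by simp
  qed
  from ex[of "top_last T"] show 1: "left_end T < top_left T (top_last T)"
    using t(5) interval_partition_left[OF g(4)] g(3) by fastforce
  from ex[of "bot_last T"] show 2: "left_end T < bot_left T (bot_last T)"
    using t(6) interval_partition_left[OF g(5)] g(3) by fastforce
  \<comment> \<open>Equality would be a connection with m = 0.\<close>
  show ne: "top_left T (top_last T) \<noteq> bot_left T (bot_last T)"
    using assms 1 2 t(1,2) unfolding good_def no_conn_def by (metis funpow_0 less_irrefl)
  then show "top_last T \<noteq> bot_last T" using t(3,4) by auto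
qed

lemma rauzy_step_top:
  assumes "good T" "top_wins T"
  shows "rauzy_step T = T\<lparr>right_end := bot_left T (bot_last T),
     width := (width T)(top_last T := width T (top_last T) - width T (bot_last T)),
     bot_left := (bot_left T)(bot_last T := bot_left T (bot_last T) + shift T (top_last T))\<rparr>"
proof -
  have d: "0 < nsym T" using good_facts(2)[OF assms(1)] by simp
  then have "u_pt T (nsym T - 1) = top_left T (top_last T)" "v_pt T (nsym T - 1) = bot_left T (bot_last T)"
    by (auto simp: u_pt_def v_pt_def top_last_def bot_last_def)
  moreover have "bot_left T (bot_last T) - top_left T (top_last T) = width T (top_last T) - width T (bot_last T)"
    using good_last(3,4)[OF assms(1)] by simp
  ultimately show ?thesis
    using assms(2) unfolding top_wins_def rauzy_step_def Let_def
    by (simp add: top_last_def[symmetric] bot_last_def[symmetric])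
qed

lemma rauzy_step_bot:
  assumes "good T" "\<not> top_wins T"
  shows "rauzy_step T = T\<lparr>right_end := top_left T (top_last T),
     width := (width T)(bot_last T := width T (bot_last T) - width T (top_last T)),
     top_left := (top_left T)(top_last T := top_left T (top_last T) - shift T (bot_last T))\<rparr>"
proof -
  have d: "0 < nsym T" using good_facts(2)[OF assms(1)] by simp
  then have "u_pt T (nsym T - 1) = top_left T (top_last T)" "v_pt T (nsym T - 1) = bot_left T (bot_last T)"
    by (auto simp: u_pt_def v_pt_def top_last_def bot_last_def)
  then show ?thesis
    using assms(2) unfolding top_wins_def rauzy_step_def Let_def
    by (simp add: top_last_def[symmetric] bot_last_def[symmetric])
qed

text \<open>Orbits of the new map are contained in orbits of the old one. The only endpoint that
  moves inside a line belongs to the loser: on the bottom line it is replaced by its image under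
  \<open>T\<close>, on the top line by a preimage. So a connection of the new map can be prolonged
  to one of \<open>T\<close>.\<close>

lemma good_rauzy_step:
  assumes "good T" shows "good (rauzy_step T)"
proof -
  let ?T = "rauzy_step T" and ?f = "iem_map T"
  note g = good_facts[OF assms] and la = good_last[OF assms]
  have d: "0 < nsym T" using g(2) by simp
  have pd: "partition_data T" using assms by (simp add: good_def)
  have uv: "u_pt T (nsym T - 1) = top_left T (top_last T)" "v_pt T (nsym T - 1) = bot_left T (bot_last T)"
    using d by (auto simp: u_pt_def v_pt_def top_last_def bot_last_def)
  have ne: "u_pt T (nsym T - 1) \<noteq> v_pt T (nsym T - 1)" using la(9) uv by simp
  note sp = rauzy_step_spec[OF good_is_iem[OF assms] ne]
  have wpos: "0 < width T (top_last T)" "0 < width T (bot_last T)" using g(3) la(1,2) by auto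
  \<comment> \<open>The exponent is the return time on the top intervals, and 0 at the remaining
    points, which the total function fixes.\<close>
  have *: "\<exists>j. iem_map ?T x = (?f ^^ j) x" for x
  proof (cases "\<exists>\<alpha>\<in>alphabet T. x \<in> I_top ?T \<alpha>")
    case True
    then show ?thesis using sp(9) unfolding first_return_def by blast
  next
    case False
    then have "iem_map ?T x = x" using sp(2) by (auto simp: iem_map_def)
    then show ?thesis by (intro exI[of _ 0]) simp
  qed
  have it: "\<exists>j. (iem_map ?T ^^ m) x = (?f ^^ j) x" for m x
  proof (induction m)
    case 0 then show ?case by (intro exI[of _ 0]) simp
  next
    case (Suc m)
    then obtain j where j: "(iem_map ?T ^^ m) x = (?f ^^ j) x" by blast
    obtain i where "iem_map ?T ((?f ^^ j) x) = (?f ^^ i) ((?f ^^ j) x)" using * by blast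
    then show ?case using j by (metis comp_apply funpow.simps(2) funpow_add)
  qed
  have le: "left_end ?T = left_end T" by (cases "top_wins T") (simp_all add: rauzy_step_top rauzy_step_bot assms)
  have bots: "\<exists>j. \<exists>\<beta>'\<in>alphabet T. bot_left T \<beta>' \<noteq> left_end T \<and> bot_left ?T \<beta> = (?f ^^ j) (bot_left T \<beta>')"
    if b: "\<beta> \<in> alphabet T" "bot_left ?T \<beta> \<noteq> left_end T" for \<beta>
  proof (cases "top_wins T \<and> \<beta> = bot_last T")
    case True
    then have "bot_left T (bot_last T) \<in> I_top T (top_last T)"
      using la(3,4) wpos by (auto simp: interval_def top_wins_def)
    then have "bot_left ?T \<beta> = (?f ^^ 1) (bot_left T (bot_last T))"
      using True iem_map_eq[OF pd la(1)] by (simp add: rauzy_step_top assms)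
    then show ?thesis using la(2,8) by (metis less_irrefl)
  next
    case False
    then have "bot_left ?T \<beta> = bot_left T \<beta>"
      by (cases "top_wins T") (auto simp: rauzy_step_top rauzy_step_bot assms)
    then have "bot_left ?T \<beta> = (?f ^^ 0) (bot_left T \<beta>)" by simp
    then show ?thesis using b \<open>bot_left ?T \<beta> = bot_left T \<beta>\<close> by metis
  qed
  have tops: "\<exists>j. \<exists>\<alpha>'\<in>alphabet T. top_left T \<alpha>' \<noteq> left_end T \<and> (?f ^^ j) (top_left ?T \<alpha>) = top_left T \<alpha>'"
    if b: "\<alpha> \<in> alphabet T" "top_left ?T \<alpha> \<noteq> left_end T" for \<alpha>
  proof (cases "\<not> top_wins T \<and> \<alpha> = top_last T")
    case True
    then have e: "top_left ?T \<alpha> = top_left T (top_last T) - shift T (bot_last T)"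
      by (simp add: rauzy_step_bot assms)
    have "top_left ?T \<alpha> \<in> I_top T (bot_last T)"
      using True la(3,4,9) wpos unfolding e by (auto simp: interval_def top_wins_def shift_def)
    then have "(?f ^^ 1) (top_left ?T \<alpha>) = top_left T (top_last T)"
      using iem_map_eq[OF pd la(2)] e by simp
    then show ?thesis using la(1,7) by (metis less_irrefl)
  next
    case False
    then have "top_left ?T \<alpha> = top_left T \<alpha>"
      by (cases "top_wins T") (auto simp: rauzy_step_top rauzy_step_bot assms)
    then have "(?f ^^ 0) (top_left ?T \<alpha>) = top_left T \<alpha>" by simp
    then show ?thesis using b \<open>top_left ?T \<alpha> = top_left T \<alpha>\<close> by metis
  qed
  have "no_conn ?T"
    unfolding no_conn_def
  proof (intro ballI allI impI notI)
    fix \<alpha> \<beta> m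
    assume a: "\<alpha> \<in> alphabet ?T" "\<beta> \<in> alphabet ?T" "top_left ?T \<alpha> \<noteq> left_end ?T"
      "bot_left ?T \<beta> \<noteq> left_end ?T" "(iem_map ?T ^^ m) (bot_left ?T \<beta>) = top_left ?T \<alpha>"
    obtain j \<beta>' where 1: "\<beta>' \<in> alphabet T" "bot_left T \<beta>' \<noteq> left_end T" "bot_left ?T \<beta> = (?f ^^ j) (bot_left T \<beta>')"
      using bots a(2,4) unfolding sp(2) le by blast
    obtain i \<alpha>' where 2: "\<alpha>' \<in> alphabet T" "top_left T \<alpha>' \<noteq> left_end T" "(?f ^^ i) (top_left ?T \<alpha>) = top_left T \<alpha>'"
      using tops a(1,3) unfolding sp(2) le by blast
    obtain k where "(iem_map ?T ^^ m) (bot_left ?T \<beta>) = (?f ^^ k) (bot_left ?T \<beta>)" using it by blast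
    then have "(?f ^^ (i + (k + j))) (bot_left T \<beta>') = top_left T \<alpha>'"
      using 1(3) 2(3) a(5) by (metis comp_apply funpow_add)
    then show False using assms 1 2 unfolding good_def no_conn_def by blast
  qed
  then show ?thesis using sp(1) by (simp add: good_def)
qed

lemma rv_0 [simp]: "rv T 0 = T" and rv_Suc [simp]: "rv T (Suc n) = rauzy_step (rv T n)"
  by (simp_all add: rv_def)

lemma rv_rv: "rv (rv T m) n = rv T (m + n)"
  unfolding rv_def by (subst add.commute) (simp add: funpow_add)

lemma good_rv: "good T \<Longrightarrow> good (rv T n)"
  by (induction n) (auto intro: good_rauzy_step)

lemma rauzy_step_alphabet: "good T \<Longrightarrow> alphabet (rauzy_step T) = alphabet T"
  and rauzy_step_left_end: "good T \<Longrightarrow> left_end (rauzy_step T) = left_end T"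
  by (cases "top_wins T"; simp add: rauzy_step_top rauzy_step_bot)+

lemma rv_alphabet: "good T \<Longrightarrow> alphabet (rv T n) = alphabet T"
  and rv_left_end: "good T \<Longrightarrow> left_end (rv T n) = left_end T"
  by (induction n) (auto simp: rauzy_step_alphabet rauzy_step_left_end good_rv)

section \<open>Orthogonality and isotropic subspaces\<close>

lemma sum_fun_apply: "(\<Sum>i\<in>S. f i) x = (\<Sum>i\<in>S. f i x :: 'b :: comm_monoid_add)"
  by (induction S rule: infinite_finite_induct)
    (simp_all only: sum.infinite sum.empty sum.insert zero_fun_apply plus_fun_apply not_False_eq_True)

definition ip :: "'a set \<Rightarrow> ('a \<Rightarrow> real) \<Rightarrow> ('a \<Rightarrow> real) \<Rightarrow> real" where
  "ip A x y = (\<Sum>\<alpha>\<in>A. x \<alpha> * y \<alpha>)"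

text \<open>This is \<open>Gam\<close> in terms of the alphabet alone, hence the same space at all
  levels of the algorithm.\<close>

definition vecs :: "'a set \<Rightarrow> ('a \<Rightarrow> real) set" where
  "vecs A = {\<xi>. \<forall>\<alpha>. \<alpha> \<notin> A \<longrightarrow> \<xi> \<alpha> = 0}"

lemma Gam_vecs: "Gam T = vecs (alphabet T)"
  by (simp add: Gam_def vecs_def)

lemma ip_commute: "ip A x y = ip A y x"
  by (simp add: ip_def mult.commute)

lemma ip_simps [simp]:
  "ip A (x + y) z = ip A x z + ip A y z" "ip A z (x + y) = ip A z x + ip A z y"
  "ip A (x - y) z = ip A x z - ip A y z" "ip A z (x - y) = ip A z x - ip A z y"
  "ip A (- x) z = - ip A x z" "ip A z (- x) = - ip A z x"
  "ip A (fscale c x) z = c * ip A x z" "ip A z (fscale c x) = c * ip A z x"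
  "ip A 0 z = 0" "ip A z 0 = 0"
  by (simp_all add: ip_def algebra_simps sum.distrib sum_subtractf sum_distrib_left sum_negf fscale_def)

lemma ip_sum_left: "ip A (\<Sum>i\<in>S. f i) y = (\<Sum>i\<in>S. ip A (f i) y)"
  by (induction S rule: infinite_finite_induct) (simp_all only: sum.infinite sum.empty sum.insert ip_simps not_False_eq_True)

lemma ip_self_eq_0:
  assumes "finite A" "x \<in> vecs A" "ip A x x = 0" shows "x = 0"
proof -
  have "\<forall>\<alpha>\<in>A. x \<alpha> * x \<alpha> = 0"
    using assms(1,3) unfolding ip_def by (subst (asm) sum_nonneg_eq_0_iff) auto
  then show ?thesis using assms(2) by (auto simp: vecs_def fun_eq_iff)
qed

lemma subspace_vecs: "fvec.subspace (vecs A)"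
  unfolding fvec.subspace_def by (auto simp: vecs_def fscale_def)

lemma vecs_in_span:
  assumes "finite A"
  shows "vecs A \<subseteq> fvec.span ((\<lambda>\<alpha> \<beta>. of_bool (\<beta> = \<alpha>)) ` A)"
proof
  fix \<xi> assume x: "\<xi> \<in> vecs A"
  have "\<xi> = (\<Sum>\<alpha>\<in>A. fscale (\<xi> \<alpha>) (\<lambda>\<beta>. of_bool (\<beta> = \<alpha>)))"
  proof
    fix \<beta>
    have "(\<Sum>\<alpha>\<in>A. fscale (\<xi> \<alpha>) (\<lambda>\<beta>. of_bool (\<beta> = \<alpha>))) \<beta> = (\<Sum>\<alpha>\<in>A. if \<alpha> = \<beta> then \<xi> \<alpha> else 0)"
      unfolding sum_fun_apply fscale_def by (intro sum.cong) auto
    then show "\<xi> \<beta> = (\<Sum>\<alpha>\<in>A. fscale (\<xi> \<alpha>) (\<lambda>\<beta>. of_bool (\<beta> = \<alpha>))) \<beta>"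
      using assms x by (auto simp: vecs_def sum.delta)
  qed
  also have "\<dots> \<in> fvec.span ((\<lambda>\<alpha> \<beta>. of_bool (\<beta> = \<alpha>)) ` A)"
    by (intro fvec.span_sum fvec.span_scale fvec.span_base) auto
  finally show "\<xi> \<in> \<dots>" .
qed

lemma independent_vecs_bound:
  assumes "finite A" "fvec.independent B" "B \<subseteq> vecs A"
  shows "finite B" "card B \<le> card A"
proof -
  let ?E = "(\<lambda>\<alpha> \<beta>. of_bool (\<beta> = \<alpha>)) ` A :: ('a \<Rightarrow> real) set"
  have "finite B \<and> card B \<le> card ?E"
    using assms vecs_in_span[OF assms(1)] by (intro fvec.independent_span_bound) auto
  moreover have "card ?E \<le> card A" using assms(1) by (rule card_image_le)
  ultimately show "finite B" "card B \<le> card A" by auto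
qed

definition orthogonal_set :: "'a set \<Rightarrow> ('a \<Rightarrow> real) set \<Rightarrow> bool" where
  "orthogonal_set A B \<longleftrightarrow> finite B \<and> 0 \<notin> B \<and> (\<forall>b\<in>B. \<forall>b'\<in>B. b \<noteq> b' \<longrightarrow> ip A b b' = 0)"

definition orth_proj :: "'a set \<Rightarrow> ('a \<Rightarrow> real) set \<Rightarrow> ('a \<Rightarrow> real) \<Rightarrow> 'a \<Rightarrow> real" where
  "orth_proj A B \<xi> = (\<Sum>b\<in>B. fscale (ip A \<xi> b / ip A b b) b)"

lemma orth_proj_ip:
  assumes "finite A" "orthogonal_set A B" "B \<subseteq> vecs A" "b \<in> B"
  shows "ip A (orth_proj A B \<xi>) b = ip A \<xi> b"
proof -
  have "ip A (orth_proj A B \<xi>) b = (\<Sum>b'\<in>B. if b' = b then ip A \<xi> b else 0)"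
    unfolding orth_proj_def ip_sum_left
  proof (intro sum.cong refl)
    fix b' assume b': "b' \<in> B"
    have "ip A b b \<noteq> 0" using assms ip_self_eq_0[of A b] by (auto simp: orthogonal_set_def)
    then show "ip A (fscale (ip A \<xi> b' / ip A b' b') b') b = (if b' = b then ip A \<xi> b else 0)"
      using assms(2,4) b' by (auto simp: orthogonal_set_def)
  qed
  then show ?thesis using assms(2,4) by (simp add: orthogonal_set_def)
qed

lemma orthogonal_independent:
  assumes "finite A" "orthogonal_set A B" "B \<subseteq> vecs A"
  shows "fvec.independent B"
proof (rule fvec.independent_if_scalars_zero)
  show "finite B" using assms(2) by (simp add: orthogonal_set_def)
  fix f x assume s: "(\<Sum>x\<in>B. fscale (f x) x) = 0" and x: "x \<in> B"
  have "0 = ip A (\<Sum>x\<in>B. fscale (f x) x) x" unfolding s by simp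
  also have "\<dots> = (\<Sum>b\<in>B. if b = x then f x * ip A x x else 0)"
    unfolding ip_sum_left using assms(2) x by (intro sum.cong) (auto simp: orthogonal_set_def)
  also have "\<dots> = f x * ip A x x" using x assms(2) by (simp add: orthogonal_set_def)
  finally have "f x = 0 \<or> ip A x x = 0" by simp
  moreover have "ip A x x \<noteq> 0" using assms x ip_self_eq_0[of A x] by (auto simp: orthogonal_set_def)
  ultimately show "f x = 0" by simp
qed

text \<open>Take an orthogonal subset of \<open>W\<close> of maximal size, which exists because
  sizes are bounded by \<open>card A\<close>. A vector of \<open>W\<close> different from its
  projection would allow the residual to be added.\<close>

lemma orthogonal_basis_exists:
  assumes fin: "finite A" and W: "fvec.subspace W" "W \<subseteq> vecs A"
  obtains B where "orthogonal_set A B" "B \<subseteq> W" "\<And>\<xi>. \<xi> \<in> W \<Longrightarrow> orth_proj A B \<xi> = \<xi>"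
proof -
  define P where "P n \<longleftrightarrow> (\<exists>B. orthogonal_set A B \<and> B \<subseteq> W \<and> card B = n)" for n
  have "P 0" unfolding P_def by (intro exI[of _ "{}"]) (auto simp: orthogonal_set_def)
  moreover have bnd: "n \<le> card A" if "P n" for n
    using that W(2) orthogonal_independent[OF fin] independent_vecs_bound[OF fin] unfolding P_def
    by (metis order_trans)
  ultimately obtain n where n: "P n" "\<And>m. P m \<Longrightarrow> m \<le> n"
    using GreatestI_nat[of P 0 "card A"] Greatest_le_nat[of P _ "card A"] by blast
  from n(1) obtain B where B: "orthogonal_set A B" "B \<subseteq> W" "card B = n" unfolding P_def by blast
  have BA: "B \<subseteq> vecs A" using B W by auto
  have "orth_proj A B \<xi> = \<xi>" if x: "\<xi> \<in> W" for \<xi>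
  proof (rule ccontr)
    assume ne: "orth_proj A B \<xi> \<noteq> \<xi>"
    define r where "r = \<xi> - orth_proj A B \<xi>"
    have "orth_proj A B \<xi> \<in> W"
      unfolding orth_proj_def using B(2) W(1)
      by (intro fvec.subspace_sum fvec.subspace_scale) auto
    then have rW: "r \<in> W" unfolding r_def using x W(1) by (intro fvec.subspace_diff)
    have r0: "r \<noteq> 0" using ne by (simp add: r_def)
    have orth: "ip A r b = 0" if "b \<in> B" for b
      using orth_proj_ip[OF fin B(1) BA that] by (simp add: r_def)
    have "r \<notin> B"
      using orth[of r] r0 ip_self_eq_0[OF fin, of r] rW W(2) by auto
    moreover have "orthogonal_set A (insert r B)"
    proof -
      have "ip A b r = 0" if "b \<in> B" for b using orth[OF that] by (simp add: ip_commute)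
      then show ?thesis using B(1) orth r0 unfolding orthogonal_set_def by blast
    qed
    ultimately have "P (Suc n)"
      unfolding P_def using B rW by (intro exI[of _ "insert r B"]) (auto simp: orthogonal_set_def)
    then show False using n(2) by fastforce
  qed
  then show ?thesis by (rule that[OF B(1,2)])
qed

lemma orthogonal_decomposition:
  assumes fin: "finite A" and W: "fvec.subspace W" "W \<subseteq> vecs A"
  obtains s where "s \<in> W" "\<And>\<eta>. \<eta> \<in> W \<Longrightarrow> ip A (\<xi> - s) \<eta> = 0"
proof -
  obtain B where B: "orthogonal_set A B" "B \<subseteq> W" "\<And>\<xi>. \<xi> \<in> W \<Longrightarrow> orth_proj A B \<xi> = \<xi>"
    using orthogonal_basis_exists[OF fin W] by blast
  have BA: "B \<subseteq> vecs A" using B W by auto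
  show ?thesis
  proof (rule that[of "orth_proj A B \<xi>"])
    show "orth_proj A B \<xi> \<in> W"
      unfolding orth_proj_def using B(2) W(1)
      by (intro fvec.subspace_sum fvec.subspace_scale) auto
    fix \<eta> assume e: "\<eta> \<in> W"
    define r where "r = \<xi> - orth_proj A B \<xi>"
    have "ip A b r = 0" if "b \<in> B" for b
      using orth_proj_ip[OF fin B(1) BA that, of \<xi>] by (simp add: r_def ip_commute[of A b])
    then have "ip A (orth_proj A B \<eta>) r = 0"
      unfolding orth_proj_def ip_sum_left by (intro sum.neutral) simp
    then show "ip A (\<xi> - orth_proj A B \<xi>) \<eta> = 0"
      using B(3)[OF e] by (simp add: ip_commute r_def)
  qed
qed

section \<open>Antisymmetric matrices and the symplectic form on their range\<close>

lemma mat_vec_vecs: "mat_vec A M x \<in> vecs A"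
  by (simp add: mat_vec_def vecs_def)

lemma mat_vec_linear:
  "mat_vec A M (x + y) = mat_vec A M x + mat_vec A M y"
  "mat_vec A M (fscale c x) = fscale c (mat_vec A M x)"
  "mat_vec A M 0 = 0"
  by (auto simp: mat_vec_def fun_eq_iff fscale_def algebra_simps sum.distrib sum_distrib_left)

lemma mat_vec_sum: "mat_vec A M (\<Sum>i\<in>S. f i) = (\<Sum>i\<in>S. mat_vec A M (f i))"
  by (induction S rule: infinite_finite_induct) (simp_all only: sum.infinite sum.empty sum.insert mat_vec_linear not_False_eq_True)

lemma mat_vec_antisym:
  assumes "\<And>\<alpha> \<beta>. \<alpha> \<in> A \<Longrightarrow> \<beta> \<in> A \<Longrightarrow> M \<alpha> \<beta> = - M \<beta> \<alpha>"
  shows "ip A (mat_vec A M x) y = - ip A x (mat_vec A M y)"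
proof -
  have "ip A (mat_vec A M x) y = (\<Sum>\<alpha>\<in>A. \<Sum>\<beta>\<in>A. M \<alpha> \<beta> * x \<beta> * y \<alpha>)"
    by (simp add: ip_def mat_vec_def sum_distrib_right)
  also have "\<dots> = (\<Sum>\<beta>\<in>A. \<Sum>\<alpha>\<in>A. M \<alpha> \<beta> * x \<beta> * y \<alpha>)" by (rule sum.swap)
  also have "\<dots> = (\<Sum>\<beta>\<in>A. \<Sum>\<alpha>\<in>A. - (x \<beta> * (M \<beta> \<alpha> * y \<alpha>)))"
    by (intro sum.cong refl) (subst assms, auto)
  finally show ?thesis by (simp add: ip_def mat_vec_def sum_negf sum_distrib_left)
qed

lemma subspace_mat_vec_image: "fvec.subspace (mat_vec A M ` vecs A)"
  unfolding fvec.subspace_def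
proof (intro conjI ballI allI)
  have 0: "(0 :: 'a \<Rightarrow> real) \<in> vecs A" and add: "\<And>x y :: 'a \<Rightarrow> real. x \<in> vecs A \<Longrightarrow> y \<in> vecs A \<Longrightarrow> x + y \<in> vecs A"
    and sc: "\<And>x c. x \<in> vecs A \<Longrightarrow> fscale c x \<in> vecs A"
    using subspace_vecs[of A] unfolding fvec.subspace_def by auto
  show "0 \<in> mat_vec A M ` vecs A" using 0 mat_vec_linear(3) by force
  show "x + y \<in> mat_vec A M ` vecs A" if xy: "x \<in> mat_vec A M ` vecs A" "y \<in> mat_vec A M ` vecs A" for x y
  proof -
    obtain x' y' where "x' \<in> vecs A" "y' \<in> vecs A" "x = mat_vec A M x'" "y = mat_vec A M y'"
      using xy by blast
    then show ?thesis using add[of x' y'] by (intro image_eqI[of _ _ "x' + y'"]) (simp_all add: mat_vec_linear)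
  qed
  show "fscale c x \<in> mat_vec A M ` vecs A" if xy: "x \<in> mat_vec A M ` vecs A" for x c
  proof -
    obtain x' where "x' \<in> vecs A" "x = mat_vec A M x'" using xy by blast
    then show ?thesis using sc[of x' c] by (intro image_eqI[of _ _ "fscale c x'"]) (simp_all add: mat_vec_linear)
  qed
qed

locale antisymmetric_form =
  fixes A :: "'a set" and M :: "'a \<Rightarrow> 'a \<Rightarrow> real"
  assumes fin: "finite A" and antisym: "\<And>\<alpha> \<beta>. \<alpha> \<in> A \<Longrightarrow> \<beta> \<in> A \<Longrightarrow> M \<alpha> \<beta> = - M \<beta> \<alpha>"
begin

abbreviation om :: "('a \<Rightarrow> real) \<Rightarrow> 'a \<Rightarrow> real" where "om \<equiv> mat_vec A M"

lemma om_flip: "ip A (om x) y = - ip A x (om y)"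
  by (rule mat_vec_antisym[OF antisym])

text \<open>Testing with \<open>om (om t)\<close> gives, by antisymmetry, minus the square of the
  length of \<open>om t\<close>.\<close>

lemma orthogonal_range_kernel:
  assumes "\<And>\<eta>. \<eta> \<in> om ` vecs A \<Longrightarrow> ip A t \<eta> = 0"
  shows "om t = 0"
proof (rule ip_self_eq_0[OF fin mat_vec_vecs])
  show "ip A (om t) (om t) = 0"
    using assms[of "om (om t)"] om_flip[of t "om t"] mat_vec_vecs by auto
qed

text \<open>A preimage may be replaced by its projection to the range, because the rest lies in the
  kernel.\<close>

lemma range_twice:
  assumes "b \<in> om ` vecs A"
  obtains s where "s \<in> om ` vecs A" "om s = b"
proof -
  obtain q where q: "q \<in> vecs A" "b = om q" using assms by auto
  obtain s where s: "s \<in> om ` vecs A" "\<And>\<eta>. \<eta> \<in> om ` vecs A \<Longrightarrow> ip A (q - s) \<eta> = 0"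
    using orthogonal_decomposition[OF fin subspace_mat_vec_image[where M = M], where \<xi> = q] mat_vec_vecs
    by blast
  have "om (q - s) = 0" by (rule orthogonal_range_kernel[OF s(2)])
  then have "om s = b" using mat_vec_linear(1)[of A M "q - s" s] q by simp
  with s(1) that show ?thesis by blast
qed

text \<open>\<open>ip A p v\<close> is the symplectic form of the range at \<open>om p\<close> and
  \<open>v\<close>, so \<open>iso\<close> says that \<open>V\<close> is isotropic. A basis of
  \<open>V\<close> together with preimages of it inside the range is an independent set of twice the
  size.\<close>

lemma isotropic_dim:
  assumes V: "fvec.subspace V" "V \<subseteq> om ` vecs A"
    and iso: "\<And>p v. p \<in> vecs A \<Longrightarrow> om p \<in> V \<Longrightarrow> v \<in> V \<Longrightarrow> ip A p v = 0"
  shows "2 * fvec.dim V \<le> fvec.dim (om ` vecs A)"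
proof -
  have sub: "om ` vecs A \<subseteq> vecs A" using mat_vec_vecs by auto
  obtain B where B: "B \<subseteq> V" "fvec.independent B" "V \<subseteq> fvec.span B" "card B = fvec.dim V"
    by (rule fvec.basis_exists)
  have finB: "finite B" using independent_vecs_bound[OF fin B(2)] B(1) V(2) sub by auto
  obtain D where D: "D \<subseteq> om ` vecs A" "fvec.independent D" "om ` vecs A \<subseteq> fvec.span D"
      "card D = fvec.dim (om ` vecs A)"
    by (rule fvec.basis_exists)
  have finD: "finite D" using independent_vecs_bound[OF fin D(2)] D(1) sub by auto
  have "\<forall>b\<in>B. \<exists>s. s \<in> om ` vecs A \<and> om s = b" using range_twice B(1) V(2) by (metis subset_iff)
  then obtain p where p: "\<And>b. b \<in> B \<Longrightarrow> p b \<in> om ` vecs A \<and> om (p b) = b" by metis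
  have inj: "inj_on p B" using p by (metis inj_onI)
  have disj: "p ` B \<inter> B = {}"
  proof (rule ccontr)
    assume "\<not> ?thesis"
    then obtain b where b: "b \<in> B" "p b \<in> B" by auto
    then have "p b \<in> vecs A" "om (p b) \<in> V" "p b \<in> V" using p B(1) sub by auto
    then have "ip A (p b) (p b) = 0" by (rule iso)
    then have "p b = 0" using ip_self_eq_0[OF fin] p b sub by auto
    then show False using b(2) B(2) fvec.dependent_zero by auto
  qed
  have "fvec.independent (p ` B \<union> B)"
  proof (rule fvec.independent_if_scalars_zero)
    show "finite (p ` B \<union> B)" using finB by simp
    fix f x assume s: "(\<Sum>x\<in>p ` B \<union> B. fscale (f x) x) = 0" and x: "x \<in> p ` B \<union> B"
    define u where "u = (\<Sum>b\<in>B. fscale (f (p b)) (p b))"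
    define v where "v = (\<Sum>b\<in>B. fscale (f b) b)"
    have uv: "u + v = 0"
      using s finB disj by (simp add: sum.union_disjoint sum.reindex[OF inj] u_def v_def)
    have omu: "om u = (\<Sum>b\<in>B. fscale (f (p b)) b)"
      unfolding u_def mat_vec_sum using p by (intro sum.cong) (auto simp: mat_vec_linear)
    then have "om u \<in> V" using B(1) V(1) by (auto intro!: fvec.subspace_sum fvec.subspace_scale)
    moreover have vV: "v \<in> V" unfolding v_def using B(1) V(1) by (auto intro!: fvec.subspace_sum fvec.subspace_scale)
    moreover have uA: "u \<in> vecs A"
      unfolding u_def using p sub subspace_vecs by (auto intro!: fvec.subspace_sum fvec.subspace_scale)
    ultimately have "ip A u v = 0" using iso by blast
    moreover have "u = - v" using uv by (simp add: eq_neg_iff_add_eq_0)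
    ultimately have "ip A v v = 0" by simp
    then have "v = 0" using ip_self_eq_0[OF fin] vV V(2) sub by blast
    then have "u = 0" using uv by simp
    then have "(\<Sum>b\<in>B. fscale (f (p b)) b) = 0" using omu mat_vec_linear(3) by metis
    then have "f (p b) = 0" "f b = 0" if "b \<in> B" for b
      using \<open>v = 0\<close> that fvec.independentD[OF B(2) finB order_refl] unfolding v_def by metis+
    then show "f x = 0" using x by auto
  qed
  then have "card (p ` B \<union> B) \<le> card D"
    using fvec.independent_span_bound[OF finD] p D(3) B(1) V(2) by (meson Un_least image_subsetI order_trans)
  then show ?thesis
    using finB disj inj B(4) D(4) by (simp add: card_Un_disjoint card_image)
qed

text \<open>That \<mu> annihilates \<open>W\<close> means that \<open>om \<mu>\<close> is
  symplectically orthogonal to \<open>W\<close>. Adjoining \<open>om \<mu>\<close> to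
  \<open>W\<close> therefore keeps it isotropic, and if \<open>om \<mu>\<close> were outside
  \<open>W\<close> the dimension would exceed half that of the range.\<close>

lemma lagrangian:
  assumes W: "fvec.subspace W" "W \<subseteq> om ` vecs A"
    and iso: "\<And>p v. p \<in> vecs A \<Longrightarrow> om p \<in> W \<Longrightarrow> v \<in> W \<Longrightarrow> ip A p v = 0"
    and dimW: "fvec.dim W = fvec.dim (om ` vecs A) div 2"
    and mu: "\<mu> \<in> vecs A" "\<And>w. w \<in> W \<Longrightarrow> ip A \<mu> w = 0"
  shows "om \<mu> \<in> W"
proof (rule ccontr)
  assume out: "om \<mu> \<notin> W"
  have sub: "om ` vecs A \<subseteq> vecs A" using mat_vec_vecs by auto
  define V where "V = fvec.span (insert (om \<mu>) W)"
  have V: "fvec.subspace V" unfolding V_def by (rule fvec.subspace_span)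
  have VR: "V \<subseteq> om ` vecs A"
    unfolding V_def using W(2) mu(1) subspace_mat_vec_image by (intro fvec.span_minimal) auto
  have Vx: "\<exists>w\<in>W. \<exists>c. v = w + fscale c (om \<mu>)" if v: "v \<in> V" for v
  proof -
    obtain c where "v - fscale c (om \<mu>) \<in> fvec.span W"
      using v unfolding V_def fvec.span_insert by auto
    then have "v - fscale c (om \<mu>) \<in> W" using W(1) fvec.span_eq_iff by blast
    then show ?thesis by (intro bexI[of _ "v - fscale c (om \<mu>)"] exI[of _ c]) auto
  qed
  have "2 * fvec.dim V \<le> fvec.dim (om ` vecs A)"
  proof (rule isotropic_dim[OF V VR])
    fix p v assume p: "p \<in> vecs A" "om p \<in> V" and v: "v \<in> V"
    obtain w c where w: "w \<in> W" "om p = w + fscale c (om \<mu>)" using Vx[OF p(2)] by blast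
    obtain w' c' where w': "w' \<in> W" "v = w' + fscale c' (om \<mu>)" using Vx[OF v] by blast
    obtain q where q: "q \<in> vecs A" "w' = om q" using w'(1) W(2) by auto
    have mm: "ip A (om \<mu>) \<mu> = 0" using om_flip[of \<mu> \<mu>] by (simp add: ip_commute)
    have "ip A p (om \<mu>) = - ip A (om p) \<mu>" using om_flip[of p \<mu>] by simp
    also have "\<dots> = 0" using w mu(2)[OF w(1)] mm by (simp add: ip_commute)
    finally have 1: "ip A p (om \<mu>) = 0" .
    have "ip A (om \<mu>) q = - ip A \<mu> w'" using om_flip[of \<mu> q] q by simp
    also have "\<dots> = 0" using mu(2)[OF w'(1)] by simp
    finally have 2: "ip A (om \<mu>) q = 0" .
    have "ip A w q = 0" using iso[OF q(1) _ w(1)] q(2) w'(1) by (simp add: ip_commute)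
    then have "ip A p w' = 0" using om_flip[of p q] q w 2 by simp
    then show "ip A p v = 0" using w' 1 by simp
  qed
  moreover have "fvec.dim W < fvec.dim V"
  proof -
    obtain B where B: "B \<subseteq> W" "fvec.independent B" "W \<subseteq> fvec.span B" "card B = fvec.dim W"
      by (rule fvec.basis_exists)
    have finB: "finite B" using independent_vecs_bound[OF fin B(2)] B(1) W(2) sub by auto
    have "fvec.span B \<subseteq> W" using B(1) W(1) by (rule fvec.span_minimal)
    then have nB: "om \<mu> \<notin> fvec.span B" using out by auto
    then have "om \<mu> \<notin> B" using fvec.span_base by blast
    have ind: "fvec.independent (insert (om \<mu>) B)"
      using B(2) nB by (simp add: fvec.independent_insert)
    obtain C where C: "C \<subseteq> V" "fvec.independent C" "V \<subseteq> fvec.span C" "card C = fvec.dim V"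
      by (rule fvec.basis_exists)
    have finC: "finite C" using independent_vecs_bound[OF fin C(2)] C(1) VR sub by auto
    have "insert (om \<mu>) B \<subseteq> V" unfolding V_def using B(1) fvec.span_superset by blast
    then have "card (insert (om \<mu>) B) \<le> card C"
      using fvec.independent_span_bound[OF finC ind] C(3) by auto
    then show ?thesis using finB \<open>om \<mu> \<notin> B\<close> B(4) C(4) by simp
  qed
  ultimately show False using dimW by linarith
qed

end

section \<open>The cocycle along the elementary steps\<close>

text \<open>The value type is general: over the natural numbers the recursion counts visits and
  return times, over the reals it transports vectors.\<close>

definition stepv :: "'a iem \<Rightarrow> ('a \<Rightarrow> 'b::plus) \<Rightarrow> 'a \<Rightarrow> 'b" where
  "stepv T \<xi> = \<xi>(loser T := \<xi> (loser T) + \<xi> (winner T))"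

text \<open>The inverse transpose of \<open>stepv\<close>; widths transform in this way.\<close>

definition stepw :: "'a iem \<Rightarrow> ('a \<Rightarrow> real) \<Rightarrow> 'a \<Rightarrow> real" where
  "stepw T W = W(winner T := W (winner T) - W (loser T))"

text \<open>
  \<open>cv T n\<close> is \<open>B(0,n)\<close> and \<open>cw T n\<close> is its inverse transpose, both as products over the elementary steps.
\<close>

primrec cv :: "'a iem \<Rightarrow> nat \<Rightarrow> ('a \<Rightarrow> 'b::plus) \<Rightarrow> 'a \<Rightarrow> 'b" where
  "cv T 0 \<xi> = \<xi>"
| "cv T (Suc n) \<xi> = stepv (rv T n) (cv T n \<xi>)"

primrec cw :: "'a iem \<Rightarrow> nat \<Rightarrow> ('a \<Rightarrow> real) \<Rightarrow> 'a \<Rightarrow> real" where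
  "cw T 0 W = W"
| "cw T (Suc n) W = stepw (rv T n) (cw T n W)"

lemma cv_add: "cv T (m + n) \<xi> = cv (rv T m) n (cv T m \<xi>)"
  by (induction n) (auto simp: rv_rv)

lemma cw_add: "cw T (m + n) W = cw (rv T m) n (cw T m W)"
  by (induction n) (auto simp: rv_rv)

lemma winner_loser:
  assumes "good T"
  shows "winner T \<in> alphabet T" "loser T \<in> alphabet T" "winner T \<noteq> loser T"
  using good_last(1,2,10)[OF assms] by (auto simp: winner_def loser_def)

lemma width_step: "good T \<Longrightarrow> width (rauzy_step T) = stepw T (width T)"
  by (cases "top_wins T") (auto simp: rauzy_step_top rauzy_step_bot stepw_def winner_def loser_def)

lemma shift_step: "good T \<Longrightarrow> shift (rauzy_step T) = stepv T (shift T)"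
  by (cases "top_wins T")
    (auto simp: rauzy_step_top rauzy_step_bot stepv_def winner_def loser_def shift_def fun_eq_iff)

lemma width_rv: "good T \<Longrightarrow> width (rv T n) = cw T n (width T)"
  by (induction n) (auto simp: width_step good_rv)

text \<open>The term gained at the loser and the term lost at the winner are the same product
  \<open>\<xi> (winner T) * W (loser T)\<close>.\<close>

lemma ip_step:
  assumes "good T" shows "ip (alphabet T) (stepv T \<xi>) (stepw T W) = ip (alphabet T) \<xi> W"
proof -
  note wl = winner_loser[OF assms] and fin = good_facts(1)[OF assms]
  have "ip (alphabet T) (stepv T \<xi>) (stepw T W) - ip (alphabet T) \<xi> W =
      (\<Sum>\<alpha>\<in>alphabet T. (if \<alpha> = loser T then \<xi> (winner T) * W (loser T) else 0) -
        (if \<alpha> = winner T then \<xi> (winner T) * W (loser T) else 0))"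
    unfolding ip_def sum_subtractf[symmetric] using wl(3)
    by (intro sum.cong) (auto simp: stepv_def stepw_def algebra_simps)
  also have "\<dots> = 0" using wl fin by (simp add: sum_subtractf)
  finally show ?thesis by simp
qed

lemma ip_cv_cw:
  assumes "good T" shows "ip (alphabet T) (cv T n \<xi>) (cw T n W) = ip (alphabet T) \<xi> W"
proof (induction n)
  case (Suc n)
  then show ?case using ip_step[OF good_rv[OF assms], of n] by (simp add: rv_alphabet assms)
qed simp

lemma cv_plus: "cv T n (x + y :: 'a \<Rightarrow> real) = cv T n x + cv T n y"
  by (induction n) (auto simp: stepv_def fun_eq_iff)

lemma cv_fscale: "cv T n (fscale c x) = fscale c (cv T n x)"
  by (induction n) (auto simp: stepv_def fun_eq_iff fscale_def algebra_simps)

lemma cv_0: "cv T n (0 :: 'a \<Rightarrow> real) = 0"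
  by (induction n) (auto simp: stepv_def fun_eq_iff)

lemma cv_diff: "cv T n (x - y :: 'a \<Rightarrow> real) = cv T n x - cv T n y"
  by (induction n) (auto simp: stepv_def fun_eq_iff)

lemma cv_sum: "cv T n (\<Sum>i\<in>S. f i :: 'a \<Rightarrow> real) = (\<Sum>i\<in>S. cv T n (f i))"
  by (induction S rule: infinite_finite_induct)
    (simp_all only: sum.infinite sum.empty sum.insert cv_0 cv_plus not_False_eq_True)

lemma cv_of_nat: "cv T n (\<lambda>\<alpha>. of_nat (k \<alpha>) :: real) \<alpha> = of_nat (cv T n k \<alpha>)"
  by (induction n arbitrary: \<alpha>) (auto simp: stepv_def)

lemma cv_mono:
  fixes x y :: "'a \<Rightarrow> real"
  assumes "good T" "\<And>\<alpha>. \<alpha> \<in> alphabet T \<Longrightarrow> x \<alpha> \<le> y \<alpha>" "\<alpha> \<in> alphabet T"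
  shows "cv T n x \<alpha> \<le> cv T n y \<alpha>"
  using assms(3)
proof (induction n arbitrary: \<alpha>)
  case (Suc n)
  then show ?case
    using winner_loser[OF good_rv[OF assms(1)], of n] Suc.IH[of \<alpha>]
    by (auto simp: stepv_def rv_alphabet assms(1) intro!: add_mono)
qed (use assms in auto)

lemma cv_abs_le:
  fixes x :: "'a \<Rightarrow> real"
  assumes "good T" "\<And>\<alpha>. \<alpha> \<in> alphabet T \<Longrightarrow> \<bar>x \<alpha>\<bar> \<le> y \<alpha>" "\<alpha> \<in> alphabet T"
  shows "\<bar>cv T n x \<alpha>\<bar> \<le> cv T n y \<alpha>"
proof -
  have "cv T n (fscale (-1) y) \<alpha> \<le> cv T n x \<alpha>"
    using assms(2) by (intro cv_mono assms) (force simp: fscale_def abs_le_iff)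
  moreover have "cv T n x \<alpha> \<le> cv T n y \<alpha>"
    using assms(2) by (intro cv_mono assms) (auto simp: abs_le_iff)
  ultimately show ?thesis using cv_fscale[of T n "-1" y] by (simp add: fscale_def abs_le_iff)
qed

lemma cv_vecs:
  assumes "good T" "x \<in> vecs (alphabet T)" shows "cv T n x \<in> vecs (alphabet T)"
proof (induction n)
  case (Suc n)
  then show ?case
    using winner_loser[OF good_rv[OF assms(1)], of n]
    by (auto simp: stepv_def vecs_def rv_alphabet assms(1))
qed (use assms in auto)

text \<open>By \<open>orbit_structure\<close> these are the return times to I(n), that is, the
  heights of the towers; by \<open>ret_expand\<close> they are the row sums of B(0,n).\<close>

abbreviation ret :: "'a iem \<Rightarrow> nat \<Rightarrow> 'a \<Rightarrow> real" where
  "ret T n \<equiv> cv T n (\<lambda>_. 1)"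

lemma ret_ge_1: "good T \<Longrightarrow> \<alpha> \<in> alphabet T \<Longrightarrow> 1 \<le> ret T n \<alpha>"
proof (induction n arbitrary: \<alpha>)
  case (Suc n)
  show ?case
    using winner_loser(1,2)[OF good_rv[OF Suc.prems(1)], of n, unfolded rv_alphabet[OF Suc.prems(1)]]
      Suc.IH[OF Suc.prems] Suc.IH[OF Suc.prems(1), of "winner (rv T n)"]
      Suc.IH[OF Suc.prems(1), of "loser (rv T n)"]
    by (auto simp: stepv_def)
qed simp

section \<open>Orbits up to the return to a later interval\<close>

definition unit_vec :: "'a \<Rightarrow> 'a \<Rightarrow> 'b::zero_neq_one" where
  "unit_vec \<beta> = (\<lambda>\<alpha>. if \<alpha> = \<beta> then 1 else 0)"

text \<open>In both types of step a point of the loser's new interval starts in the interval of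
  \<open>bot_last T\<close>, leaves the new base into the interval of \<open>top_last T\<close>, and
  then returns. The type only decides which of these two letters is called the loser.\<close>

lemma step_orbit:
  assumes "good T" "\<alpha> \<in> alphabet T" "x \<in> I_top (rauzy_step T) \<alpha>"
  shows "\<alpha> \<noteq> loser T \<Longrightarrow> x \<in> I_top T \<alpha> \<and> iem_map (rauzy_step T) x = iem_map T x"
    and "\<alpha> = loser T \<Longrightarrow> x \<in> I_top T (bot_last T) \<and> iem_map T x \<in> I_top T (top_last T) \<and>
      iem_map T x \<notin> base (rauzy_step T) \<and> iem_map (rauzy_step T) x = iem_map T (iem_map T x)"
proof -
  let ?T = "rauzy_step T"
  note g = good_facts[OF assms(1)] and la = good_last[OF assms(1)]
  have pd: "partition_data T" using assms by (simp add: good_def)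
  have pd': "partition_data ?T" using good_rauzy_step[OF assms(1)] by (simp add: good_def)
  have wpos: "0 < width T (top_last T)" "0 < width T (bot_last T)" using g(3) la(1,2) by auto
  have m': "iem_map ?T x = x + shift ?T \<alpha>"
    using iem_map_eq[OF pd' _ assms(3)] assms(1,2) by (simp add: rauzy_step_alphabet)
  {
    assume nl: "\<alpha> \<noteq> loser T"
    have x: "x \<in> I_top T \<alpha>"
      using assms(3) nl wpos assms(1)
      by (cases "top_wins T")
         (auto simp: interval_def rauzy_step_top rauzy_step_bot loser_def split: if_splits)
    have "iem_map T x = x + shift T \<alpha>" using iem_map_eq[OF pd assms(2) x] .
    then show "x \<in> I_top T \<alpha> \<and> iem_map ?T x = iem_map T x"
      using x m' nl shift_step[OF assms(1)] by (simp add: stepv_def)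
  }
  {
    assume l: "\<alpha> = loser T"
    have x: "x \<in> I_top T (bot_last T)" and x2: "x + shift T (bot_last T) \<in> I_top T (top_last T)"
      and x3: "x + shift T (bot_last T) \<notin> base ?T"
      using assms(3) l wpos la(3,4,9,10) assms(1)
      by (cases "top_wins T";
          force simp: interval_def rauzy_step_top rauzy_step_bot loser_def shift_def top_wins_def)+
    have 1: "iem_map T x = x + shift T (bot_last T)" using iem_map_eq[OF pd la(2) x] .
    have 2: "iem_map T (iem_map T x) = iem_map T x + shift T (top_last T)"
      using iem_map_eq[OF pd la(1)] x2 1 by simp
    have "shift ?T \<alpha> = shift T (bot_last T) + shift T (top_last T)"
      using l shift_step[OF assms(1)] by (auto simp: stepv_def loser_def winner_def)
    then show "x \<in> I_top T (bot_last T) \<and> iem_map T x \<in> I_top T (top_last T) \<and>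
      iem_map T x \<notin> base ?T \<and> iem_map ?T x = iem_map T (iem_map T x)"
      using x x2 x3 m' 1 2 by simp
  }
qed

lemma step_base:
  assumes "good T" shows "right_end (rauzy_step T) < right_end T"
proof -
  note g = good_facts[OF assms] and la = good_last[OF assms]
  have wpos: "0 < width T (top_last T)" "0 < width T (bot_last T)" using g(3) la(1,2) by auto
  then show ?thesis using la(3,4) assms by (cases "top_wins T") (auto simp: rauzy_step_top rauzy_step_bot)
qed

lemma cv_loser:
  "cv T (Suc n) \<xi> (loser (rv T n)) = cv T n \<xi> (bot_last (rv T n)) + cv T n \<xi> (top_last (rv T n))"
  for \<xi> :: "'a \<Rightarrow> 'b::comm_monoid_add"
  by (auto simp: stepv_def loser_def winner_def add.commute)

text \<open>Induction on the steps. Over the loser's interval the orbit is the concatenation of the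
  orbits belonging to \<open>bot_last\<close> and \<open>top_last\<close>, so return times and
  numbers of visits add up exactly as \<open>stepv\<close> prescribes.\<close>

lemma orbit_structure:
  assumes "good T" "\<alpha> \<in> alphabet T" "x \<in> I_top (rv T n) \<alpha>"
  defines "r \<equiv> cv T n (\<lambda>_. 1 :: nat)" and "f \<equiv> iem_map T"
  shows "(f ^^ r \<alpha>) x = iem_map (rv T n) x \<and> (\<forall>j. 0 < j \<longrightarrow> j < r \<alpha> \<longrightarrow> (f ^^ j) x \<notin> base (rv T n)) \<and>
    (\<forall>\<beta>\<in>alphabet T. card {j. j < r \<alpha> \<and> (f ^^ j) x \<in> I_top T \<beta>} = cv T n (unit_vec \<beta>) \<alpha>)"
  using assms(2,3) unfolding r_def
proof (induction n arbitrary: \<alpha> x)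
  case 0
  have "x \<notin> I_top T \<beta>" if "\<beta> \<in> alphabet T" "\<beta> \<noteq> \<alpha>" for \<beta>
    using good_facts(4)[OF assms(1)] 0 that
    unfolding interval_partition_def disjoint_family_on_def by (metis IntI empty_iff rv_0)
  then have "{j. j < Suc 0 \<and> (f ^^ j) x \<in> I_top T \<beta>} = (if \<beta> = \<alpha> then {0} else {})" if "\<beta> \<in> alphabet T" for \<beta>
    using 0 that by auto
  then show ?case by (auto simp: f_def unit_vec_def)
next
  case (Suc n)
  let ?S = "rv T n"
  let ?r = "cv T n (\<lambda>_. 1 :: nat)"
  have gS: "good ?S" using assms(1) by (rule good_rv)
  have A: "alphabet ?S = alphabet T" using assms(1) by (rule rv_alphabet)
  have base: "base (rv T (Suc n)) \<subseteq> base ?S"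
    using step_base[OF gS] rauzy_step_left_end[OF gS] by auto
  note so = step_orbit[OF gS, of \<alpha> x, unfolded A, OF Suc.prems(1) Suc.prems(2)[unfolded rv_Suc]]
  show ?case
  proof (cases "\<alpha> = loser ?S")
    case False
    then have cv: "cv T (Suc n) \<xi> \<alpha> = cv T n \<xi> \<alpha>" for \<xi> :: "'a \<Rightarrow> nat" by (simp add: stepv_def)
    have x: "x \<in> I_top ?S \<alpha>" "iem_map (rv T (Suc n)) x = iem_map ?S x" using so(1)[OF False] by auto
    note I = Suc.IH[OF Suc.prems(1) x(1)]
    show ?thesis unfolding cv x(2) using I base by blast
  next
    case True
    note s = so(2)[OF True]
    let ?b = "bot_last ?S" and ?t = "top_last ?S"
    have bt: "?b \<in> alphabet T" "?t \<in> alphabet T" using good_last(1,2)[OF gS] A by auto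
    note Ib = Suc.IH[OF bt(1), of x] and It = Suc.IH[OF bt(2), of "iem_map ?S x"]
    \<comment> \<open>The junction of the two orbit pieces lies in the old base but not in the new
      one, so the return to the new base happens only at the end of the second piece.\<close>
    define y where "y = iem_map ?S x"
    have y: "(f ^^ ?r ?b) x = y" using Ib s by (simp add: y_def)
    have fy: "(f ^^ (?r ?b + j)) x = (f ^^ j) y" for j
      using y by (metis add.commute comp_apply funpow_add)
    have rr: "cv T (Suc n) (\<lambda>_. 1 :: nat) \<alpha> = ?r ?b + ?r ?t" using True cv_loser by metis
    have 1: "(f ^^ (?r ?b + ?r ?t)) x = iem_map (rv T (Suc n)) x"
      unfolding fy using It s by (simp add: y_def)
    have 2: "(f ^^ j) x \<notin> base (rv T (Suc n))" if j: "0 < j" "j < ?r ?b + ?r ?t" for j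
    proof -
      consider "j < ?r ?b" | "j = ?r ?b" | i where "j = ?r ?b + i" "0 < i" "i < ?r ?t"
        using j by (metis add_diff_inverse_nat nat_neq_iff nat_add_left_cancel_less zero_less_diff)
      then show ?thesis
      proof cases
        case 1 then show ?thesis using Ib s j base by blast
      next
        case 2 then show ?thesis using y s by (simp add: y_def)
      next
        case 3 then show ?thesis using It s base unfolding 3(1) fy y_def by blast
      qed
    qed
    have 3: "card {j. j < ?r ?b + ?r ?t \<and> (f ^^ j) x \<in> I_top T \<beta>} = cv T (Suc n) (unit_vec \<beta>) \<alpha>"
      if be: "\<beta> \<in> alphabet T" for \<beta>
    proof -
      let ?X = "{j. j < ?r ?b \<and> (f ^^ j) x \<in> I_top T \<beta>}" and ?Y = "{j. j < ?r ?t \<and> (f ^^ j) y \<in> I_top T \<beta>}"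
      have "{j. j < ?r ?b + ?r ?t \<and> (f ^^ j) x \<in> I_top T \<beta>} = ?X \<union> (+) (?r ?b) ` ?Y" (is "?L = ?R")
      proof
        show "?R \<subseteq> ?L" using fy by auto
        show "?L \<subseteq> ?R"
        proof
          fix j assume j: "j \<in> ?L"
          show "j \<in> ?R"
          proof (cases "j < ?r ?b")
            case False
            then obtain i where "j = ?r ?b + i" using le_Suc_ex by (metis not_less)
            then show ?thesis using j fy by auto
          qed (use j in auto)
        qed
      qed
      moreover have "?X \<inter> (+) (?r ?b) ` ?Y = {}" by auto
      ultimately have "card ?L = card ?X + card ?Y"
        by (simp add: card_Un_disjoint card_image)
      also have "card ?X = cv T n (unit_vec \<beta>) ?b" using Ib s be by blast
      also have "card ?Y = cv T n (unit_vec \<beta>) ?t" using It s be unfolding y_def by blast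
      finally show ?thesis using True cv_loser by metis
    qed
    show ?thesis using 1 2 3 rr by simp
  qed
qed

section \<open>The matrices B(m,n) as products over the elementary steps\<close>

lemma visits_eq:
  assumes "good T" "\<alpha> \<in> alphabet T" "\<beta> \<in> alphabet T"
  shows "visits T (rv T n) \<alpha> \<beta> = cv T n (unit_vec \<beta>) \<alpha>"
proof -
  let ?f = "iem_map T" and ?r = "cv T n (\<lambda>_. 1 :: nat) \<alpha>"
  have gn: "good (rv T n)" using assms(1) by (rule good_rv)
  have A: "alphabet (rv T n) = alphabet T" using assms(1) by (rule rv_alphabet)
  have rpos: "0 < ?r" using ret_ge_1[OF assms(1,2), of n] cv_of_nat[of T n "\<lambda>_. 1"] by auto
  have card: "card {j. j < return_time ?f (base (rv T n)) x \<and> (?f ^^ j) x \<in> I_top T \<beta>} = cv T n (unit_vec \<beta>) \<alpha>"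
    if x: "x \<in> I_top (rv T n) \<alpha>" for x
  proof -
    note o = orbit_structure[OF assms(1,2) x]
    have "iem_map (rv T n) x = x + shift (rv T n) \<alpha>"
      using gn x assms(2) A unfolding good_def by (intro iem_map_eq) auto
    then have "iem_map (rv T n) x \<in> I_bot (rv T n) \<alpha>" using x by (auto simp: interval_def shift_def)
    then have "iem_map (rv T n) x \<in> base (rv T n)"
      using good_facts(5)[OF gn] assms(2) A unfolding interval_partition_def by blast
    then have "return_time ?f (base (rv T n)) x = ?r"
      unfolding return_time_def using o rpos
      by (intro Least_equality) (auto simp: not_less[symmetric])
    then show ?thesis using o assms(3) by simp
  qed
  \<comment> \<open>The interval has to contain a point for the definite description in
    \<open>visits\<close> to determine the number.\<close>
  obtain x where "x \<in> I_top (rv T n) \<alpha>"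
    using good_facts(3)[OF gn] assms(2) A dense[of "top_left (rv T n) \<alpha>" "top_left (rv T n) \<alpha> + width (rv T n) \<alpha>"]
    by (auto simp: interval_def)
  then show ?thesis unfolding visits_def using card by (intro the_equality) auto
qed

lemma Bmat_eq:
  assumes "good T" "\<alpha> \<in> alphabet T" "\<beta> \<in> alphabet T"
  shows "Bmat T m (m + n) \<alpha> \<beta> = cv (rv T m) n (unit_vec \<beta>) \<alpha>"
proof -
  have "cv (rv T m) n (unit_vec \<beta>) \<alpha> = cv (rv T m) n (\<lambda>\<gamma>. real (unit_vec \<beta> \<gamma>)) \<alpha>"
    by (intro arg_cong[where f = "\<lambda>x. cv (rv T m) n x \<alpha>"]) (auto simp: unit_vec_def)
  then show ?thesis
    using visits_eq[OF good_rv[OF assms(1)], of \<alpha> m \<beta> n] assms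
    by (simp add: Bmat_def rv_alphabet rv_rv cv_of_nat)
qed

lemma cv_expand:
  assumes "good T" "x \<in> vecs (alphabet T)"
  shows "cv T n x \<alpha> = (\<Sum>\<beta>\<in>alphabet T. cv T n (unit_vec \<beta>) \<alpha> * x \<beta>)"
proof -
  have fin: "finite (alphabet T)" using good_facts(1)[OF assms(1)] .
  have "x = (\<Sum>\<beta>\<in>alphabet T. fscale (x \<beta>) (unit_vec \<beta>))"
  proof
    fix \<alpha>
    have "(\<Sum>\<beta>\<in>alphabet T. fscale (x \<beta>) (unit_vec \<beta>)) \<alpha> = (\<Sum>\<beta>\<in>alphabet T. if \<alpha> = \<beta> then x \<beta> else 0)"
      unfolding sum_fun_apply by (intro sum.cong) (auto simp: fscale_def unit_vec_def)
    then show "x \<alpha> = (\<Sum>\<beta>\<in>alphabet T. fscale (x \<beta>) (unit_vec \<beta>)) \<alpha>"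
      using assms(2) fin by (auto simp: vecs_def)
  qed
  then have "cv T n x = (\<Sum>\<beta>\<in>alphabet T. fscale (x \<beta>) (cv T n (unit_vec \<beta>)))"
    using cv_sum[of T n "\<lambda>\<beta>. fscale (x \<beta>) (unit_vec \<beta>)" "alphabet T"] by (simp add: cv_fscale)
  then show ?thesis by (simp add: sum_fun_apply fscale_def mult.commute)
qed

lemma B_op_eq:
  assumes "good T" "x \<in> vecs (alphabet T)"
  shows "B_op T m (m + n) x = cv (rv T m) n x"
proof
  fix \<alpha>
  have g: "good (rv T m)" and A: "alphabet (rv T m) = alphabet T"
    using good_rv[OF assms(1)] rv_alphabet[OF assms(1)] by auto
  show "B_op T m (m + n) x \<alpha> = cv (rv T m) n x \<alpha>"
  proof (cases "\<alpha> \<in> alphabet T")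
    case True
    then show ?thesis
      using cv_expand[OF g, of x n \<alpha>] assms A by (simp add: B_op_def mat_vec_def Bmat_eq)
  next
    case False
    then show ?thesis
      using cv_vecs[OF g, of x n] assms A by (simp add: B_op_def mat_vec_def vecs_def)
  qed
qed

lemma ret_expand:
  assumes "good T" "\<alpha> \<in> alphabet T"
  shows "ret T n \<alpha> = (\<Sum>\<beta>\<in>alphabet T. cv T n (unit_vec \<beta>) \<alpha>)"
proof -
  let ?x = "\<lambda>\<alpha>. if \<alpha> \<in> alphabet T then 1 else 0 :: real"
  have "ret T n \<alpha> = cv T n ?x \<alpha>"
    by (intro antisym cv_mono assms) auto
  then show ?thesis using cv_expand[OF assms(1), of ?x n \<alpha>] by (simp add: vecs_def)
qed

text \<open>The entries are nonnegative, so the norm is the longest return time.\<close>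

lemma B_norm_eq:
  assumes "good T"
  shows "B_norm T m (m + n) = Max (ret (rv T m) n ` alphabet T)"
proof -
  have g: "good (rv T m)" and A: "alphabet (rv T m) = alphabet T"
    using good_rv[OF assms(1)] rv_alphabet[OF assms(1)] by auto
  have nn: "0 \<le> cv (rv T m) n (unit_vec \<beta> :: _ \<Rightarrow> real) \<alpha>" if "\<alpha> \<in> alphabet T" for \<alpha> \<beta>
    using cv_mono[OF g, of 0 "unit_vec \<beta>" \<alpha> n] that A by (auto simp: unit_vec_def cv_0)
  show ?thesis
    unfolding B_norm_def mnorm_def
    using ret_expand[OF g] A nn assms by (intro arg_cong[where f = Max] image_cong) (auto simp: Bmat_eq)
qed

section \<open>Positivity and displacements\<close>

text \<open>The line on which the winner is last keeps its left endpoints. So the winner is still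
  last there and takes part in the next step.\<close>

lemma winner_persists:
  assumes "good T" shows "winner T \<in> {winner (rauzy_step T), loser (rauzy_step T)}"
proof -
  let ?T = "rauzy_step T"
  have gT: "good ?T" and A: "alphabet ?T = alphabet T"
    using assms by (auto intro: good_rauzy_step simp: rauzy_step_alphabet)
  note la = good_last[OF assms] and la' = good_last[OF gT, unfolded A]
  have w: "\<alpha> \<in> alphabet T \<Longrightarrow> 0 < width T \<alpha>" "\<alpha> \<in> alphabet T \<Longrightarrow> 0 < width ?T \<alpha>" for \<alpha>
    using good_facts(3)[OF assms] good_facts(3)[OF gT] A by auto
  have "winner T \<in> {top_last ?T, bot_last ?T}"
  proof (cases "top_wins T")
    case True
    then have "top_left ?T = top_left T" by (simp add: rauzy_step_top assms)
    then have "top_last ?T = top_last T"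
      using la(1) la(5)[of "top_last ?T"] la'(1) la'(5)[of "top_last T"] w(1)[of "top_last ?T"] w(2)[of "top_last T"]
      by fastforce
    then show ?thesis using True by (simp add: winner_def)
  next
    case False
    then have "bot_left ?T = bot_left T" by (simp add: rauzy_step_bot assms)
    then have "bot_last ?T = bot_last T"
      using la(2) la(6)[of "bot_last ?T"] la'(2) la'(6)[of "bot_last T"] w(1)[of "bot_last ?T"] w(2)[of "bot_last T"]
      by fastforce
    then show ?thesis using False by (simp add: winner_def)
  qed
  then show ?thesis by (auto simp: winner_def loser_def)
qed

text \<open>Every win of a member enlarges the set, which is possible only finitely often inside
  \<open>A\<close>; but \<beta> belongs to the set from \<open>n0\<close> on and wins infinitely
  often.\<close>

lemma growing_sets_avoid:
  fixes L :: "nat \<Rightarrow> 'a set"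
  assumes "finite A" "\<And>n. L n \<subseteq> A"
    and mono: "\<And>n. N \<le> n \<Longrightarrow> L n \<subseteq> L (Suc n)"
    and strict: "\<And>n. N \<le> n \<Longrightarrow> win n \<in> L n \<Longrightarrow> L n \<noteq> L (Suc n)"
    and n0: "N \<le> n0" "\<beta> \<in> L n0" and inf: "\<And>m. \<exists>n\<ge>m. win n = \<beta>"
  shows False
proof -
  have mono': "L m \<subseteq> L n" if "N \<le> m" "m \<le> n" for m n
    using that(2,1)
  proof (induction n rule: dec_induct)
    case (step n)
    then show ?case using mono[of n] by (meson le_trans order_trans)
  qed simp
  have fin: "finite (L n)" for n using assms(1,2) by (rule finite_subset[rotated])
  have "\<exists>n\<ge>n0. k \<le> card (L n)" for k
  proof (induction k)
    case (Suc k)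
    then obtain m where m: "m \<ge> n0" "k \<le> card (L m)" by blast
    obtain n where n: "n \<ge> m" "win n = \<beta>" using inf by blast
    have "win n \<in> L n" using mono'[of n0 n] n m n0 by auto
    then have "L n \<subset> L (Suc n)" using mono[of n] strict[of n] n m n0 by auto
    then have "card (L n) < card (L (Suc n))" by (rule psubset_card_mono[OF fin])
    moreover have "card (L m) \<le> card (L n)" using mono'[of m n] n m n0 by (intro card_mono fin) auto
    ultimately show ?case using m n by (intro exI[of _ "Suc n"]) auto
  qed auto
  then obtain n where "Suc (card A) \<le> card (L n)" by blast
  then show False using card_mono[OF assms(1,2), of n] by simp
qed

text \<open>
  The widths of the losers tend to zero, so a letter that eventually never wins eventually never
  loses either, and then it is not moved any more. A win of a letter to its left would insert one
  more letter to its left, which happens only finitely often. So the letters that stop winning form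
  an initial segment on both lines, against irreducibility.
\<close>

lemma winner_infinitely_often:
  assumes T: "good T" and "\<alpha> \<in> alphabet T"
  shows "\<exists>n\<ge>m. winner (rv T n) = \<alpha>"
proof -
  let ?A = "alphabet T" and ?S = "rv T"
  define Wi where "Wi = {\<alpha> \<in> ?A. \<forall>m. \<exists>n\<ge>m. winner (?S n) = \<alpha>}"
  have g: "good (?S n)" and A: "alphabet (?S n) = ?A" for n using good_rv[OF T] rv_alphabet[OF T] by auto
  have fin: "finite ?A" using good_facts(1)[OF T] .
  have wl: "winner (?S n) \<in> ?A" "loser (?S n) \<in> ?A" "winner (?S n) \<noteq> loser (?S n)" for n
    using winner_loser[OF g, unfolded A] by auto
  have wpos: "0 < width (?S n) \<alpha>" if "\<alpha> \<in> ?A" for n \<alpha> using good_facts(3)[OF g, of n] A that by auto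
  have "\<forall>\<alpha>\<in>?A - Wi. \<exists>m. \<forall>n\<ge>m. winner (?S n) \<noteq> \<alpha>" unfolding Wi_def by blast
  then obtain M where M: "\<And>\<alpha>. \<alpha> \<in> ?A - Wi \<Longrightarrow> \<forall>n\<ge>M \<alpha>. winner (?S n) \<noteq> \<alpha>" by metis
  \<comment> \<open>The sum serves as a common upper bound of the finitely many times;
    \<open>N\<close> below is built in the same way.\<close>
  define N1 where "N1 = (\<Sum>\<alpha>\<in>?A - Wi. M \<alpha>)"
  have N1: "winner (?S n) \<in> Wi" if "n \<ge> N1" for n
  proof (rule ccontr)
    assume "winner (?S n) \<notin> Wi"
    then have w: "winner (?S n) \<in> ?A - Wi" using wl by auto
    have "M (winner (?S n)) \<le> N1" unfolding N1_def using fin w by (intro member_le_sum) auto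
    then show False using M[OF w, rule_format, of n] that by simp
  qed
  have wconst: "width (?S n) \<alpha> = width (?S N1) \<alpha>" if "\<alpha> \<notin> Wi" "n \<ge> N1" for n \<alpha>
    using that(2)
  proof (induction n rule: dec_induct)
    case (step n)
    then show ?case using N1[of n] that(1) by (auto simp: width_step g stepw_def)
  qed simp
  \<comment> \<open>The length of the current interval. Each step cuts off the width of the loser,
    so these widths tend to 0, whereas the widths outside \<open>Wi\<close> are constant from
    \<open>N1\<close> on.\<close>
  define s where "s n = sum (width (?S n)) ?A" for n
  have sstep: "s (Suc n) = s n - width (?S n) (loser (?S n))" for n
  proof -
    have "s n - s (Suc n) = (\<Sum>\<alpha>\<in>?A. if \<alpha> = winner (?S n) then width (?S n) (loser (?S n)) else 0)"
      unfolding s_def sum_subtractf[symmetric]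
      by (intro sum.cong) (auto simp: width_step g stepw_def)
    then show ?thesis using wl fin by simp
  qed
  have "decseq s" using sstep wpos wl by (intro decseq_SucI) (simp add: less_imp_le)
  moreover have "0 \<le> s n" for n unfolding s_def using wpos by (intro sum_nonneg) (simp add: less_imp_le)
  ultimately obtain l where l: "s \<longlonglongrightarrow> l" using decseq_convergent[of s 0] by blast
  then have "(\<lambda>n. s n - s (Suc n)) \<longlonglongrightarrow> l - l" by (intro tendsto_diff LIMSEQ_Suc)
  then have lim: "(\<lambda>n. width (?S n) (loser (?S n))) \<longlonglongrightarrow> 0" using sstep by simp
  have "\<exists>N\<ge>N1. \<forall>n\<ge>N. loser (?S n) \<noteq> \<alpha>" if a: "\<alpha> \<in> ?A - Wi" for \<alpha>
  proof -
    have "eventually (\<lambda>n. width (?S n) (loser (?S n)) < width (?S N1) \<alpha>) sequentially"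
      using order_tendstoD(2)[OF lim] wpos a by blast
    then obtain N where N: "\<And>n. n \<ge> N \<Longrightarrow> width (?S n) (loser (?S n)) < width (?S N1) \<alpha>"
      unfolding eventually_sequentially by blast
    have "loser (?S n) \<noteq> \<alpha>" if "n \<ge> max N N1" for n using N[of n] wconst[of \<alpha> n] a that by auto
    then show ?thesis by (intro exI[of _ "max N N1"]) auto
  qed
  then obtain K where K: "\<And>\<alpha>. \<alpha> \<in> ?A - Wi \<Longrightarrow> \<forall>n\<ge>K \<alpha>. loser (?S n) \<noteq> \<alpha>" by metis
  define N where "N = N1 + (\<Sum>\<alpha>\<in>?A - Wi. K \<alpha>)"
  have Nw: "winner (?S n) \<in> Wi" if "n \<ge> N" for n using N1 that by (simp add: N_def)
  have Nl: "loser (?S n) \<in> Wi" if "n \<ge> N" for n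
  proof (rule ccontr)
    assume "loser (?S n) \<notin> Wi"
    then have w: "loser (?S n) \<in> ?A - Wi" using wl by auto
    have "K (loser (?S n)) \<le> N" unfolding N_def using fin w by (intro trans_le_add2 member_le_sum) auto
    then show False using K[OF w, rule_format, of n] that by simp
  qed
  have last: "top_left (?S n) \<beta> \<le> top_left (?S n) (top_last (?S n))"
      "bot_left (?S n) \<beta> \<le> bot_left (?S n) (bot_last (?S n))" if "\<beta> \<in> ?A" for n \<beta>
    using good_last(5)[OF g, of \<beta> n] good_last(6)[OF g, of \<beta> n] wpos[OF that, of n] that A by fastforce+
  have top: "\<beta> \<notin> Wi" if a: "\<alpha> \<in> ?A - Wi" and b: "\<beta> \<in> ?A" "top_left (?S N) \<beta> < top_left (?S N) \<alpha>" for \<alpha> \<beta>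
  proof
    assume bW: "\<beta> \<in> Wi"
    let ?L = "\<lambda>n. {\<beta> \<in> ?A. top_left (?S n) \<beta> < top_left (?S n) \<alpha>}"
    have ca: "top_left (?S (Suc n)) \<gamma> = top_left (?S n) \<gamma>" if "n \<ge> N" "\<gamma> = \<alpha> \<or> \<gamma> \<in> ?L n" for n \<gamma>
    proof (cases "top_wins (?S n)")
      case False
      have "\<gamma> \<noteq> top_last (?S n)"
        using that(2) a last(1)[of \<alpha> n] Nl[OF that(1)] False by (auto simp: loser_def)
      then show ?thesis using False by (simp add: rauzy_step_bot g)
    qed (simp add: rauzy_step_top g)
    show False
    proof (rule growing_sets_avoid[OF fin, of ?L N "\<lambda>n. winner (?S n)" N \<beta>])
      show "?L n \<subseteq> ?L (Suc n)" if "N \<le> n" for n using ca[OF that] by auto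
      show "?L n \<noteq> ?L (Suc n)" if n: "N \<le> n" and w: "winner (?S n) \<in> ?L n" for n
      proof -
        have nt: "\<not> top_wins (?S n)" using w last(1)[of \<alpha> n] a by (auto simp: winner_def)
        then have wb: "winner (?S n) = bot_last (?S n)" by (simp add: winner_def)
        note P = good_facts(4)[OF g, of n, unfolded A]
        have "top_left (?S n) (bot_last (?S n)) + width (?S n) (bot_last (?S n)) \<le> top_left (?S n) \<alpha>"
          using interval_partition_separated[OF P, of "bot_last (?S n)" \<alpha>] wpos w wb a by auto
        \<comment> \<open>The loser's new top interval is the right part of the winner's old one,
          hence it lies to the left of \<alpha> and is the additional letter.\<close>
        moreover have "top_left (?S (Suc n)) (top_last (?S n)) <
            top_left (?S n) (bot_last (?S n)) + width (?S n) (bot_last (?S n))"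
          using nt good_last(3,4)[OF g, of n] wpos[of "top_last (?S n)" n] good_last(1)[OF g, of n] A
          by (auto simp: rauzy_step_bot g shift_def)
        ultimately have "top_last (?S n) \<in> ?L (Suc n)"
          using ca[OF n, of \<alpha>] good_last(1)[OF g, of n] A by auto
        moreover have "top_last (?S n) \<notin> ?L n" using last(1)[of \<alpha> n] a by auto
        ultimately show ?thesis by blast
      qed
      show "\<beta> \<in> ?L N" using b by simp
      show "\<exists>n\<ge>m. winner (?S n) = \<beta>" for m using bW by (auto simp: Wi_def)
    qed auto
  qed
  have bot: "\<beta> \<notin> Wi" if a: "\<alpha> \<in> ?A - Wi" and b: "\<beta> \<in> ?A" "bot_left (?S N) \<beta> < bot_left (?S N) \<alpha>" for \<alpha> \<beta>
  proof
    assume bW: "\<beta> \<in> Wi"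
    let ?L = "\<lambda>n. {\<beta> \<in> ?A. bot_left (?S n) \<beta> < bot_left (?S n) \<alpha>}"
    have ca: "bot_left (?S (Suc n)) \<gamma> = bot_left (?S n) \<gamma>" if "n \<ge> N" "\<gamma> = \<alpha> \<or> \<gamma> \<in> ?L n" for n \<gamma>
    proof (cases "top_wins (?S n)")
      case True
      have "\<gamma> \<noteq> bot_last (?S n)"
        using that(2) a last(2)[of \<alpha> n] Nl[OF that(1)] True by (auto simp: loser_def)
      then show ?thesis using True by (simp add: rauzy_step_top g)
    qed (simp add: rauzy_step_bot g)
    show False
    proof (rule growing_sets_avoid[OF fin, of ?L N "\<lambda>n. winner (?S n)" N \<beta>])
      show "?L n \<subseteq> ?L (Suc n)" if "N \<le> n" for n using ca[OF that] by auto
      show "?L n \<noteq> ?L (Suc n)" if n: "N \<le> n" and w: "winner (?S n) \<in> ?L n" for n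
      proof -
        have nt: "top_wins (?S n)" using w last(2)[of \<alpha> n] a by (auto simp: winner_def split: if_splits)
        then have wb: "winner (?S n) = top_last (?S n)" by (simp add: winner_def)
        note P = good_facts(5)[OF g, of n, unfolded A]
        have "bot_left (?S n) (top_last (?S n)) + width (?S n) (top_last (?S n)) \<le> bot_left (?S n) \<alpha>"
          using interval_partition_separated[OF P, of "top_last (?S n)" \<alpha>] wpos w wb a by auto
        moreover have "bot_left (?S (Suc n)) (bot_last (?S n)) <
            bot_left (?S n) (top_last (?S n)) + width (?S n) (top_last (?S n))"
          using nt good_last(3,4)[OF g, of n] wpos[of "bot_last (?S n)" n] good_last(2)[OF g, of n] A
          by (auto simp: rauzy_step_top g shift_def)
        ultimately have "bot_last (?S n) \<in> ?L (Suc n)"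
          using ca[OF n, of \<alpha>] good_last(2)[OF g, of n] A by auto
        moreover have "bot_last (?S n) \<notin> ?L n" using last(2)[of \<alpha> n] a by auto
        ultimately show ?thesis by blast
      qed
      show "\<beta> \<in> ?L N" using b by simp
      show "\<exists>n\<ge>m. winner (?S n) = \<beta>" for m using bW by (auto simp: Wi_def)
    qed auto
  qed
  have sep: "top_left (?S N) \<alpha> \<noteq> top_left (?S N) \<beta>" "bot_left (?S N) \<alpha> \<noteq> bot_left (?S N) \<beta>"
    if "\<alpha> \<in> ?A" "\<beta> \<in> ?A" "\<alpha> \<noteq> \<beta>" for \<alpha> \<beta>
    using interval_partition_separated[OF good_facts(4)[OF g, of N, unfolded A], of \<alpha> \<beta>]
      interval_partition_separated[OF good_facts(5)[OF g, of N, unfolded A], of \<alpha> \<beta>] wpos[of _ N] that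
    by fastforce+
  have "Wi = ?A"
  proof (rule ccontr)
    assume ne: "Wi \<noteq> ?A"
    have sub: "Wi \<subseteq> ?A" by (auto simp: Wi_def)
    have "Wi \<noteq> {}" using Nw[of N] by auto
    show False
    proof (rule good_cut_free[OF g[of N], where K = "?A - Wi", unfolded A])
      show "?A - Wi \<noteq> {}" "?A - Wi \<noteq> ?A" using ne sub \<open>Wi \<noteq> {}\<close> by auto
      show "\<alpha> \<in> ?A \<Longrightarrow> \<beta> \<in> ?A - Wi \<Longrightarrow> top_left (?S N) \<alpha> \<le> top_left (?S N) \<beta> \<Longrightarrow> \<alpha> \<in> ?A - Wi" for \<alpha> \<beta>
        using top[of \<beta> \<alpha>] sep(1)[of \<alpha> \<beta>] by fastforce
      show "\<alpha> \<in> ?A \<Longrightarrow> \<beta> \<in> ?A - Wi \<Longrightarrow> bot_left (?S N) \<alpha> \<le> bot_left (?S N) \<beta> \<Longrightarrow> \<alpha> \<in> ?A - Wi" for \<alpha> \<beta>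
        using bot[of \<beta> \<alpha>] sep(2)[of \<alpha> \<beta>] by fastforce
    qed auto
  qed
  then show ?thesis using assms(2) unfolding Wi_def by blast
qed

section \<open>Positivity of the matrices\<close>

lemma cv_unit_nonneg:
  assumes "good T" "\<alpha> \<in> alphabet T" shows "0 \<le> cv T n (unit_vec \<beta> :: _ \<Rightarrow> real) \<alpha>"
  using cv_mono[OF assms(1), of 0 "unit_vec \<beta>" \<alpha> n] assms(2) by (auto simp: unit_vec_def cv_0)

text \<open>In the column of \<beta> the set of rows with a positive entry only grows. Suppose that
  it stops at a proper subset \<open>Y\<close>. Since all letters win infinitely often, some winner
  outside \<open>Y\<close> is followed by a winner in \<open>Y\<close>; the former then loses to the
  latter and would have to enter \<open>Y\<close>.\<close>

lemma eventually_positive: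
  assumes T: "good T"
  shows "\<exists>n. \<forall>\<alpha>\<in>alphabet T. \<forall>\<beta>\<in>alphabet T. 0 < cv T n (unit_vec \<beta> :: _ \<Rightarrow> real) \<alpha>"
proof -
  let ?A = "alphabet T" and ?S = "rv T"
  have g: "good (?S n)" and A: "alphabet (?S n) = ?A" for n using good_rv[OF T] rv_alphabet[OF T] by auto
  have fin: "finite ?A" using good_facts(1)[OF T] .
  have wl: "winner (?S n) \<in> ?A" "loser (?S n) \<in> ?A" for n
    using winner_loser[OF g, unfolded A] by auto
  define X where "X \<beta> n = {\<alpha> \<in> ?A. 0 < cv T n (unit_vec \<beta> :: _ \<Rightarrow> real) \<alpha>}" for \<beta> n
  have Xstep: "X \<beta> n \<subseteq> X \<beta> (Suc n)" for \<beta> n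
    using cv_unit_nonneg[OF T wl(1)] by (auto simp: X_def stepv_def add_pos_nonneg)
  have Xmono: "X \<beta> m \<subseteq> X \<beta> n" if "m \<le> n" for \<beta> m n
    using lift_Suc_mono_le[of "X \<beta>", OF Xstep that] .
  have Xwin: "loser (?S n) \<in> X \<beta> (Suc n)" if "winner (?S n) \<in> X \<beta> n" for \<beta> n
    using cv_unit_nonneg[OF T wl(2)] that wl by (auto simp: X_def stepv_def add_nonneg_pos)
  have "\<exists>N. X \<beta> N = ?A" if be: "\<beta> \<in> ?A" for \<beta>
  proof -
    define Y where "Y = (\<Union>n. X \<beta> n)"
    have YA: "Y \<subseteq> ?A" by (auto simp: Y_def X_def)
    have "\<forall>\<alpha>\<in>Y. \<exists>n. \<alpha> \<in> X \<beta> n" by (auto simp: Y_def)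
    then obtain M where M: "\<And>\<alpha>. \<alpha> \<in> Y \<Longrightarrow> \<alpha> \<in> X \<beta> (M \<alpha>)" by metis
    define N where "N = sum M Y"
    have "\<alpha> \<in> X \<beta> N" if "\<alpha> \<in> Y" for \<alpha>
    proof -
      have "M \<alpha> \<le> N" unfolding N_def using that YA fin by (intro member_le_sum) (auto intro: finite_subset)
      then show ?thesis using Xmono M[OF that] by blast
    qed
    then have XN: "X \<beta> n = Y" if "n \<ge> N" for n using Xmono[OF that] by (auto simp: Y_def)
    have "Y = ?A"
    proof (rule ccontr)
      assume "Y \<noteq> ?A"
      then obtain \<alpha> where al: "\<alpha> \<in> ?A" "\<alpha> \<notin> Y" using YA by auto
      obtain n1 where n1: "n1 \<ge> N" "winner (?S n1) = \<alpha>" using winner_infinitely_often[OF T al(1)] by blast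
      have "\<beta> \<in> X \<beta> 0" using be by (simp add: X_def unit_vec_def)
      then have "\<beta> \<in> Y" by (auto simp: Y_def)
      then have ex: "\<exists>n. n \<ge> n1 \<and> winner (?S n) \<in> Y" using winner_infinitely_often[OF T be, of n1] by metis
      \<comment> \<open>The first win of a letter of \<open>Y\<close> after a win of \<alpha>. The
        winner one step earlier is outside \<open>Y\<close> and, by \<open>winner_persists\<close>,
        is the loser now.\<close>
      define n where "n = (LEAST n. n \<ge> n1 \<and> winner (?S n) \<in> Y)"
      have n: "n \<ge> n1" "winner (?S n) \<in> Y" using LeastI_ex[OF ex] by (auto simp: n_def)
      have "n \<noteq> n1" using n n1 al by auto
      then obtain k where k: "n = Suc k" "k \<ge> n1" using n(1) by (metis Suc_leI le_neq_implies_less less_imp_Suc_add le_add1 add_Suc_right Suc_le_mono not0_implies_Suc le_0_eq le_SucE)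
      have "winner (?S k) \<notin> Y" using not_less_Least[of k "\<lambda>n. n \<ge> n1 \<and> winner (?S n) \<in> Y"] k by (auto simp: n_def)
      then have "loser (?S n) = winner (?S k)" using winner_persists[OF g, of k] n(2) k(1) by auto
      moreover have "loser (?S n) \<in> Y"
        using Xwin[of n \<beta>] XN[of n] XN[of "Suc n"] n n1 by auto
      ultimately show False using \<open>winner (?S k) \<notin> Y\<close> by simp
    qed
    then show ?thesis using XN[of N] by auto
  qed
  then obtain M where M: "\<And>\<beta>. \<beta> \<in> ?A \<Longrightarrow> X \<beta> (M \<beta>) = ?A" by metis
  define N where "N = sum M ?A"
  have "X \<beta> N = ?A" if "\<beta> \<in> ?A" for \<beta>
  proof -
    have "M \<beta> \<le> N" unfolding N_def using that fin by (intro member_le_sum) auto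
    then show ?thesis using Xmono[of "M \<beta>" N \<beta>] M[OF that] by (auto simp: X_def)
  qed
  then show ?thesis by (intro exI[of _ N]) (auto simp: X_def)
qed

text \<open>By \<open>eventually_positive\<close>, applied at level \<open>n_seq T k\<close>, the
  \<open>LEAST\<close> in the definition of \<open>n_seq\<close> is attained.\<close>

lemma n_seq_props:
  assumes T: "good T"
  shows "n_seq T k \<le> n_seq T (Suc k)"
    "\<And>\<alpha> \<beta>. \<alpha> \<in> alphabet T \<Longrightarrow> \<beta> \<in> alphabet T \<Longrightarrow>
      0 < cv (rv T (n_seq T k)) (n_seq T (Suc k) - n_seq T k) (unit_vec \<beta> :: _ \<Rightarrow> real) \<alpha>"
proof -
  let ?P = "\<lambda>n. n_seq T k \<le> n \<and> (\<forall>\<alpha>\<in>alphabet T. \<forall>\<beta>\<in>alphabet T. 0 < Bmat T (n_seq T k) n \<alpha> \<beta>)"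
  have g: "good (rv T (n_seq T k))" and A: "alphabet (rv T (n_seq T k)) = alphabet T"
    using good_rv[OF T] rv_alphabet[OF T] by auto
  obtain n where "\<forall>\<alpha>\<in>alphabet T. \<forall>\<beta>\<in>alphabet T. 0 < cv (rv T (n_seq T k)) n (unit_vec \<beta> :: _ \<Rightarrow> real) \<alpha>"
    using eventually_positive[OF g] A by auto
  then have "?P (n_seq T k + n)" using Bmat_eq[OF T] by auto
  then have P: "?P (n_seq T (Suc k))" unfolding n_seq.simps by (rule LeastI)
  then show le: "n_seq T k \<le> n_seq T (Suc k)" by blast
  fix \<alpha> \<beta> assume ab: "\<alpha> \<in> alphabet T" "\<beta> \<in> alphabet T"
  then have "0 < Bmat T (n_seq T k) (n_seq T (Suc k)) \<alpha> \<beta>" using P by blast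
  then show "0 < cv (rv T (n_seq T k)) (n_seq T (Suc k) - n_seq T k) (unit_vec \<beta> :: _ \<Rightarrow> real) \<alpha>"
    using Bmat_eq[OF T ab, of "n_seq T k" "n_seq T (Suc k) - n_seq T k"] le by simp
qed

text \<open>If \<open>W\<close> is the vector of widths and \<open>x\<close> a left endpoint, this
  is the distance of \<open>x\<close> from the left end of the base. For general \<open>W\<close> it
  plays the part of a position, although \<open>W\<close> may have any signs.\<close>

definition psum :: "'a set \<Rightarrow> ('a \<Rightarrow> real) \<Rightarrow> real \<Rightarrow> ('a \<Rightarrow> real) \<Rightarrow> real" where
  "psum A l x W = (\<Sum>\<beta> | \<beta> \<in> A \<and> l \<beta> < x. W \<beta>)"

text \<open>
  Partial sums of the transported vector are partial sums of the old one, except at the new position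
  of the loser, where one displacement of the winner is added. This bounds the inverse transpose of
  the cocycle by the cocycle.
\<close>

lemma psum_step:
  fixes W :: "'a \<Rightarrow> real"
  assumes fin: "finite A" and zy: "z \<in> A" "y \<in> A" "z \<noteq> y"
    and l: "\<forall>\<alpha>\<in>A. \<alpha> \<noteq> z \<longrightarrow> l \<alpha> < l z" and m: "\<forall>\<alpha>\<in>A. \<alpha> \<noteq> y \<longrightarrow> m \<alpha> < m y"
    and c: "m z < c" "c < m y" "\<forall>\<alpha>\<in>A. \<alpha> \<noteq> z \<longrightarrow> m \<alpha> < m z \<or> c < m \<alpha>"
  defines "m' \<equiv> m(y := c)" and "W' \<equiv> W(z := W z - W y)"
    and "D \<equiv> \<lambda>\<alpha>. psum A m (m \<alpha>) W - psum A l (l \<alpha>) W"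
  shows "psum A l x W' = (if x \<le> l z then psum A l x W else psum A m (m y) W)"
    "psum A m' x W' = (if x \<le> m z then psum A m x W else if x \<le> c then psum A m (m y) W + D z
      else psum A m (min x (m y)) W)"
    "\<And>\<alpha>. \<alpha> \<in> A \<Longrightarrow> psum A m' (m' \<alpha>) W' - psum A l (l \<alpha>) W' = (D(y := D y + D z)) \<alpha>"
proof -
  \<comment> \<open>Here \<open>z\<close> is the winner and \<open>l\<close> the line on which it is
    last; \<open>y\<close> is the loser, which is moved on the other line \<open>m\<close> to the
    place \<open>c\<close> directly after the start of \<open>z\<close>.\<close>
  have my: "sum W A = psum A m (m y) W + W y"
  proof -
    have "{\<beta> \<in> A. m \<beta> < m y} = A - {y}" using m by auto
    then show ?thesis unfolding psum_def using fin zy by (simp add: sum.remove[of A y])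
  qed
  have lz: "sum W A = psum A l (l z) W + W z"
  proof -
    have "{\<beta> \<in> A. l \<beta> < l z} = A - {z}" using l by auto
    then show ?thesis unfolding psum_def using fin zy by (simp add: sum.remove[of A z])
  qed
  have tot: "sum W' A = sum W A - W y"
    using fin zy unfolding W'_def by (simp add: sum.remove[of A z])
  show 1: "psum A l x W' = (if x \<le> l z then psum A l x W else psum A m (m y) W)" for x
  proof (cases "x \<le> l z")
    case True
    then show ?thesis unfolding psum_def W'_def by (auto intro!: sum.cong)
  next
    case False
    then have "{\<beta> \<in> A. l \<beta> < x} = A" using l by force
    then show ?thesis using False tot my unfolding psum_def by auto
  qed
  show 2: "psum A m' x W' = (if x \<le> m z then psum A m x W else if x \<le> c then psum A m (m y) W + D z
      else psum A m (min x (m y)) W)" for x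
  proof -
    consider "x \<le> m z" | "m z < x" "x \<le> c" | "c < x" by linarith
    then show ?thesis
    proof cases
      case 1
      have "{\<beta> \<in> A. m' \<beta> < x} = {\<beta> \<in> A. m \<beta> < x}" using 1 c by (auto simp: m'_def)
      then show ?thesis using 1 unfolding psum_def W'_def by (auto intro!: sum.cong)
    next
      case 2
      \<comment> \<open>The only partial sum that is not an old one: it ends with the reduced entry
        of \<open>z\<close>, the loser not yet being included.\<close>
      have s: "{\<beta> \<in> A. m' \<beta> < x} = insert z {\<beta> \<in> A. m \<beta> < m z}"
      proof -
        have "m' \<beta> < x \<longleftrightarrow> \<beta> = z \<or> m \<beta> < m z" if "\<beta> \<in> A" for \<beta>
          using bspec[OF c(3) that] 2 c(1,2) zy by (auto simp: m'_def)
        then show ?thesis using zy by blast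
      qed
      have "sum W' {\<beta> \<in> A. m \<beta> < m z} = psum A m (m z) W"
        unfolding psum_def W'_def by (auto intro!: sum.cong)
      then have "psum A m' x W' = psum A m (m z) W + W z - W y"
        unfolding psum_def[of A m'] s using fin by (simp add: W'_def)
      then show ?thesis using 2 my lz by (simp add: D_def)
    next
      case 3
      define S where "S = {\<beta> \<in> A. m \<beta> < min x (m y)} - {z}"
      have S: "finite S" "z \<notin> S" "y \<notin> S" using fin by (auto simp: S_def)
      have s: "{\<beta> \<in> A. m' \<beta> < x} = insert z (insert y S)"
        using 3 c zy m by (auto simp: m'_def S_def)
      have s2: "{\<beta> \<in> A. m \<beta> < min x (m y)} = insert z S"
        using 3 c zy m by (auto simp: S_def)
      have "sum W' S = sum W S" unfolding W'_def using S by (auto intro!: sum.cong)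
      then show ?thesis
        using 3 c zy S unfolding psum_def[of A m'] psum_def[of A m "min x (m y)"] s s2 by (simp add: W'_def)
    qed
  qed
  fix \<alpha> assume al: "\<alpha> \<in> A"
  have la: "l \<alpha> \<le> l z" using l al by fastforce
  show "psum A m' (m' \<alpha>) W' - psum A l (l \<alpha>) W' = (D(y := D y + D z)) \<alpha>"
  proof (cases "\<alpha> = y")
    case True
    then show ?thesis using la c(1,2) 1[of "l y"] 2[of c] by (simp add: m'_def D_def)
  next
    case False
    have "m \<alpha> < m y" using m al False by auto
    moreover have "m \<alpha> \<le> m z \<or> c < m \<alpha>" using c(3) al by (cases "\<alpha> = z") auto
    ultimately show ?thesis using la False c(1) 1[of "l \<alpha>"] 2[of "m \<alpha>"] by (auto simp: m'_def D_def)
  qed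
qed

definition psum_bounded :: "'a iem \<Rightarrow> ('a \<Rightarrow> real) \<Rightarrow> real \<Rightarrow> bool" where
  "psum_bounded T W P \<longleftrightarrow>
     (\<forall>x. \<bar>psum (alphabet T) (top_left T) x W\<bar> \<le> P \<and> \<bar>psum (alphabet T) (bot_left T) x W\<bar> \<le> P)"

text \<open>For the widths this is the translation \<open>shift\<close> on the alphabet; for general
  \<open>W\<close> it is the vector Omega W, see \<open>disp_Omega\<close>.\<close>

definition disp :: "'a iem \<Rightarrow> ('a \<Rightarrow> real) \<Rightarrow> 'a \<Rightarrow> real" where
  "disp T W = (\<lambda>\<alpha>. if \<alpha> \<in> alphabet T then
     psum (alphabet T) (bot_left T) (bot_left T \<alpha>) W - psum (alphabet T) (top_left T) (top_left T \<alpha>) W else 0)"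

text \<open>In view of \<open>disp_Omega\<close>, the first part says that Omega carries the inverse
  transpose of the cocycle to the cocycle, which is its symplectic invariance. The two cases are
  mirror images: the lines exchange their roles and displacements change sign.\<close>

lemma disp_step:
  fixes W :: "'a \<Rightarrow> real"
  assumes "good T"
  shows "disp (rauzy_step T) (stepw T W) = stepv T (disp T W)"
    and "psum_bounded T W P \<Longrightarrow>
      psum_bounded (rauzy_step T) (stepw T W) (P + \<bar>disp T W (winner T)\<bar>)"
proof -
  let ?A = "alphabet T" and ?T = "rauzy_step T"
  note g = good_facts[OF assms] and la = good_last[OF assms] and wl = winner_loser[OF assms]
  have w: "0 < width T \<alpha>" if "\<alpha> \<in> ?A" for \<alpha> using g(3) that by blast
  have lst: "\<forall>\<alpha>\<in>?A. \<alpha> \<noteq> top_last T \<longrightarrow> top_left T \<alpha> < top_left T (top_last T)"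
     "\<forall>\<alpha>\<in>?A. \<alpha> \<noteq> bot_last T \<longrightarrow> bot_left T \<alpha> < bot_left T (bot_last T)"
    using la(5,6) w by fastforce+
  have A: "alphabet ?T = ?A" using assms by (rule rauzy_step_alphabet)
  have "disp ?T (stepw T W) = stepv T (disp T W) \<and>
    (psum_bounded T W P \<longrightarrow> psum_bounded ?T (stepw T W) (P + \<bar>disp T W (winner T)\<bar>))"
  proof (cases "top_wins T")
    case True
    let ?z = "top_last T" and ?y = "bot_last T" and ?l = "top_left T" and ?m = "bot_left T"
    let ?c = "?m ?y + shift T ?z"
    have T': "top_left ?T = ?l" "bot_left ?T = ?m(?y := ?c)" using True by (simp_all add: rauzy_step_top assms)
    have W': "stepw T W = W(?z := W ?z - W ?y)" using True by (simp add: stepw_def winner_def loser_def)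
    have "?l ?z < ?m ?y" using True by (simp add: top_wins_def)
    then have c: "?m ?z < ?c" "?c < ?m ?y" "?c < ?m ?z + width T ?z"
      using la(3,4) la(6)[OF la(1,10)] w[OF la(2)] by (auto simp: shift_def)
    have c3: "\<forall>\<alpha>\<in>?A. \<alpha> \<noteq> ?z \<longrightarrow> ?m \<alpha> < ?m ?z \<or> ?c < ?m \<alpha>"
      using interval_partition_separated[OF g(5,3) la(1)] c(3) by fastforce
    note ps = psum_step[where W = W, OF g(1) la(1,2,10) lst c(1,2) c3, folded T' W']
    have d: "psum ?A ?m (?m \<alpha>) W - psum ?A ?l (?l \<alpha>) W = disp T W \<alpha>" if "\<alpha> \<in> ?A" for \<alpha>
      using that by (simp add: disp_def)
    have "disp ?T (stepw T W) \<alpha> = stepv T (disp T W) \<alpha>" for \<alpha>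
    proof (cases "\<alpha> \<in> ?A")
      case al: True
      then show ?thesis using ps(3)[OF al] True la(1,2)
        by (simp add: disp_def A stepv_def winner_def loser_def T'(1)[symmetric])
    next
      case False
      then show ?thesis using wl by (auto simp: disp_def A stepv_def)
    qed
    moreover have "psum_bounded ?T (stepw T W) (P + \<bar>disp T W (winner T)\<bar>)" if b: "psum_bounded T W P"
      unfolding psum_bounded_def A
    proof (intro allI conjI)
      fix x
      have P: "\<bar>psum ?A ?l x W\<bar> \<le> P" "\<bar>psum ?A ?m x W\<bar> \<le> P" for x using b by (auto simp: psum_bounded_def)
      show "\<bar>psum ?A (top_left ?T) x (stepw T W)\<bar> \<le> P + \<bar>disp T W (winner T)\<bar>"
        using ps(1)[of x] P(1)[of x] P(2)[of "?m ?y"] unfolding T'(1) by (auto split: if_splits)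
      have "\<bar>psum ?A ?m (?m ?y) W + disp T W (winner T)\<bar> \<le> P + \<bar>disp T W (winner T)\<bar>"
        using P(2)[of "?m ?y"] by linarith
      then show "\<bar>psum ?A (bot_left ?T) x (stepw T W)\<bar> \<le> P + \<bar>disp T W (winner T)\<bar>"
        using ps(2)[of x] P(2)[of x] P(2)[of "min x (?m ?y)"] d[OF la(1)] True
        by (auto simp: winner_def T'(1) split: if_splits)
    qed
    ultimately show ?thesis by blast
  next
    case False
    let ?z = "bot_last T" and ?y = "top_last T" and ?l = "bot_left T" and ?m = "top_left T"
    let ?c = "?m ?y - shift T ?z"
    have T': "bot_left ?T = ?l" "top_left ?T = ?m(?y := ?c)" using False by (simp_all add: rauzy_step_bot assms)
    have W': "stepw T W = W(?z := W ?z - W ?y)" using False by (simp add: stepw_def winner_def loser_def)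
    have "?l ?z < ?m ?y" using False la(9) by (simp add: top_wins_def)
    then have c: "?m ?z < ?c" "?c < ?m ?y" "?c < ?m ?z + width T ?z"
      using la(3,4) la(5)[OF la(2) la(10)[symmetric]] w[OF la(1)] by (auto simp: shift_def)
    have c3: "\<forall>\<alpha>\<in>?A. \<alpha> \<noteq> ?z \<longrightarrow> ?m \<alpha> < ?m ?z \<or> ?c < ?m \<alpha>"
      using interval_partition_separated[OF g(4,3) la(2)] c(3) by fastforce
    note ps = psum_step[where W = W, OF g(1) la(2,1) la(10)[symmetric] lst(2,1) c(1,2) c3, folded T' W']
    have d: "psum ?A ?m (?m \<alpha>) W - psum ?A ?l (?l \<alpha>) W = - disp T W \<alpha>" if "\<alpha> \<in> ?A" for \<alpha>
      using that by (simp add: disp_def)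
    have "disp ?T (stepw T W) \<alpha> = stepv T (disp T W) \<alpha>" for \<alpha>
    proof (cases "\<alpha> \<in> ?A")
      case al: True
      then show ?thesis using ps(3)[OF al] False la(1,2)
        by (simp add: disp_def A stepv_def winner_def loser_def T'(1)[symmetric] split: if_splits)
    next
      case False
      then show ?thesis using wl by (auto simp: disp_def A stepv_def)
    qed
    moreover have "psum_bounded ?T (stepw T W) (P + \<bar>disp T W (winner T)\<bar>)" if b: "psum_bounded T W P"
      unfolding psum_bounded_def A
    proof (intro allI conjI)
      fix x
      have P: "\<bar>psum ?A ?l x W\<bar> \<le> P" "\<bar>psum ?A ?m x W\<bar> \<le> P" for x using b by (auto simp: psum_bounded_def)
      show "\<bar>psum ?A (bot_left ?T) x (stepw T W)\<bar> \<le> P + \<bar>disp T W (winner T)\<bar>"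
        using ps(1)[of x] P(1)[of x] P(2)[of "?m ?y"] unfolding T'(1) by (auto split: if_splits)
      have "\<bar>psum ?A ?m (?m ?y) W - disp T W (winner T)\<bar> \<le> P + \<bar>disp T W (winner T)\<bar>"
        using P(2)[of "?m ?y"] by linarith
      then show "\<bar>psum ?A (top_left ?T) x (stepw T W)\<bar> \<le> P + \<bar>disp T W (winner T)\<bar>"
        using ps(2)[of x] P(2)[of x] P(2)[of "min x (?m ?y)"] d[OF la(2)] False
        by (auto simp: winner_def T'(1) split: if_splits)
    qed
    ultimately show ?thesis by blast
  qed
  then show "disp (rauzy_step T) (stepw T W) = stepv T (disp T W)"
    and "psum_bounded T W P \<Longrightarrow>
      psum_bounded (rauzy_step T) (stepw T W) (P + \<bar>disp T W (winner T)\<bar>)" by blast+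
qed

lemma disp_rv:
  assumes "good T" shows "disp (rv T n) (cw T n W) = cv T n (disp T W)"
  using disp_step(1)[OF good_rv[OF assms]] by (induction n) auto

lemma psum_bounded_rv:
  assumes "good T" "psum_bounded T W P" "\<And>m. m < n \<Longrightarrow> \<forall>\<alpha>\<in>alphabet T. \<bar>cv T m (disp T W) \<alpha>\<bar> \<le> D m"
  shows "psum_bounded (rv T n) (cw T n W) (P + sum D {..<n})"
  using assms(3)
proof (induction n)
  case (Suc n)
  have gn: "good (rv T n)" using assms(1) by (rule good_rv)
  have "psum_bounded (rv T n) (cw T n W) (P + sum D {..<n})" using Suc by simp
  from disp_step(2)[OF gn this]
  have "psum_bounded (rv T (Suc n)) (cw T (Suc n) W)
      (P + sum D {..<n} + \<bar>cv T n (disp T W) (winner (rv T n))\<bar>)"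
    by (simp add: disp_rv assms(1))
  moreover have "\<bar>cv T n (disp T W) (winner (rv T n))\<bar> \<le> D n"
    using Suc.prems[of n] winner_loser(1)[OF gn] rv_alphabet[OF assms(1)] by auto
  ultimately show ?case unfolding psum_bounded_def sum.lessThan_Suc by (smt (verit))
qed (use assms in auto)

text \<open>An entry is the difference of two consecutive partial sums on the top line.\<close>

lemma psum_bounded_entry:
  assumes "good T" "psum_bounded T W P" "\<alpha> \<in> alphabet T"
  shows "\<bar>W \<alpha>\<bar> \<le> 2 * P"
proof -
  let ?A = "alphabet T" and ?l = "top_left T"
  note g = good_facts[OF assms(1)]
  have "{\<beta> \<in> ?A. ?l \<beta> < ?l \<alpha> + width T \<alpha>} = insert \<alpha> {\<beta> \<in> ?A. ?l \<beta> < ?l \<alpha>}"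
    using interval_partition_separated[OF g(4,3) assms(3)] g(3) assms(3) by fastforce
  then have "psum ?A ?l (?l \<alpha> + width T \<alpha>) W = W \<alpha> + psum ?A ?l (?l \<alpha>) W"
    unfolding psum_def using g(1) by simp
  moreover have "\<bar>psum ?A ?l x W\<bar> \<le> P" for x using assms(2) by (simp add: psum_bounded_def)
  from this[of "?l \<alpha> + width T \<alpha>"] this[of "?l \<alpha>"]
  have "\<bar>psum ?A ?l (?l \<alpha> + width T \<alpha>) W\<bar> \<le> P" "\<bar>psum ?A ?l (?l \<alpha>) W\<bar> \<le> P" .
  ultimately show ?thesis by linarith
qed

lemma psum_bounded_sum:
  assumes "good T" shows "psum_bounded T W (\<Sum>\<alpha>\<in>alphabet T. \<bar>W \<alpha>\<bar>)"
proof -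
  have "\<bar>psum (alphabet T) l x W\<bar> \<le> (\<Sum>\<alpha>\<in>alphabet T. \<bar>W \<alpha>\<bar>)" for l x
    unfolding psum_def using good_facts(1)[OF assms]
    by (intro order_trans[OF sum_abs] sum_mono2) auto
  then show ?thesis by (simp add: psum_bounded_def)
qed

text \<open>Displacements evolve by the cocycle itself. Any bound on \<open>cv\<close> along
  \<open>disp T W\<close>, decay included, thus passes to \<open>cw\<close> along \<open>W\<close>
  after summation over the steps, and the size of the alphabet enters no exponent.\<close>

lemma cw_bound:
  assumes "good T" "\<And>m. m < n \<Longrightarrow> \<forall>\<alpha>\<in>alphabet T. \<bar>cv T m (disp T W) \<alpha>\<bar> \<le> D m" "\<alpha> \<in> alphabet T"
  shows "\<bar>cw T n W \<alpha>\<bar> \<le> 2 * ((\<Sum>\<alpha>\<in>alphabet T. \<bar>W \<alpha>\<bar>) + sum D {..<n})"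
  using psum_bounded_entry[OF good_rv[OF assms(1)] psum_bounded_rv[OF assms(1) psum_bounded_sum[OF assms(1)] assms(2)]]
    assms(3) by (simp add: rv_alphabet assms(1))

lemma disp_Omega:
  assumes "good T" shows "disp T W = mat_vec (alphabet T) (Omega T) W"
proof
  fix \<alpha>
  let ?A = "alphabet T"
  note g = good_facts[OF assms]
  show "disp T W \<alpha> = mat_vec ?A (Omega T) W \<alpha>"
  proof (cases "\<alpha> \<in> ?A")
    case True
    have sep: "top_left T \<alpha> \<noteq> top_left T \<beta>" "bot_left T \<alpha> \<noteq> bot_left T \<beta>" if "\<beta> \<in> ?A" "\<alpha> \<noteq> \<beta>" for \<beta>
      using interval_partition_separated[OF g(4,3) True that(1)] interval_partition_separated[OF g(5,3) True that(1)]
        g(3) True that by fastforce+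
    have p: "pi_t T \<beta> < pi_t T \<gamma> \<longleftrightarrow> top_left T \<beta> < top_left T \<gamma>" "pi_b T \<beta> < pi_b T \<gamma> \<longleftrightarrow> bot_left T \<beta> < bot_left T \<gamma>"
      if "\<beta> \<in> ?A" "\<gamma> \<in> ?A" for \<beta> \<gamma>
      unfolding pi_t_def pi_b_def
      using position_less[OF g(1) that] position_le[OF g(1) that(2,1)] by (meson leI leD)+
    have "disp T W \<alpha> = (\<Sum>\<beta>\<in>?A. if bot_left T \<beta> < bot_left T \<alpha> then W \<beta> else 0) -
        (\<Sum>\<beta>\<in>?A. if top_left T \<beta> < top_left T \<alpha> then W \<beta> else 0)"
      using True g(1) by (simp add: disp_def psum_def sum.inter_filter)
    also have "\<dots> = (\<Sum>\<beta>\<in>?A. Omega T \<alpha> \<beta> * W \<beta>)"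
      unfolding sum_subtractf[symmetric]
    proof (intro sum.cong refl)
      fix \<beta> assume b: "\<beta> \<in> ?A"
      show "(if bot_left T \<beta> < bot_left T \<alpha> then W \<beta> else 0) - (if top_left T \<beta> < top_left T \<alpha> then W \<beta> else 0) =
          Omega T \<alpha> \<beta> * W \<beta>"
      proof (cases "\<alpha> = \<beta>")
        case False
        then show ?thesis using sep[OF b False] unfolding Omega_def using p[OF True b] p[OF b True] by auto
      qed (simp add: Omega_def)
    qed
    finally show ?thesis using True by (simp add: mat_vec_def)
  qed (simp add: disp_def mat_vec_def)
qed

lemma Omega_antisym: "Omega T \<alpha> \<beta> = - Omega T \<beta> \<alpha>"
  by (auto simp: Omega_def)

section \<open>Growth estimates\<close>

lemma vnorm_ge: "finite A \<Longrightarrow> \<alpha> \<in> A \<Longrightarrow> \<bar>\<xi> \<alpha>\<bar> \<le> vnorm A \<xi>"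
  unfolding vnorm_def by (intro Max_ge) auto

lemma vnorm_le: "finite A \<Longrightarrow> A \<noteq> {} \<Longrightarrow> (\<And>\<alpha>. \<alpha> \<in> A \<Longrightarrow> \<bar>\<xi> \<alpha>\<bar> \<le> c) \<Longrightarrow> vnorm A \<xi> \<le> c"
  unfolding vnorm_def by (subst Max_le_iff) auto

text \<open>Positivity of \<open>g\<close> allows the finitely many terms before the asymptotic
  bound to be absorbed in the constant.\<close>

lemma bigo_uniform:
  fixes f g :: "nat \<Rightarrow> real"
  assumes "f \<in> O(g)" "\<And>n. 0 < g n"
  obtains C where "C > 0" "\<And>n. \<bar>f n\<bar> \<le> C * g n"
proof -
  obtain c where c: "c > 0" "eventually (\<lambda>n. norm (f n) \<le> c * norm (g n)) sequentially"
    using assms(1) by (rule landau_o.bigE)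
  then obtain M where M: "\<And>n. n \<ge> M \<Longrightarrow> \<bar>f n\<bar> \<le> c * g n"
    using assms(2) unfolding eventually_sequentially by (auto simp: less_imp_le abs_of_pos)
  define C where "C = c + (\<Sum>n<M. \<bar>f n\<bar> / g n)"
  have s: "0 \<le> (\<Sum>n<M. \<bar>f n\<bar> / g n)" using assms(2) by (intro sum_nonneg) (simp add: less_imp_le)
  have "\<bar>f n\<bar> \<le> C * g n" for n
  proof (cases "n < M")
    case True
    have "\<bar>f n\<bar> / g n \<le> (\<Sum>n<M. \<bar>f n\<bar> / g n)"
      using True assms(2) by (intro member_le_sum[where f = "\<lambda>n. \<bar>f n\<bar> / g n"]) (auto simp: less_imp_le)
    then have "\<bar>f n\<bar> / g n \<le> C" using c(1) by (simp add: C_def)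
    then show ?thesis using assms(2)[of n] by (simp add: divide_le_eq)
  next
    case False
    then have "\<bar>f n\<bar> \<le> c * g n" using M by simp
    also have "\<dots> \<le> C * g n" using s assms(2)[of n] by (intro mult_right_mono) (auto simp: C_def less_imp_le)
    finally show ?thesis .
  qed
  moreover have "C > 0" using c s by (simp add: C_def)
  ultimately show ?thesis using that by blast
qed

lemma ret_mono:
  assumes "good T" "\<alpha> \<in> alphabet T" "m \<le> n"
  shows "ret T m \<alpha> \<le> ret T n \<alpha>"
  using assms(3)
proof (induction n rule: dec_induct)
  case (step n)
  have "ret T n \<alpha> \<le> ret T (Suc n) \<alpha>"
    using ret_ge_1[OF assms(1), of "winner (rv T n)" n] winner_loser(1)[OF good_rv[OF assms(1)], of n]
      rv_alphabet[OF assms(1), of n]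
    by (auto simp: stepv_def)
  then show ?case using step by simp
qed simp

text \<open>Every step adds the return time of the winner, at least 1, to the total. This bounds the
  number of steps by norms of the cocycle.\<close>

lemma ret_sum_ge:
  assumes "good T" shows "real n \<le> (\<Sum>\<alpha>\<in>alphabet T. ret T n \<alpha>)"
proof (induction n)
  case 0
  show ?case by simp
next
  case (Suc n)
  note wl = winner_loser[OF good_rv[OF assms, of n], unfolded rv_alphabet[OF assms]]
  have "(\<Sum>\<alpha>\<in>alphabet T. ret T (Suc n) \<alpha>) - (\<Sum>\<alpha>\<in>alphabet T. ret T n \<alpha>) =
      (\<Sum>\<alpha>\<in>alphabet T. if \<alpha> = loser (rv T n) then ret T n (winner (rv T n)) else 0)"
    unfolding sum_subtractf[symmetric] by (intro sum.cong) (auto simp: stepv_def)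
  also have "\<dots> = ret T n (winner (rv T n))" using wl good_facts(1)[OF assms] by simp
  also have "\<dots> \<ge> 1" using ret_ge_1[OF assms wl(1)] .
  finally show ?case using Suc by simp
qed

lemma cv_surj:
  fixes \<eta> :: "'a \<Rightarrow> real"
  assumes "good T" "\<eta> \<in> vecs (alphabet T)"
  shows "\<exists>\<xi>\<in>vecs (alphabet T). cv T n \<xi> = \<eta>"
  using assms(2)
proof (induction n arbitrary: \<eta>)
  case (Suc n)
  let ?w = "winner (rv T n)" and ?l = "loser (rv T n)"
  note wl = winner_loser[OF good_rv[OF assms(1), of n], unfolded rv_alphabet[OF assms(1)]]
  have "\<eta>(?l := \<eta> ?l - \<eta> ?w) \<in> vecs (alphabet T)" using Suc.prems wl by (auto simp: vecs_def)
  then obtain \<xi> where "\<xi> \<in> vecs (alphabet T)" "cv T n \<xi> = \<eta>(?l := \<eta> ?l - \<eta> ?w)" using Suc.IH by blast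
  then show ?case using wl by (intro bexI[of _ \<xi>]) (auto simp: stepv_def)
qed simp

lemma cw_surj:
  assumes "good T" "\<eta> \<in> vecs (alphabet T)"
  shows "\<exists>\<xi>\<in>vecs (alphabet T). cw T n \<xi> = \<eta>"
  using assms(2)
proof (induction n arbitrary: \<eta>)
  case (Suc n)
  let ?w = "winner (rv T n)" and ?l = "loser (rv T n)"
  note wl = winner_loser[OF good_rv[OF assms(1), of n], unfolded rv_alphabet[OF assms(1)]]
  have "\<eta>(?w := \<eta> ?w + \<eta> ?l) \<in> vecs (alphabet T)" using Suc.prems wl by (auto simp: vecs_def)
  then obtain \<xi> where "\<xi> \<in> vecs (alphabet T)" "cw T n \<xi> = \<eta>(?w := \<eta> ?w + \<eta> ?l)" using Suc.IH by blast
  then show ?case using wl by (intro bexI[of _ \<xi>]) (auto simp: stepw_def)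
qed simp

text \<open>The entries are natural numbers.\<close>

lemma cv_unit_ge_1:
  assumes "0 < cv T n (unit_vec \<beta> :: _ \<Rightarrow> real) \<alpha>" shows "1 \<le> cv T n (unit_vec \<beta> :: _ \<Rightarrow> real) \<alpha>"
proof -
  have "cv T n (unit_vec \<beta> :: _ \<Rightarrow> real) \<alpha> = real (cv T n (unit_vec \<beta>) \<alpha>)"
    unfolding cv_of_nat[symmetric]
    by (intro arg_cong[where f = "\<lambda>x. cv T n x \<alpha>"]) (auto simp: unit_vec_def)
  with assms show ?thesis by simp
qed

text \<open>
  Positivity of \<open>B(n\<^sub>k,n\<^sub>k\<^sub>+\<^sub>1)\<close> only gives \<open>N\<^sub>k\<^sub>+\<^sub>2 \<ge> N\<^sub>k\<^sub>+\<^sub>1 + N\<^sub>k\<close>, hence doubling along every second index.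
\<close>

locale growing =
  fixes N :: "nat \<Rightarrow> real"
  assumes N_ge_1: "1 \<le> N k" and N_Suc: "N k \<le> N (Suc k)" and N_double: "2 * N k \<le> N (k + 2)"
begin

lemma N_pos: "0 < N k" using N_ge_1[of k] by linarith

lemma N_mono: "j \<le> k \<Longrightarrow> N j \<le> N k"
  using lift_Suc_mono_le[of N, OF N_Suc] .

lemma sum_neg_powr:
  assumes "a > 0"
  shows "(\<Sum>j\<in>{k..<J}. N j powr (- a)) \<le> 2 / (1 - 2 powr (- a)) * N k powr (- a)"
proof (induction "J - k" arbitrary: k rule: less_induct)
  case less
  define q where "q = (2::real) powr (- a)"
  \<comment> \<open>The fixed point of C = 2 + C q: two terms are split off, and two indices further
    the power has shrunk by the factor q.\<close>
  define C where "C = 2 / (1 - q)"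
  have q: "q < 1" using assms by (simp add: q_def powr_less_one)
  have C: "2 + C * q = C" "C > 0" using q by (auto simp: C_def field_simps)
  show ?case
  proof (cases "k + 2 \<le> J")
    case True
    have s: "{k..<J} = {k, Suc k} \<union> {k + 2..<J}" using True by auto
    have "(\<Sum>j\<in>{k..<J}. N j powr (- a)) = N k powr (- a) + N (Suc k) powr (- a) + (\<Sum>j\<in>{k + 2..<J}. N j powr (- a))"
      unfolding s by (subst sum.union_disjoint) auto
    also have "\<dots> \<le> N k powr (- a) + N k powr (- a) + C * N (k + 2) powr (- a)"
      using less[of "k + 2"] True N_Suc[of k] N_pos[of k] assms
      by (intro add_mono powr_mono2') (auto simp: C_def q_def)
    also have "N (k + 2) powr (- a) \<le> (2 * N k) powr (- a)"
      using N_double[of k] N_pos[of k] assms by (intro powr_mono2') auto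
    also have "(2 * N k) powr (- a) = q * N k powr (- a)"
      using N_pos[of k] by (simp add: powr_mult q_def)
    finally have "(\<Sum>j\<in>{k..<J}. N j powr (- a)) \<le> (2 + C * q) * N k powr (- a)"
      using C(2) by (simp add: algebra_simps)
    then show ?thesis unfolding C(1) by (simp add: C_def q_def)
  next
    case False
    then have "{k..<J} \<subseteq> {k}" by auto
    then have "(\<Sum>j\<in>{k..<J}. N j powr (- a)) \<le> (\<Sum>j\<in>{k}. N j powr (- a))" by (intro sum_mono2) auto
    also have "\<dots> \<le> 2 / (1 - q) * N k powr (- a)"
    proof -
      have "0 < q" by (simp add: q_def)
      then have "1 \<le> 2 / (1 - q)" using q by (simp add: field_simps)
      then show ?thesis using mult_right_mono[of 1 "2 / (1 - q)" "N k powr (- a)"] by simp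
    qed
    finally show ?thesis by (simp add: q_def)
  qed
qed

lemma sum_pos_powr:
  assumes "a > 0"
  shows "(\<Sum>j<k. N j powr a) \<le> 2 / (1 - 2 powr (- a)) * N k powr a"
proof (induction k rule: less_induct)
  case (less k)
  define q where "q = (2::real) powr (- a)"
  define C where "C = 2 / (1 - q)"
  have q: "q < 1" using assms by (simp add: q_def powr_less_one)
  have C: "2 + C * q = C" "C > 0" using q by (auto simp: C_def field_simps)
  consider "k = 0" | "k = Suc 0" | i where "k = i + 2"
    by (metis add_2_eq_Suc' not0_implies_Suc)
  then show ?case
  proof cases
    case 1 then show ?thesis using C N_pos[of 0] by (simp add: C_def q_def)
  next
    case 2
    have "N 0 powr a \<le> N 1 powr a" using N_Suc[of 0] N_pos[of 0] assms by (intro powr_mono2) auto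
    moreover have "1 \<le> C" using C q by (simp add: C_def field_simps q_def)
    ultimately have "N 0 powr a \<le> C * N 1 powr a"
      by (meson mult_le_cancel_right1 order_trans powr_ge_zero linorder_not_less)
    then show ?thesis using 2 by (simp add: C_def q_def)
  next
    case 3
    have "(\<Sum>j<k. N j powr a) = (\<Sum>j<i. N j powr a) + N i powr a + N (Suc i) powr a" using 3 by simp
    also have "\<dots> \<le> C * N i powr a + N (i + 2) powr a + N (i + 2) powr a"
      using less[of i] 3 N_mono[of i "i + 2"] N_Suc[of "Suc i"] N_pos[of i] N_pos[of "Suc i"] assms
      by (intro add_mono powr_mono2) (auto simp: C_def q_def)
    also have "N i powr a = q * (2 * N i) powr a"
      using N_pos[of i] assms by (simp add: powr_mult q_def powr_minus)
    also have "(2 * N i) powr a \<le> N (i + 2) powr a"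
      using N_double[of i] N_pos[of i] assms by (intro powr_mono2) auto
    finally have "(\<Sum>j<k. N j powr a) \<le> (2 + C * q) * N (i + 2) powr a"
      using C(2) by (simp add: algebra_simps q_def)
    then show ?thesis unfolding C(1) using 3 by (simp add: C_def q_def)
  qed
qed

lemma N_at_top: "filterlim N at_top sequentially"
proof -
  have "2 ^ k \<le> N (2 * k)" for k
  proof (induction k)
    case (Suc k)
    then show ?case using N_double[of "2 * k"] by simp
  qed (use N_ge_1 in simp)
  then have *: "real k \<le> N (2 * k)" for k
    by (meson of_nat_less_two_power less_imp_le order_trans)
  show ?thesis
    unfolding filterlim_at_top eventually_sequentially
  proof
    fix Z :: real
    have "Z \<le> N n" if "n \<ge> 2 * nat \<lceil>Z\<rceil>" for n
      using *[of "nat \<lceil>Z\<rceil>"] N_mono[OF that] by linarith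
    then show "\<exists>K. \<forall>n\<ge>K. Z \<le> N n" by blast
  qed
qed

lemma N_neg_powr_tendsto:
  assumes "a > 0" shows "(\<lambda>k. N k powr (- a)) \<longlonglongrightarrow> 0"
  using tendsto_neg_powr[OF _ N_at_top, of "- a"] assms by simp

end

section \<open>The levels n_k and the growth of the norms\<close>

locale roth =
  fixes T :: "'a iem" and \<theta> \<sigma> :: real
  assumes Roth: "restricted_Roth T" and th: "theta_const T \<theta>" and sg: "sigma_const T \<sigma>"
begin

abbreviation "A \<equiv> alphabet T"
abbreviation "ns \<equiv> n_seq T"

definition "lev k = rv T (ns k)"
definition "N k = B_norm T 0 (ns k)"
definition "b k = B_norm T (ns k) (ns (Suc k))"
text \<open>This is B(n_j,n_k) when j \<le> k. For k < j the truncated difference makes it the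
  identity.\<close>

definition tr :: "nat \<Rightarrow> nat \<Rightarrow> ('a \<Rightarrow> real) \<Rightarrow> 'a \<Rightarrow> real" where
  "tr j k = cv (lev j) (ns k - ns j)"
definition "d = real (card A)"

lemma good_T: "good T"
  using Roth no_connection_imp_no_conn by (auto simp: restricted_Roth_def is_iem_def good_def)

lemma good_lev: "good (lev k)" unfolding lev_def by (rule good_rv[OF good_T])
lemma alphabet_lev: "alphabet (lev k) = A" unfolding lev_def by (rule rv_alphabet[OF good_T])
lemma finite_A: "finite A" and A_nonempty: "A \<noteq> {}" and card2: "2 \<le> card A"
  using good_facts(1,2,6)[OF good_T] by auto
lemma two_le_d: "2 \<le> d" using card2 by (simp add: d_def)

lemma ns_mono: "j \<le> k \<Longrightarrow> ns j \<le> ns k"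
  using lift_Suc_mono_le[of ns, OF n_seq_props(1)[OF good_T]] .

lemma lev_0: "lev 0 = T" by (simp add: lev_def)

lemma tr_tr: "i \<le> j \<Longrightarrow> j \<le> k \<Longrightarrow> tr j k (tr i j \<xi>) = tr i k \<xi>"
  using ns_mono[of i j] ns_mono[of j k] cv_add[of "lev i" "ns j - ns i" "ns k - ns j" \<xi>]
  by (simp add: tr_def lev_def rv_rv)

lemma tr_refl: "tr k k \<xi> = \<xi>" by (simp add: tr_def)

lemma B_norm_tr: "j \<le> k \<Longrightarrow> B_norm T (ns j) (ns k) = Max (tr j k (\<lambda>_. 1) ` A)"
  using B_norm_eq[OF good_T, of "ns j" "ns k - ns j"] ns_mono[of j k] by (simp add: tr_def lev_def)

lemma tr_one_le: "j \<le> k \<Longrightarrow> \<alpha> \<in> A \<Longrightarrow> tr j k (\<lambda>_. 1) \<alpha> \<le> B_norm T (ns j) (ns k)"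
  using finite_A by (simp add: B_norm_tr)

lemma tr_one_max: "j \<le> k \<Longrightarrow> \<exists>\<alpha>\<in>A. tr j k (\<lambda>_. 1) \<alpha> = B_norm T (ns j) (ns k)"
proof -
  assume "j \<le> k"
  moreover have "Max (tr j k (\<lambda>_. 1) ` A) \<in> tr j k (\<lambda>_. 1) ` A" using finite_A A_nonempty by (intro Max_in) auto
  ultimately show ?thesis unfolding B_norm_tr[OF \<open>j \<le> k\<close>] by (metis imageE)
qed

lemma tr_one_ge: "\<alpha> \<in> A \<Longrightarrow> 1 \<le> tr j k (\<lambda>_. 1) \<alpha>"
  unfolding tr_def using ret_ge_1[OF good_lev] by (simp add: alphabet_lev)

lemma B_norm_ge_1: "j \<le> k \<Longrightarrow> 1 \<le> B_norm T (ns j) (ns k)"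
  using tr_one_max tr_one_ge by metis

lemma tr_mono: "(\<And>\<alpha>. \<alpha> \<in> A \<Longrightarrow> x \<alpha> \<le> y \<alpha>) \<Longrightarrow> \<alpha> \<in> A \<Longrightarrow> tr j k x \<alpha> \<le> tr j k y \<alpha>"
  unfolding tr_def by (rule cv_mono[OF good_lev]) (auto simp: alphabet_lev)

lemma tr_scale: "tr j k (fscale c x) = fscale c (tr j k x)"
  unfolding tr_def by (rule cv_fscale)

lemma tr_const: "tr j k (\<lambda>_. c) \<alpha> = c * tr j k (\<lambda>_. 1) \<alpha>"
  using fun_cong[OF tr_scale[of j k c "\<lambda>_. 1"], of \<alpha>] by (simp add: fscale_def)

lemma tr_vecs: "x \<in> vecs A \<Longrightarrow> tr j k x \<in> vecs A"
  unfolding tr_def using cv_vecs[OF good_lev] by (simp add: alphabet_lev)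

lemma tr_bound:
  assumes "j \<le> k" "\<And>\<alpha>. \<alpha> \<in> A \<Longrightarrow> \<bar>\<xi> \<alpha>\<bar> \<le> M" "\<alpha> \<in> A"
  shows "\<bar>tr j k \<xi> \<alpha>\<bar> \<le> B_norm T (ns j) (ns k) * M"
proof -
  have M: "0 \<le> M" using assms(2)[OF assms(3)] by linarith
  have "\<bar>tr j k \<xi> \<alpha>\<bar> \<le> tr j k (\<lambda>_. M) \<alpha>"
    unfolding tr_def using cv_abs_le[OF good_lev, of j \<xi> "\<lambda>_. M"] assms by (simp add: alphabet_lev)
  also have "\<dots> = M * tr j k (\<lambda>_. 1) \<alpha>" by (rule tr_const)
  also have "\<dots> \<le> M * B_norm T (ns j) (ns k)" using tr_one_le assms M by (intro mult_left_mono) auto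
  finally show ?thesis by (simp add: mult.commute)
qed

text \<open>The entries of the block from level k to level k + 1 are positive integers, hence at
  least 1.\<close>

lemma tr_Suc_ge_sum:
  assumes "\<And>\<alpha>. \<alpha> \<in> A \<Longrightarrow> 0 \<le> x \<alpha>" "\<alpha> \<in> A"
  shows "sum x A \<le> tr k (Suc k) x \<alpha>"
proof -
  let ?x = "\<lambda>\<alpha>. if \<alpha> \<in> A then x \<alpha> else 0"
  have "sum x A \<le> (\<Sum>\<beta>\<in>A. tr k (Suc k) (unit_vec \<beta>) \<alpha> * x \<beta>)"
  proof (intro sum_mono)
    fix \<beta> assume b: "\<beta> \<in> A"
    have "1 \<le> tr k (Suc k) (unit_vec \<beta>) \<alpha>"
      unfolding tr_def lev_def using n_seq_props(2)[OF good_T assms(2) b] by (rule cv_unit_ge_1)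
    then show "x \<beta> \<le> tr k (Suc k) (unit_vec \<beta>) \<alpha> * x \<beta>"
      using assms(1)[OF b] by (simp add: mult_le_cancel_right1)
  qed
  also have "\<dots> = tr k (Suc k) ?x \<alpha>"
    unfolding tr_def using cv_expand[OF good_lev, of ?x k _ \<alpha>] by (simp add: alphabet_lev vecs_def)
  also have "\<dots> \<le> tr k (Suc k) x \<alpha>" using assms by (intro tr_mono) auto
  finally show ?thesis .
qed

lemma N_tr: "N k = Max (tr 0 k (\<lambda>_. 1) ` A)"
  using B_norm_tr[of 0 k] by (simp add: N_def)

lemma N_le_sum: "N k \<le> (\<Sum>\<alpha>\<in>A. tr 0 k (\<lambda>_. 1) \<alpha>)"
proof -
  obtain \<alpha> where "\<alpha> \<in> A" "tr 0 k (\<lambda>_. 1) \<alpha> = N k" using tr_one_max[of 0 k] by (auto simp: N_def)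
  then show ?thesis using member_le_sum[of \<alpha> A "tr 0 k (\<lambda>_. 1)"] tr_one_ge[of _ 0 k] finite_A by force
qed

lemma one_le_N: "1 \<le> N k" using B_norm_ge_1[of 0 k] by (simp add: N_def)
lemma one_le_b: "1 \<le> b k" using B_norm_ge_1[of k "Suc k"] by (simp add: b_def)

text \<open>Every row of a positive block visits all letters, in particular the one with the longest
  return time. So the return times of level k + 1 are balanced up to the factor
  \<open>b k\<close>.\<close>

lemma N_le_ret_Suc: "\<alpha> \<in> A \<Longrightarrow> N k \<le> tr 0 (Suc k) (\<lambda>_. 1) \<alpha>"
proof -
  assume "\<alpha> \<in> A"
  have "N k \<le> (\<Sum>\<alpha>\<in>A. tr 0 k (\<lambda>_. 1) \<alpha>)" by (rule N_le_sum)
  also have "\<dots> \<le> tr k (Suc k) (tr 0 k (\<lambda>_. 1)) \<alpha>"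
    using tr_one_ge[of _ 0 k] \<open>\<alpha> \<in> A\<close> by (intro tr_Suc_ge_sum) (auto intro: order_trans[of 0 1])
  finally show ?thesis by (simp add: tr_tr)
qed

text \<open>Since there are at least two letters, one can take a letter of maximal return time at
  level k + 1 and another one, whose return time is at least \<open>N k\<close>; the next positive
  block visits both.\<close>

lemma N_add_le: "N k + N (Suc k) \<le> N (k + 2)"
proof -
  obtain \<alpha> where a: "\<alpha> \<in> A" "tr 0 (Suc k) (\<lambda>_. 1) \<alpha> = N (Suc k)"
    using tr_one_max[of 0 "Suc k"] by (auto simp: N_def)
  have "A \<noteq> {\<alpha>}" using card2 by auto
  then obtain \<beta> where be: "\<beta> \<in> A" "\<beta> \<noteq> \<alpha>" using a(1) by blast
  have "N k + N (Suc k) \<le> (\<Sum>\<gamma>\<in>{\<beta>, \<alpha>}. tr 0 (Suc k) (\<lambda>_. 1) \<gamma>)"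
    using N_le_ret_Suc[OF be(1), of k] a be by simp
  also have "\<dots> \<le> (\<Sum>\<gamma>\<in>A. tr 0 (Suc k) (\<lambda>_. 1) \<gamma>)"
    using a be finite_A tr_one_ge by (intro sum_mono2) (auto intro: order_trans[of 0 1])
  also have "\<dots> \<le> tr (Suc k) (Suc (Suc k)) (tr 0 (Suc k) (\<lambda>_. 1)) \<alpha>"
    using tr_one_ge[of _ 0 "Suc k"] a by (intro tr_Suc_ge_sum) (auto intro: order_trans[of 0 1])
  also have "\<dots> \<le> N (k + 2)" using tr_one_le[of 0 "Suc (Suc k)" \<alpha>] a by (simp add: tr_tr N_def)
  finally show ?thesis .
qed

lemma N_le_Suc: "N k \<le> N (Suc k)"
proof -
  obtain \<alpha> where "\<alpha> \<in> A" using A_nonempty by blast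
  then show ?thesis using N_le_ret_Suc[of \<alpha> k] tr_one_le[of 0 "Suc k" \<alpha>] by (simp add: N_def)
qed

sublocale growing N
  using one_le_N N_le_Suc N_add_le N_le_Suc by unfold_locales (auto, smt (verit))

text \<open>Norms are submultiplicative in general. This reverse inequality up to the factor
  \<open>b j\<close> rests on the balance of the return times at level j + 1.\<close>

lemma quasi_mult:
  assumes "j \<le> k" shows "B_norm T (ns j) (ns k) * N j \<le> b j * N k"
proof (cases "j = k")
  case True
  then show ?thesis
    using B_norm_tr[of k k] finite_A A_nonempty one_le_b[of k] N_pos[of k] by (simp add: tr_refl image_constant_conv)
next
  case False
  then have jk: "Suc j \<le> k" using assms by simp
  obtain \<alpha> where a: "\<alpha> \<in> A" "tr j k (\<lambda>_. 1) \<alpha> = B_norm T (ns j) (ns k)" using tr_one_max[OF assms] by blast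
  have "tr j k (\<lambda>_. 1) \<alpha> = tr (Suc j) k (tr j (Suc j) (\<lambda>_. 1)) \<alpha>" using jk by (simp add: tr_tr)
  also have "\<dots> \<le> tr (Suc j) k (\<lambda>_. b j) \<alpha>"
    using tr_one_le[of j "Suc j"] a by (intro tr_mono) (auto simp: b_def)
  also have "\<dots> = b j * tr (Suc j) k (\<lambda>_. 1) \<alpha>" by (rule tr_const)
  finally have 1: "B_norm T (ns j) (ns k) \<le> b j * tr (Suc j) k (\<lambda>_. 1) \<alpha>" using a by simp
  have "N j * tr (Suc j) k (\<lambda>_. 1) \<alpha> = tr (Suc j) k (\<lambda>_. N j) \<alpha>" by (rule tr_const[symmetric])
  also have "\<dots> \<le> tr (Suc j) k (tr 0 (Suc j) (\<lambda>_. 1)) \<alpha>" using N_le_ret_Suc a by (intro tr_mono) auto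
  also have "\<dots> \<le> N k" using jk a tr_one_le[of 0 k \<alpha>] by (simp add: tr_tr N_def)
  finally have 2: "N j * tr (Suc j) k (\<lambda>_. 1) \<alpha> \<le> N k" .
  have "B_norm T (ns j) (ns k) * N j \<le> (b j * tr (Suc j) k (\<lambda>_. 1) \<alpha>) * N j"
    using 1 N_pos[of j] by (intro mult_right_mono) auto
  also have "\<dots> = b j * (N j * tr (Suc j) k (\<lambda>_. 1) \<alpha>)" by simp
  also have "\<dots> \<le> b j * N k" using 2 one_le_b[of j] by (intro mult_left_mono) auto
  finally show ?thesis .
qed

lemma N_Suc_le: "N (Suc k) \<le> b k * N k"
proof -
  obtain \<alpha> where a: "\<alpha> \<in> A" "tr 0 (Suc k) (\<lambda>_. 1) \<alpha> = N (Suc k)"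
    using tr_one_max[of 0 "Suc k"] by (auto simp: N_def)
  have "\<bar>tr k (Suc k) (tr 0 k (\<lambda>_. 1)) \<alpha>\<bar> \<le> b k * N k"
    unfolding b_def
  proof (rule tr_bound)
    show "\<bar>tr 0 k (\<lambda>_. 1) \<alpha>\<bar> \<le> N k" if "\<alpha> \<in> A" for \<alpha>
      using tr_one_le[of 0 k, OF _ that] tr_one_ge[OF that, of 0 k] by (simp add: N_def)
  qed (use a in auto)
  then show ?thesis using a by (simp add: tr_tr)
qed

lemma step_count: "real (ns (Suc k) - ns k) \<le> d * b k"
proof -
  have "real (ns (Suc k) - ns k) \<le> (\<Sum>\<alpha>\<in>A. tr k (Suc k) (\<lambda>_. 1) \<alpha>)"
    unfolding tr_def using ret_sum_ge[OF good_lev[of k]] by (simp add: alphabet_lev)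
  also have "\<dots> \<le> (\<Sum>\<alpha>\<in>A. b k)" using tr_one_le[of k "Suc k"] by (intro sum_mono) (auto simp: b_def)
  finally show ?thesis by (simp add: d_def)
qed

lemma step_count_0: "real (ns k) \<le> d * N k"
proof -
  have "real (ns k) \<le> (\<Sum>\<alpha>\<in>A. tr 0 k (\<lambda>_. 1) \<alpha>)"
    unfolding tr_def using ret_sum_ge[OF good_T] by (simp add: lev_0)
  also have "\<dots> \<le> (\<Sum>\<alpha>\<in>A. N k)" using tr_one_le[of 0 k] by (intro sum_mono) (auto simp: N_def)
  finally show ?thesis by (simp add: d_def)
qed

text \<open>Return times increase with each step, so \<open>b k\<close> also controls the steps
  before level k + 1.\<close>

lemma intermediate_bound:
  assumes "m \<le> ns (Suc k) - ns k" "\<And>\<alpha>. \<alpha> \<in> A \<Longrightarrow> \<bar>\<xi> \<alpha>\<bar> \<le> M" "\<alpha> \<in> A"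
  shows "\<bar>cv (lev k) m \<xi> \<alpha>\<bar> \<le> b k * M"
proof -
  have M: "0 \<le> M" using assms(2)[OF assms(3)] by linarith
  have "\<bar>cv (lev k) m \<xi> \<alpha>\<bar> \<le> cv (lev k) m (\<lambda>_. M) \<alpha>"
    using cv_abs_le[OF good_lev[of k], of \<xi> "\<lambda>_. M"] assms by (simp add: alphabet_lev)
  also have "\<dots> = M * ret (lev k) m \<alpha>"
    using fun_cong[OF cv_fscale[of "lev k" m M "\<lambda>_. 1"], of \<alpha>] by (simp add: fscale_def)
  also have "\<dots> \<le> M * tr k (Suc k) (\<lambda>_. 1) \<alpha>"
    unfolding tr_def using ret_mono[OF good_lev[of k], of \<alpha>] assms M by (intro mult_left_mono) (auto simp: alphabet_lev)
  also have "\<dots> \<le> M * b k"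
    using tr_one_le[of k "Suc k" \<alpha>] assms M by (intro mult_left_mono) (auto simp: b_def)
  finally show ?thesis by (simp add: mult.commute)
qed

text \<open>The two factors \<open>b i\<close> have different origins: one bounds each single step,
  the other, together with \<open>d\<close>, the number of steps between levels i and i + 1.\<close>

lemma sum_over_steps:
  assumes "j \<le> k" "\<And>i m. j \<le> i \<Longrightarrow> i < k \<Longrightarrow> ns i \<le> m \<Longrightarrow> m < ns (Suc i) \<Longrightarrow> f m \<le> b i * h i"
    and "\<And>i. j \<le> i \<Longrightarrow> i < k \<Longrightarrow> 0 \<le> h i"
  shows "(\<Sum>m\<in>{ns j..<ns k}. f m) \<le> (\<Sum>i\<in>{j..<k}. d * (b i)\<^sup>2 * h i)"
  using assms
proof (induction k rule: dec_induct)
  case (step k)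
  have "(\<Sum>m\<in>{ns j..<ns (Suc k)}. f m) = (\<Sum>m\<in>{ns j..<ns k}. f m) + (\<Sum>m\<in>{ns k..<ns (Suc k)}. f m)"
    using step.hyps ns_mono[of j k] ns_mono[of k "Suc k"] by (intro sum.atLeastLessThan_concat[symmetric]) auto
  also have "(\<Sum>m\<in>{ns k..<ns (Suc k)}. f m) \<le> (\<Sum>m\<in>{ns k..<ns (Suc k)}. b k * h k)"
    using step by (intro sum_mono) auto
  also have "\<dots> = real (ns (Suc k) - ns k) * (b k * h k)" by simp
  also have "\<dots> \<le> (d * b k) * (b k * h k)"
    using step_count[of k] one_le_b[of k] step.prems(2)[of k] step.hyps by (intro mult_right_mono mult_nonneg_nonneg) auto
  also have "\<dots> = d * (b k)\<^sup>2 * h k" by (simp add: power2_eq_square)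
  also have "(\<Sum>m\<in>{ns j..<ns k}. f m) \<le> (\<Sum>i\<in>{j..<k}. d * (b i)\<^sup>2 * h i)"
    using step by (intro step.IH) auto
  finally show ?case using step.hyps by simp
qed simp

definition cotr :: "nat \<Rightarrow> nat \<Rightarrow> ('a \<Rightarrow> real) \<Rightarrow> 'a \<Rightarrow> real" where
  "cotr j k = cw (lev j) (ns k - ns j)"

lemma cotr_cotr: "i \<le> j \<Longrightarrow> j \<le> k \<Longrightarrow> cotr j k (cotr i j \<xi>) = cotr i k \<xi>"
  using ns_mono[of i j] ns_mono[of j k] cw_add[of "lev i" "ns j - ns i" "ns k - ns j" \<xi>]
  by (simp add: cotr_def lev_def rv_rv)

lemma ip_tr_cotr: "ip A (tr j k \<xi>) (cotr j k W) = ip A \<xi> W"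
  unfolding tr_def cotr_def using ip_cv_cw[OF good_lev[of j]] by (simp add: alphabet_lev)

lemma disp_cotr: "j \<le> k \<Longrightarrow> disp (lev k) (cotr j k W) = tr j k (disp (lev j) W)"
  unfolding tr_def cotr_def using disp_rv[OF good_lev[of j], of "ns k - ns j" W] ns_mono[of j k]
  by (simp add: lev_def rv_rv)

text \<open>This is \<open>cw_bound\<close> when displacements are controlled at the levels only;
  the steps in between are covered by \<open>intermediate_bound\<close>.\<close>

lemma cotr_bound:
  assumes "j \<le> k" "\<And>i \<alpha>. j \<le> i \<Longrightarrow> i < k \<Longrightarrow> \<alpha> \<in> A \<Longrightarrow> \<bar>tr j i (disp (lev j) W) \<alpha>\<bar> \<le> h i" "\<alpha> \<in> A"
  shows "\<bar>cotr j k W \<alpha>\<bar> \<le> 2 * ((\<Sum>\<alpha>\<in>A. \<bar>W \<alpha>\<bar>) + (\<Sum>i\<in>{j..<k}. d * (b i)\<^sup>2 * h i))"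
proof -
  define D where "D m = Max ((\<lambda>\<alpha>. \<bar>cv (lev j) m (disp (lev j) W) \<alpha>\<bar>) ` A)" for m
  have "\<bar>cotr j k W \<alpha>\<bar> \<le> 2 * ((\<Sum>\<alpha>\<in>A. \<bar>W \<alpha>\<bar>) + sum D {..<ns k - ns j})"
    unfolding cotr_def using cw_bound[OF good_lev[of j], of "ns k - ns j" W D \<alpha>] assms(3) finite_A
    by (simp add: alphabet_lev D_def)
  also have "sum D {..<ns k - ns j} = (\<Sum>m\<in>{ns j..<ns k}. D (m - ns j))"
    using ns_mono[OF assms(1)]
    by (intro sum.reindex_bij_witness[of _ "\<lambda>m. m - ns j" "\<lambda>m. m + ns j"]) auto
  also have "\<dots> \<le> (\<Sum>i\<in>{j..<k}. d * (b i)\<^sup>2 * h i)"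
  proof (rule sum_over_steps[OF assms(1)])
    fix i m assume i: "j \<le> i" "i < k" "ns i \<le> m" "m < ns (Suc i)"
    have "cv (lev j) (m - ns j) (disp (lev j) W) = cv (lev i) (m - ns i) (tr j i (disp (lev j) W))"
      using cv_add[of "lev j" "ns i - ns j" "m - ns i"] i ns_mono[OF i(1)]
      by (simp add: tr_def lev_def rv_rv)
    moreover have "\<bar>cv (lev i) (m - ns i) (tr j i (disp (lev j) W)) \<alpha>\<bar> \<le> b i * h i" if "\<alpha> \<in> A" for \<alpha>
      using assms(2)[OF i(1,2)] i that by (intro intermediate_bound) auto
    ultimately show "D (m - ns j) \<le> b i * h i" unfolding D_def using finite_A A_nonempty by simp
  next
    fix i assume "j \<le> i" "i < k"
    then show "0 \<le> h i" using assms(2)[of i \<alpha>] assms(3) by linarith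
  qed
  finally show ?thesis by simp
qed

lemma roth_b:
  assumes "\<tau> > 0"
  obtains C where "C > 0" "\<And>k. b k \<le> C * N k powr \<tau>"
proof -
  have "(\<lambda>k. b k) \<in> O(\<lambda>k. N k powr \<tau>)"
    using Roth assms unfolding restricted_Roth_def b_def N_def by blast
  then obtain C where C: "C > 0" "\<And>k. \<bar>b k\<bar> \<le> C * N k powr \<tau>"
    by (rule bigo_uniform) (use N_pos in \<open>auto simp: less_imp_neq[symmetric]\<close>)
  show ?thesis
  proof (rule that[OF C(1)])
    show "b k \<le> C * N k powr \<tau>" for k using C(2)[of k] by linarith
  qed
qed

end

section \<open>The stable space\<close>

lemma ip_abs_le:
  assumes "\<And>\<alpha>. \<alpha> \<in> A \<Longrightarrow> \<bar>x \<alpha>\<bar> \<le> X" "\<And>\<alpha>. \<alpha> \<in> A \<Longrightarrow> \<bar>y \<alpha>\<bar> \<le> Y"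
  shows "\<bar>ip A x y\<bar> \<le> real (card A) * (X * Y)"
proof -
  have "\<bar>ip A x y\<bar> \<le> (\<Sum>\<alpha>\<in>A. \<bar>x \<alpha> * y \<alpha>\<bar>)" unfolding ip_def by (rule sum_abs)
  also have "\<dots> \<le> (\<Sum>\<alpha>\<in>A. X * Y)"
    unfolding abs_mult using assms by (intro sum_mono mult_mono) (auto intro: order_trans[OF abs_ge_zero])
  finally show ?thesis by simp
qed

lemma ip_unit_vec: "finite A \<Longrightarrow> \<beta> \<in> A \<Longrightarrow> ip A x (unit_vec \<beta>) = x \<beta>"
  unfolding ip_def unit_vec_def by (simp add: if_distrib cong: if_cong)

lemma indicator_open_interval_integral:
  fixes a b :: real
  assumes "L \<le> a" "a \<le> b" "b \<le> R"
  shows "(indicat_real {a<..<b} has_integral (b - a)) {L..R}"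
proof -
  have "((\<lambda>_. 1 :: real) has_integral (b - a)) {a<..<b}"
    using assms has_integral_const_real[of "1::real" a b] has_integral_open_interval[of "\<lambda>_. 1 :: real" "b - a" a b]
    by (simp add: box_real)
  then have "((\<lambda>x. if x \<in> {a<..<b} then 1 else 0 :: real) has_integral (b - a)) {L..R}"
    using assms by (subst has_integral_restrict) auto
  then show ?thesis by (rule has_integral_cong[THEN iffD1, rotated]) (auto simp: indicator_def)
qed

lemma Gam_0_eq:
  assumes "good T" shows "Gam_0 T = {\<xi> \<in> vecs (alphabet T). ip (alphabet T) \<xi> (width T) = 0}"
proof -
  let ?A = "alphabet T"
  note g = good_facts[OF assms]
  have "(step_function T \<xi> has_integral ip ?A \<xi> (width T)) {left_end T..right_end T}" for \<xi>
    unfolding step_function_def ip_def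
  proof (intro has_integral_sum g(1) has_integral_mult_right)
    fix \<alpha> assume a: "\<alpha> \<in> ?A"
    have "(indicat_real (I_top T \<alpha>) has_integral (top_left T \<alpha> + width T \<alpha> - top_left T \<alpha>)) {left_end T..right_end T}"
      unfolding interval_def using interval_partition_left[OF g(4) a] interval_partition_right[OF g(4) a] g(3) a
      by (intro indicator_open_interval_integral) (auto simp: less_imp_le)
    then show "(indicat_real (I_top T \<alpha>) has_integral width T \<alpha>) {left_end T..right_end T}" by simp
  qed
  then have "integral {left_end T..right_end T} (step_function T \<xi>) = ip ?A \<xi> (width T)" for \<xi>
    by (rule integral_unique)
  then show ?thesis by (simp add: Gam_0_def Gam_vecs)
qed

text \<open>\<open>restr_norm\<close> is a supremum, so it bounds its members only once the set is
  known to be bounded above, which \<open>B_norm\<close> provides. The rest is scaling, possible for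
  nonzero \<open>M\<close>.\<close>

lemma restr_norm_bound:
  assumes T: "good T" and W: "W \<subseteq> vecs (alphabet T)" "\<And>c \<xi>. \<xi> \<in> W \<Longrightarrow> fscale c \<xi> \<in> W"
    and xi: "\<xi> \<in> W" "\<And>\<alpha>. \<alpha> \<in> alphabet T \<Longrightarrow> \<bar>\<xi> \<alpha>\<bar> \<le> M" and al: "\<alpha> \<in> alphabet T"
  shows "\<bar>cv (rv T m) n \<xi> \<alpha>\<bar> \<le> restr_norm (alphabet T) W (B_op T m (m + n)) * M"
proof -
  let ?A = "alphabet T"
  let ?S = "{vnorm ?A (B_op T m (m + n) \<xi>) | \<xi>. \<xi> \<in> W \<and> vnorm ?A \<xi> \<le> 1}"
  have fin: "finite ?A" and ne: "?A \<noteq> {}" using good_facts[OF T] by auto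
  have g: "good (rv T m)" and A: "alphabet (rv T m) = ?A" using good_rv[OF T] rv_alphabet[OF T] by auto
  have bnd: "s \<le> B_norm T m (m + n)" if s: "s \<in> ?S" for s
  proof -
    obtain \<eta> where e: "\<eta> \<in> W" "vnorm ?A \<eta> \<le> 1" "s = vnorm ?A (B_op T m (m + n) \<eta>)" using s by blast
    have "\<bar>cv (rv T m) n \<eta> \<beta>\<bar> \<le> B_norm T m (m + n)" if b: "\<beta> \<in> ?A" for \<beta>
    proof -
      have "\<bar>cv (rv T m) n \<eta> \<beta>\<bar> \<le> ret (rv T m) n \<beta>"
      proof (rule cv_abs_le[OF g])
        show "\<beta> \<in> alphabet (rv T m)" using b A by simp
        show "\<bar>\<eta> \<gamma>\<bar> \<le> 1" if "\<gamma> \<in> alphabet (rv T m)" for \<gamma>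
          using vnorm_ge[OF fin, of \<gamma> \<eta>] e(2) that A by simp
      qed
      also have "\<dots> \<le> B_norm T m (m + n)" unfolding B_norm_eq[OF T] using fin b by simp
      finally show ?thesis .
    qed
    then show ?thesis unfolding e(3) B_op_eq[OF T subsetD[OF W(1) e(1)]] by (intro vnorm_le fin ne)
  qed
  then have bdd: "bdd_above ?S" by (rule bdd_aboveI)
  have M: "0 \<le> M" using xi(2)[OF al] by linarith
  show ?thesis
  proof (cases "M = 0")
    case True
    then have "\<xi> = 0" using xi W(1) by (fastforce simp: vecs_def fun_eq_iff)
    then show ?thesis using True by (simp add: cv_0)
  next
    case False
    define \<eta> where "\<eta> = fscale (1 / M) \<xi>"
    have "vnorm ?A \<eta> \<le> 1"
      using xi(2) M False by (intro vnorm_le fin ne) (auto simp: \<eta>_def fscale_def abs_mult divide_le_eq)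
    moreover have eW: "\<eta> \<in> W" unfolding \<eta>_def by (rule W(2)[OF xi(1)])
    ultimately have "vnorm ?A (B_op T m (m + n) \<eta>) \<le> restr_norm ?A W (B_op T m (m + n))"
      unfolding restr_norm_def by (intro cSup_upper bdd) blast
    then have "\<bar>cv (rv T m) n \<eta> \<alpha>\<bar> \<le> restr_norm ?A W (B_op T m (m + n))"
      using vnorm_ge[OF fin al, of "cv (rv T m) n \<eta>"] B_op_eq[OF T subsetD[OF W(1) eW], of m n] by simp
    moreover have "cv (rv T m) n \<eta> \<alpha> = cv (rv T m) n \<xi> \<alpha> / M"
      unfolding \<eta>_def cv_fscale by (simp add: fscale_def)
    ultimately show ?thesis using M False by (simp add: abs_divide divide_le_eq)
  qed
qed

lemma Gam_s_fscale: "\<xi> \<in> Gam_s T \<Longrightarrow> good T \<Longrightarrow> fscale c \<xi> \<in> Gam_s T"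
proof -
  assume xi: "\<xi> \<in> Gam_s T" and T: "good T"
  then have v: "\<xi> \<in> vecs (alphabet T)" "fscale c \<xi> \<in> vecs (alphabet T)"
    by (auto simp: Gam_s_def Gam_vecs vecs_def fscale_def)
  obtain s where s: "s > 0" "(\<lambda>n. vnorm (alphabet T) (B_op T 0 n \<xi>)) \<in> O(\<lambda>n. B_norm T 0 n powr (- s))"
    using xi by (auto simp: Gam_s_def)
  have fin: "finite (alphabet T)" and ne: "alphabet T \<noteq> {}" using good_facts[OF T] by auto
  have "vnorm (alphabet T) (B_op T 0 n (fscale c \<xi>)) = \<bar>c\<bar> * vnorm (alphabet T) (B_op T 0 n \<xi>)" for n
  proof -
    have "B_op T 0 n (fscale c \<xi>) = fscale c (B_op T 0 n \<xi>)"
      using B_op_eq[OF T v(1), of 0 n] B_op_eq[OF T v(2), of 0 n] by (simp add: cv_fscale)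
    then show ?thesis
      unfolding vnorm_def using fin ne
      by (simp add: fscale_def abs_mult mono_Max_commute[of "(*) \<bar>c\<bar>", OF monoI[OF mult_left_mono]] image_image)
  qed
  then have "(\<lambda>n. vnorm (alphabet T) (B_op T 0 n (fscale c \<xi>))) \<in> O(\<lambda>n. B_norm T 0 n powr (- s))"
    using s(2) by simp
  then show ?thesis using s(1) v(2) by (auto simp: Gam_s_def Gam_vecs)
qed

section \<open>Lengths of the intervals and heights of the towers\<close>

context roth begin

abbreviation "Gs \<equiv> Gam_s T"

definition "wd k = width (lev k)"
definition "len k = right_end (lev k) - left_end T"

lemma sigma_pos: "\<sigma> > 0" and theta_pos: "\<theta> > 0"
  using sg th by (auto simp: sigma_const_def theta_const_def)

lemma wd_pos: "\<alpha> \<in> A \<Longrightarrow> 0 < wd k \<alpha>"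
  using good_facts(3)[OF good_lev[of k]] by (simp add: wd_def alphabet_lev)

lemma len_sum: "len k = sum (wd k) A"
  using interval_partition_telescope[where h = id, OF good_facts(1)[OF good_lev[of k]] good_facts(4,3)[OF good_lev[of k]]]
    good_facts(7)[OF good_lev[of k]] rv_left_end[OF good_T, of "ns k"]
  by (simp add: rv_alphabet[OF good_T] len_def wd_def lev_def)

lemma len_pos: "0 < len k"
  unfolding len_sum using wd_pos finite_A A_nonempty by (intro sum_pos) auto

lemma wd_cotr: "j \<le> k \<Longrightarrow> cotr j k (wd j) = wd k"
  unfolding cotr_def wd_def using width_rv[OF good_lev[of j], of "ns k - ns j"] ns_mono[of j k]
  by (simp add: lev_def rv_rv)

text \<open>Pairing with the widths is integration of step functions, so this says that special
  Birkhoff sums preserve the integral.\<close>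

lemma ip_tr_wd: "j \<le> k \<Longrightarrow> ip A (tr j k \<xi>) (wd k) = ip A \<xi> (wd j)"
  using ip_tr_cotr[of j k \<xi> "wd j"] by (simp add: wd_cotr)

lemma ip_one_wd: "ip A (\<lambda>_. 1) (wd k) = len k"
  by (simp add: ip_def len_sum)

text \<open>The towers over I(n_k) fill the base, and none of them is higher than
  \<open>N k\<close>.\<close>

lemma len_0_le: "len 0 \<le> N k * len k"
proof -
  have "len 0 = ip A (tr 0 k (\<lambda>_. 1)) (wd k)" by (simp add: ip_tr_wd ip_one_wd)
  also have "\<dots> \<le> (\<Sum>\<alpha>\<in>A. N k * wd k \<alpha>)"
    unfolding ip_def using tr_one_le[of 0 k] wd_pos by (intro sum_mono mult_right_mono) (auto simp: N_def less_imp_le)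
  finally show ?thesis by (simp add: len_sum sum_distrib_left)
qed

text \<open>By positivity, each of the towers of level k + 1 has a floor inside the interval of
  \<alpha> at level k.\<close>

lemma len_Suc_le_wd: "\<alpha> \<in> A \<Longrightarrow> len (Suc k) \<le> wd k \<alpha>"
proof -
  assume a: "\<alpha> \<in> A"
  have "len (Suc k) = (\<Sum>\<beta>\<in>A. 1 * wd (Suc k) \<beta>)" by (simp add: len_sum)
  also have "\<dots> \<le> ip A (tr k (Suc k) (unit_vec \<alpha>)) (wd (Suc k))"
    unfolding ip_def
  proof (intro sum_mono mult_right_mono)
    fix \<beta> assume b: "\<beta> \<in> A"
    show "1 \<le> tr k (Suc k) (unit_vec \<alpha>) \<beta>"
      unfolding tr_def lev_def using n_seq_props(2)[OF good_T b a] by (rule cv_unit_ge_1)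
    show "0 \<le> wd (Suc k) \<beta>" using wd_pos[OF b] by (rule less_imp_le)
  qed
  also have "\<dots> = wd k \<alpha>" using finite_A a by (simp add: ip_tr_wd ip_commute[of A "unit_vec \<alpha>"] ip_unit_vec)
  finally show ?thesis .
qed

lemma len_le_b: "len k \<le> b k * len (Suc k)"
proof -
  have "len k = ip A (tr k (Suc k) (\<lambda>_. 1)) (wd (Suc k))" by (simp add: ip_tr_wd ip_one_wd)
  also have "\<dots> \<le> (\<Sum>\<alpha>\<in>A. b k * wd (Suc k) \<alpha>)"
    unfolding ip_def using tr_one_le[of k "Suc k"] wd_pos
    by (intro sum_mono mult_right_mono) (auto simp: b_def less_imp_le)
  finally show ?thesis by (simp add: len_sum sum_distrib_left)
qed

text \<open>The highest tower alone has total length at most \<open>len 0\<close>, and its base is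
  not shorter than \<open>len k / b k\<close>.\<close>

lemma len_upper: "len k * N k \<le> b k * len 0"
proof -
  obtain \<alpha> where a: "\<alpha> \<in> A" "tr 0 k (\<lambda>_. 1) \<alpha> = N k" using tr_one_max[of 0 k] by (auto simp: N_def)
  have nn: "0 \<le> tr 0 k (\<lambda>_. 1) \<beta> * wd k \<beta>" if "\<beta> \<in> A" for \<beta>
    using tr_one_ge[OF that, of 0 k] wd_pos[OF that, of k] by simp
  have "N k * wd k \<alpha> \<le> ip A (tr 0 k (\<lambda>_. 1)) (wd k)"
    unfolding ip_def using a nn finite_A member_le_sum[of \<alpha> A "\<lambda>\<beta>. tr 0 k (\<lambda>_. 1) \<beta> * wd k \<beta>"] by simp
  also have "\<dots> = len 0" by (simp add: ip_tr_wd ip_one_wd)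
  finally have 1: "N k * wd k \<alpha> \<le> len 0" .
  have "len k \<le> b k * wd k \<alpha>"
    using len_le_b[of k] len_Suc_le_wd[OF a(1), of k] one_le_b[of k]
    by (meson mult_left_mono order_trans zero_le_one)
  then have "len k * N k \<le> b k * (N k * wd k \<alpha>)" using N_pos[of k] by (simp add: mult.assoc mult.left_commute)
  also have "\<dots> \<le> b k * len 0" using 1 one_le_b[of k] by (intro mult_left_mono) auto
  finally show ?thesis .
qed

lemma tr_restr_norm:
  assumes "j \<le> k" "W \<subseteq> vecs A" "\<And>c \<xi>. \<xi> \<in> W \<Longrightarrow> fscale c \<xi> \<in> W"
    "\<xi> \<in> W" "\<And>\<alpha>. \<alpha> \<in> A \<Longrightarrow> \<bar>\<xi> \<alpha>\<bar> \<le> M" "\<alpha> \<in> A"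
  shows "\<bar>tr j k \<xi> \<alpha>\<bar> \<le> restr_norm A W (B_op T (ns j) (ns k)) * M"
  using restr_norm_bound[OF good_T assms(2-6), of "ns j" "ns k - ns j"] ns_mono[OF assms(1)]
  by (simp add: tr_def lev_def)

lemma B_norm_0_pos: "0 < B_norm T 0 n"
proof -
  obtain \<alpha> where a: "\<alpha> \<in> A" using A_nonempty by blast
  have "1 \<le> ret T n \<alpha>" using ret_ge_1[OF good_T a] .
  also have "\<dots> \<le> B_norm T 0 n" using B_norm_eq[OF good_T, of 0 n] finite_A a by simp
  finally show ?thesis by simp
qed

lemma mean_zero_bound:
  obtains K where "K > 0" "\<And>k \<xi> M \<alpha>. \<xi> \<in> vecs A \<Longrightarrow> ip A \<xi> (wd 0) = 0 \<Longrightarrow>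
    (\<And>\<alpha>. \<alpha> \<in> A \<Longrightarrow> \<bar>\<xi> \<alpha>\<bar> \<le> M) \<Longrightarrow> \<alpha> \<in> A \<Longrightarrow> \<bar>tr 0 k \<xi> \<alpha>\<bar> \<le> K * N k powr (1 - \<theta>) * M"
proof -
  have "(\<lambda>n. restr_norm A (Gam_0 T) (B_op T 0 n)) \<in> O(\<lambda>n. B_norm T 0 n powr (1 - \<theta>))"
    using th by (simp add: theta_const_def)
  then obtain C where C: "C > 0" "\<And>n. \<bar>restr_norm A (Gam_0 T) (B_op T 0 n)\<bar> \<le> C * B_norm T 0 n powr (1 - \<theta>)"
    by (rule bigo_uniform) (auto simp: less_imp_neq[OF B_norm_0_pos, symmetric])
  show ?thesis
  proof (rule that[OF C(1)])
    fix k \<xi> M \<alpha>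
    assume x: "\<xi> \<in> vecs A" "ip A \<xi> (wd 0) = 0" "\<And>\<alpha>. \<alpha> \<in> A \<Longrightarrow> \<bar>\<xi> \<alpha>\<bar> \<le> M" "\<alpha> \<in> A"
    have M: "0 \<le> M" using x(3,4) by (meson abs_ge_zero order_trans)
    have xG: "\<xi> \<in> Gam_0 T" using x(1,2) by (simp add: Gam_0_eq[OF good_T] wd_def lev_0)
    have "\<bar>tr 0 k \<xi> \<alpha>\<bar> \<le> restr_norm A (Gam_0 T) (B_op T 0 (ns k)) * M"
      using tr_restr_norm[of 0 k "Gam_0 T" \<xi> M \<alpha>] xG x
      by (simp add: Gam_0_eq[OF good_T]) (auto simp: vecs_def fscale_def)
    also have "\<dots> \<le> (C * B_norm T 0 (ns k) powr (1 - \<theta>)) * M"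
      using C(2)[of "ns k"] M by (intro mult_right_mono) auto
    finally show "\<bar>tr 0 k \<xi> \<alpha>\<bar> \<le> C * N k powr (1 - \<theta>) * M" by (simp add: N_def)
  qed
qed

section \<open>Contraction on the stable space\<close>

lemma Gam_s_vecs: "Gam_s (lev k) \<subseteq> vecs A"
  by (auto simp: Gam_s_def Gam_vecs alphabet_lev)

lemma Gs_vecs: "Gs \<subseteq> vecs A"
  using Gam_s_vecs[of 0] by (simp add: lev_0)

lemma stable_bound:
  assumes "\<tau> > 0"
  obtains K where "K > 0" "\<And>j k \<xi> M \<alpha>. j \<le> k \<Longrightarrow> \<xi> \<in> Gam_s (lev j) \<Longrightarrow>
    (\<And>\<alpha>. \<alpha> \<in> A \<Longrightarrow> \<bar>\<xi> \<alpha>\<bar> \<le> M) \<Longrightarrow> \<alpha> \<in> A \<Longrightarrow> \<bar>tr j k \<xi> \<alpha>\<bar> \<le> K * N k powr \<tau> * M"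
proof -
  obtain K where K: "\<And>m n. m \<le> n \<Longrightarrow> B_s_norm T m n \<le> K * B_norm T 0 n powr \<tau>"
    using Roth assms unfolding restricted_Roth_def by blast
  show ?thesis
  proof (rule that[of "max K 1"])
    fix j k \<xi> M \<alpha>
    assume x: "j \<le> k" "\<xi> \<in> Gam_s (lev j)" "\<And>\<alpha>. \<alpha> \<in> A \<Longrightarrow> \<bar>\<xi> \<alpha>\<bar> \<le> M" "\<alpha> \<in> A"
    have M: "0 \<le> M" using x(3,4) by (meson abs_ge_zero order_trans)
    have "\<bar>tr j k \<xi> \<alpha>\<bar> \<le> restr_norm A (Gam_s (lev j)) (B_op T (ns j) (ns k)) * M"
      using tr_restr_norm[OF x(1) Gam_s_vecs[of j] _ x(2-4)] Gam_s_fscale[OF _ good_lev] by blast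
    also have "\<dots> = B_s_norm T (ns j) (ns k) * M" by (simp add: B_s_norm_def lev_def)
    also have "\<dots> \<le> (K * N k powr \<tau>) * M"
      using K[OF ns_mono[OF x(1)]] M unfolding N_def by (intro mult_right_mono) auto
    also have "\<dots> \<le> (max K 1 * N k powr \<tau>) * M" using M by (intro mult_right_mono) auto
    finally show "\<bar>tr j k \<xi> \<alpha>\<bar> \<le> max K 1 * N k powr \<tau> * M" .
  qed simp
qed

lemma Gs_decay:
  assumes "\<xi> \<in> Gs"
  obtains C where "C > 0" "\<And>n \<alpha>. \<alpha> \<in> A \<Longrightarrow> \<bar>cv T n \<xi> \<alpha>\<bar> \<le> C * B_norm T 0 n powr (- \<sigma>)"
proof -
  have "(\<lambda>n. vnorm A (B_op T 0 n \<xi>)) \<in> O(\<lambda>n. B_norm T 0 n powr (- \<sigma>))"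
    using sg assms by (simp add: sigma_const_def)
  then obtain C where C: "C > 0" "\<And>n. \<bar>vnorm A (B_op T 0 n \<xi>)\<bar> \<le> C * B_norm T 0 n powr (- \<sigma>)"
    by (rule bigo_uniform) (auto simp: less_imp_neq[OF B_norm_0_pos, symmetric])
  show ?thesis
  proof (rule that[OF C(1)])
    fix n \<alpha> assume "\<alpha> \<in> A"
    then have "\<bar>cv T n \<xi> \<alpha>\<bar> \<le> vnorm A (B_op T 0 n \<xi>)"
      using vnorm_ge[OF finite_A, of \<alpha> "cv T n \<xi>"] B_op_eq[OF good_T, of \<xi> 0 n] Gs_vecs assms by auto
    then show "\<bar>cv T n \<xi> \<alpha>\<bar> \<le> C * B_norm T 0 n powr (- \<sigma>)" using C(2)[of n] by linarith
  qed
qed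

lemma Gs_I:
  assumes "\<xi> \<in> vecs A" "\<And>n \<alpha>. \<alpha> \<in> A \<Longrightarrow> \<bar>cv T n \<xi> \<alpha>\<bar> \<le> C * B_norm T 0 n powr (- \<sigma>)"
  shows "\<xi> \<in> Gs"
proof -
  have "vnorm A (B_op T 0 n \<xi>) \<le> C * B_norm T 0 n powr (- \<sigma>)" for n
    using assms B_op_eq[OF good_T assms(1), of 0 n] by (intro vnorm_le finite_A A_nonempty) auto
  moreover have "0 \<le> vnorm A \<xi>" for \<xi> :: "'a \<Rightarrow> real"
    using vnorm_ge[OF finite_A] A_nonempty by (meson abs_ge_zero all_not_in_conv order_trans)
  ultimately have "(\<lambda>n. vnorm A (B_op T 0 n \<xi>)) \<in> O(\<lambda>n. B_norm T 0 n powr (- \<sigma>))"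
    by (intro bigoI[of _ C]) auto
  then show ?thesis using assms(1) sigma_pos by (auto simp: Gam_s_def Gam_vecs)
qed

lemma subspace_Gs: "fvec.subspace Gs"
  unfolding fvec.subspace_def
proof (intro conjI ballI allI)
  show "0 \<in> Gs"
    by (rule Gs_I[of _ 0]) (auto simp: vecs_def cv_0)
  fix x assume x: "x \<in> Gs"
  show "fscale c x \<in> Gs" for c using Gam_s_fscale[OF x good_T] .
  fix y assume y: "y \<in> Gs"
  obtain C where C: "\<And>n \<alpha>. \<alpha> \<in> A \<Longrightarrow> \<bar>cv T n x \<alpha>\<bar> \<le> C * B_norm T 0 n powr (- \<sigma>)"
    using Gs_decay[OF x] by metis
  obtain D where D: "\<And>n \<alpha>. \<alpha> \<in> A \<Longrightarrow> \<bar>cv T n y \<alpha>\<bar> \<le> D * B_norm T 0 n powr (- \<sigma>)"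
    using Gs_decay[OF y] by metis
  show "x + y \<in> Gs"
  proof (rule Gs_I[of _ "C + D"])
    show "x + y \<in> vecs A" using x y Gs_vecs subspace_vecs[of A] fvec.subspace_add by blast
    show "\<bar>cv T n (x + y) \<alpha>\<bar> \<le> (C + D) * B_norm T 0 n powr (- \<sigma>)" if "\<alpha> \<in> A" for n \<alpha>
      using C[OF that, of n] D[OF that, of n] abs_triangle_ineq[of "cv T n x \<alpha>" "cv T n y \<alpha>"]
      by (simp add: cv_plus algebra_simps)
  qed
qed

text \<open>The definition of the stable space gives a constant for each vector. A finite orthogonal
  basis turns these into one constant, because coefficients are bounded by the size of the
  vector.\<close>

lemma stable_decay:
  obtains K where "K > 0" "\<And>k \<xi> M \<alpha>. \<xi> \<in> Gs \<Longrightarrow>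
    (\<And>\<alpha>. \<alpha> \<in> A \<Longrightarrow> \<bar>\<xi> \<alpha>\<bar> \<le> M) \<Longrightarrow> \<alpha> \<in> A \<Longrightarrow> \<bar>tr 0 k \<xi> \<alpha>\<bar> \<le> K * N k powr (- \<sigma>) * M"
proof -
  obtain B where B: "orthogonal_set A B" "B \<subseteq> Gs" "\<And>\<xi>. \<xi> \<in> Gs \<Longrightarrow> orth_proj A B \<xi> = \<xi>"
    using orthogonal_basis_exists[OF finite_A subspace_Gs Gs_vecs] by blast
  have finB: "finite B" using B(1) by (simp add: orthogonal_set_def)
  have "\<forall>b\<in>B. \<exists>C. C > 0 \<and> (\<forall>n \<alpha>. \<alpha> \<in> A \<longrightarrow> \<bar>cv T n b \<alpha>\<bar> \<le> C * B_norm T 0 n powr (- \<sigma>))"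
    using Gs_decay B(2) by (metis subsetD)
  then obtain C where C: "\<And>b. b \<in> B \<Longrightarrow> C b > 0"
      "\<And>b n \<alpha>. b \<in> B \<Longrightarrow> \<alpha> \<in> A \<Longrightarrow> \<bar>cv T n b \<alpha>\<bar> \<le> C b * B_norm T 0 n powr (- \<sigma>)"
    by metis
  \<comment> \<open>Bounds the coefficient of \<open>b\<close> in the projection of a vector with
    entries at most 1.\<close>
  define L where "L b = (\<Sum>\<alpha>\<in>A. \<bar>b \<alpha>\<bar>) / \<bar>ip A b b\<bar>" for b
  have L: "0 \<le> L b" for b unfolding L_def by (intro divide_nonneg_nonneg sum_nonneg) auto
  define K where "K = 1 + (\<Sum>b\<in>B. L b * C b)"
  have K: "(\<Sum>b\<in>B. L b * C b) \<le> K" "K > 0"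
    using sum_nonneg[of B "\<lambda>b. L b * C b"] L C(1) by (auto simp: K_def less_imp_le add_pos_nonneg)
  show ?thesis
  proof (rule that[OF K(2)])
    fix k \<xi> M \<alpha> assume x: "\<xi> \<in> Gs" "\<And>\<alpha>. \<alpha> \<in> A \<Longrightarrow> \<bar>\<xi> \<alpha>\<bar> \<le> M" "\<alpha> \<in> A"
    have M: "0 \<le> M" using x(2,3) by (meson abs_ge_zero order_trans)
    have co: "\<bar>ip A \<xi> b / ip A b b\<bar> \<le> M * L b" for b
    proof -
      have "\<bar>ip A \<xi> b\<bar> \<le> (\<Sum>\<alpha>\<in>A. \<bar>\<xi> \<alpha>\<bar> * \<bar>b \<alpha>\<bar>)" unfolding ip_def by (simp add: abs_mult[symmetric])
      also have "\<dots> \<le> (\<Sum>\<alpha>\<in>A. M * \<bar>b \<alpha>\<bar>)" using x by (intro sum_mono mult_right_mono) auto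
      finally have "\<bar>ip A \<xi> b\<bar> / \<bar>ip A b b\<bar> \<le> (M * (\<Sum>\<alpha>\<in>A. \<bar>b \<alpha>\<bar>)) / \<bar>ip A b b\<bar>"
        by (intro divide_right_mono) (auto simp: sum_distrib_left)
      then show ?thesis by (simp add: L_def abs_divide)
    qed
    have "tr 0 k \<xi> = (\<Sum>b\<in>B. fscale (ip A \<xi> b / ip A b b) (tr 0 k b))"
      using B(3)[OF x(1)] unfolding orth_proj_def tr_def by (metis (no_types, lifting) cv_sum cv_fscale sum.cong)
    then have "tr 0 k \<xi> \<alpha> = (\<Sum>b\<in>B. (ip A \<xi> b / ip A b b) * tr 0 k b \<alpha>)"
      by (simp add: sum_fun_apply fscale_def)
    then have "\<bar>tr 0 k \<xi> \<alpha>\<bar> \<le> (\<Sum>b\<in>B. \<bar>(ip A \<xi> b / ip A b b) * tr 0 k b \<alpha>\<bar>)"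
      by (simp only: sum_abs)
    also have "\<dots> \<le> (\<Sum>b\<in>B. (M * L b) * (C b * N k powr (- \<sigma>)))"
    proof (intro sum_mono)
      fix b assume b: "b \<in> B"
      have "\<bar>tr 0 k b \<alpha>\<bar> \<le> C b * N k powr (- \<sigma>)"
        using C(2)[OF b x(3), of "ns k"] by (simp add: tr_def lev_0 N_def)
      then show "\<bar>(ip A \<xi> b / ip A b b) * tr 0 k b \<alpha>\<bar> \<le> (M * L b) * (C b * N k powr (- \<sigma>))"
        unfolding abs_mult using co[of b] M L by (intro mult_mono) auto
    qed
    also have "\<dots> = (\<Sum>b\<in>B. L b * C b) * (N k powr (- \<sigma>) * M)"
      by (simp add: sum_distrib_left sum_distrib_right algebra_simps)
    also have "\<dots> \<le> K * (N k powr (- \<sigma>) * M)" using K(1) M by (intro mult_right_mono) auto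
    finally show "\<bar>tr 0 k \<xi> \<alpha>\<bar> \<le> K * N k powr (- \<sigma>) * M" by (simp add: mult.assoc)
  qed
qed

text \<open>A coordinate of \<xi> is its pairing with a unit vector, and pairings are invariant, so
  it suffices to bound the dual orbit of the unit vector. Its displacements are at most 2, hence at
  most \<open>2 * N k\<close> before level k, and they are added over at most \<open>d * N k\<close>
  steps.\<close>

lemma inverse_bound:
  assumes x: "\<xi> \<in> vecs A" "\<And>\<alpha>. \<alpha> \<in> A \<Longrightarrow> \<bar>tr 0 k \<xi> \<alpha>\<bar> \<le> M" "\<beta> \<in> A"
  shows "\<bar>\<xi> \<beta>\<bar> \<le> 6 * d\<^sup>2 * (N k)\<^sup>2 * M"
proof -
  let ?e = "unit_vec \<beta> :: 'a \<Rightarrow> real"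
  have ps: "\<bar>psum A l y ?e\<bar> \<le> 1" for l y
    unfolding psum_def unit_vec_def using finite_A by (simp add: sum.If_cases)
  have "\<bar>disp T ?e \<alpha>\<bar> \<le> 2" for \<alpha>
    using ps[of "bot_left T" "bot_left T \<alpha>"] ps[of "top_left T" "top_left T \<alpha>"] by (auto simp: disp_def)
  then have D: "\<bar>cv T m (disp T ?e) \<alpha>\<bar> \<le> 2 * N k" if "m < ns k" "\<alpha> \<in> A" for m \<alpha>
  proof -
    have "\<bar>cv T m (disp T ?e) \<alpha>\<bar> \<le> cv T m (\<lambda>_. 2) \<alpha>"
      using cv_abs_le[OF good_T, of "disp T ?e" "\<lambda>_. 2"] that \<open>\<And>\<alpha>. \<bar>disp T ?e \<alpha>\<bar> \<le> 2\<close> by simp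
    also have "\<dots> = 2 * ret T m \<alpha>"
      using fun_cong[OF cv_fscale[of T m 2 "\<lambda>_. 1"], of \<alpha>] by (simp add: fscale_def)
    also have "ret T m \<alpha> \<le> tr 0 k (\<lambda>_. 1) \<alpha>"
      unfolding tr_def using ret_mono[OF good_T that(2), of m "ns k"] that by (simp add: lev_0)
    also have "\<dots> \<le> N k" using tr_one_le[of 0 k \<alpha>] that by (simp add: N_def)
    finally show ?thesis by simp
  qed
  have c: "\<bar>cotr 0 k ?e \<alpha>\<bar> \<le> 6 * d * (N k)\<^sup>2" if "\<alpha> \<in> A" for \<alpha>
  proof -
    have "(\<Sum>\<alpha>\<in>A. \<bar>?e \<alpha>\<bar>) = 1" using finite_A x(3) by (simp add: unit_vec_def if_distrib cong: if_cong)
    then have "\<bar>cotr 0 k ?e \<alpha>\<bar> \<le> 2 * (1 + real (ns k) * (2 * N k))"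
      unfolding cotr_def using cw_bound[OF good_T, of "ns k" ?e "\<lambda>_. 2 * N k" \<alpha>] D that by (simp add: lev_0)
    also have "\<dots> \<le> 2 * (d * (N k)\<^sup>2 + (d * N k) * (2 * N k))"
    proof -
      have "1 \<le> d * (N k)\<^sup>2" using two_le_d one_le_N[of k] by (meson mult_ge1_I one_le_power order_trans one_le_numeral)
      moreover have "real (ns k) * (2 * N k) \<le> (d * N k) * (2 * N k)"
        using step_count_0[of k] N_pos[of k] by (intro mult_right_mono) auto
      ultimately show ?thesis by simp
    qed
    also have "\<dots> = 6 * d * (N k)\<^sup>2" by (simp add: power2_eq_square)
    finally show ?thesis .
  qed
  have "\<xi> \<beta> = ip A (tr 0 k \<xi>) (cotr 0 k ?e)" using finite_A x(3) by (simp add: ip_tr_cotr ip_unit_vec)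
  then have "\<bar>\<xi> \<beta>\<bar> \<le> d * (M * (6 * d * (N k)\<^sup>2))"
    using ip_abs_le[of A "tr 0 k \<xi>" M "cotr 0 k ?e", OF x(2) c] by (simp add: d_def)
  then show ?thesis by (simp add: power2_eq_square mult.assoc mult.commute mult.left_commute)
qed

text \<open>
  Since the displacement decays, the dual orbit stays bounded even though the dual cocycle is
  expanding in general.
\<close>

lemma cotr_bounded:
  assumes "disp T p \<in> Gs"
  obtains P where "\<And>k \<alpha>. \<alpha> \<in> A \<Longrightarrow> \<bar>cotr 0 k p \<alpha>\<bar> \<le> P"
proof -
  obtain K where K: "K > 0" "\<And>k \<xi> M \<alpha>. \<xi> \<in> Gs \<Longrightarrow> (\<And>\<alpha>. \<alpha> \<in> A \<Longrightarrow> \<bar>\<xi> \<alpha>\<bar> \<le> M) \<Longrightarrow> \<alpha> \<in> A \<Longrightarrow>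
      \<bar>tr 0 k \<xi> \<alpha>\<bar> \<le> K * N k powr (- \<sigma>) * M"
    using stable_decay by blast
  \<comment> \<open>The square of \<open>b k\<close> then costs \<sigma>/2 of the decay \<sigma> of
    the displacements, and the remaining decay \<sigma>/2 is summable over the levels.\<close>
  obtain C where C: "C > 0" "\<And>k. b k \<le> C * N k powr (\<sigma> / 4)"
    using roth_b[of "\<sigma> / 4"] sigma_pos by auto
  define M where "M = vnorm A (disp T p)"
  have M: "\<bar>disp T p \<alpha>\<bar> \<le> M" if "\<alpha> \<in> A" for \<alpha> unfolding M_def using vnorm_ge[OF finite_A that] .
  have M0: "0 \<le> M" using M A_nonempty by (meson abs_ge_zero all_not_in_conv order_trans)
  define E where "E = d * C\<^sup>2 * K * M"
  have E: "0 \<le> E" unfolding E_def using K C M0 two_le_d by simp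
  define P where "P = 2 * ((\<Sum>\<alpha>\<in>A. \<bar>p \<alpha>\<bar>) + E * (2 / (1 - 2 powr (- (\<sigma> / 2))) * N 0 powr (- (\<sigma> / 2))))"
  show ?thesis
  proof (rule that[of P])
    fix k \<alpha> assume a: "\<alpha> \<in> A"
    have "\<bar>cotr 0 k p \<alpha>\<bar> \<le> 2 * ((\<Sum>\<alpha>\<in>A. \<bar>p \<alpha>\<bar>) + (\<Sum>i\<in>{0..<k}. d * (b i)\<^sup>2 * (K * N i powr (- \<sigma>) * M)))"
      using K(2)[OF assms M] a by (intro cotr_bound) (auto simp: lev_0)
    also have "(\<Sum>i\<in>{0..<k}. d * (b i)\<^sup>2 * (K * N i powr (- \<sigma>) * M)) \<le> (\<Sum>i\<in>{0..<k}. E * N i powr (- (\<sigma> / 2)))"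
    proof (intro sum_mono)
      fix i
      have "(b i)\<^sup>2 \<le> (C * N i powr (\<sigma> / 4))\<^sup>2" using C(2)[of i] one_le_b[of i] by (intro power_mono) auto
      also have "\<dots> = C\<^sup>2 * N i powr (\<sigma> / 2)"
        using N_pos[of i] by (simp add: power_mult_distrib powr_powr[symmetric] powr_power)
      finally have "d * (b i)\<^sup>2 * (K * N i powr (- \<sigma>) * M) \<le> d * (C\<^sup>2 * N i powr (\<sigma> / 2)) * (K * N i powr (- \<sigma>) * M)"
        using two_le_d K M0 by (intro mult_right_mono mult_left_mono mult_nonneg_nonneg) auto
      also have "\<dots> = E * (N i powr (\<sigma> / 2) * N i powr (- \<sigma>))" by (simp add: E_def)
      also have "N i powr (\<sigma> / 2) * N i powr (- \<sigma>) = N i powr (- (\<sigma> / 2))"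
        by (simp add: powr_add[symmetric])
      finally show "d * (b i)\<^sup>2 * (K * N i powr (- \<sigma>) * M) \<le> E * N i powr (- (\<sigma> / 2))" .
    qed
    also have "\<dots> \<le> E * (2 / (1 - 2 powr (- (\<sigma> / 2))) * N 0 powr (- (\<sigma> / 2)))"
      unfolding sum_distrib_left[symmetric] using sum_neg_powr[of "\<sigma> / 2" 0 k] sigma_pos E by (intro mult_left_mono) auto
    finally show "\<bar>cotr 0 k p \<alpha>\<bar> \<le> P" by (simp add: P_def)
  qed
qed

text \<open>The pairing is invariant, but along the levels \<open>v\<close> tends to 0 while the
  dual orbit of \<open>p\<close> stays bounded.\<close>

lemma stable_isotropic:
  assumes "disp T p \<in> Gs" "v \<in> Gs"
  shows "ip A p v = 0"
proof -
  obtain P where P: "\<And>k \<alpha>. \<alpha> \<in> A \<Longrightarrow> \<bar>cotr 0 k p \<alpha>\<bar> \<le> P" using cotr_bounded[OF assms(1)] by blast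
  obtain K where K: "K > 0" "\<And>k \<xi> M \<alpha>. \<xi> \<in> Gs \<Longrightarrow> (\<And>\<alpha>. \<alpha> \<in> A \<Longrightarrow> \<bar>\<xi> \<alpha>\<bar> \<le> M) \<Longrightarrow> \<alpha> \<in> A \<Longrightarrow>
      \<bar>tr 0 k \<xi> \<alpha>\<bar> \<le> K * N k powr (- \<sigma>) * M"
    using stable_decay by blast
  have v: "\<bar>tr 0 k v \<alpha>\<bar> \<le> K * N k powr (- \<sigma>) * vnorm A v" if "\<alpha> \<in> A" for k \<alpha>
    using K(2)[OF assms(2) vnorm_ge[OF finite_A] that] .
  have bnd: "\<bar>ip A p v\<bar> \<le> real (card A) * (K * N k powr (- \<sigma>) * vnorm A v * P)" for k
  proof -
    have "ip A p v = ip A (tr 0 k v) (cotr 0 k p)" using ip_tr_cotr[of 0 k v p] by (simp add: ip_commute)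
    then show ?thesis using ip_abs_le[of A "tr 0 k v" _ "cotr 0 k p" P, OF v P] by simp
  qed
  have "(\<lambda>k. real (card A) * (K * N k powr (- \<sigma>) * vnorm A v * P)) \<longlonglongrightarrow> real (card A) * (K * 0 * vnorm A v * P)"
    by (intro tendsto_intros N_neg_powr_tendsto sigma_pos)
  then have "\<bar>ip A p v\<bar> \<le> real (card A) * (K * 0 * vnorm A v * P)"
    using bnd by (intro LIMSEQ_le_const) auto
  then show ?thesis by simp
qed

section \<open>The stable space is Lagrangian\<close>

sublocale antisymmetric_form A "Omega T"
  by unfold_locales (auto intro: finite_A Omega_antisym)

lemma disp_T: "disp T W = om W"
  by (rule disp_Omega[OF good_T])

text \<open>The part of \<xi> orthogonal to the range has displacement 0, which lies in
  \<open>Gs\<close>. By isotropy this part is orthogonal to \<xi>, hence to itself.\<close>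

lemma Gs_range: "Gs \<subseteq> om ` vecs A"
proof
  fix \<xi> assume x: "\<xi> \<in> Gs"
  obtain s where s: "s \<in> om ` vecs A" "\<And>\<eta>. \<eta> \<in> om ` vecs A \<Longrightarrow> ip A (\<xi> - s) \<eta> = 0"
    using orthogonal_decomposition[OF finite_A subspace_mat_vec_image[where M = "Omega T"], where \<xi> = \<xi>] mat_vec_vecs
    by blast
  have "om (\<xi> - s) = 0" by (rule orthogonal_range_kernel[OF s(2)])
  then have "disp T (\<xi> - s) \<in> Gs" using fvec.subspace_0[OF subspace_Gs] by (simp add: disp_T)
  then have "ip A (\<xi> - s) \<xi> = 0" using x by (rule stable_isotropic)
  then have "ip A (\<xi> - s) (\<xi> - s) = 0" using s(2)[OF s(1)] by simp
  moreover have "\<xi> - s \<in> vecs A"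
    using x s(1) Gs_vecs mat_vec_vecs[of A "Omega T"] fvec.subspace_diff[OF subspace_vecs[of A]] by blast
  ultimately have "\<xi> = s" using ip_self_eq_0[OF finite_A, of "\<xi> - s"] by simp
  then show "\<xi> \<in> om ` vecs A" using s(1) by simp
qed

text \<open>By invariance \<mu> comes from a dual vector at level 0 that annihilates
  \<open>Gs\<close>; the Lagrangian property places its displacement in \<open>Gs\<close>. The bound
  \<open>P\<close> depends on \<mu> and is meant for a limit argument only.\<close>

lemma dual_stable:
  assumes mu: "\<mu> \<in> vecs A" "\<And>\<xi>. \<xi> \<in> Gs \<Longrightarrow> ip A \<mu> (tr 0 j \<xi>) = 0"
  shows "disp (lev j) \<mu> \<in> tr 0 j ` Gs" "\<exists>P. \<forall>k\<ge>j. \<forall>\<alpha>\<in>A. \<bar>cotr j k \<mu> \<alpha>\<bar> \<le> P"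
proof -
  obtain \<nu> where nu: "\<nu> \<in> vecs A" "cotr 0 j \<nu> = \<mu>"
    using cw_surj[OF good_T mu(1), of "ns j"] by (auto simp: cotr_def lev_0)
  have "om \<nu> \<in> Gs"
  proof (rule lagrangian[OF subspace_Gs Gs_range _ _ nu(1)])
    show "p \<in> vecs A \<Longrightarrow> om p \<in> Gs \<Longrightarrow> v \<in> Gs \<Longrightarrow> ip A p v = 0" for p v
      using stable_isotropic[of p v] by (simp add: disp_T)
    show "fvec.dim Gs = fvec.dim (om ` vecs A) div 2"
      using Roth by (simp add: restricted_Roth_def genus_def Gam_vecs)
    show "ip A \<nu> w = 0" if "w \<in> Gs" for w
      using mu(2)[OF that] ip_tr_cotr[of 0 j w \<nu>] nu(2) by (simp add: ip_commute)
  qed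
  then have G: "disp T \<nu> \<in> Gs" by (simp add: disp_T)
  show "disp (lev j) \<mu> \<in> tr 0 j ` Gs"
    using G disp_cotr[of 0 j \<nu>] nu(2) by (auto simp: lev_0)
  obtain P where "\<And>k \<alpha>. \<alpha> \<in> A \<Longrightarrow> \<bar>cotr 0 k \<nu> \<alpha>\<bar> \<le> P" using cotr_bounded[OF G] by blast
  then have "\<forall>k\<ge>j. \<forall>\<alpha>\<in>A. \<bar>cotr j k \<mu> \<alpha>\<bar> \<le> P"
    using cotr_cotr[of 0 j _ \<nu>] nu(2) by auto
  then show "\<exists>P. \<forall>k\<ge>j. \<forall>\<alpha>\<in>A. \<bar>cotr j k \<mu> \<alpha>\<bar> \<le> P" by blast
qed

lemma B_norm_tail_le: "B_norm (rv T m) 0 n \<le> B_norm T 0 (m + n)"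
proof -
  have gm: "good (rv T m)" and Am: "alphabet (rv T m) = A" using good_rv[OF good_T] rv_alphabet[OF good_T] by auto
  have "ret (rv T m) n \<alpha> \<le> B_norm T 0 (m + n)" if a: "\<alpha> \<in> A" for \<alpha>
  proof -
    have "ret (rv T m) n \<alpha> \<le> cv (rv T m) n (ret T m) \<alpha>"
      using cv_mono[OF gm, of "\<lambda>_. 1" "ret T m" \<alpha> n] ret_ge_1[OF good_T] a Am by simp
    also have "\<dots> = ret T (m + n) \<alpha>" by (simp add: cv_add)
    also have "\<dots> \<le> B_norm T 0 (m + n)" using B_norm_eq[OF good_T, of 0 "m + n"] finite_A a by simp
    finally show ?thesis .
  qed
  then show ?thesis
    using B_norm_eq[OF gm, of 0 n] finite_A A_nonempty by (simp add: Am)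
qed

text \<open>Norms of the cocycle started at level k do not exceed those started at level 0, so a
  negative power of the latter is the stronger bound.\<close>

lemma tr_Gs: "\<xi> \<in> Gs \<Longrightarrow> tr 0 k \<xi> \<in> Gam_s (lev k)"
proof -
  assume x: "\<xi> \<in> Gs"
  let ?\<eta> = "tr 0 k \<xi>"
  have v: "?\<eta> \<in> vecs A" using x Gs_vecs by (intro tr_vecs) auto
  obtain C where C: "C > 0" "\<And>n \<alpha>. \<alpha> \<in> A \<Longrightarrow> \<bar>cv T n \<xi> \<alpha>\<bar> \<le> C * B_norm T 0 n powr (- \<sigma>)"
    using Gs_decay[OF x] by metis
  have pos: "0 < B_norm (lev k) 0 n" for n
  proof -
    obtain \<alpha> where a: "\<alpha> \<in> A" using A_nonempty by blast
    have "1 \<le> ret (lev k) n \<alpha>" using ret_ge_1[OF good_lev] a by (simp add: alphabet_lev)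
    also have "\<dots> \<le> B_norm (lev k) 0 n" using B_norm_eq[OF good_lev, of k 0 n] finite_A a by (simp add: alphabet_lev)
    finally show ?thesis by simp
  qed
  have "vnorm A (B_op (lev k) 0 n ?\<eta>) \<le> C * B_norm (lev k) 0 n powr (- \<sigma>)" for n
  proof (intro vnorm_le finite_A A_nonempty)
    fix \<alpha> assume a: "\<alpha> \<in> A"
    have "B_op (lev k) 0 n ?\<eta> \<alpha> = cv T (ns k + n) \<xi> \<alpha>"
      using B_op_eq[OF good_lev[of k], of ?\<eta> 0 n] v unfolding alphabet_lev by (simp add: cv_add tr_def lev_def)
    then have "\<bar>B_op (lev k) 0 n ?\<eta> \<alpha>\<bar> \<le> C * B_norm T 0 (ns k + n) powr (- \<sigma>)" using C(2)[OF a] by simp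
    also have "B_norm T 0 (ns k + n) powr (- \<sigma>) \<le> B_norm (lev k) 0 n powr (- \<sigma>)"
      using B_norm_tail_le[of "ns k" n] pos[of n] sigma_pos by (intro powr_mono2') (auto simp: lev_def)
    finally show "\<bar>B_op (lev k) 0 n ?\<eta> \<alpha>\<bar> \<le> C * B_norm (lev k) 0 n powr (- \<sigma>)" using C(1) by simp
  qed
  moreover have "0 \<le> vnorm A \<xi>" for \<xi> :: "'a \<Rightarrow> real"
    using vnorm_ge[OF finite_A] A_nonempty by (meson abs_ge_zero all_not_in_conv order_trans)
  ultimately have "(\<lambda>n. vnorm A (B_op (lev k) 0 n ?\<eta>)) \<in> O(\<lambda>n. B_norm (lev k) 0 n powr (- \<sigma>))"
    by (intro bigoI[of _ C]) auto
  then show ?thesis using v sigma_pos by (auto simp: Gam_s_def Gam_vecs alphabet_lev)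
qed

end

section \<open>Special Birkhoff sums\<close>

definition cell :: "'a iem \<Rightarrow> 'a \<Rightarrow> real set" where
  "cell T \<alpha> = {top_left T \<alpha>..top_left T \<alpha> + width T \<alpha>}"

text \<open>The two terms follow the order of visits in \<open>step_orbit\<close>, now for points of
  the closed cells.\<close>

definition stepf :: "'a iem \<Rightarrow> ('a \<Rightarrow> real \<Rightarrow> real) \<Rightarrow> 'a \<Rightarrow> real \<Rightarrow> real" where
  "stepf T G = G(loser T := \<lambda>x. G (bot_last T) x + G (top_last T) (x + shift T (bot_last T)))"

text \<open>
  \<open>bsum T n G\<close> is the special Birkhoff sum \<open>S(0,n) G\<close>, where \<open>G \<alpha>\<close> is the component on the closed
  interval of the letter \<open>\<alpha>\<close>.
\<close>

primrec bsum :: "'a iem \<Rightarrow> nat \<Rightarrow> ('a \<Rightarrow> real \<Rightarrow> real) \<Rightarrow> 'a \<Rightarrow> real \<Rightarrow> real" where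
  "bsum T 0 G = G"
| "bsum T (Suc n) G = stepf (rv T n) (bsum T n G)"

lemma bsum_add: "bsum T (m + n) G = bsum (rv T m) n (bsum T m G)"
  by (induction n) (auto simp: rv_rv)

lemma step_cell:
  assumes "good T" "x \<in> cell (rauzy_step T) \<alpha>"
  shows "\<alpha> \<noteq> loser T \<Longrightarrow> x \<in> cell T \<alpha>"
    and "\<alpha> = loser T \<Longrightarrow> x \<in> cell T (bot_last T) \<and> x + shift T (bot_last T) \<in> cell T (top_last T)"
proof -
  note g = good_facts[OF assms(1)] and la = good_last[OF assms(1)]
  have wpos: "0 < width T (top_last T)" "0 < width T (bot_last T)" using g(3) la(1,2) by auto
  show "x \<in> cell T \<alpha>" if "\<alpha> \<noteq> loser T"
    using assms that wpos
    by (cases "top_wins T") (auto simp: cell_def rauzy_step_top rauzy_step_bot loser_def split: if_splits)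
  show "x \<in> cell T (bot_last T) \<and> x + shift T (bot_last T) \<in> cell T (top_last T)" if "\<alpha> = loser T"
    using assms that wpos la(3,4,9,10)
    by (cases "top_wins T")
       (auto simp: cell_def rauzy_step_top rauzy_step_bot loser_def shift_def top_wins_def)
qed

lemma loser_shift:
  assumes "good T"
  shows "shift (rauzy_step T) (loser T) = shift T (bot_last T) + shift T (top_last T)"
  using shift_step[OF assms] by (auto simp: stepv_def loser_def winner_def)

lemma loser_cv: "stepv T \<xi> (loser T) = \<xi> (bot_last T) + \<xi> (top_last T)" for \<xi> :: "'a \<Rightarrow> real"
  by (auto simp: stepv_def loser_def winner_def)

lemma bsum_coboundary:
  assumes "good T" "\<And>\<alpha> x. \<alpha> \<in> alphabet T \<Longrightarrow> x \<in> cell T \<alpha> \<Longrightarrow> G \<alpha> x = \<psi> (x + shift T \<alpha>) - \<psi> x"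
    and "\<alpha> \<in> alphabet T" "x \<in> cell (rv T n) \<alpha>"
  shows "bsum T n G \<alpha> x = \<psi> (x + shift (rv T n) \<alpha>) - \<psi> x"
  using assms(3,4)
proof (induction n arbitrary: \<alpha> x)
  case 0 then show ?case using assms(2) by simp
next
  case (Suc n)
  have gn: "good (rv T n)" using good_rv[OF assms(1)] .
  note la = good_last(1,2)[OF gn, unfolded rv_alphabet[OF assms(1)]]
  note sc = step_cell[OF gn Suc.prems(2)[unfolded rv_Suc]]
  show ?case
  proof (cases "\<alpha> = loser (rv T n)")
    case True
    note s = sc(2)[OF True]
    show ?thesis
      using Suc.IH[OF la(2) conjunct1[OF s]] Suc.IH[OF la(1) conjunct2[OF s]] True
      by (simp add: stepf_def loser_shift[OF gn] add.assoc)
  next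
    case False
    then show ?thesis using Suc.IH[OF Suc.prems(1) sc(1)[OF False]] shift_step[OF gn]
      by (simp add: stepf_def stepv_def)
  qed
qed

lemma bsum_deriv:
  assumes "good T"
    "\<And>\<alpha> x. \<alpha> \<in> alphabet T \<Longrightarrow> x \<in> cell T \<alpha> \<Longrightarrow> (G \<alpha> has_real_derivative G' \<alpha> x) (at x within cell T \<alpha>)"
    and "\<alpha> \<in> alphabet T" "x \<in> cell (rv T n) \<alpha>"
  shows "(bsum T n G \<alpha> has_real_derivative bsum T n G' \<alpha> x) (at x within cell (rv T n) \<alpha>)"
  using assms(3,4)
proof (induction n arbitrary: \<alpha> x)
  case 0 then show ?case using assms(2) by simp
next
  case (Suc n)
  have gn: "good (rv T n)" using good_rv[OF assms(1)] .
  let ?S = "rv T n" and ?s = "shift (rv T n) (bot_last (rv T n))"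
  note la = good_last(1,2)[OF gn, unfolded rv_alphabet[OF assms(1)]]
  note sc = step_cell[OF gn, folded rv_Suc]
  show ?case
  proof (cases "\<alpha> = loser ?S")
    case True
    note s = sc(2)[OF Suc.prems(2) True]
    have 1: "(bsum T n G (bot_last ?S) has_real_derivative bsum T n G' (bot_last ?S) x) (at x within cell (rv T (Suc n)) \<alpha>)"
      by (rule DERIV_subset[OF Suc.IH[OF la(2)]]) (use sc(2) True s in blast)+
    have 2: "((bsum T n G (top_last ?S)) has_real_derivative bsum T n G' (top_last ?S) (x + ?s))
        (at (x + ?s) within (\<lambda>x. x + ?s) ` cell (rv T (Suc n)) \<alpha>)"
      by (rule DERIV_subset[OF Suc.IH[OF la(1)]]) (use sc(2) True s in blast)+
    have 3: "((\<lambda>x. x + ?s) has_real_derivative 1) (at x within cell (rv T (Suc n)) \<alpha>)"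
      by (auto intro!: derivative_eq_intros)
    have "((\<lambda>x. bsum T n G (bot_last ?S) x + (bsum T n G (top_last ?S) \<circ> (\<lambda>x. x + ?s)) x) has_real_derivative
        bsum T n G' (bot_last ?S) x + bsum T n G' (top_last ?S) (x + ?s) * 1) (at x within cell (rv T (Suc n)) \<alpha>)"
      by (intro DERIV_add 1 DERIV_image_chain[OF 2 3])
    then show ?thesis using True by (simp add: stepf_def o_def)
  next
    case False
    have "(bsum T n G \<alpha> has_real_derivative bsum T n G' \<alpha> x) (at x within cell (rv T (Suc n)) \<alpha>)"
      by (rule DERIV_subset[OF Suc.IH[OF Suc.prems(1)]]) (use sc(1) False Suc.prems in blast)+
    then show ?thesis using False by (simp add: stepf_def)
  qed
qed

text \<open>The passage from functions to vectors: constants move by \<open>cv\<close>, and so do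
  error bounds because the entries are nonnegative.\<close>

lemma bsum_approx:
  assumes "good T" "\<And>\<alpha> x. \<alpha> \<in> alphabet T \<Longrightarrow> x \<in> cell T \<alpha> \<Longrightarrow> \<bar>G \<alpha> x - c \<alpha>\<bar> \<le> M \<alpha>"
    and "\<alpha> \<in> alphabet T" "x \<in> cell (rv T n) \<alpha>"
  shows "\<bar>bsum T n G \<alpha> x - cv T n c \<alpha>\<bar> \<le> cv T n M \<alpha>"
  using assms(3,4)
proof (induction n arbitrary: \<alpha> x)
  case 0 then show ?case using assms(2) by simp
next
  case (Suc n)
  have gn: "good (rv T n)" using good_rv[OF assms(1)] .
  note la = good_last(1,2)[OF gn, unfolded rv_alphabet[OF assms(1)]]
  note sc = step_cell[OF gn Suc.prems(2)[unfolded rv_Suc]]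
  show ?case
  proof (cases "\<alpha> = loser (rv T n)")
    case True
    note s = sc(2)[OF True]
    show ?thesis
      using Suc.IH[OF la(2) conjunct1[OF s]] Suc.IH[OF la(1) conjunct2[OF s]] True
      by (simp add: stepf_def loser_cv)
  next
    case False
    then show ?thesis using Suc.IH[OF Suc.prems(1) sc(1)[OF False]] by (simp add: stepf_def stepv_def)
  qed
qed

text \<open>Two points of one cell keep their difference along the orbit, so each visit contributes
  the same \<open>w (x - y)\<close>.\<close>

lemma bsum_modulus:
  assumes "good T" "\<And>\<alpha> x y. \<alpha> \<in> alphabet T \<Longrightarrow> x \<in> cell T \<alpha> \<Longrightarrow> y \<in> cell T \<alpha> \<Longrightarrow> \<bar>G \<alpha> x - G \<alpha> y\<bar> \<le> w (x - y)"
    and "\<alpha> \<in> alphabet T" "x \<in> cell (rv T n) \<alpha>" "y \<in> cell (rv T n) \<alpha>"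
  shows "\<bar>bsum T n G \<alpha> x - bsum T n G \<alpha> y\<bar> \<le> ret T n \<alpha> * w (x - y)"
  using assms(3-5)
proof (induction n arbitrary: \<alpha> x y)
  case 0 then show ?case using assms(2) by simp
next
  case (Suc n)
  have gn: "good (rv T n)" using good_rv[OF assms(1)] .
  note la = good_last(1,2)[OF gn, unfolded rv_alphabet[OF assms(1)]]
  note sx = step_cell[OF gn Suc.prems(2)[unfolded rv_Suc]] and sy = step_cell[OF gn Suc.prems(3)[unfolded rv_Suc]]
  show ?case
  proof (cases "\<alpha> = loser (rv T n)")
    case True
    note s = sx(2)[OF True] sy(2)[OF True]
    show ?thesis
      using Suc.IH[OF la(2) conjunct1[OF s(1)] conjunct1[OF s(2)]]
        Suc.IH[OF la(1) conjunct2[OF s(1)] conjunct2[OF s(2)]] True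
      by (simp add: stepf_def loser_cv algebra_simps)
  next
    case False
    then show ?thesis
      using Suc.IH[OF Suc.prems(1) sx(1)[OF False] sy(1)[OF False]] by (simp add: stepf_def stepv_def)
  qed
qed

text \<open>Collects the input of the estimates: \<open>G\<close> stands for \<phi> - \<chi> on the
  closed cells and \<open>G'\<close> for its derivative. One bound \<open>M\<close> serves all
  conditions, and the constants below are uniform over these data, so that the final estimate is
  linear in \<open>M\<close>.\<close>

definition coboundary_data ::
    "'a iem \<Rightarrow> real \<Rightarrow> real \<Rightarrow> (real \<Rightarrow> real) \<Rightarrow> ('a \<Rightarrow> real \<Rightarrow> real) \<Rightarrow> ('a \<Rightarrow> real \<Rightarrow> real) \<Rightarrow> bool" where
  "coboundary_data T \<rho> M \<psi> G G' \<longleftrightarrow>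
     continuous_on {left_end T..right_end T} \<psi> \<and> (\<forall>x\<in>{left_end T..right_end T}. \<bar>\<psi> x\<bar> \<le> M) \<and>
     (\<forall>\<alpha>\<in>alphabet T. \<forall>x\<in>cell T \<alpha>. G \<alpha> x = \<psi> (x + shift T \<alpha>) - \<psi> x \<and>
        (G \<alpha> has_real_derivative G' \<alpha> x) (at x within cell T \<alpha>) \<and> \<bar>G' \<alpha> x\<bar> \<le> M \<and>
        (\<forall>y\<in>cell T \<alpha>. \<bar>G' \<alpha> x - G' \<alpha> y\<bar> \<le> M * \<bar>x - y\<bar> powr \<rho>))"

lemma cell_subset:
  assumes "good T" "\<alpha> \<in> alphabet T" "x \<in> cell T \<alpha>"
  shows "x \<in> {left_end T..right_end T}" "x + shift T \<alpha> \<in> {left_end T..right_end T}"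
  using assms(3) interval_partition_left[OF good_facts(4)[OF assms(1)] assms(2)]
    interval_partition_right[OF good_facts(4)[OF assms(1)] assms(2)]
    interval_partition_left[OF good_facts(5)[OF assms(1)] assms(2)]
    interval_partition_right[OF good_facts(5)[OF assms(1)] assms(2)] good_facts(3)[OF assms(1)] assms(2)
  by (auto simp: cell_def shift_def)

lemma cell_diam: "x \<in> cell T \<alpha> \<Longrightarrow> y \<in> cell T \<alpha> \<Longrightarrow> \<bar>x - y\<bar> \<le> width T \<alpha>"
  by (auto simp: cell_def)

section \<open>Averages of the derivative at an intermediate level\<close>

context roth begin

lemma wd_le_len: "\<alpha> \<in> A \<Longrightarrow> wd k \<alpha> \<le> len k"
  unfolding len_sum using member_le_sum[of \<alpha> A "wd k"] wd_pos finite_A by (simp add: less_imp_le)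

text \<open>Take the greatest \<open>j\<close> with \<open>N j \<le> N k powr \<eta>\<close>; it
  exists because \<open>N 0 = 1\<close>. If it is not \<open>k\<close>, level j + 1 exceeds the
  threshold, and the Roth condition bounds N(j + 1) by a constant times the square of N(j).\<close>

lemma choose_level:
  assumes "0 < \<eta>" "\<eta> < 1"
  obtains C where "C \<ge> 1" "\<And>k. \<exists>j\<le>k. N j \<le> N k powr \<eta> \<and> N k powr \<eta> \<le> C * (N j)\<^sup>2"
proof -
  obtain B where B: "B > 0" "\<And>k. b k \<le> B * N k powr 1" using roth_b[of 1] by auto
  define C where "C = max B 1"
  have "\<exists>j\<le>k. N j \<le> N k powr \<eta> \<and> N k powr \<eta> \<le> C * (N j)\<^sup>2" for k
  proof -
    have "N 0 = 1"
      using N_tr[of 0] A_nonempty by (simp add: tr_refl image_constant_conv)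
    then have "N 0 \<le> N k powr \<eta>" using assms(1) by (simp add: ge_one_powr_ge_zero N_ge_1)
    then have ex: "\<exists>j. j \<le> k \<and> N j \<le> N k powr \<eta>" by (intro exI[of _ 0]) simp
    define j where "j = (GREATEST j. j \<le> k \<and> N j \<le> N k powr \<eta>)"
    have j: "j \<le> k" "N j \<le> N k powr \<eta>"
      using GreatestI_ex_nat[of "\<lambda>j. j \<le> k \<and> N j \<le> N k powr \<eta>" k] ex by (auto simp: j_def)
    have sq: "N j \<le> (N j)\<^sup>2" using N_ge_1[of j] by (simp add: power2_eq_square)
    have "N k powr \<eta> \<le> C * (N j)\<^sup>2"
    proof (cases "j = k")
      case True
      have "N k powr \<eta> \<le> N k powr 1" using N_ge_1[of k] assms by (intro powr_mono) auto
      also have "\<dots> = N j" using True N_pos[of k] by simp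
      also have "\<dots> \<le> (N j)\<^sup>2" by (rule sq)
      also have "\<dots> \<le> C * (N j)\<^sup>2" using mult_right_mono[of 1 C "(N j)\<^sup>2"] by (simp add: C_def)
      finally show ?thesis .
    next
      case False
      then have "Suc j \<le> k" using j by simp
      have "N k powr \<eta> \<le> N (Suc j)"
      proof (rule ccontr)
        assume "\<not> ?thesis"
        then have "Suc j \<le> j"
          unfolding j_def using \<open>Suc j \<le> k\<close>
          by (intro Greatest_le_nat[where b = k]) (auto simp: j_def)
        then show False by simp
      qed
      also have "\<dots> \<le> b j * N j" by (rule N_Suc_le)
      also have "\<dots> \<le> (B * N j) * N j" using B(2)[of j] N_pos[of j] by (intro mult_right_mono) auto
      also have "\<dots> \<le> C * (N j)\<^sup>2" by (auto simp: C_def power2_eq_square mult.assoc intro: mult_right_mono)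
      finally show ?thesis .
    qed
    with j show ?thesis by blast
  qed
  then show ?thesis by (intro that[of C]) (auto simp: C_def)
qed

lemma rv_interval: "{left_end (rv T n)..right_end (rv T n)} \<subseteq> {left_end T..right_end T}"
proof -
  have "right_end (rv T n) \<le> right_end T"
  proof (induction n)
    case (Suc n)
    then show ?case using step_base[OF good_rv[OF good_T, of n]] by simp
  qed simp
  then show ?thesis by (auto simp: rv_left_end[OF good_T])
qed

lemma coboundary_dataD:
  assumes "coboundary_data T \<rho> M \<psi> G G'"
  shows "continuous_on {left_end T..right_end T} \<psi>" "0 \<le> M"
    "\<And>x. x \<in> {left_end T..right_end T} \<Longrightarrow> \<bar>\<psi> x\<bar> \<le> M"
    "\<And>n \<alpha> x. \<alpha> \<in> A \<Longrightarrow> x \<in> cell (rv T n) \<alpha> \<Longrightarrow> bsum T n G \<alpha> x = \<psi> (x + shift (rv T n) \<alpha>) - \<psi> x"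
    "\<And>n \<alpha> x. \<alpha> \<in> A \<Longrightarrow> x \<in> cell (rv T n) \<alpha> \<Longrightarrow>
       (bsum T n G \<alpha> has_real_derivative bsum T n G' \<alpha> x) (at x within cell (rv T n) \<alpha>)"
    "\<And>\<alpha> x. \<alpha> \<in> A \<Longrightarrow> x \<in> cell T \<alpha> \<Longrightarrow> \<bar>G' \<alpha> x\<bar> \<le> M"
    "\<And>\<alpha> x y. \<alpha> \<in> A \<Longrightarrow> x \<in> cell T \<alpha> \<Longrightarrow> y \<in> cell T \<alpha> \<Longrightarrow> \<bar>G' \<alpha> x - G' \<alpha> y\<bar> \<le> M * \<bar>x - y\<bar> powr \<rho>"
proof -
  note cd = assms[unfolded coboundary_data_def]
  show "continuous_on {left_end T..right_end T} \<psi>" and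
    psi: "\<And>x. x \<in> {left_end T..right_end T} \<Longrightarrow> \<bar>\<psi> x\<bar> \<le> M" and
    "\<And>\<alpha> x. \<alpha> \<in> A \<Longrightarrow> x \<in> cell T \<alpha> \<Longrightarrow> \<bar>G' \<alpha> x\<bar> \<le> M" and
    "\<And>\<alpha> x y. \<alpha> \<in> A \<Longrightarrow> x \<in> cell T \<alpha> \<Longrightarrow> y \<in> cell T \<alpha> \<Longrightarrow> \<bar>G' \<alpha> x - G' \<alpha> y\<bar> \<le> M * \<bar>x - y\<bar> powr \<rho>"
    using cd by blast+
  have "left_end T \<in> {left_end T..right_end T}" using good_facts(7)[OF good_T] by simp
  from psi[OF this] show "0 \<le> M" by linarith
  show "\<And>n \<alpha> x. \<alpha> \<in> A \<Longrightarrow> x \<in> cell (rv T n) \<alpha> \<Longrightarrow> bsum T n G \<alpha> x = \<psi> (x + shift (rv T n) \<alpha>) - \<psi> x"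
    using cd by (intro bsum_coboundary good_T) auto
  show "\<And>n \<alpha> x. \<alpha> \<in> A \<Longrightarrow> x \<in> cell (rv T n) \<alpha> \<Longrightarrow>
       (bsum T n G \<alpha> has_real_derivative bsum T n G' \<alpha> x) (at x within cell (rv T n) \<alpha>)"
    using cd by (intro bsum_deriv good_T) auto
qed

lemma mean_value_coboundary:
  assumes cd: "coboundary_data T \<rho> M \<psi> G G'" and rho: "0 < \<rho>"
  obtains c where "c \<in> vecs A" "ip A c (wd j) = 0" "\<And>\<alpha>. \<alpha> \<in> A \<Longrightarrow> \<bar>c \<alpha>\<bar> \<le> N j * M"
    "\<And>\<alpha> x. \<alpha> \<in> A \<Longrightarrow> x \<in> cell (lev j) \<alpha> \<Longrightarrow> \<bar>bsum T (ns j) G' \<alpha> x - c \<alpha>\<bar> \<le> N j * (M * len j powr \<rho>)"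
proof -
  note D = coboundary_dataD[OF cd]
  define l where "l \<alpha> = top_left (lev j) \<alpha>" for \<alpha>
  define F where "F = bsum T (ns j) G"
  define c where "c \<alpha> = (if \<alpha> \<in> A then (F \<alpha> (l \<alpha> + wd j \<alpha>) - F \<alpha> (l \<alpha>)) / wd j \<alpha> else 0)" for \<alpha>
  have cell: "cell (lev j) \<alpha> = {l \<alpha>..l \<alpha> + wd j \<alpha>}" for \<alpha> by (simp add: cell_def l_def wd_def)
  have ret: "ret T (ns j) \<alpha> \<le> N j" if "\<alpha> \<in> A" for \<alpha>
    using tr_one_le[of 0 j \<alpha>] that by (simp add: tr_def lev_0 N_def)
  have ret0: "0 \<le> ret T (ns j) \<alpha>" if "\<alpha> \<in> A" for \<alpha> using ret_ge_1[OF good_T that, of "ns j"] by simp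
  have mv: "\<exists>\<xi>\<in>cell (lev j) \<alpha>. c \<alpha> = bsum T (ns j) G' \<alpha> \<xi>" if a: "\<alpha> \<in> A" for \<alpha>
  proof -
    have w: "0 < wd j \<alpha>" using wd_pos[OF a] .
    have "\<exists>\<xi>\<in>{l \<alpha>..l \<alpha> + wd j \<alpha>}. F \<alpha> (l \<alpha> + wd j \<alpha>) - F \<alpha> (l \<alpha>) =
        (*) (bsum T (ns j) G' \<alpha> \<xi>) (l \<alpha> + wd j \<alpha> - l \<alpha>)"
    proof (rule mvt_very_simple)
      fix \<xi> assume "l \<alpha> \<le> \<xi>" "\<xi> \<le> l \<alpha> + wd j \<alpha>"
      then have "\<xi> \<in> cell (lev j) \<alpha>" by (simp add: cell)
      then show "(F \<alpha> has_derivative (*) (bsum T (ns j) G' \<alpha> \<xi>)) (at \<xi> within {l \<alpha>..l \<alpha> + wd j \<alpha>})"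
        using D(5)[OF a, of \<xi> "ns j"] unfolding F_def cell[symmetric] has_field_derivative_def by (simp add: lev_def)
    qed (use w in simp)
    then show ?thesis using a w unfolding cell c_def by auto
  qed
  show ?thesis
  proof (rule that[of c])
    show "c \<in> vecs A" by (auto simp: vecs_def c_def)
    show "\<bar>c \<alpha>\<bar> \<le> N j * M" if a: "\<alpha> \<in> A" for \<alpha>
    proof -
      obtain \<xi> where xi: "\<xi> \<in> cell (lev j) \<alpha>" "c \<alpha> = bsum T (ns j) G' \<alpha> \<xi>" using mv[OF a] by blast
      have "\<bar>bsum T (ns j) G' \<alpha> \<xi> - cv T (ns j) 0 \<alpha>\<bar> \<le> cv T (ns j) (\<lambda>_. M) \<alpha>"
        using xi(1) D(6) by (intro bsum_approx[OF good_T] a) (auto simp: lev_def)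
      also have "\<dots> = M * ret T (ns j) \<alpha>" using tr_const[of 0 j M \<alpha>] by (simp add: tr_def lev_0)
      also have "\<dots> \<le> M * N j" using ret[OF a] D(2) by (intro mult_left_mono) auto
      finally show ?thesis using xi(2) by (simp add: cv_0 mult.commute)
    qed
    show "\<bar>bsum T (ns j) G' \<alpha> x - c \<alpha>\<bar> \<le> N j * (M * len j powr \<rho>)" if a: "\<alpha> \<in> A" and x: "x \<in> cell (lev j) \<alpha>" for \<alpha> x
    proof -
      obtain \<xi> where xi: "\<xi> \<in> cell (lev j) \<alpha>" "c \<alpha> = bsum T (ns j) G' \<alpha> \<xi>" using mv[OF a] by blast
      have "\<bar>bsum T (ns j) G' \<alpha> x - c \<alpha>\<bar> \<le> ret T (ns j) \<alpha> * (M * \<bar>x - \<xi>\<bar> powr \<rho>)"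
        unfolding xi(2) using x xi(1) D(7)
        by (intro bsum_modulus[OF good_T, where w = "\<lambda>t. M * \<bar>t\<bar> powr \<rho>"] a) (auto simp: lev_def)
      also have "\<dots> \<le> N j * (M * len j powr \<rho>)"
      proof -
        have "\<bar>x - \<xi>\<bar> \<le> len j"
          using cell_diam[OF x xi(1)] wd_le_len[OF a, of j] by (simp add: wd_def)
        then have "\<bar>x - \<xi>\<bar> powr \<rho> \<le> len j powr \<rho>" using rho by (intro powr_mono2) auto
        then show ?thesis using ret[OF a] ret0[OF a] D(2) N_pos[of j]
          by (intro mult_mono mult_left_mono) auto
      qed
      finally show ?thesis .
    qed
    have "ip A c (wd j) = (\<Sum>\<alpha>\<in>A. F \<alpha> (l \<alpha> + wd j \<alpha>) - F \<alpha> (l \<alpha>))"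
      unfolding ip_def using wd_pos[of _ j] by (intro sum.cong) (auto simp: c_def)
    also have "\<dots> = (\<Sum>\<alpha>\<in>A. (\<psi> (bot_left (lev j) \<alpha> + width (lev j) \<alpha>) - \<psi> (bot_left (lev j) \<alpha>)) -
        (\<psi> (top_left (lev j) \<alpha> + width (lev j) \<alpha>) - \<psi> (top_left (lev j) \<alpha>)))"
    proof (intro sum.cong refl)
      fix \<alpha> assume a: "\<alpha> \<in> A"
      have "l \<alpha> \<in> cell (rv T (ns j)) \<alpha>" "l \<alpha> + wd j \<alpha> \<in> cell (rv T (ns j)) \<alpha>"
        using cell[of \<alpha>] wd_pos[OF a, of j] by (auto simp: lev_def)
      from D(4)[OF a this(1)] D(4)[OF a this(2)]
      show "F \<alpha> (l \<alpha> + wd j \<alpha>) - F \<alpha> (l \<alpha>) =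
        (\<psi> (bot_left (lev j) \<alpha> + width (lev j) \<alpha>) - \<psi> (bot_left (lev j) \<alpha>)) -
        (\<psi> (top_left (lev j) \<alpha> + width (lev j) \<alpha>) - \<psi> (top_left (lev j) \<alpha>))"
        by (simp add: F_def l_def wd_def lev_def shift_def algebra_simps)
    qed
    also have "\<dots> = 0"
      unfolding sum_subtractf
      using interval_partition_telescope[where h = \<psi>, OF good_facts(1)[OF good_lev[of j]] good_facts(4,3)[OF good_lev[of j]]]
        interval_partition_telescope[where h = \<psi>, OF good_facts(1)[OF good_lev[of j]] good_facts(5,3)[OF good_lev[of j]]]
        good_facts(7)[OF good_lev[of j]]
      by (simp add: alphabet_lev sum_subtractf)
    finally show "ip A c (wd j) = 0" .
  qed
qed

end

section \<open>Decay of the cocycle part\<close>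

context roth begin

lemma len_bound:
  assumes "\<tau> > 0"
  obtains C where "C > 0" "\<And>k. len k \<le> C * N k powr (\<tau> - 1)"
proof -
  obtain B where B: "B > 0" "\<And>k. b k \<le> B * N k powr \<tau>" using roth_b[OF assms] by blast
  show ?thesis
  proof (rule that[of "B * len 0"])
    show "B * len 0 > 0" using B len_pos by simp
    fix k
    have "len k * N k \<le> (B * N k powr \<tau>) * len 0"
      using len_upper[of k] mult_right_mono[OF B(2)[of k], of "len 0"] len_pos[of 0] by linarith
    then have "len k \<le> (B * N k powr \<tau>) * len 0 / N k" using N_pos[of k] by (simp add: field_simps)
    also have "\<dots> = B * len 0 * N k powr (\<tau> - 1)" using N_pos[of k] by (simp add: powr_diff)
    finally show "len k \<le> B * len 0 * N k powr (\<tau> - 1)" .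
  qed
qed

text \<open>The means at level j are pulled back to level 0 by \<open>inverse_bound\<close>, then
  pushed to level k with the gain \<theta>; this costs the cube of \<open>N j\<close>. The
  deviations from the means are pushed from level j to level k, where \<open>quasi_mult\<close>
  keeps the loss at \<open>b j * N k\<close> and the factor \<open>len j powr \<rho>\<close> yields
  the gain.\<close>

lemma deriv_bound:
  assumes rho: "0 < \<rho>" "\<rho> \<le> 1"
  obtains C where "C > 0" "\<And>M \<psi> G G' k \<alpha> x. coboundary_data T \<rho> M \<psi> G G' \<Longrightarrow> \<alpha> \<in> A \<Longrightarrow> x \<in> cell (lev k) \<alpha> \<Longrightarrow>
    \<bar>bsum T (ns k) G' \<alpha> x\<bar> \<le> C * N k powr (1 - \<rho> * min \<theta> 1 / 24) * M"
proof -
  define t where "t = min \<theta> 1"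
  have t: "0 < t" "t \<le> 1" "t \<le> \<theta>" using theta_pos by (auto simp: t_def)
  \<comment> \<open>The gain of the deviations: N_j^(-\<rho>/2), where the square of N_j is at least
    a constant times N_k^(t/6).\<close>
  define \<delta> where "\<delta> = \<rho> * t / 24"
  have rt: "\<rho> * t \<le> t" "0 < \<rho> * t" using rho t by (auto simp: mult_le_cancel_right2)
  obtain K where K: "K > 0" "\<And>k \<xi> M \<alpha>. \<xi> \<in> vecs A \<Longrightarrow> ip A \<xi> (wd 0) = 0 \<Longrightarrow>
    (\<And>\<alpha>. \<alpha> \<in> A \<Longrightarrow> \<bar>\<xi> \<alpha>\<bar> \<le> M) \<Longrightarrow> \<alpha> \<in> A \<Longrightarrow> \<bar>tr 0 k \<xi> \<alpha>\<bar> \<le> K * N k powr (1 - \<theta>) * M"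
    using mean_zero_bound by blast
  obtain B where B: "B > 0" "\<And>k. b k \<le> B * N k powr (\<rho> / 4)" using roth_b[of "\<rho> / 4"] rho by auto
  obtain L where L: "L > 0" "\<And>k. len k \<le> L * N k powr (1 / 4 - 1)" using len_bound[of "1/4"] by auto
  \<comment> \<open>With the exponent t/6 the cube of N_j costs N_k^(t/2), at most half of the gain
    \<theta>.\<close>
  obtain Q where Q: "Q \<ge> 1" "\<And>k. \<exists>j\<le>k. N j \<le> N k powr (t / 6) \<and> N k powr (t / 6) \<le> Q * (N j)\<^sup>2"
    using choose_level[of "t / 6"] t by auto
  define C1 where "C1 = K * (6 * d\<^sup>2)"
  define C2 where "C2 = B * L powr \<rho> * Q powr (\<rho> / 4)"
  have C: "0 < C1" "0 < C2" using K B L Q two_le_d by (auto simp: C1_def C2_def)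
  show ?thesis
  proof (rule that[of "C1 + C2"])
    show "C1 + C2 > 0" using C by simp
    fix M \<psi> G G' k \<alpha> x
    assume cd: "coboundary_data T \<rho> M \<psi> G G'" and a: "\<alpha> \<in> A" and x: "x \<in> cell (lev k) \<alpha>"
    have M: "0 \<le> M" using coboundary_dataD(2)[OF cd] .
    obtain j where j: "j \<le> k" "N j \<le> N k powr (t / 6)" "N k powr (t / 6) \<le> Q * (N j)\<^sup>2" using Q(2) by blast
    obtain c where c: "c \<in> vecs A" "ip A c (wd j) = 0" "\<And>\<alpha>. \<alpha> \<in> A \<Longrightarrow> \<bar>c \<alpha>\<bar> \<le> N j * M"
      "\<And>\<alpha> x. \<alpha> \<in> A \<Longrightarrow> x \<in> cell (lev j) \<alpha> \<Longrightarrow> \<bar>bsum T (ns j) G' \<alpha> x - c \<alpha>\<bar> \<le> N j * (M * len j powr \<rho>)"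
      using mean_value_coboundary[OF cd rho(1)] by blast
    obtain \<xi> where xi: "\<xi> \<in> vecs A" "tr 0 j \<xi> = c" using cv_surj[OF good_T c(1), of "ns j"] by (auto simp: tr_def lev_0)
    have "ip A \<xi> (wd 0) = 0" using ip_tr_wd[of 0 j \<xi>] xi(2) c(2) by simp
    then have "\<bar>tr 0 k \<xi> \<alpha>\<bar> \<le> K * N k powr (1 - \<theta>) * (6 * d\<^sup>2 * (N j)\<^sup>2 * (N j * M))"
      using inverse_bound[OF xi(1), of j "N j * M"] xi(2) c(3) a by (intro K(2) xi) auto
    also have "\<dots> = C1 * (N k powr (1 - \<theta>) * (N j) ^ 3 * M)"
      by (simp add: C1_def power2_eq_square power3_eq_cube)
    also have "\<dots> \<le> C1 * (N k powr (1 - \<delta>) * M)"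
    proof -
      have "(N j) ^ 3 \<le> (N k powr (t / 6)) ^ 3" using j(2) N_pos[of j] by (intro power_mono) auto
      also have "\<dots> = N k powr (t / 2)" using N_pos[of k] by (simp add: powr_power)
      finally have "N k powr (1 - \<theta>) * (N j) ^ 3 \<le> N k powr (1 - \<theta>) * N k powr (t / 2)"
        by (intro mult_left_mono) auto
      also have "\<dots> = N k powr (1 - \<theta> + t / 2)" by (simp add: powr_add)
      also have "\<dots> \<le> N k powr (1 - \<delta>)"
        using t rt N_ge_1[of k] by (intro powr_mono) (auto simp: \<delta>_def)
      finally show ?thesis using C M by (intro mult_left_mono mult_right_mono) auto
    qed
    finally have 1: "\<bar>tr j k c \<alpha>\<bar> \<le> C1 * (N k powr (1 - \<delta>) * M)"
      using tr_tr[of 0 j k \<xi>] j(1) xi(2) by simp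
    define H where "H = bsum T (ns j) G'"
    have Hk: "bsum T (ns k) G' = bsum (lev j) (ns k - ns j) H"
      using bsum_add[of T "ns j" "ns k - ns j" G'] ns_mono[OF j(1)] by (simp add: H_def lev_def)
    have lk: "lev k = rv (lev j) (ns k - ns j)" using ns_mono[OF j(1)] by (simp add: lev_def rv_rv)
    have "\<bar>bsum T (ns k) G' \<alpha> x - tr j k c \<alpha>\<bar> \<le> tr j k (\<lambda>_. N j * (M * len j powr \<rho>)) \<alpha>"
      unfolding Hk tr_def using c(4) a x unfolding lk H_def by (intro bsum_approx[OF good_lev[of j]]) (auto simp: alphabet_lev)
    also have "\<dots> \<le> B_norm T (ns j) (ns k) * (N j * (M * len j powr \<rho>))"
      using tr_const[of j k "N j * (M * len j powr \<rho>)" \<alpha>] tr_one_le[OF j(1) a] M N_pos[of j]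
      by (simp add: mult.commute mult_left_mono)
    also have "\<dots> = (B_norm T (ns j) (ns k) * N j) * (M * len j powr \<rho>)" by simp
    also have "\<dots> \<le> (b j * N k) * (M * len j powr \<rho>)"
      using quasi_mult[OF j(1)] M by (intro mult_right_mono) auto
    also have "\<dots> \<le> ((B * N j powr (\<rho> / 4)) * N k) * (M * (L powr \<rho> * N j powr (- (3 * \<rho> / 4))))"
    proof -
      have "len j powr \<rho> \<le> (L * N j powr (1 / 4 - 1)) powr \<rho>"
        using L(2)[of j] len_pos[of j] rho by (intro powr_mono2) auto
      also have "\<dots> = L powr \<rho> * N j powr (- (3 * \<rho> / 4))" using L by (simp add: powr_mult powr_powr mult.commute)
      finally show ?thesis
        using B(2)[of j] B(1) M N_pos[of k] one_le_b[of j] by (intro mult_mono mult_left_mono mult_right_mono) auto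
    qed
    also have "\<dots> = B * L powr \<rho> * (N j powr (\<rho> / 4) * N j powr (- (3 * \<rho> / 4))) * (N k * M)" by simp
    also have "N j powr (\<rho> / 4) * N j powr (- (3 * \<rho> / 4)) = ((N j)\<^sup>2) powr (- (\<rho> / 4))"
      using N_pos[of j] by (simp add: powr_add[symmetric] powr_realpow[symmetric] powr_powr del: powr_realpow powr_numeral)
    also have "\<dots> \<le> (N k powr (t / 6) / Q) powr (- (\<rho> / 4))"
      using j(3) Q(1) rho N_pos[of k] N_pos[of j] by (intro powr_mono2') (auto simp: divide_le_eq mult.commute)
    also have "(N k powr (t / 6) / Q) powr (- (\<rho> / 4)) = Q powr (\<rho> / 4) * N k powr (- \<delta>)"
      using Q N_pos[of k] by (simp add: powr_divide powr_powr \<delta>_def powr_minus_divide mult.commute)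
    finally have "\<bar>bsum T (ns k) G' \<alpha> x - tr j k c \<alpha>\<bar> \<le> B * L powr \<rho> * (Q powr (\<rho> / 4) * N k powr (- \<delta>)) * (N k * M)"
      using B L M N_pos[of k] by (simp add: mult_left_mono mult_right_mono)
    also have "\<dots> = C2 * (N k powr (1 - \<delta>) * M)"
      using N_pos[of k] by (simp add: C2_def powr_diff powr_minus_divide)
    finally have "\<bar>bsum T (ns k) G' \<alpha> x\<bar> \<le> C1 * (N k powr (1 - \<delta>) * M) + C2 * (N k powr (1 - \<delta>) * M)"
      using 1 by linarith
    then show "\<bar>bsum T (ns k) G' \<alpha> x\<bar> \<le> (C1 + C2) * N k powr (1 - \<rho> * min \<theta> 1 / 24) * M"
      by (simp add: \<delta>_def t_def algebra_simps)
  qed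
qed

lemma N_Suc_square:
  obtains C where "C \<ge> 1" "\<And>k. N (Suc k) \<le> C * (N k)\<^sup>2"
proof -
  obtain B where B: "B > 0" "\<And>k. b k \<le> B * N k powr 1" using roth_b[of 1] by auto
  show ?thesis
  proof (rule that[of "max B 1"])
    fix k
    have "N (Suc k) \<le> b k * N k" by (rule N_Suc_le)
    also have "\<dots> \<le> (max B 1 * N k) * N k"
    proof (intro mult_right_mono)
      have "b k \<le> B * N k" using B(2)[of k] N_pos[of k] by simp
      also have "\<dots> \<le> max B 1 * N k" using N_pos[of k] by (intro mult_right_mono) auto
      finally show "b k \<le> max B 1 * N k" .
    qed (use N_pos[of k] in simp)
    finally show "N (Suc k) \<le> max B 1 * (N k)\<^sup>2" by (simp add: power2_eq_square)
  qed simp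
qed

lemma b_square:
  assumes "\<tau> > 0"
  obtains C where "C > 0" "\<And>k. (b k)\<^sup>2 \<le> C * N k powr \<tau>"
proof -
  obtain B where B: "B > 0" "\<And>k. b k \<le> B * N k powr (\<tau> / 2)" using roth_b[of "\<tau> / 2"] assms by auto
  show ?thesis
  proof (rule that[of "B\<^sup>2"])
    fix k
    have "(b k)\<^sup>2 \<le> (B * N k powr (\<tau> / 2))\<^sup>2" using B(2)[of k] one_le_b[of k] by (intro power_mono) auto
    then show "(b k)\<^sup>2 \<le> B\<^sup>2 * N k powr \<tau>" using N_pos[of k] by (simp add: power_mult_distrib powr_power)
  qed (use B in simp)
qed

text \<open>The stable space of level k enters as the image of that of level 0, which makes pulling
  back immediate; \<open>tr_Gs\<close> connects it with condition (c).\<close>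

lemma Gs_level: "tr 0 k ` Gs \<subseteq> vecs A" "fvec.subspace (tr 0 k ` Gs)"
proof -
  show "tr 0 k ` Gs \<subseteq> vecs A" using Gs_vecs tr_vecs by blast
  have add: "tr 0 k (x + y) = tr 0 k x + tr 0 k y" for x y unfolding tr_def by (rule cv_plus)
  show "fvec.subspace (tr 0 k ` Gs)"
    unfolding fvec.subspace_def
  proof (intro conjI ballI allI)
    show "0 \<in> tr 0 k ` Gs"
      using fvec.subspace_0[OF subspace_Gs] by (intro image_eqI[of _ _ 0]) (auto simp: tr_def cv_0)
    fix x assume x: "x \<in> tr 0 k ` Gs"
    then obtain x' where x': "x' \<in> Gs" "x = tr 0 k x'" by blast
    show "fscale c x \<in> tr 0 k ` Gs" for c
      using fvec.subspace_scale[OF subspace_Gs x'(1), of c] x' by (intro image_eqI[of _ _ "fscale c x'"]) (auto simp: tr_scale)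
    fix y assume "y \<in> tr 0 k ` Gs"
    then obtain y' where y': "y' \<in> Gs" "y = tr 0 k y'" by blast
    show "x + y \<in> tr 0 k ` Gs"
      using fvec.subspace_add[OF subspace_Gs x'(1) y'(1)] x' y' by (intro image_eqI[of _ _ "x' + y'"]) (auto simp: add)
  qed
qed

text \<open>
  Pairing the sequence with a vector \<open>\<mu>\<close> orthogonal to the stable space and transporting \<open>\<mu>\<close> to
  infinity, where the sequence vanishes, leaves only the errors. Taking for \<open>\<mu>\<close> the orthogonal
  component itself bounds it.
\<close>

lemma transverse_decay:
  assumes del: "0 < \<delta>"
  obtains C where "C > 0" "\<And>M c k \<mu> \<alpha>. 0 \<le> M \<Longrightarrow> (\<And>\<alpha>. \<alpha> \<in> A \<Longrightarrow> (\<lambda>k. c k \<alpha>) \<longlonglongrightarrow> 0) \<Longrightarrow>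
    (\<And>k \<alpha>. \<alpha> \<in> A \<Longrightarrow> \<bar>c (Suc k) \<alpha> - tr k (Suc k) (c k) \<alpha>\<bar> \<le> M * N k powr (- \<delta>)) \<Longrightarrow>
    \<mu> \<in> vecs A \<Longrightarrow> (\<And>\<eta>. \<eta> \<in> tr 0 k ` Gs \<Longrightarrow> ip A \<mu> \<eta> = 0) \<Longrightarrow> c k - \<mu> \<in> tr 0 k ` Gs \<Longrightarrow> \<alpha> \<in> A \<Longrightarrow>
    \<bar>\<mu> \<alpha>\<bar> \<le> C * M * N k powr (- (\<delta> / 2))"
proof -
  obtain K where K: "K > 0" "\<And>j k \<xi> M \<alpha>. j \<le> k \<Longrightarrow> \<xi> \<in> Gam_s (lev j) \<Longrightarrow>
    (\<And>\<alpha>. \<alpha> \<in> A \<Longrightarrow> \<bar>\<xi> \<alpha>\<bar> \<le> M) \<Longrightarrow> \<alpha> \<in> A \<Longrightarrow> \<bar>tr j k \<xi> \<alpha>\<bar> \<le> K * N k powr (\<delta> / 8) * M"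
    using stable_bound[of "\<delta> / 8"] del by auto
  obtain B where B: "B > 0" "\<And>k. (b k)\<^sup>2 \<le> B * N k powr (\<delta> / 8)" using b_square[of "\<delta> / 8"] del by auto
  obtain Q where Q: "Q \<ge> 1" "\<And>k. N (Suc k) \<le> Q * (N k)\<^sup>2" using N_Suc_square by blast
  define S1 where "S1 = 2 / (1 - 2 powr (- (\<delta> / 4)))"
  define S2 where "S2 = 2 / (1 - 2 powr (- (\<delta> / 2)))"
  have q: "2 powr (- (\<delta> / 4)) < (1::real)" "2 powr (- (\<delta> / 2)) < (1::real)" using del by (simp_all add: powr_less_one)
  have S: "0 < S1" "0 < S2" using q by (auto simp: S1_def S2_def)
  define E where "E = d * B * (K * (2 * d))"
  have E: "0 < E" using two_le_d B K by (simp add: E_def)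
  define C1 where "C1 = 2 * (d + E * S1)"
  have C1: "0 < C1" using two_le_d E S by (simp add: C1_def add_pos_pos)
  define C where "C = d * C1 * Q powr (\<delta> / 4) * S2"
  show ?thesis
  proof (rule that[of C])
    show "C > 0" using two_le_d C1 S Q by (simp add: C_def)
    fix M c k \<mu> \<alpha>
    assume M: "0 \<le> (M::real)" and lim: "\<And>\<alpha>. \<alpha> \<in> A \<Longrightarrow> (\<lambda>k. c k \<alpha>) \<longlonglongrightarrow> 0"
      and err: "\<And>k \<alpha>. \<alpha> \<in> A \<Longrightarrow> \<bar>c (Suc k) \<alpha> - tr k (Suc k) (c k) \<alpha>\<bar> \<le> M * N k powr (- \<delta>)"
      and mu: "\<mu> \<in> vecs A" "\<And>\<eta>. \<eta> \<in> tr 0 k ` Gs \<Longrightarrow> ip A \<mu> \<eta> = 0" "c k - \<mu> \<in> tr 0 k ` Gs" and a: "\<alpha> \<in> A"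
    define e where "e i = c (Suc i) - tr i (Suc i) (c i)" for i
    have e: "\<bar>e i \<alpha>\<bar> \<le> M * N i powr (- \<delta>)" if "\<alpha> \<in> A" for i \<alpha> using err[OF that] by (simp add: e_def)
    define m where "m = vnorm A \<mu>"
    have m: "\<bar>\<mu> \<alpha>\<bar> \<le> m" if "\<alpha> \<in> A" for \<alpha> unfolding m_def using vnorm_ge[OF finite_A that] .
    have m0: "0 \<le> m" using m[OF a] by linarith
    have dual: "disp (lev k) \<mu> \<in> tr 0 k ` Gs" "\<exists>P. \<forall>J\<ge>k. \<forall>\<alpha>\<in>A. \<bar>cotr k J \<mu> \<alpha>\<bar> \<le> P"
      using dual_stable[OF mu(1), of k] mu(2) by auto
    have sm: "(\<Sum>\<alpha>\<in>A. \<bar>\<mu> \<alpha>\<bar>) \<le> d * m"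
      using sum_mono[of A "\<lambda>\<alpha>. \<bar>\<mu> \<alpha>\<bar>" "\<lambda>_. m"] m by (simp add: d_def)
    have dm: "\<bar>disp (lev k) \<mu> \<alpha>\<bar> \<le> 2 * d * m" for \<alpha>
    proof -
      have "psum_bounded (lev k) \<mu> (\<Sum>\<alpha>\<in>A. \<bar>\<mu> \<alpha>\<bar>)" using psum_bounded_sum[OF good_lev[of k], of \<mu>] by (simp add: alphabet_lev)
      then have "\<bar>psum A (bot_left (lev k)) (bot_left (lev k) \<alpha>) \<mu>\<bar> \<le> d * m"
        "\<bar>psum A (top_left (lev k)) (top_left (lev k) \<alpha>) \<mu>\<bar> \<le> d * m"
        using sm unfolding psum_bounded_def alphabet_lev by (meson order_trans)+
      then show ?thesis using m0 two_le_d unfolding disp_def alphabet_lev by (auto simp: algebra_simps)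
    qed
    \<comment> \<open>A bound linear in the size \<open>m\<close> of \<mu>, with constants
      independent of \<mu>. The displacement of \<mu> is stable, so condition (c) lets it grow by
      N^(\<delta>/8) only; the squares of \<open>b\<close> cost another \<delta>/8.\<close>
    have cot: "\<bar>cotr k J \<mu> \<alpha>\<bar> \<le> C1 * m * N J powr (\<delta> / 4)" if J: "k \<le> J" and al: "\<alpha> \<in> A" for J \<alpha>
    proof -
      have "\<bar>cotr k J \<mu> \<alpha>\<bar> \<le> 2 * ((\<Sum>\<alpha>\<in>A. \<bar>\<mu> \<alpha>\<bar>) + (\<Sum>i\<in>{k..<J}. d * (b i)\<^sup>2 * (K * N i powr (\<delta> / 8) * (2 * d * m))))"
      proof (rule cotr_bound[OF J _ al])
        fix i \<alpha> assume "k \<le> i" "i < J" "\<alpha> \<in> A"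
        then show "\<bar>tr k i (disp (lev k) \<mu>) \<alpha>\<bar> \<le> K * N i powr (\<delta> / 8) * (2 * d * m)"
          using dual(1) tr_Gs dm by (intro K(2)) auto
      qed
      also have "(\<Sum>i\<in>{k..<J}. d * (b i)\<^sup>2 * (K * N i powr (\<delta> / 8) * (2 * d * m))) \<le>
          (\<Sum>i\<in>{k..<J}. E * m * N i powr (\<delta> / 4))"
      proof (intro sum_mono)
        fix i
        have "d * (b i)\<^sup>2 * (K * N i powr (\<delta> / 8) * (2 * d * m)) \<le> d * (B * N i powr (\<delta> / 8)) * (K * N i powr (\<delta> / 8) * (2 * d * m))"
          using B(2)[of i] two_le_d K m0 by (intro mult_right_mono mult_left_mono) auto
        also have "\<dots> = E * m * (N i powr (\<delta> / 8) * N i powr (\<delta> / 8))" by (simp add: E_def)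
        finally show "d * (b i)\<^sup>2 * (K * N i powr (\<delta> / 8) * (2 * d * m)) \<le> E * m * N i powr (\<delta> / 4)"
          by (simp add: powr_add[symmetric])
      qed
      also have "\<dots> \<le> E * m * (\<Sum>i<J. N i powr (\<delta> / 4))"
        unfolding sum_distrib_left using E m0 by (intro sum_mono2) auto
      also have "\<dots> \<le> E * m * (S1 * N J powr (\<delta> / 4))"
        using sum_pos_powr[of "\<delta> / 4" J] del E m0 by (intro mult_left_mono) (auto simp: S1_def)
      also have "(\<Sum>\<alpha>\<in>A. \<bar>\<mu> \<alpha>\<bar>) \<le> d * m * N J powr (\<delta> / 4)"
      proof -
        have "1 \<le> N J powr (\<delta> / 4)" using del N_ge_1[of J] by (simp add: ge_one_powr_ge_zero)
        then have "d * m * 1 \<le> d * m * N J powr (\<delta> / 4)" using two_le_d m0 by (intro mult_left_mono) auto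
        then show ?thesis using sm by simp
      qed
      finally show ?thesis by (simp add: C1_def algebra_simps)
    qed
    \<comment> \<open>Without errors the pairing would be constant along the levels, so only the
      pairings with the errors accumulate.\<close>
    have tele: "ip A \<mu> (c k) = ip A (cotr k J \<mu>) (c J) - (\<Sum>i\<in>{k..<J}. ip A (cotr k (Suc i) \<mu>) (e i))" if "k \<le> J" for J
      using that
    proof (induction J rule: dec_induct)
      case base
      show ?case by (simp add: cotr_def)
    next
      case (step J)
      have "ip A (cotr k (Suc J) \<mu>) (c (Suc J)) =
          ip A (cotr k (Suc J) \<mu>) (tr J (Suc J) (c J)) + ip A (cotr k (Suc J) \<mu>) (e J)"
        by (simp add: e_def)
      also have "ip A (cotr k (Suc J) \<mu>) (tr J (Suc J) (c J)) = ip A (cotr k J \<mu>) (c J)"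
        using ip_tr_cotr[of J "Suc J" "c J" "cotr k J \<mu>"] cotr_cotr[of k J "Suc J" \<mu>] step by (simp add: ip_commute)
      finally show ?case using step by simp
    qed
    have sumb: "\<bar>\<Sum>i\<in>{k..<J}. ip A (cotr k (Suc i) \<mu>) (e i)\<bar> \<le> C * m * M * N k powr (- (\<delta> / 2))" for J
    proof -
      have "\<bar>\<Sum>i\<in>{k..<J}. ip A (cotr k (Suc i) \<mu>) (e i)\<bar> \<le> (\<Sum>i\<in>{k..<J}. \<bar>ip A (cotr k (Suc i) \<mu>) (e i)\<bar>)"
        by (rule sum_abs)
      also have "\<dots> \<le> (\<Sum>i\<in>{k..<J}. d * C1 * Q powr (\<delta> / 4) * m * M * N i powr (- (\<delta> / 2)))"
      proof (intro sum_mono)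
        fix i assume i: "i \<in> {k..<J}"
        have "\<bar>ip A (cotr k (Suc i) \<mu>) (e i)\<bar> \<le> d * ((C1 * m * N (Suc i) powr (\<delta> / 4)) * (M * N i powr (- \<delta>)))"
          unfolding d_def using i cot e by (intro ip_abs_le) auto
        \<comment> \<open>The dual vector sits one level further than the error. Since N(i + 1) is
          at most a constant times the square of N(i), its growth \<delta>/4 becomes \<delta>/2, and
          half of the decay of the error survives.\<close>
        also have "\<dots> \<le> d * ((C1 * m * (Q powr (\<delta> / 4) * N i powr (\<delta> / 2))) * (M * N i powr (- \<delta>)))"
        proof -
          have "N (Suc i) powr (\<delta> / 4) \<le> (Q * (N i)\<^sup>2) powr (\<delta> / 4)"
            using Q(2)[of i] N_pos[of "Suc i"] del by (intro powr_mono2) auto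
          also have "\<dots> = Q powr (\<delta> / 4) * N i powr (\<delta> / 2)"
            using N_pos[of i] Q(1) by (simp add: powr_mult powr_realpow[symmetric] powr_powr del: powr_realpow powr_numeral)
          finally show ?thesis using two_le_d C1 m0 M by (intro mult_left_mono mult_right_mono) auto
        qed
        also have "\<dots> = d * C1 * Q powr (\<delta> / 4) * m * M * (N i powr (\<delta> / 2) * N i powr (- \<delta>))" by simp
        also have "N i powr (\<delta> / 2) * N i powr (- \<delta>) = N i powr (- (\<delta> / 2))" by (simp add: powr_add[symmetric])
        finally show "\<bar>ip A (cotr k (Suc i) \<mu>) (e i)\<bar> \<le> d * C1 * Q powr (\<delta> / 4) * m * M * N i powr (- (\<delta> / 2))" .
      qed
      also have "\<dots> \<le> d * C1 * Q powr (\<delta> / 4) * m * M * (S2 * N k powr (- (\<delta> / 2)))"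
        unfolding sum_distrib_left[symmetric] S2_def using sum_neg_powr[of "\<delta> / 2" k J] del two_le_d C1 m0 M
        by (intro mult_left_mono) auto
      finally show ?thesis by (simp add: C_def mult.assoc mult.commute mult.left_commute)
    qed
    \<comment> \<open>A bound without growth is required here, because \<open>c J\<close> is known
      to tend to 0 but not at which rate.\<close>
    obtain P where P: "\<And>J \<alpha>. k \<le> J \<Longrightarrow> \<alpha> \<in> A \<Longrightarrow> \<bar>cotr k J \<mu> \<alpha>\<bar> \<le> P" using dual(2) by blast
    have "(\<lambda>J. ip A (cotr k J \<mu>) (c J)) \<longlonglongrightarrow> 0"
    proof (rule Lim_null_comparison)
      show "\<forall>\<^sub>F J in sequentially. norm (ip A (cotr k J \<mu>) (c J)) \<le> (\<Sum>\<alpha>\<in>A. P * \<bar>c J \<alpha>\<bar>)"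
        unfolding eventually_sequentially
      proof (intro exI allI impI)
        fix J assume J: "k \<le> J"
        have "norm (ip A (cotr k J \<mu>) (c J)) \<le> (\<Sum>\<alpha>\<in>A. \<bar>cotr k J \<mu> \<alpha> * c J \<alpha>\<bar>)" unfolding ip_def by (simp add: sum_abs)
        also have "\<dots> \<le> (\<Sum>\<alpha>\<in>A. P * \<bar>c J \<alpha>\<bar>)" unfolding abs_mult using P[OF J] by (intro sum_mono mult_right_mono) auto
        finally show "norm (ip A (cotr k J \<mu>) (c J)) \<le> (\<Sum>\<alpha>\<in>A. P * \<bar>c J \<alpha>\<bar>)" .
      qed
      have "(\<lambda>J. \<Sum>\<alpha>\<in>A. P * \<bar>c J \<alpha>\<bar>) \<longlonglongrightarrow> (\<Sum>\<alpha>\<in>A. P * \<bar>0\<bar>)" by (intro tendsto_intros lim)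
      then show "(\<lambda>J. \<Sum>\<alpha>\<in>A. P * \<bar>c J \<alpha>\<bar>) \<longlonglongrightarrow> 0" by simp
    qed
    then have lim2: "(\<lambda>J. \<bar>ip A (cotr k J \<mu>) (c J)\<bar> + C * m * M * N k powr (- (\<delta> / 2))) \<longlonglongrightarrow>
        \<bar>0\<bar> + C * m * M * N k powr (- (\<delta> / 2))" by (intro tendsto_intros)
    have "\<bar>ip A \<mu> (c k)\<bar> \<le> \<bar>0\<bar> + C * m * M * N k powr (- (\<delta> / 2))"
    proof (rule LIMSEQ_le_const[OF lim2], intro exI allI impI)
      fix J assume "k \<le> J"
      then show "\<bar>ip A \<mu> (c k)\<bar> \<le> \<bar>ip A (cotr k J \<mu>) (c J)\<bar> + C * m * M * N k powr (- (\<delta> / 2))"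
        using tele[of J] sumb[of J] by linarith
    qed
    moreover have "ip A \<mu> (c k) = ip A \<mu> \<mu>" using mu(2)[OF mu(3)] by simp
    moreover have "m\<^sup>2 \<le> ip A \<mu> \<mu>"
    proof -
      obtain \<beta> where be: "\<beta> \<in> A" "m = \<bar>\<mu> \<beta>\<bar>"
      proof -
        have "m \<in> (\<lambda>\<alpha>. \<bar>\<mu> \<alpha>\<bar>) ` A" unfolding m_def vnorm_def using finite_A A_nonempty by (intro Max_in) auto
        then show ?thesis using that by blast
      qed
      have "\<mu> \<beta> * \<mu> \<beta> \<le> ip A \<mu> \<mu>"
        unfolding ip_def using be(1) finite_A by (intro member_le_sum[where f = "\<lambda>\<beta>. \<mu> \<beta> * \<mu> \<beta>"]) auto
      then show ?thesis using be(2) by (simp add: power2_eq_square)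
    qed
    \<comment> \<open>The pairing is at least quadratic in \<open>m\<close>, its bound is linear, so
      one factor \<open>m\<close> can be cancelled.\<close>
    ultimately have "m * m \<le> C * m * M * N k powr (- (\<delta> / 2))" by (simp add: power2_eq_square)
    then have "m * m \<le> (C * M * N k powr (- (\<delta> / 2))) * m" by (simp add: mult_ac)
    moreover have "0 \<le> C * M * N k powr (- (\<delta> / 2))" using \<open>C > 0\<close> M by simp
    ultimately have "m \<le> C * M * N k powr (- (\<delta> / 2))"
      using m0 by (cases "m = 0") (auto simp: mult_le_cancel_right)
    then show "\<bar>\<mu> \<alpha>\<bar> \<le> C * M * N k powr (- (\<delta> / 2))" using m[OF a] by linarith
  qed
qed

text \<open>\<open>X / p\<close> is the product of its own powers with exponents 1 - l and l, and
  each factor is estimated by one of the two bounds.\<close>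

lemma interpolate:
  fixes X p u v l :: real
  assumes "0 \<le> X" "X \<le> p * u" "X \<le> p * v" "0 \<le> p" "0 < u" "0 < v" "0 \<le> l" "l \<le> 1"
  shows "X \<le> p * (u powr (1 - l) * v powr l)"
proof (cases "X = 0")
  case False
  then have X: "0 < X" using assms(1) by simp
  then have p: "0 < p" using assms by (metis mult_zero_left not_less order_le_less)
  define Y where "Y = X / p"
  have Y: "0 < Y" "Y \<le> u" "Y \<le> v" using X p assms by (auto simp: Y_def field_simps)
  have "Y = Y powr (1 - l) * Y powr l" using Y by (simp add: powr_add[symmetric])
  also have "\<dots> \<le> u powr (1 - l) * v powr l" using Y assms by (intro mult_mono powr_mono2) auto
  finally show ?thesis using p by (simp add: Y_def field_simps)
qed (use assms in simp)

text \<open>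
  Early errors are contracted by \<open>\<sigma>\<close> at the price of an inverse; late ones are small. Interpolating
  between the two bounds treats all of them at once.
\<close>

lemma decay:
  assumes del: "0 < \<delta>" "\<delta> \<le> 1"
  obtains C where "C > 0" "\<And>M c k \<alpha>. 0 \<le> M \<Longrightarrow> (\<And>k. c k \<in> vecs A) \<Longrightarrow>
    (\<And>\<alpha>. \<alpha> \<in> A \<Longrightarrow> (\<lambda>k. c k \<alpha>) \<longlonglongrightarrow> 0) \<Longrightarrow>
    (\<And>k \<alpha>. \<alpha> \<in> A \<Longrightarrow> \<bar>c (Suc k) \<alpha> - tr k (Suc k) (c k) \<alpha>\<bar> \<le> M * N k powr (- \<delta>)) \<Longrightarrow>
    (\<And>\<alpha>. \<alpha> \<in> A \<Longrightarrow> \<bar>c 0 \<alpha>\<bar> \<le> M) \<Longrightarrow> \<alpha> \<in> A \<Longrightarrow> \<bar>c k \<alpha>\<bar> \<le> C * M * N k powr (- (min \<sigma> 1 * \<delta> / 64))"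
proof -
  define s1 where "s1 = min \<sigma> 1"
  have s1: "0 < s1" "s1 \<le> 1" "s1 \<le> \<sigma>" using sigma_pos by (auto simp: s1_def)
  have sd: "0 < s1 * \<delta>" "s1 * \<delta> \<le> \<delta>" "s1 * \<delta> \<le> s1" using s1 del by (auto simp: mult_le_cancel_right2 mult_le_cancel_left2)
  obtain C1 where C1: "C1 > 0" "\<And>M c k \<mu> \<alpha>. 0 \<le> M \<Longrightarrow> (\<And>\<alpha>. \<alpha> \<in> A \<Longrightarrow> (\<lambda>k. c k \<alpha>) \<longlonglongrightarrow> 0) \<Longrightarrow>
    (\<And>k \<alpha>. \<alpha> \<in> A \<Longrightarrow> \<bar>c (Suc k) \<alpha> - tr k (Suc k) (c k) \<alpha>\<bar> \<le> M * N k powr (- \<delta>)) \<Longrightarrow>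
    \<mu> \<in> vecs A \<Longrightarrow> (\<And>\<eta>. \<eta> \<in> tr 0 k ` Gs \<Longrightarrow> ip A \<mu> \<eta> = 0) \<Longrightarrow> c k - \<mu> \<in> tr 0 k ` Gs \<Longrightarrow> \<alpha> \<in> A \<Longrightarrow>
    \<bar>\<mu> \<alpha>\<bar> \<le> C1 * M * N k powr (- (\<delta> / 2))"
    using transverse_decay[OF del(1)] by blast
  obtain B where B: "B > 0" "\<And>k. b k \<le> B * N k powr (\<delta> / 4)" using roth_b[of "\<delta> / 4"] del by auto
  define C2 where "C2 = 1 + C1 + B * C1"
  have C2: "0 < C2" using B C1 by (simp add: C2_def add_pos_pos)
  \<comment> \<open>The inverse costs N_j^4, which the interpolation turns into N_j^(4 l) =
    N_j^(\<delta>/8), half of the decay \<delta>/4 of the stable errors. The gain in N_k is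
    \<open>s1 * l\<close>; \<tau> is half of it, so \<open>s1 * \<delta> / 64\<close>
    remains.\<close>
  define l where "l = \<delta> / 32"
  define \<tau> where "\<tau> = s1 * l / 2"
  have l: "0 < l" "l \<le> 1" using del by (auto simp: l_def)
  have tau: "0 < \<tau>" using s1 l by (simp add: \<tau>_def)
  obtain Kt where Kt: "Kt > 0" "\<And>j k \<xi> M \<alpha>. j \<le> k \<Longrightarrow> \<xi> \<in> Gam_s (lev j) \<Longrightarrow>
    (\<And>\<alpha>. \<alpha> \<in> A \<Longrightarrow> \<bar>\<xi> \<alpha>\<bar> \<le> M) \<Longrightarrow> \<alpha> \<in> A \<Longrightarrow> \<bar>tr j k \<xi> \<alpha>\<bar> \<le> Kt * N k powr \<tau> * M"
    using stable_bound[OF tau] by blast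
  obtain Kd where Kd: "Kd > 0" "\<And>k \<xi> M \<alpha>. \<xi> \<in> Gs \<Longrightarrow> (\<And>\<alpha>. \<alpha> \<in> A \<Longrightarrow> \<bar>\<xi> \<alpha>\<bar> \<le> M) \<Longrightarrow> \<alpha> \<in> A \<Longrightarrow>
      \<bar>tr 0 k \<xi> \<alpha>\<bar> \<le> Kd * N k powr (- \<sigma>) * M"
    using stable_decay by blast
  obtain Q where Q: "Q \<ge> 1" "\<And>k. N (Suc k) \<le> Q * (N k)\<^sup>2" using N_Suc_square by blast
  define K3 where "K3 = Kt + Kd * (6 * d\<^sup>2 * Q\<^sup>2)"
  have K3: "Kt \<le> K3" "Kd * (6 * d\<^sup>2 * Q\<^sup>2) \<le> K3" "0 < K3" using Kt Kd Q two_le_d by (auto simp: K3_def add_pos_nonneg)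
  define S where "S = 2 / (1 - 2 powr (- (\<delta> / 8)))"
  have q: "2 powr (- (\<delta> / 8)) < (1::real)" using del by (simp add: powr_less_one)
  have S: "0 < S" using q by (simp add: S_def)
  define C where "C = Kd * (1 + C1) + K3 * C2 * S + C1"
  have Npow: "N k powr (- a) \<le> N k powr (- (s1 * \<delta> / 64))" if "s1 * \<delta> / 64 \<le> a" for k a
    using that N_ge_1[of k] by (intro powr_mono) auto
  have Nle1: "N k powr (- a) \<le> 1" if "0 < a" for k a
    using powr_mono[of "- a" 0 "N k"] that N_ge_1[of k] N_pos[of k] by simp
  show ?thesis
  proof (rule that[of C])
    show "C > 0" using Kd C1 K3 C2 S by (simp add: C_def add_pos_pos)
    fix M c k \<alpha>
    assume M: "0 \<le> (M::real)" and cv: "\<And>k. c k \<in> vecs A" and lim: "\<And>\<alpha>. \<alpha> \<in> A \<Longrightarrow> (\<lambda>k. c k \<alpha>) \<longlonglongrightarrow> 0"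
      and err: "\<And>k \<alpha>. \<alpha> \<in> A \<Longrightarrow> \<bar>c (Suc k) \<alpha> - tr k (Suc k) (c k) \<alpha>\<bar> \<le> M * N k powr (- \<delta>)"
      and c0: "\<And>\<alpha>. \<alpha> \<in> A \<Longrightarrow> \<bar>c 0 \<alpha>\<bar> \<le> M" and a: "\<alpha> \<in> A"
    \<comment> \<open>\<open>s k\<close> is the orthogonal projection of \<open>c k\<close> to the
      stable space of level k; the residual falls under \<open>transverse_decay\<close>.\<close>
    have "\<exists>s. s \<in> tr 0 k ` Gs \<and> (\<forall>\<eta>\<in>tr 0 k ` Gs. ip A (c k - s) \<eta> = 0)" for k
      using orthogonal_decomposition[OF finite_A Gs_level(2,1)[of k], of "c k"] by metis
    then obtain s where s: "\<And>k. s k \<in> tr 0 k ` Gs" "\<And>k \<eta>. \<eta> \<in> tr 0 k ` Gs \<Longrightarrow> ip A (c k - s k) \<eta> = 0"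
      by metis
    have t: "\<bar>c k \<alpha> - s k \<alpha>\<bar> \<le> C1 * M * N k powr (- (\<delta> / 2))" if "\<alpha> \<in> A" for k \<alpha>
    proof -
      have "c k - s k \<in> vecs A"
        using cv s(1)[of k] Gs_level(1)[of k] fvec.subspace_diff[OF subspace_vecs[of A]] by blast
      from C1(2)[where c = c, OF M lim err this s(2) _ that, of k] s(1)[of k]
      show ?thesis by simp
    qed
    \<comment> \<open>The projections do not commute with the cocycle. Their defect is stable and is
      small because the original errors and the transverse residuals are.\<close>
    define gg where "gg k = s (Suc k) - tr k (Suc k) (s k)" for k
    have gW: "gg k \<in> tr 0 (Suc k) ` Gs" for k
    proof -
      obtain \<xi> where "\<xi> \<in> Gs" "s k = tr 0 k \<xi>" using s(1)[of k] by blast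
      then have "tr k (Suc k) (s k) \<in> tr 0 (Suc k) ` Gs" by (auto simp: tr_tr)
      then show ?thesis unfolding gg_def using s(1)[of "Suc k"] fvec.subspace_diff[OF Gs_level(2)] by blast
    qed
    have gb: "\<bar>gg k \<alpha>\<bar> \<le> C2 * M * N k powr (- (\<delta> / 4))" if al: "\<alpha> \<in> A" for k \<alpha>
    proof -
      have trd: "tr k (Suc k) (c k - s k) = tr k (Suc k) (c k) - tr k (Suc k) (s k)" unfolding tr_def by (rule cv_diff)
      have p: "N k powr (- \<delta>) \<le> N k powr (- (\<delta> / 4))" "N k powr (- (\<delta> / 2)) \<le> N k powr (- (\<delta> / 4))"
        using N_ge_1[of k] del by (auto intro!: powr_mono)
      have 1: "\<bar>c (Suc k) \<alpha> - tr k (Suc k) (c k) \<alpha>\<bar> \<le> M * N k powr (- (\<delta> / 4))"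
        using err[OF al, of k] mult_left_mono[OF p(1) M] by linarith
      have "N (Suc k) powr (- (\<delta> / 2)) \<le> N k powr (- (\<delta> / 2))" using N_Suc[of k] N_pos[of k] del by (intro powr_mono2') auto
      then have "C1 * M * N (Suc k) powr (- (\<delta> / 2)) \<le> C1 * M * N k powr (- (\<delta> / 4))"
        using p(2) C1(1) M by (intro mult_left_mono) auto
      then have 2: "\<bar>c (Suc k) \<alpha> - s (Suc k) \<alpha>\<bar> \<le> C1 * M * N k powr (- (\<delta> / 4))" using t[OF al, of "Suc k"] by linarith
      have "\<bar>tr k (Suc k) (c k - s k) \<alpha>\<bar> \<le> b k * (C1 * M * N k powr (- (\<delta> / 2)))"
        unfolding b_def using t al by (intro tr_bound) auto
      also have "\<dots> \<le> (B * N k powr (\<delta> / 4)) * (C1 * M * N k powr (- (\<delta> / 2)))"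
        using B(2)[of k] C1(1) M by (intro mult_right_mono) auto
      also have "\<dots> = B * C1 * M * (N k powr (\<delta> / 4) * N k powr (- (\<delta> / 2)))" by simp
      also have "N k powr (\<delta> / 4) * N k powr (- (\<delta> / 2)) = N k powr (- (\<delta> / 4))" by (simp add: powr_add[symmetric])
      finally have "\<bar>(tr k (Suc k) (c k) - tr k (Suc k) (s k)) \<alpha>\<bar> \<le> B * C1 * M * N k powr (- (\<delta> / 4))"
        unfolding trd .
      then have 3: "\<bar>tr k (Suc k) (c k) \<alpha> - tr k (Suc k) (s k) \<alpha>\<bar> \<le> B * C1 * M * N k powr (- (\<delta> / 4))" by simp
      have "\<bar>gg k \<alpha>\<bar> \<le> M * N k powr (- (\<delta> / 4)) + C1 * M * N k powr (- (\<delta> / 4)) + B * C1 * M * N k powr (- (\<delta> / 4))"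
        using 1 2 3 unfolding gg_def by simp
      then show ?thesis by (simp add: C2_def algebra_simps)
    qed
    \<comment> \<open>Variation of constants: each stable defect is transported from the level at
      which it arises.\<close>
    have sk: "s k = tr 0 k (s 0) + (\<Sum>j<k. tr (Suc j) k (gg j))" for k
    proof (induction k)
      case 0 then show ?case by (simp add: tr_refl)
    next
      case (Suc k)
      have "s (Suc k) = tr k (Suc k) (s k) + gg k" by (simp add: gg_def)
      also have "tr k (Suc k) (s k) = tr k (Suc k) (tr 0 k (s 0)) + (\<Sum>j<k. tr k (Suc k) (tr (Suc j) k (gg j)))"
        unfolding Suc.IH[symmetric] using Suc.IH cv_plus cv_sum unfolding tr_def by metis
      also have "tr k (Suc k) (tr 0 k (s 0)) = tr 0 (Suc k) (s 0)" by (simp add: tr_tr)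
      also have "(\<Sum>j<k. tr k (Suc k) (tr (Suc j) k (gg j))) = (\<Sum>j<k. tr (Suc j) (Suc k) (gg j))"
        by (intro sum.cong refl) (simp add: tr_tr)
      finally show ?case by (simp add: tr_refl add.assoc)
    qed
    have s0: "\<bar>s 0 \<alpha>\<bar> \<le> (1 + C1) * M" if "\<alpha> \<in> A" for \<alpha>
    proof -
      have "C1 * M * N 0 powr (- (\<delta> / 2)) \<le> C1 * M * 1" using Nle1[of "\<delta> / 2" 0] del C1 M by (intro mult_left_mono) auto
      then show ?thesis using t[OF that, of 0] c0[OF that] by (simp add: algebra_simps)
    qed
    have "s 0 \<in> Gs" using s(1)[of 0] by (auto simp: tr_refl)
    then have "\<bar>tr 0 k (s 0) \<alpha>\<bar> \<le> Kd * N k powr (- \<sigma>) * ((1 + C1) * M)" using s0 a by (intro Kd(2)) auto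
    also have "\<dots> \<le> Kd * N k powr (- (s1 * \<delta> / 64)) * ((1 + C1) * M)"
      using Npow[of \<sigma> k] s1 sd Kd C1 M by (intro mult_right_mono mult_left_mono) auto
    finally have T1: "\<bar>tr 0 k (s 0) \<alpha>\<bar> \<le> Kd * (1 + C1) * (M * N k powr (- (s1 * \<delta> / 64)))" by (simp add: mult_ac)
    have X: "\<bar>tr (Suc j) k (gg j) \<alpha>\<bar> \<le> K3 * C2 * M * N k powr (- (s1 * \<delta> / 64)) * N j powr (- (\<delta> / 8))" if j: "j < k" for j
    proof -
      define \<gamma> where "\<gamma> = C2 * M * N j powr (- (\<delta> / 4))"
      have gam: "0 \<le> \<gamma>" using C2 M by (simp add: \<gamma>_def)
      obtain \<xi> where xi: "\<xi> \<in> Gs" "gg j = tr 0 (Suc j) \<xi>" using gW[of j] by blast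
      have gs: "gg j \<in> Gam_s (lev (Suc j))" unfolding xi(2) by (rule tr_Gs[OF xi(1)])
      have "\<bar>tr (Suc j) k (gg j) \<alpha>\<bar> \<le> Kt * N k powr \<tau> * \<gamma>"
        using j gb[of _ j] a by (intro Kt(2) gs) (auto simp: \<gamma>_def)
      also have "\<dots> \<le> K3 * N k powr \<tau> * \<gamma>" using K3 gam by (intro mult_right_mono) auto
      finally have u: "\<bar>tr (Suc j) k (gg j) \<alpha>\<bar> \<le> (K3 * \<gamma>) * N k powr \<tau>" by (simp add: mult_ac)
      have "tr (Suc j) k (gg j) = tr 0 k \<xi>" using j xi(2) by (simp add: tr_tr)
      moreover have "\<bar>\<xi> \<beta>\<bar> \<le> 6 * d\<^sup>2 * (N (Suc j))\<^sup>2 * \<gamma>" if "\<beta> \<in> A" for \<beta>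
        using gb[of _ j] xi Gs_vecs that by (intro inverse_bound) (auto simp: \<gamma>_def)
      ultimately have "\<bar>tr (Suc j) k (gg j) \<alpha>\<bar> \<le> Kd * N k powr (- \<sigma>) * (6 * d\<^sup>2 * (N (Suc j))\<^sup>2 * \<gamma>)"
        using Kd(2)[OF xi(1) _ a] by simp
      also have "\<dots> \<le> Kd * N k powr (- s1) * (6 * d\<^sup>2 * (Q\<^sup>2 * N j ^ 4) * \<gamma>)"
      proof -
        have "(N (Suc j))\<^sup>2 \<le> (Q * (N j)\<^sup>2)\<^sup>2" using Q(2)[of j] N_pos[of "Suc j"] by (intro power_mono) auto
        also have "\<dots> = Q\<^sup>2 * N j ^ 4" by (simp add: power_mult_distrib)
        finally have 1: "(N (Suc j))\<^sup>2 \<le> Q\<^sup>2 * N j ^ 4" .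
        have 2: "N k powr (- \<sigma>) \<le> N k powr (- s1)" using N_ge_1[of k] s1 by (intro powr_mono) auto
        show ?thesis using 1 2 Kd gam by (intro mult_mono mult_left_mono mult_right_mono) auto
      qed
      also have "\<dots> = (Kd * (6 * d\<^sup>2 * Q\<^sup>2)) * (N k powr (- s1) * N j ^ 4 * \<gamma>)" by (simp add: mult_ac)
      also have "\<dots> \<le> K3 * (N k powr (- s1) * N j ^ 4 * \<gamma>)" using K3 gam N_pos[of j] by (intro mult_right_mono) auto
      finally have v: "\<bar>tr (Suc j) k (gg j) \<alpha>\<bar> \<le> (K3 * \<gamma>) * (N k powr (- s1) * N j ^ 4)" by (simp add: mult_ac)
      have "\<bar>tr (Suc j) k (gg j) \<alpha>\<bar> \<le> (K3 * \<gamma>) * ((N k powr \<tau>) powr (1 - l) * (N k powr (- s1) * N j ^ 4) powr l)"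
        using N_pos[of k] N_pos[of j] K3 gam l by (intro interpolate u v) auto
      also have "(N k powr \<tau>) powr (1 - l) * (N k powr (- s1) * N j ^ 4) powr l = N k powr (\<tau> * (1 - l) - s1 * l) * N j powr (4 * l)"
        using N_pos[of k] N_pos[of j]
        by (simp add: powr_mult powr_powr powr_add[symmetric] powr_realpow[symmetric] del: powr_realpow powr_numeral)
      also have "\<dots> \<le> N k powr (- (s1 * \<delta> / 64)) * N j powr (\<delta> / 8)"
      proof (intro mult_mono powr_mono)
        have "\<tau> * (1 - l) \<le> \<tau>" using tau l by (simp add: mult_le_cancel_left2)
        moreover have "\<tau> - s1 * l = - (s1 * \<delta> / 64)" by (simp add: \<tau>_def l_def)
        ultimately show "\<tau> * (1 - l) - s1 * l \<le> - (s1 * \<delta> / 64)" by linarith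
      qed (use N_ge_1[of k] N_ge_1[of j] in \<open>auto simp: l_def\<close>)
      finally have "\<bar>tr (Suc j) k (gg j) \<alpha>\<bar> \<le> (K3 * \<gamma>) * (N k powr (- (s1 * \<delta> / 64)) * N j powr (\<delta> / 8))"
        using K3 gam by (simp add: mult_left_mono)
      also have "\<dots> = K3 * C2 * M * N k powr (- (s1 * \<delta> / 64)) * (N j powr (- (\<delta> / 4)) * N j powr (\<delta> / 8))"
        by (simp add: \<gamma>_def mult_ac)
      also have "N j powr (- (\<delta> / 4)) * N j powr (\<delta> / 8) = N j powr (- (\<delta> / 8))" by (simp add: powr_add[symmetric])
      finally show ?thesis .
    qed
    have "\<bar>(\<Sum>j<k. tr (Suc j) k (gg j)) \<alpha>\<bar> \<le> (\<Sum>j<k. K3 * C2 * M * N k powr (- (s1 * \<delta> / 64)) * N j powr (- (\<delta> / 8)))"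
      unfolding sum_fun_apply using X by (intro order_trans[OF sum_abs] sum_mono) auto
    also have "\<dots> \<le> K3 * C2 * M * N k powr (- (s1 * \<delta> / 64)) * S"
    proof -
      have "(\<Sum>j<k. N j powr (- (\<delta> / 8))) \<le> S * N 0 powr (- (\<delta> / 8))"
        using sum_neg_powr[of "\<delta> / 8" 0 k] del by (simp add: S_def lessThan_atLeast0)
      also have "\<dots> \<le> S" using Nle1[of "\<delta> / 8" 0] del S mult_left_mono[of "N 0 powr (- (\<delta> / 8))" 1 S] by simp
      finally show ?thesis unfolding sum_distrib_left[symmetric] using K3 C2 M by (intro mult_left_mono) auto
    qed
    finally have T2: "\<bar>(\<Sum>j<k. tr (Suc j) k (gg j)) \<alpha>\<bar> \<le> K3 * C2 * S * (M * N k powr (- (s1 * \<delta> / 64)))" by (simp add: mult_ac)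
    have T3: "\<bar>c k \<alpha> - s k \<alpha>\<bar> \<le> C1 * (M * N k powr (- (s1 * \<delta> / 64)))"
    proof -
      have "C1 * M * N k powr (- (\<delta> / 2)) \<le> C1 * M * N k powr (- (s1 * \<delta> / 64))"
        using sd del C1(1) M by (intro mult_left_mono Npow) auto
      then show ?thesis using t[OF a, of k] by (simp add: mult.assoc)
    qed
    have "c k \<alpha> = (c k \<alpha> - s k \<alpha>) + tr 0 k (s 0) \<alpha> + (\<Sum>j<k. tr (Suc j) k (gg j)) \<alpha>"
      using fun_cong[OF sk[of k], of \<alpha>] by simp
    then have "\<bar>c k \<alpha>\<bar> \<le> C * (M * N k powr (- (s1 * \<delta> / 64)))"
      using T1 T2 T3 by (simp add: C_def distrib_right)
    then show "\<bar>c k \<alpha>\<bar> \<le> C * M * N k powr (- (min \<sigma> 1 * \<delta> / 64))" by (simp add: s1_def mult_ac)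
  qed
qed

end

section \<open>Floors of the towers\<close>

lemma interval_partition_next:
  fixes w :: "'a \<Rightarrow> real"
  assumes fin: "finite A" and P: "interval_partition A l w a b" and pos: "\<forall>\<alpha>\<in>A. 0 < w \<alpha>"
    and al: "\<alpha> \<in> A" "l \<alpha> + w \<alpha> \<noteq> b"
  obtains \<beta> where "\<beta> \<in> A" "l \<beta> = l \<alpha> + w \<alpha>"
proof -
  let ?K = "{\<beta> \<in> A. l \<beta> \<le> l \<alpha>}"
  have K: "?K = insert \<alpha> {\<beta> \<in> A. l \<beta> < l \<alpha>}"
    using interval_partition_separated[OF P pos _ al(1)] interval_partition_separated[OF P pos al(1)] pos al(1)
    by fastforce
  have s: "a + sum w ?K = l \<alpha> + w \<alpha>"
    unfolding K using interval_partition_left_eq[OF fin P pos al(1)] fin by simp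
  have "?K \<noteq> A"
  proof
    assume KA: "?K = A"
    have "a \<le> b" using interval_partition_left[OF P al(1)] interval_partition_right[OF P al(1)] pos al(1) by fastforce
    then have "sum w A = b - a"
      using interval_partition_telescope[OF fin P pos, of id] by simp
    then show False using s al(2) unfolding KA by simp
  qed
  then obtain \<beta> where "\<beta> \<in> A" "l \<beta> = a + sum w ?K"
    by (rule initial_cut[OF fin P pos, of ?K, rotated]) auto
  then show ?thesis using s that by simp
qed

text \<open>The translation by \<open>shift T (bot_last T)\<close> carries the loser's new cell onto
  the part of the base that the step cuts off. So each point of that part has a preimage in the new
  base.\<close>

lemma loser_cell_image:
  assumes "good T"
  shows "top_left (rauzy_step T) (loser T) + shift T (bot_last T) = right_end (rauzy_step T)"
    "top_left (rauzy_step T) (loser T) + width (rauzy_step T) (loser T) + shift T (bot_last T) = right_end T"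
  using good_last[OF assms] assms
  by (cases "top_wins T"; auto simp: rauzy_step_top rauzy_step_bot loser_def shift_def)+

lemma tail_cell:
  assumes "good T" "right_end (rauzy_step T) \<le> x" "x \<le> right_end T"
  shows "x - shift T (bot_last T) \<in> cell (rauzy_step T) (loser T)"
    "x - shift T (bot_last T) \<in> cell T (bot_last T)"
proof -
  show 1: "x - shift T (bot_last T) \<in> cell (rauzy_step T) (loser T)"
    using assms(2,3) loser_cell_image[OF assms(1)] unfolding cell_def by simp
  show "x - shift T (bot_last T) \<in> cell T (bot_last T)" using step_cell(2)[OF assms(1) 1] by simp
qed

text \<open>
  The cut points \<open>E\<close> are the end points of the floors of the towers over a later interval \<open>I(n)\<close>.
\<close>

definition floors :: "'a iem \<Rightarrow> (real \<Rightarrow> real) \<Rightarrow> real \<Rightarrow> real \<Rightarrow> bool" where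
  "floors T \<psi> l D \<longleftrightarrow> (\<exists>E. insert (right_end T) (top_left T ` alphabet T) \<subseteq> E \<and>
     E \<subseteq> {left_end T..right_end T} \<and> (\<forall>e\<in>E. \<forall>e'\<in>E. e < e' \<longrightarrow> e + l \<le> e') \<and>
     (\<forall>x y. left_end T \<le> x \<longrightarrow> x \<le> y \<longrightarrow> y \<le> right_end T \<longrightarrow> y - x \<le> l \<longrightarrow> {x<..<y} \<inter> E = {} \<longrightarrow>
        \<bar>\<psi> x - \<psi> y\<bar> \<le> D))"

lemma floors_base:
  assumes T: "good T" and l: "\<And>\<alpha>. \<alpha> \<in> alphabet T \<Longrightarrow> l \<le> width T \<alpha>"
    and D: "\<And>x. x \<in> {left_end T..right_end T} \<Longrightarrow> \<bar>\<psi> x - z\<bar> \<le> D"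
  shows "floors T \<psi> l (2 * D)"
  unfolding floors_def
proof (intro exI[of _ "insert (right_end T) (top_left T ` alphabet T)"] conjI)
  let ?E = "insert (right_end T) (top_left T ` alphabet T)"
  note g = good_facts[OF T]
  have r: "top_left T \<alpha> + width T \<alpha> \<le> right_end T" "left_end T \<le> top_left T \<alpha>" "0 < width T \<alpha>" if "\<alpha> \<in> alphabet T" for \<alpha>
    using interval_partition_right[OF g(4) that] interval_partition_left[OF g(4) that] g(3) that by auto
  show "?E \<subseteq> {left_end T..right_end T}" using r g(7) by force
  show "\<forall>e\<in>?E. \<forall>e'\<in>?E. e < e' \<longrightarrow> e + l \<le> e'"
  proof (intro ballI impI)
    fix e e' assume e: "e \<in> ?E" "e' \<in> ?E" "e < e'"
    have "e \<noteq> right_end T" using e(2,3) r by force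
    then obtain \<alpha> where a: "\<alpha> \<in> alphabet T" "e = top_left T \<alpha>" using e(1) by auto
    have "e + width T \<alpha> \<le> e'"
    proof (cases "e' = right_end T")
      case True
      then show ?thesis using r[OF a(1)] a by simp
    next
      case False
      then obtain \<beta> where b: "\<beta> \<in> alphabet T" "e' = top_left T \<beta>" using e(2) by auto
      then show ?thesis using interval_partition_separated[OF g(4,3) a(1) b(1)] a e(3) by force
    qed
    then show "e + l \<le> e'" using l[OF a(1)] by simp
  qed
  show "\<forall>x y. left_end T \<le> x \<longrightarrow> x \<le> y \<longrightarrow> y \<le> right_end T \<longrightarrow> y - x \<le> l \<longrightarrow> {x<..<y} \<inter> ?E = {} \<longrightarrow>
        \<bar>\<psi> x - \<psi> y\<bar> \<le> 2 * D"
  proof (intro allI impI)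
    fix x y assume "left_end T \<le> x" "x \<le> y" "y \<le> right_end T"
    then show "\<bar>\<psi> x - \<psi> y\<bar> \<le> 2 * D" using D[of x] D[of y] by auto
  qed
qed simp

text \<open>Undoing a step adds the part that was cut off, a translate of the loser's cell, and the
  cut points of that cell are translated with it. There \<psi> differs from its values on the cell
  by a function with Lipschitz constant \<open>L\<close>, which over a distance \<open>l\<close>
  adds at most \<open>l * L\<close> to the oscillation.\<close>

lemma floors_step:
  assumes T: "good T" and F: "floors (rauzy_step T) \<psi> l D" and L: "0 \<le> L"
    and lip: "\<And>x y. x \<in> cell T (bot_last T) \<Longrightarrow> y \<in> cell T (bot_last T) \<Longrightarrow>
      \<bar>(\<psi> (x + shift T (bot_last T)) - \<psi> x) - (\<psi> (y + shift T (bot_last T)) - \<psi> y)\<bar> \<le> L * \<bar>x - y\<bar>"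
  shows "floors T \<psi> l (D + l * L)"
proof -
  let ?T = "rauzy_step T" and ?s = "shift T (bot_last T)" and ?c = "cell (rauzy_step T) (loser T)"
  have gT: "good ?T" using good_rauzy_step[OF T] .
  have A: "alphabet ?T = alphabet T" and le: "left_end ?T = left_end T"
    using rauzy_step_alphabet[OF T] rauzy_step_left_end[OF T] by auto
  have lo: "loser T \<in> alphabet T" using winner_loser(2)[OF T] .
  note g = good_facts[OF gT, unfolded A]
  define p where "p = top_left ?T (loser T)"
  define q where "q = p + width ?T (loser T)"
  define r where "r = right_end ?T"
  define R where "R = right_end T"
  have pq: "p + ?s = r" "q + ?s = R" "?c = {p..q}"
    using loser_cell_image[OF T] by (auto simp: p_def q_def r_def R_def cell_def)
  have rR: "r < R" using step_base[OF T] by (simp add: r_def R_def)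
  obtain E where E: "insert r (top_left ?T ` alphabet T) \<subseteq> E" "E \<subseteq> {left_end T..r}"
      "\<And>e e'. e \<in> E \<Longrightarrow> e' \<in> E \<Longrightarrow> e < e' \<Longrightarrow> e + l \<le> e'"
      "\<And>x y. left_end T \<le> x \<Longrightarrow> x \<le> y \<Longrightarrow> y \<le> r \<Longrightarrow> y - x \<le> l \<Longrightarrow> {x<..<y} \<inter> E = {} \<Longrightarrow> \<bar>\<psi> x - \<psi> y\<bar> \<le> D"
    using F unfolding floors_def A le r_def by metis
  have pE: "p \<in> E" using E(1) lo by (auto simp: p_def)
  have qE: "q \<in> E"
  proof (cases "q = r")
    case True then show ?thesis using E(1) by auto
  next
    case False
    then obtain \<beta> where "\<beta> \<in> alphabet T" "top_left ?T \<beta> = q"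
      using interval_partition_next[OF g(1,4,3) lo] unfolding p_def q_def r_def by metis
    then show ?thesis using E(1) by blast
  qed
  have rE: "r \<in> E" using E(1) by auto
  define E1 where "E1 = E \<union> {e. r \<le> e \<and> e \<le> R \<and> e - ?s \<in> E}"
  have le_r: "left_end T \<le> r" using E(2) rE by auto
  have bl: "e - ?s \<in> cell T (bot_last T)" "e - ?s \<in> {p..q}" if "r \<le> e" "e \<le> R" for e
    using tail_cell[OF T, of e] that pq by (auto simp: r_def R_def)
  show ?thesis
    unfolding floors_def
  proof (intro exI[of _ E1] conjI)
    show "insert (right_end T) (top_left T ` alphabet T) \<subseteq> E1"
    proof -
      have "R \<in> E1" using rR qE pq(2) by (auto simp: E1_def algebra_simps)
      moreover have "top_left T \<alpha> \<in> E" if "\<alpha> \<in> alphabet T" for \<alpha>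
      proof (cases "top_wins T \<or> \<alpha> \<noteq> top_last T")
        case True
        then have "top_left T \<alpha> = top_left ?T \<alpha>" by (cases "top_wins T") (auto simp: rauzy_step_top rauzy_step_bot T)
        then show ?thesis using E(1) that by auto
      next
        case False
        then have "top_left T \<alpha> = r" by (simp add: rauzy_step_bot T r_def)
        then show ?thesis using rE by simp
      qed
      ultimately show ?thesis by (auto simp: R_def E1_def)
    qed
    show "E1 \<subseteq> {left_end T..right_end T}" using E(2) rR le_r by (auto simp: E1_def R_def)
    show "\<forall>e\<in>E1. \<forall>e'\<in>E1. e < e' \<longrightarrow> e + l \<le> e'"
    proof (intro ballI impI)
      fix e e' assume e: "e \<in> E1" "e' \<in> E1" "e < e'"
      consider "e \<in> E" "e' \<in> E" | "e \<in> E" "r < e'" "e' \<le> R" "e' - ?s \<in> E"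
        | "e \<notin> E" "r \<le> e" "e \<le> R" "e - ?s \<in> E" "r \<le> e'" "e' - ?s \<in> E"
        using e E(2) rE unfolding E1_def by fastforce
      then show "e + l \<le> e'"
      proof cases
        case 1 then show ?thesis using E(3) e by blast
      next
        case 2
        have "e \<le> r" using 2 E(2) by auto
        have "p < e' - ?s" using 2 pq(1) by simp
        then have "p + l \<le> e' - ?s" using E(3)[OF pE 2(4)] by simp
        then show ?thesis using pq(1) \<open>e \<le> r\<close> by simp
      next
        case 3
        then have "(e - ?s) + l \<le> e' - ?s" using E(3)[OF 3(4) 3(6)] e(3) by simp
        then show ?thesis by simp
      qed
    qed
    show "\<forall>x y. left_end T \<le> x \<longrightarrow> x \<le> y \<longrightarrow> y \<le> right_end T \<longrightarrow> y - x \<le> l \<longrightarrow> {x<..<y} \<inter> E1 = {} \<longrightarrow>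
        \<bar>\<psi> x - \<psi> y\<bar> \<le> D + l * L"
    proof (intro allI impI)
      fix x y assume xy: "left_end T \<le> x" "x \<le> y" "y \<le> right_end T" "y - x \<le> l" "{x<..<y} \<inter> E1 = {}"
      have l0: "0 \<le> l * L" using xy L by (intro mult_nonneg_nonneg) auto
      \<comment> \<open>The old right end \<open>r\<close> is itself a cut point, so no floor
        crosses it.\<close>
      consider "y \<le> r" | "r \<le> x" using xy(5) rE by (force simp: E1_def)
      then show "\<bar>\<psi> x - \<psi> y\<bar> \<le> D + l * L"
      proof cases
        case 1
        have "{x<..<y} \<inter> E = {}" using xy(5) by (auto simp: E1_def)
        then show ?thesis using E(4)[of x y] xy 1 l0 by auto
      next
        case 2
        have c: "x - ?s \<in> cell T (bot_last T)" "y - ?s \<in> cell T (bot_last T)" "x - ?s \<in> {p..q}" "y - ?s \<in> {p..q}"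
          using bl[of x] bl[of y] 2 xy by (auto simp: R_def)
        have "{x - ?s<..<y - ?s} \<inter> E = {}"
        proof (rule ccontr)
          assume "\<not> ?thesis"
          then obtain e where e: "e \<in> E" "x - ?s < e" "e < y - ?s" by auto
          then have "e + ?s \<in> E1" using 2 xy by (auto simp: E1_def R_def)
          moreover have "e + ?s \<in> {x<..<y}" using e by auto
          ultimately show False using xy(5) by blast
        qed
        moreover have "left_end T \<le> x - ?s" "y - ?s \<le> r"
          using cell_subset(1)[OF gT, of "loser T"] c(3,4) pq(3) lo A le by (auto simp: r_def)
        ultimately have "\<bar>\<psi> (x - ?s) - \<psi> (y - ?s)\<bar> \<le> D" using xy by (intro E(4)) auto
        moreover have "\<bar>(\<psi> x - \<psi> (x - ?s)) - (\<psi> y - \<psi> (y - ?s))\<bar> \<le> L * \<bar>x - y\<bar>"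
          using lip[OF c(1,2)] by simp
        moreover have "L * \<bar>x - y\<bar> \<le> l * L" using xy L by (simp add: mult.commute mult_left_mono)
        ultimately show ?thesis by linarith
      qed
    qed
  qed
qed

text \<open>An open interval of length at most \<open>l\<close> contains at most one cut point,
  since distinct cut points are at least \<open>l\<close> apart.\<close>

lemma floors_modulus:
  assumes F: "floors T \<psi> l D" and xy: "x \<in> {left_end T..right_end T}" "y \<in> {left_end T..right_end T}" "\<bar>x - y\<bar> \<le> l"
  shows "\<bar>\<psi> x - \<psi> y\<bar> \<le> 2 * D"
proof -
  obtain E where E: "E \<subseteq> {left_end T..right_end T}" "\<And>e e'. e \<in> E \<Longrightarrow> e' \<in> E \<Longrightarrow> e < e' \<Longrightarrow> e + l \<le> e'"
      "\<And>x y. left_end T \<le> x \<Longrightarrow> x \<le> y \<Longrightarrow> y \<le> right_end T \<Longrightarrow> y - x \<le> l \<Longrightarrow> {x<..<y} \<inter> E = {} \<Longrightarrow> \<bar>\<psi> x - \<psi> y\<bar> \<le> D"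
    using F unfolding floors_def by metis
  have *: "\<bar>\<psi> x - \<psi> y\<bar> \<le> 2 * D" if h: "left_end T \<le> x" "x \<le> y" "y \<le> right_end T" "y - x \<le> l" for x y
  proof (cases "{x<..<y} \<inter> E = {}")
    case True
    then show ?thesis using E(3)[OF h True] abs_ge_zero[of "\<psi> x - \<psi> y"] by linarith
  next
    case False
    then obtain e where e: "e \<in> E" "x < e" "e < y" by auto
    have "{x<..<e} \<inter> E = {}" "{e<..<y} \<inter> E = {}" using E(2)[of _ e] E(2)[of e] e h by force+
    then have "\<bar>\<psi> x - \<psi> e\<bar> \<le> D" "\<bar>\<psi> e - \<psi> y\<bar> \<le> D" using e h by (auto intro!: E(3))
    then show ?thesis by linarith
  qed
  show ?thesis using *[of x y] *[of y x] xy by (cases "x \<le> y") (auto simp: abs_minus_commute)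
qed

section \<open>From special Birkhoff sums to the oscillation of \<psi>\<close>

context roth begin

lemma intermediate_bsum:
  assumes h: "\<And>\<alpha> x. \<alpha> \<in> A \<Longrightarrow> x \<in> cell (lev i) \<alpha> \<Longrightarrow> \<bar>bsum T (ns i) G \<alpha> x\<bar> \<le> h"
    and n: "n \<le> ns (Suc i) - ns i" and a: "\<alpha> \<in> A" and x: "x \<in> cell (rv T (ns i + n)) \<alpha>" and h0: "0 \<le> h"
  shows "\<bar>bsum T (ns i + n) G \<alpha> x\<bar> \<le> b i * h"
proof -
  have x': "x \<in> cell (rv (lev i) n) \<alpha>" using x by (simp add: lev_def rv_rv)
  have "\<bar>bsum (lev i) n (bsum T (ns i) G) \<alpha> x - cv (lev i) n 0 \<alpha>\<bar> \<le> cv (lev i) n (\<lambda>_. h) \<alpha>"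
    using h a x' by (intro bsum_approx[OF good_lev[of i]]) (auto simp: alphabet_lev)
  also have "\<dots> \<le> b i * h" using intermediate_bound[OF n, of "\<lambda>_. h" h \<alpha>] a h0 by simp
  finally show ?thesis by (simp add: cv_0 bsum_add lev_def)
qed

text \<open>The intervals I(n_k) share their left endpoint and their lengths tend to 0, so
  continuity of \<psi> at that point suffices.\<close>

lemma psi_tendsto_left:
  assumes "continuous_on {left_end T..right_end T} \<psi>" "\<And>k. y k \<in> {left_end T..right_end (lev k)}"
  shows "(\<lambda>k. \<psi> (y k)) \<longlonglongrightarrow> \<psi> (left_end T)"
proof -
  obtain L where L: "L > 0" "\<And>k. len k \<le> L * N k powr (1 / 2 - 1)" using len_bound[of "1/2"] by auto
  have "(\<lambda>k. L * N k powr (- (1 / 2))) \<longlonglongrightarrow> L * 0" by (intro tendsto_intros N_neg_powr_tendsto) auto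
  then have lim0: "(\<lambda>k. L * N k powr (- (1 / 2))) \<longlonglongrightarrow> 0" by simp
  have "(\<lambda>k. y k - left_end T) \<longlonglongrightarrow> 0"
  proof (rule Lim_null_comparison[OF _ lim0])
    show "\<forall>\<^sub>F k in sequentially. norm (y k - left_end T) \<le> L * N k powr (- (1 / 2))"
    proof (intro always_eventually allI)
      fix k
      have "norm (y k - left_end T) \<le> len k" using assms(2)[of k] by (simp add: len_def)
      then show "norm (y k - left_end T) \<le> L * N k powr (- (1 / 2))" using L(2)[of k] by simp
    qed
  qed
  then have "y \<longlonglongrightarrow> left_end T" by (rule LIM_zero_cancel)
  then show ?thesis
  proof (rule continuous_on_tendsto_compose[OF assms(1)])
    show "left_end T \<in> {left_end T..right_end T}" using good_facts(7)[OF good_T] by simp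
    have "y k \<in> {left_end T..right_end T}" for k
      using assms(2)[of k] rv_interval[of "ns k"] rv_left_end[OF good_T, of "ns k"] by (auto simp: lev_def)
    then show "\<forall>\<^sub>F k in sequentially. y k \<in> {left_end T..right_end T}" by simp
  qed
qed

lemma lev_left_end: "left_end (lev k) = left_end T"
  unfolding lev_def by (rule rv_left_end[OF good_T])

lemma top_left_cell: "\<alpha> \<in> A \<Longrightarrow> top_left (lev k) \<alpha> \<in> cell (lev k) \<alpha>"
  using wd_pos[of \<alpha> k] by (simp add: cell_def wd_def)

text \<open>The derivative is O(N_k^(1-\<delta>)) and the cells have length O(N_k^(\<delta>/2-1)),
  so the sums are constant on cells up to N_k^(-\<delta>/2). Their values at the left endpoints form
  the vectors \<open>c k\<close>; a block costs \<delta>/4 more, and \<open>decay\<close> applied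
  with \<delta>/4 yields the denominator 256 = 4 * 64.\<close>

lemma bsum_bound:
  fixes \<rho> :: real
  assumes rho: "0 < \<rho>" "\<rho> \<le> 1"
  defines "\<delta> \<equiv> \<rho> * min \<theta> 1 / 24"
  obtains C where "C > 0" "\<And>M \<psi> G G' k \<alpha> x. coboundary_data T \<rho> M \<psi> G G' \<Longrightarrow> \<alpha> \<in> A \<Longrightarrow> x \<in> cell (lev k) \<alpha> \<Longrightarrow>
    \<bar>bsum T (ns k) G \<alpha> x\<bar> \<le> C * N k powr (- (min \<sigma> 1 * \<delta> / 256)) * M"
proof -
  have t: "0 < min \<theta> 1" "min \<theta> 1 \<le> 1" using theta_pos by auto
  have "\<rho> * min \<theta> 1 \<le> 1 * 1" using rho t by (intro mult_mono) auto
  then have del: "0 < \<delta>" "\<delta> \<le> 1" using rho t by (auto simp: \<delta>_def)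
  have s1: "0 < min \<sigma> 1" "min \<sigma> 1 \<le> 1" using sigma_pos by auto
  have sd: "0 < min \<sigma> 1 * \<delta>" "min \<sigma> 1 * \<delta> \<le> \<delta>" using s1 del by (auto simp: mult_le_cancel_right2)
  obtain Cd where Cd: "Cd > 0" "\<And>M \<psi> G G' k \<alpha> x. coboundary_data T \<rho> M \<psi> G G' \<Longrightarrow> \<alpha> \<in> A \<Longrightarrow> x \<in> cell (lev k) \<alpha> \<Longrightarrow>
    \<bar>bsum T (ns k) G' \<alpha> x\<bar> \<le> Cd * N k powr (1 - \<delta>) * M"
    using deriv_bound[OF rho] unfolding \<delta>_def by blast
  obtain L where L: "L > 0" "\<And>k. len k \<le> L * N k powr (\<delta> / 2 - 1)" using len_bound[of "\<delta> / 2"] del by auto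
  obtain B where B: "B > 0" "\<And>k. b k \<le> B * N k powr (\<delta> / 4)" using roth_b[of "\<delta> / 4"] del by auto
  obtain Cc where Cc: "Cc > 0" "\<And>M c k \<alpha>. 0 \<le> M \<Longrightarrow> (\<And>k. c k \<in> vecs A) \<Longrightarrow>
    (\<And>\<alpha>. \<alpha> \<in> A \<Longrightarrow> (\<lambda>k. c k \<alpha>) \<longlonglongrightarrow> 0) \<Longrightarrow>
    (\<And>k \<alpha>. \<alpha> \<in> A \<Longrightarrow> \<bar>c (Suc k) \<alpha> - tr k (Suc k) (c k) \<alpha>\<bar> \<le> M * N k powr (- (\<delta> / 4))) \<Longrightarrow>
    (\<And>\<alpha>. \<alpha> \<in> A \<Longrightarrow> \<bar>c 0 \<alpha>\<bar> \<le> M) \<Longrightarrow> \<alpha> \<in> A \<Longrightarrow> \<bar>c k \<alpha>\<bar> \<le> Cc * M * N k powr (- (min \<sigma> 1 * (\<delta> / 4) / 64))"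
  proof -
    have "0 < \<delta> / 4" "\<delta> / 4 \<le> 1" using del by auto
    from decay[OF this] show ?thesis using that by blast
  qed
  define D where "D = B * Cd * L + 2"
  have D: "0 < D" "B * Cd * L \<le> D" "2 \<le> D" using B Cd L by (auto simp: D_def add_pos_pos)
  show ?thesis
  proof (rule that[of "Cc * D + Cd * L"])
    show "Cc * D + Cd * L > 0" using Cc D Cd L by (simp add: add_pos_pos)
    fix M \<psi> G G' k \<alpha> x
    assume cd: "coboundary_data T \<rho> M \<psi> G G'" and a: "\<alpha> \<in> A" and x: "x \<in> cell (lev k) \<alpha>"
    note cD = coboundary_dataD[OF cd]
    have M: "0 \<le> M" by (rule cD(2))
    define F where "F k = bsum T (ns k) G" for k
    define c where "c k \<alpha> = (if \<alpha> \<in> A then F k \<alpha> (top_left (lev k) \<alpha>) else 0)" for k \<alpha>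
    have osc: "\<bar>F k \<alpha> x - c k \<alpha>\<bar> \<le> Cd * L * M * N k powr (- (\<delta> / 2))" if a: "\<alpha> \<in> A" and x: "x \<in> cell (lev k) \<alpha>" for k \<alpha> x
    proof -
      have "norm (F k \<alpha> x - F k \<alpha> (top_left (lev k) \<alpha>)) \<le> (Cd * N k powr (1 - \<delta>) * M) * norm (x - top_left (lev k) \<alpha>)"
        using cD(5)[OF a, of _ "ns k"] Cd(2)[OF cd a] x top_left_cell[OF a, of k]
        by (intro field_differentiable_bound[where S = "cell (lev k) \<alpha>" and f' = "bsum T (ns k) G' \<alpha>"])
           (auto simp: F_def lev_def cell_def[of _ \<alpha>])
      also have "\<dots> \<le> (Cd * N k powr (1 - \<delta>) * M) * (L * N k powr (\<delta> / 2 - 1))"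
      proof (intro mult_left_mono)
        have "\<bar>x - top_left (lev k) \<alpha>\<bar> \<le> len k"
          using cell_diam[OF x top_left_cell[OF a]] wd_le_len[OF a, of k] by (simp add: wd_def)
        then show "norm (x - top_left (lev k) \<alpha>) \<le> L * N k powr (\<delta> / 2 - 1)" using L(2)[of k] by simp
      qed (use Cd M in simp)
      also have "\<dots> = Cd * L * M * (N k powr (1 - \<delta>) * N k powr (\<delta> / 2 - 1))" by simp
      also have "N k powr (1 - \<delta>) * N k powr (\<delta> / 2 - 1) = N k powr (- (\<delta> / 2))" by (simp add: powr_add[symmetric])
      finally show ?thesis using a by (simp add: c_def)
    qed
    have cv: "c k \<in> vecs A" for k by (simp add: vecs_def c_def)
    have val: "c k \<alpha> = \<psi> (top_left (lev k) \<alpha> + shift (lev k) \<alpha>) - \<psi> (top_left (lev k) \<alpha>)" if "\<alpha> \<in> A" for k \<alpha>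
      using cD(4)[OF that, of "top_left (lev k) \<alpha>" "ns k"] top_left_cell[OF that, of k] that
      by (simp add: c_def F_def lev_def)
    have lim: "(\<lambda>k. c k \<alpha>) \<longlonglongrightarrow> 0" if al: "\<alpha> \<in> A" for \<alpha>
    proof -
      have "(\<lambda>k. \<psi> (top_left (lev k) \<alpha> + shift (lev k) \<alpha>) - \<psi> (top_left (lev k) \<alpha>)) \<longlonglongrightarrow> \<psi> (left_end T) - \<psi> (left_end T)"
        using cell_subset[OF good_lev _ top_left_cell[OF al]] al
        by (intro tendsto_diff psi_tendsto_left cD(1)) (auto simp: alphabet_lev lev_left_end)
      then show ?thesis using val[OF al] by simp
    qed
    have err: "\<bar>c (Suc k) \<alpha> - tr k (Suc k) (c k) \<alpha>\<bar> \<le> (D * M) * N k powr (- (\<delta> / 4))" if al: "\<alpha> \<in> A" for k \<alpha>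
    proof -
      have F': "F (Suc k) = bsum (lev k) (ns (Suc k) - ns k) (F k)"
        using bsum_add[of T "ns k" "ns (Suc k) - ns k" G] ns_mono[of k "Suc k"] by (simp add: F_def lev_def)
      have l': "lev (Suc k) = rv (lev k) (ns (Suc k) - ns k)" using ns_mono[of k "Suc k"] by (simp add: lev_def rv_rv)
      have "\<bar>F (Suc k) \<alpha> (top_left (lev (Suc k)) \<alpha>) - tr k (Suc k) (c k) \<alpha>\<bar> \<le> tr k (Suc k) (\<lambda>_. Cd * L * M * N k powr (- (\<delta> / 2))) \<alpha>"
        unfolding F' tr_def using osc al top_left_cell[OF al, of "Suc k"] unfolding l'
        by (intro bsum_approx[OF good_lev[of k]]) (auto simp: alphabet_lev)
      also have "\<dots> \<le> b k * (Cd * L * M * N k powr (- (\<delta> / 2)))"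
        using tr_bound[of k "Suc k" "\<lambda>_. Cd * L * M * N k powr (- (\<delta> / 2))" "Cd * L * M * N k powr (- (\<delta> / 2))" \<alpha>] al Cd L M
        by (simp add: b_def)
      also have "\<dots> \<le> (B * N k powr (\<delta> / 4)) * (Cd * L * M * N k powr (- (\<delta> / 2)))"
        using B(2)[of k] Cd L M by (intro mult_right_mono) auto
      also have "\<dots> = B * Cd * L * M * (N k powr (\<delta> / 4) * N k powr (- (\<delta> / 2)))" by simp
      also have "N k powr (\<delta> / 4) * N k powr (- (\<delta> / 2)) = N k powr (- (\<delta> / 4))" by (simp add: powr_add[symmetric])
      also have "B * Cd * L * M * N k powr (- (\<delta> / 4)) \<le> D * M * N k powr (- (\<delta> / 4))"
        using D(2) M by (intro mult_right_mono) auto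
      finally have fin_err: "\<bar>F (Suc k) \<alpha> (top_left (lev (Suc k)) \<alpha>) - tr k (Suc k) (c k) \<alpha>\<bar> \<le> D * M * N k powr (- (\<delta> / 4))" .
      have "c (Suc k) \<alpha> = F (Suc k) \<alpha> (top_left (lev (Suc k)) \<alpha>)" using al by (simp add: c_def)
      then show ?thesis using fin_err by (simp only:)
    qed
    have c0: "\<bar>c 0 \<alpha>\<bar> \<le> D * M" if al: "\<alpha> \<in> A" for \<alpha>
    proof -
      have "\<bar>c 0 \<alpha>\<bar> \<le> 2 * M"
        using val[OF al, of 0] cell_subset[OF good_T al, of "top_left T \<alpha>"] top_left_cell[OF al, of 0]
          cD(3)[of "top_left T \<alpha>"] cD(3)[of "top_left T \<alpha> + shift T \<alpha>"] by (simp add: lev_0)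
      also have "\<dots> \<le> D * M" using D(3) M by (intro mult_right_mono) auto
      finally show ?thesis .
    qed
    have "\<bar>c k \<alpha>\<bar> \<le> Cc * (D * M) * N k powr (- (min \<sigma> 1 * (\<delta> / 4) / 64))"
      using D M by (intro Cc(2)[where c = c] cv lim err c0 a) auto
    moreover have "Cd * L * M * N k powr (- (\<delta> / 2)) \<le> Cd * L * M * N k powr (- (min \<sigma> 1 * \<delta> / 256))"
      using sd del N_ge_1[of k] Cd L M by (intro mult_left_mono powr_mono) auto
    ultimately have "\<bar>F k \<alpha> x\<bar> \<le> Cc * (D * M) * N k powr (- (min \<sigma> 1 * \<delta> / 256)) + Cd * L * M * N k powr (- (min \<sigma> 1 * \<delta> / 256))"
      using osc[OF a x] by simp
    then show "\<bar>bsum T (ns k) G \<alpha> x\<bar> \<le> (Cc * D + Cd * L) * N k powr (- (min \<sigma> 1 * \<delta> / 256)) * M"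
      by (simp add: F_def algebra_simps)
  qed
qed

text \<open>At each elementary step a point in the part cut off is replaced by its preimage in the
  new base, which changes \<psi> by one value of the current Birkhoff sum; other points
  stay.\<close>

lemma descend:
  assumes cd: "coboundary_data T \<rho> M \<psi> G G'" and h: "\<And>i \<alpha> x. \<alpha> \<in> A \<Longrightarrow> x \<in> cell (lev i) \<alpha> \<Longrightarrow> \<bar>bsum T (ns i) G \<alpha> x\<bar> \<le> h i"
    and h0: "\<And>i. 0 \<le> h i" and x: "x \<in> {left_end T..right_end (lev k)}"
  shows "\<exists>y\<in>{left_end T..right_end (lev (k + J))}. \<bar>\<psi> x - \<psi> y\<bar> \<le> (\<Sum>i\<in>{k..<k + J}. d * (b i)\<^sup>2 * h i)"
proof (induction J)
  case 0
  then show ?case using x by auto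
next
  case (Suc J)
  define i where "i = k + J"
  obtain y where y: "y \<in> {left_end T..right_end (lev i)}" "\<bar>\<psi> x - \<psi> y\<bar> \<le> (\<Sum>i\<in>{k..<k + J}. d * (b i)\<^sup>2 * h i)"
    using Suc by (auto simp: i_def)
  have "\<exists>z\<in>{left_end T..right_end (rv T (ns i + n))}. \<bar>\<psi> y - \<psi> z\<bar> \<le> real n * (b i * h i)" if "n \<le> ns (Suc i) - ns i" for n
    using that
  proof (induction n)
    case 0
    then show ?case using y(1) by (auto simp: lev_def)
  next
    case (Suc n)
    then obtain z where z: "z \<in> {left_end T..right_end (rv T (ns i + n))}" "\<bar>\<psi> y - \<psi> z\<bar> \<le> real n * (b i * h i)" by auto
    let ?S = "rv T (ns i + n)"
    have gS: "good ?S" using good_rv[OF good_T] .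
    have bh: "0 \<le> b i * h i" using h0 one_le_b[of i] by simp
    show ?case
    proof (cases "z \<le> right_end (rauzy_step ?S)")
      case True
      then show ?thesis using z bh by (intro bexI[of _ z]) (auto simp: algebra_simps)
    next
      case False
      define z' where "z' = z - shift ?S (bot_last ?S)"
      have c: "z' \<in> cell (rauzy_step ?S) (loser ?S)" "z' \<in> cell ?S (bot_last ?S)"
        using tail_cell[OF gS, of z] False z(1) by (auto simp: z'_def)
      have bl: "bot_last ?S \<in> A" using good_last(2)[OF gS] by (simp add: rv_alphabet[OF good_T])
      have "z' \<in> {left_end T..right_end (rauzy_step ?S)}"
        using cell_subset(1)[OF good_rauzy_step[OF gS] _ c(1)] winner_loser(2)[OF gS]
        by (simp add: rauzy_step_alphabet[OF gS] rauzy_step_left_end[OF gS] rv_left_end[OF good_T])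
      moreover have "\<bar>\<psi> z - \<psi> z'\<bar> \<le> b i * h i"
        using intermediate_bsum[of i G "h i" n "bot_last ?S" z'] h h0 Suc.prems bl c(2)
          coboundary_dataD(4)[OF cd bl c(2)] by (simp add: z'_def)
      ultimately show ?thesis using z(2) by (intro bexI[of _ z']) (auto simp: algebra_simps)
    qed
  qed
  from this[of "ns (Suc i) - ns i"]
  obtain z where z: "z \<in> {left_end T..right_end (lev (Suc i))}" "\<bar>\<psi> y - \<psi> z\<bar> \<le> real (ns (Suc i) - ns i) * (b i * h i)"
    using ns_mono[of i "Suc i"] by (auto simp: lev_def)
  have "real (ns (Suc i) - ns i) * (b i * h i) \<le> (d * b i) * (b i * h i)"
    using step_count[of i] h0 one_le_b[of i] by (intro mult_right_mono) auto
  also have "\<dots> = d * (b i)\<^sup>2 * h i" by (simp add: power2_eq_square)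
  finally show ?case using y(2) z by (intro bexI[of _ z]) (auto simp: i_def)
qed

text \<open>Iterates \<open>floors_step\<close> backwards. The Lipschitz constants are bounds for
  the derivatives of the Birkhoff sums at the intermediate steps, and \<open>step_count\<close>
  bounds how many of them occur.\<close>

lemma floors_level:
  assumes cd: "coboundary_data T \<rho> M \<psi> G G'" and h: "\<And>i \<alpha> x. \<alpha> \<in> A \<Longrightarrow> x \<in> cell (lev i) \<alpha> \<Longrightarrow> \<bar>bsum T (ns i) G' \<alpha> x\<bar> \<le> h i"
    and h0: "\<And>i. 0 \<le> h i" and l0: "0 \<le> l" and F: "floors (lev k) \<psi> l D"
  shows "floors T \<psi> l (D + l * (\<Sum>i<k. d * (b i)\<^sup>2 * h i))"
  using F
proof (induction k arbitrary: D)
  case 0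
  then show ?case by (simp add: lev_0)
next
  case (Suc i)
  have "floors (rv T (ns (Suc i) - n)) \<psi> l (D + l * (real n * (b i * h i)))" if "n \<le> ns (Suc i) - ns i" for n
    using that
  proof (induction n)
    case 0
    then show ?case using Suc.prems by (simp add: lev_def)
  next
    case (Suc n)
    define m where "m = ns (Suc i) - Suc n - ns i"
    have m: "ns (Suc i) - Suc n = ns i + m" "ns (Suc i) - n = Suc (ns i + m)" "m \<le> ns (Suc i) - ns i"
      using Suc.prems ns_mono[of i "Suc i"] by (auto simp: m_def)
    let ?S = "rv T (ns i + m)"
    have gS: "good ?S" using good_rv[OF good_T] .
    have bl: "bot_last ?S \<in> A" using good_last(2)[OF gS] by (simp add: rv_alphabet[OF good_T])
    have bh: "0 \<le> b i * h i" using h0 one_le_b[of i] by simp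
    have "floors ?S \<psi> l ((D + l * (real n * (b i * h i))) + l * (b i * h i))"
    proof (rule floors_step[OF gS _ bh])
      show "floors (rauzy_step ?S) \<psi> l (D + l * (real n * (b i * h i)))" using Suc m(2) by simp
      fix x y assume xy: "x \<in> cell ?S (bot_last ?S)" "y \<in> cell ?S (bot_last ?S)"
      have "norm (bsum T (ns i + m) G (bot_last ?S) x - bsum T (ns i + m) G (bot_last ?S) y) \<le> (b i * h i) * norm (x - y)"
        using coboundary_dataD(5)[OF cd bl, of _ "ns i + m"] intermediate_bsum[of i G' "h i" m "bot_last ?S"] h h0 m(3) bl xy
        by (intro field_differentiable_bound[where S = "cell ?S (bot_last ?S)" and f' = "bsum T (ns i + m) G' (bot_last ?S)"])
           (auto simp: cell_def[of _ "bot_last ?S"])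
      then show "\<bar>(\<psi> (x + shift ?S (bot_last ?S)) - \<psi> x) - (\<psi> (y + shift ?S (bot_last ?S)) - \<psi> y)\<bar> \<le> b i * h i * \<bar>x - y\<bar>"
        using coboundary_dataD(4)[OF cd bl xy(1)] coboundary_dataD(4)[OF cd bl xy(2)] by simp
    qed
    then show ?case using m(1) by (simp add: algebra_simps)
  qed
  from this[of "ns (Suc i) - ns i"]
  have 1: "floors (lev i) \<psi> l (D + l * (real (ns (Suc i) - ns i) * (b i * h i)))"
    using ns_mono[of i "Suc i"] by (simp add: lev_def)
  have "real (ns (Suc i) - ns i) * (b i * h i) \<le> (d * b i) * (b i * h i)"
    using step_count[of i] h0 one_le_b[of i] by (intro mult_right_mono) auto
  then have "D + l * (real (ns (Suc i) - ns i) * (b i * h i)) \<le> D + l * (d * (b i)\<^sup>2 * h i)"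
    using l0 by (intro add_left_mono mult_left_mono) (auto simp: power2_eq_square mult_ac)
  then have "floors (lev i) \<psi> l (D + l * (d * (b i)\<^sup>2 * h i))"
    using 1 unfolding floors_def by (meson order_trans)
  from Suc.IH[OF this] show ?case by (simp add: algebra_simps)
qed

end

section \<open>The H\<ouml>lder estimate\<close>

context roth begin

text \<open>Descending to the left endpoint bounds the oscillation of \<psi> on I(n_k) by a
  convergent sum starting at level k. The floors are then used at the scale
  \<open>len (Suc k)\<close>, which no cell of level k falls below. The Lipschitz terms add up to
  N_k^(1-\<delta>/2), and multiplied by this scale they are O(N_k^(-\<delta>/4)).\<close>

lemma local_modulus:
  fixes \<rho> :: real
  assumes rho: "0 < \<rho>" "\<rho> \<le> 1"
  defines "\<gamma> \<equiv> min \<sigma> 1 * (\<rho> * min \<theta> 1 / 24) / 256"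
  obtains C where "C > 0" "\<And>M \<psi> G G' k x y. coboundary_data T \<rho> M \<psi> G G' \<Longrightarrow>
    x \<in> {left_end T..right_end T} \<Longrightarrow> y \<in> {left_end T..right_end T} \<Longrightarrow> \<bar>x - y\<bar> \<le> len (Suc k) \<Longrightarrow>
    \<bar>\<psi> x - \<psi> y\<bar> \<le> C * M * N k powr (- (\<gamma> / 2))"
proof -
  define \<delta> where "\<delta> = \<rho> * min \<theta> 1 / 24"
  have t: "0 < min \<theta> 1" "min \<theta> 1 \<le> 1" using theta_pos by auto
  have "\<rho> * min \<theta> 1 \<le> 1 * 1" using rho t by (intro mult_mono) auto
  then have del: "0 < \<delta>" "\<delta> \<le> 1" using rho t by (auto simp: \<delta>_def)
  have s1: "0 < min \<sigma> 1" "min \<sigma> 1 \<le> 1" using sigma_pos by auto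
  then have gam: "0 < \<gamma>" "\<gamma> / 2 \<le> \<delta> / 4"
    using del mult_right_mono[of "min \<sigma> 1" 1 \<delta>] by (auto simp: \<gamma>_def \<delta>_def[symmetric])
  obtain Cb where Cb: "Cb > 0" "\<And>M \<psi> G G' k \<alpha> x. coboundary_data T \<rho> M \<psi> G G' \<Longrightarrow> \<alpha> \<in> A \<Longrightarrow> x \<in> cell (lev k) \<alpha> \<Longrightarrow>
    \<bar>bsum T (ns k) G \<alpha> x\<bar> \<le> Cb * N k powr (- \<gamma>) * M"
    using bsum_bound[OF rho] unfolding \<gamma>_def by blast
  obtain Cd where Cd: "Cd > 0" "\<And>M \<psi> G G' k \<alpha> x. coboundary_data T \<rho> M \<psi> G G' \<Longrightarrow> \<alpha> \<in> A \<Longrightarrow> x \<in> cell (lev k) \<alpha> \<Longrightarrow>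
    \<bar>bsum T (ns k) G' \<alpha> x\<bar> \<le> Cd * N k powr (1 - \<delta>) * M"
    using deriv_bound[OF rho] unfolding \<delta>_def by blast
  obtain B1 where B1: "B1 > 0" "\<And>k. (b k)\<^sup>2 \<le> B1 * N k powr (\<gamma> / 2)" using b_square[of "\<gamma> / 2"] gam by auto
  obtain B2 where B2: "B2 > 0" "\<And>k. (b k)\<^sup>2 \<le> B2 * N k powr (\<delta> / 2)" using b_square[of "\<delta> / 2"] del by auto
  obtain L where L: "L > 0" "\<And>k. len k \<le> L * N k powr (\<delta> / 4 - 1)" using len_bound[of "\<delta> / 4"] del by auto
  define S1 where "S1 = 2 / (1 - 2 powr (- (\<gamma> / 2)))"
  define S2 where "S2 = 2 / (1 - 2 powr (- (1 - \<delta> / 2)))"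
  have q: "2 powr (- (\<gamma> / 2)) < (1::real)" "2 powr (- (1 - \<delta> / 2)) < (1::real)" using gam del by (simp_all add: powr_less_one)
  have S: "0 < S1" "0 < S2" using q by (auto simp: S1_def S2_def)
  define C1 where "C1 = d * B1 * Cb * S1"
  define C2 where "C2 = L * (d * B2 * Cd * S2)"
  have C: "0 < C1" "0 < C2" using two_le_d B1 Cb S L B2 Cd by (auto simp: C1_def C2_def)
  show ?thesis
  proof (rule that[of "2 * (2 * C1 + C2)"])
    show "2 * (2 * C1 + C2) > 0" using C by simp
    fix M \<psi> G G' k x y
    assume cd: "coboundary_data T \<rho> M \<psi> G G'" and xy: "x \<in> {left_end T..right_end T}" "y \<in> {left_end T..right_end T}" "\<bar>x - y\<bar> \<le> len (Suc k)"
    note cD = coboundary_dataD[OF cd]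
    have M: "0 \<le> M" by (rule cD(2))
    have osc: "\<bar>\<psi> x - \<psi> (left_end T)\<bar> \<le> C1 * M * N k powr (- (\<gamma> / 2))" if x: "x \<in> {left_end T..right_end (lev k)}" for x
    proof -
      have s: "(\<Sum>i\<in>{k..<k + J}. d * (b i)\<^sup>2 * (Cb * N i powr (- \<gamma>) * M)) \<le> C1 * M * N k powr (- (\<gamma> / 2))" for J
      proof -
        have "(\<Sum>i\<in>{k..<k + J}. d * (b i)\<^sup>2 * (Cb * N i powr (- \<gamma>) * M)) \<le> (\<Sum>i\<in>{k..<k + J}. d * B1 * Cb * M * N i powr (- (\<gamma> / 2)))"
        proof (intro sum_mono)
          fix i
          have "d * (b i)\<^sup>2 * (Cb * N i powr (- \<gamma>) * M) \<le> d * (B1 * N i powr (\<gamma> / 2)) * (Cb * N i powr (- \<gamma>) * M)"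
            using B1(2)[of i] two_le_d Cb M by (intro mult_right_mono mult_left_mono) auto
          also have "\<dots> = d * B1 * Cb * M * (N i powr (\<gamma> / 2) * N i powr (- \<gamma>))" by simp
          also have "N i powr (\<gamma> / 2) * N i powr (- \<gamma>) = N i powr (- (\<gamma> / 2))" by (simp add: powr_add[symmetric])
          finally show "d * (b i)\<^sup>2 * (Cb * N i powr (- \<gamma>) * M) \<le> d * B1 * Cb * M * N i powr (- (\<gamma> / 2))" .
        qed
        also have "\<dots> \<le> d * B1 * Cb * M * (S1 * N k powr (- (\<gamma> / 2)))"
          unfolding sum_distrib_left[symmetric] S1_def
          using sum_neg_powr[of "\<gamma> / 2" k "k + J"] gam two_le_d B1 Cb M by (intro mult_left_mono) auto
        finally show ?thesis by (simp add: C1_def mult_ac)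
      qed
      have "\<exists>y\<in>{left_end T..right_end (lev (k + J))}. \<bar>\<psi> x - \<psi> y\<bar> \<le> C1 * M * N k powr (- (\<gamma> / 2))" for J
      proof -
        have "\<exists>y\<in>{left_end T..right_end (lev (k + J))}. \<bar>\<psi> x - \<psi> y\<bar> \<le>
            (\<Sum>i\<in>{k..<k + J}. d * (b i)\<^sup>2 * (Cb * N i powr (- \<gamma>) * M))"
          by (rule descend[OF cd Cb(2)[OF cd] _ x]) (use Cb(1) M in simp_all)
        then show ?thesis using s[of J] by (meson order_trans)
      qed
      then obtain z where z: "\<And>J. z J \<in> {left_end T..right_end (lev (k + J))}" "\<And>J. \<bar>\<psi> x - \<psi> (z J)\<bar> \<le> C1 * M * N k powr (- (\<gamma> / 2))"
        by metis
      \<comment> \<open>Reindexed by the level, as \<open>psi_tendsto_left\<close> expects; the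
        finitely many values below \<open>k\<close> are arbitrary.\<close>
      define z' where "z' n = (if k \<le> n then z (n - k) else left_end T)" for n
      have "z' n \<in> {left_end T..right_end (lev n)}" for n
        using z(1)[of "n - k"] good_facts(7)[OF good_lev[of n]] by (auto simp: z'_def lev_left_end)
      then have "(\<lambda>n. \<psi> (z' n)) \<longlonglongrightarrow> \<psi> (left_end T)" by (rule psi_tendsto_left[OF cD(1)])
      then have "(\<lambda>n. \<bar>\<psi> x - \<psi> (z' n)\<bar>) \<longlonglongrightarrow> \<bar>\<psi> x - \<psi> (left_end T)\<bar>" by (intro tendsto_intros)
      then show ?thesis
      proof (rule LIMSEQ_le_const2, intro exI allI impI)
        fix n assume "k \<le> n"
        then show "\<bar>\<psi> x - \<psi> (z' n)\<bar> \<le> C1 * M * N k powr (- (\<gamma> / 2))" using z(2)[of "n - k"] by (simp add: z'_def)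
      qed
    qed
    have "floors (lev k) \<psi> (len (Suc k)) (2 * (C1 * M * N k powr (- (\<gamma> / 2))))"
      using len_Suc_le_wd[of _ k] osc by (intro floors_base[OF good_lev]) (auto simp: alphabet_lev wd_def lev_left_end)
    then have "floors T \<psi> (len (Suc k)) (2 * (C1 * M * N k powr (- (\<gamma> / 2))) +
        len (Suc k) * (\<Sum>i<k. d * (b i)\<^sup>2 * (Cd * N i powr (1 - \<delta>) * M)))"
      using Cd(2)[OF cd] Cd(1) M len_pos[of "Suc k"] by (intro floors_level[OF cd]) (auto simp: less_imp_le)
    then have "\<bar>\<psi> x - \<psi> y\<bar> \<le> 2 * (2 * (C1 * M * N k powr (- (\<gamma> / 2))) +
        len (Suc k) * (\<Sum>i<k. d * (b i)\<^sup>2 * (Cd * N i powr (1 - \<delta>) * M)))"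
      by (rule floors_modulus[OF _ xy])
    also have "len (Suc k) * (\<Sum>i<k. d * (b i)\<^sup>2 * (Cd * N i powr (1 - \<delta>) * M)) \<le>
        (L * N k powr (\<delta> / 4 - 1)) * (d * B2 * Cd * M * (S2 * N k powr (1 - \<delta> / 2)))"
    proof (intro mult_mono)
      obtain \<alpha> where a: "\<alpha> \<in> A" using A_nonempty by blast
      show "len (Suc k) \<le> L * N k powr (\<delta> / 4 - 1)"
        using len_Suc_le_wd[OF a, of k] wd_le_len[OF a, of k] L(2)[of k] by linarith
      have "(\<Sum>i<k. d * (b i)\<^sup>2 * (Cd * N i powr (1 - \<delta>) * M)) \<le> (\<Sum>i<k. d * B2 * Cd * M * N i powr (1 - \<delta> / 2))"
      proof (intro sum_mono)
        fix i
        have "d * (b i)\<^sup>2 * (Cd * N i powr (1 - \<delta>) * M) \<le> d * (B2 * N i powr (\<delta> / 2)) * (Cd * N i powr (1 - \<delta>) * M)"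
          using B2(2)[of i] two_le_d Cd M by (intro mult_right_mono mult_left_mono) auto
        also have "\<dots> = d * B2 * Cd * M * (N i powr (\<delta> / 2) * N i powr (1 - \<delta>))" by simp
        also have "N i powr (\<delta> / 2) * N i powr (1 - \<delta>) = N i powr (1 - \<delta> / 2)" by (simp add: powr_add[symmetric])
        finally show "d * (b i)\<^sup>2 * (Cd * N i powr (1 - \<delta>) * M) \<le> d * B2 * Cd * M * N i powr (1 - \<delta> / 2)" .
      qed
      also have "\<dots> \<le> d * B2 * Cd * M * (S2 * N k powr (1 - \<delta> / 2))"
        unfolding sum_distrib_left[symmetric] S2_def
        using sum_pos_powr[of "1 - \<delta> / 2" k] del two_le_d B2 Cd M by (intro mult_left_mono) auto
      finally show "(\<Sum>i<k. d * (b i)\<^sup>2 * (Cd * N i powr (1 - \<delta>) * M)) \<le> d * B2 * Cd * M * (S2 * N k powr (1 - \<delta> / 2))" .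
    qed (use L two_le_d Cd M in \<open>auto intro!: sum_nonneg mult_nonneg_nonneg\<close>)
    also have "(L * N k powr (\<delta> / 4 - 1)) * (d * B2 * Cd * M * (S2 * N k powr (1 - \<delta> / 2))) =
        C2 * M * (N k powr (\<delta> / 4 - 1) * N k powr (1 - \<delta> / 2))" by (simp add: C2_def mult_ac)
    also have "N k powr (\<delta> / 4 - 1) * N k powr (1 - \<delta> / 2) = N k powr (- (\<delta> / 4))" by (simp add: powr_add[symmetric])
    also have "C2 * M * N k powr (- (\<delta> / 4)) \<le> C2 * M * N k powr (- (\<gamma> / 2))"
      using gam N_ge_1[of k] C M by (intro mult_left_mono powr_mono) auto
    finally show "\<bar>\<psi> x - \<psi> y\<bar> \<le> 2 * (2 * C1 + C2) * M * N k powr (- (\<gamma> / 2))"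
      by (simp add: algebra_simps)
  qed
qed

text \<open>For the distance t choose k with t N(k+1) \<le> \<open>len 0\<close> < t N(k+2). By
  \<open>len_0_le\<close> the first inequality brings t below \<open>len (Suc k)\<close>, so
  \<open>local_modulus\<close> applies. The second one, with N(k+2) at most a constant times N(k)^4,
  converts the rate \<gamma>/2 in N_k into the exponent \<gamma>/8 in t.\<close>

lemma holder_estimate:
  fixes \<rho> :: real
  assumes rho: "0 < \<rho>" "\<rho> \<le> 1"
  defines "\<gamma> \<equiv> min \<sigma> 1 * (\<rho> * min \<theta> 1 / 24) / 256"
  obtains C where "C > 0" "\<And>M \<psi> G G' x y. coboundary_data T \<rho> M \<psi> G G' \<Longrightarrow>
    x \<in> {left_end T..right_end T} \<Longrightarrow> y \<in> {left_end T..right_end T} \<Longrightarrow>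
    \<bar>\<psi> x - \<psi> y\<bar> \<le> C * M * \<bar>x - y\<bar> powr (\<gamma> / 8)"
proof -
  have gam: "0 < \<gamma>" using rho theta_pos sigma_pos by (simp add: \<gamma>_def)
  obtain C1 where C1: "C1 > 0" "\<And>M \<psi> G G' k x y. coboundary_data T \<rho> M \<psi> G G' \<Longrightarrow>
    x \<in> {left_end T..right_end T} \<Longrightarrow> y \<in> {left_end T..right_end T} \<Longrightarrow> \<bar>x - y\<bar> \<le> len (Suc k) \<Longrightarrow>
    \<bar>\<psi> x - \<psi> y\<bar> \<le> C1 * M * N k powr (- (\<gamma> / 2))"
    using local_modulus[OF rho] unfolding \<gamma>_def by blast
  obtain Q where Q: "Q \<ge> 1" "\<And>k. N (Suc k) \<le> Q * (N k)\<^sup>2" using N_Suc_square by blast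
  define l0 where "l0 = len 0"
  have l0: "0 < l0" using len_pos by (simp add: l0_def)
  \<comment> \<open>For distances too large for such a level, where the supremum of \<psi> is
    enough.\<close>
  define C2 where "C2 = 2 * (N 1 / l0) powr (\<gamma> / 8)"
  define C3 where "C3 = C1 * (Q ^ 3 / l0) powr (\<gamma> / 8)"
  have C: "0 \<le> C2" "0 < C3" using C1 Q l0 by (auto simp: C2_def C3_def)
  show ?thesis
  proof (rule that[of "C2 + C3"])
    show "C2 + C3 > 0" using C by simp
    fix M \<psi> G G' x y
    assume cd: "coboundary_data T \<rho> M \<psi> G G'" and xy: "x \<in> {left_end T..right_end T}" "y \<in> {left_end T..right_end T}"
    note cD = coboundary_dataD[OF cd]
    have M: "0 \<le> M" by (rule cD(2))
    define t where "t = \<bar>x - y\<bar>"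
    have "\<bar>\<psi> x - \<psi> y\<bar> \<le> C2 * M * t powr (\<gamma> / 8) \<or> \<bar>\<psi> x - \<psi> y\<bar> \<le> C3 * M * t powr (\<gamma> / 8)"
    proof (cases "t = 0")
      case True
      then have "x = y" by (simp add: t_def)
      then show ?thesis by (simp add: t_def)
    next
      case False
      then have t: "0 < t" by (simp add: t_def)
      show ?thesis
      proof (cases "t * N 1 \<le> l0")
        case False
        then have "1 \<le> t * (N 1 / l0)" using l0 by (simp add: field_simps)
        then have "1 \<le> (t * (N 1 / l0)) powr (\<gamma> / 8)" using gam by (simp add: ge_one_powr_ge_zero)
        then have 1: "1 \<le> t powr (\<gamma> / 8) * (N 1 / l0) powr (\<gamma> / 8)" using t l0 N_pos[of 1] by (simp only: powr_mult)
        have "\<bar>\<psi> x - \<psi> y\<bar> \<le> 2 * M * 1" using cD(3)[OF xy(1)] cD(3)[OF xy(2)] by linarith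
        also have "\<dots> \<le> 2 * M * (t powr (\<gamma> / 8) * (N 1 / l0) powr (\<gamma> / 8))" using 1 M by (intro mult_left_mono) auto
        finally show ?thesis by (simp add: C2_def mult_ac)
      next
        case True
        have "\<exists>n. \<not> t * N (Suc n) \<le> l0"
        proof -
          have "eventually (\<lambda>n. l0 / t + 1 \<le> N n) sequentially" using N_at_top by (simp add: filterlim_at_top)
          then obtain n0 where n0: "\<And>n. n \<ge> n0 \<Longrightarrow> l0 / t + 1 \<le> N n" unfolding eventually_sequentially by blast
          have "l0 / t < N (Suc n0)" using n0[of "Suc n0"] by simp
          then have "l0 < t * N (Suc n0)" using t by (simp add: field_simps)
          then show ?thesis by (intro exI[of _ n0]) simp
        qed
        define n where "n = (LEAST n. \<not> t * N (Suc n) \<le> l0)"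
        have n: "\<not> t * N (Suc n) \<le> l0" unfolding n_def by (rule LeastI_ex) fact
        have "n \<noteq> 0"
        proof
          assume "n = 0"
          then show False using n True by simp
        qed
        then obtain k where k: "n = Suc k" using not0_implies_Suc by blast
        have "t * N (Suc k) \<le> l0" using not_less_Least[of k "\<lambda>n. \<not> t * N (Suc n) \<le> l0"] k by (auto simp: n_def)
        also have "l0 \<le> N (Suc k) * len (Suc k)" unfolding l0_def by (rule len_0_le)
        finally have "t \<le> len (Suc k)" using N_pos[of "Suc k"] by (simp add: mult.commute)
        then have 1: "\<bar>\<psi> x - \<psi> y\<bar> \<le> C1 * M * N k powr (- (\<gamma> / 2))" unfolding t_def by (rule C1(2)[OF cd xy])
        have "N (Suc (Suc k)) \<le> Q * (N (Suc k))\<^sup>2" by (rule Q(2))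
        also have "\<dots> \<le> Q * (Q * (N k)\<^sup>2)\<^sup>2" using Q N_pos[of "Suc k"] by (intro mult_left_mono power_mono) auto
        also have "\<dots> = Q ^ 3 * N k ^ 4" by (simp add: power_mult_distrib power2_eq_square power3_eq_cube power4_eq_xxxx)
        finally have "l0 \<le> t * (Q ^ 3 * N k ^ 4)" using n t unfolding k by (meson less_imp_le mult_left_mono not_le order_trans)
        then have "l0 / (Q ^ 3 * t) \<le> N k ^ 4" using t Q by (simp add: field_simps)
        then have "(N k ^ 4) powr (- (\<gamma> / 8)) \<le> (l0 / (Q ^ 3 * t)) powr (- (\<gamma> / 8))"
          using l0 t Q gam by (intro powr_mono2') auto
        also have "(N k ^ 4) powr (- (\<gamma> / 8)) = N k powr (- (\<gamma> / 2))"
          using N_pos[of k] by (simp add: powr_realpow[symmetric] powr_powr del: powr_realpow powr_numeral)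
        also have "(l0 / (Q ^ 3 * t)) powr (- (\<gamma> / 8)) = (Q ^ 3 / l0 * t) powr (\<gamma> / 8)"
          using l0 t Q by (simp add: powr_minus_divide powr_divide powr_mult)
        also have "\<dots> = (Q ^ 3 / l0) powr (\<gamma> / 8) * t powr (\<gamma> / 8)" using l0 t Q by (intro powr_mult)
        finally have "C1 * M * N k powr (- (\<gamma> / 2)) \<le> C1 * M * ((Q ^ 3 / l0) powr (\<gamma> / 8) * t powr (\<gamma> / 8))"
          using C1(1) M by (intro mult_left_mono) auto
        then show ?thesis using 1 by (simp add: C3_def mult_ac)
      qed
    qed
    moreover have "0 \<le> C2 * M * t powr (\<gamma> / 8)" "0 \<le> C3 * M * t powr (\<gamma> / 8)" using C M by auto
    ultimately show "\<bar>\<psi> x - \<psi> y\<bar> \<le> (C2 + C3) * M * \<bar>x - y\<bar> powr (\<gamma> / 8)"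
      by (auto simp: t_def[symmetric] distrib_right)
  qed
qed

end

section \<open>Norms of function spaces and the passage from positions to letters\<close>

lemma Ck_on_continuous:
  assumes "f \<in> Ck_on k a b" "j \<le> k"
  shows "continuous_on {a..b} (nth_deriv a b j f)"
proof (cases "j = k")
  case True
  then show ?thesis using assms by (simp add: Ck_on_def)
next
  case False
  then have "\<forall>x\<in>{a..b}. (nth_deriv a b j f has_real_derivative nth_deriv a b (Suc j) f x) (at x within {a..b})"
    using assms unfolding Ck_on_def by auto
  then show ?thesis unfolding continuous_on_eq_continuous_within using DERIV_continuous by blast
qed

lemma holder_seminorm_props:
  assumes "holder_on s a b f"
  shows "\<And>x y. x \<in> {a..b} \<Longrightarrow> y \<in> {a..b} \<Longrightarrow> \<bar>f x - f y\<bar> \<le> holder_seminorm s a b f * \<bar>x - y\<bar> powr s"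
    and "a < b \<Longrightarrow> 0 \<le> holder_seminorm s a b f"
proof -
  let ?S = "{\<bar>f x - f y\<bar> / \<bar>x - y\<bar> powr s | x y. x \<in> {a..b} \<and> y \<in> {a..b} \<and> x \<noteq> y}"
  obtain M where M: "\<And>x y. x \<in> {a..b} \<Longrightarrow> y \<in> {a..b} \<Longrightarrow> \<bar>f x - f y\<bar> \<le> M * \<bar>x - y\<bar> powr s"
    using assms unfolding holder_on_def by blast
  have bdd: "bdd_above ?S"
  proof (rule bdd_aboveI)
    fix z assume "z \<in> ?S"
    then obtain x y where "x \<in> {a..b}" "y \<in> {a..b}" "x \<noteq> y" "z = \<bar>f x - f y\<bar> / \<bar>x - y\<bar> powr s" by blast
    then show "z \<le> M" using M[of x y] by (simp add: divide_le_eq)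
  qed
  show le: "\<bar>f x - f y\<bar> \<le> holder_seminorm s a b f * \<bar>x - y\<bar> powr s" if "x \<in> {a..b}" "y \<in> {a..b}" for x y
  proof (cases "x = y")
    case False
    have "\<bar>f x - f y\<bar> / \<bar>x - y\<bar> powr s \<le> holder_seminorm s a b f"
      unfolding holder_seminorm_def using that False by (intro cSup_upper bdd) blast
    then show ?thesis using False by (simp add: divide_le_eq)
  qed simp
  show "0 \<le> holder_seminorm s a b f" if "a < b"
  proof -
    have "0 \<le> \<bar>f a - f b\<bar> / \<bar>a - b\<bar> powr s" by simp
    moreover have "\<bar>f a - f b\<bar> / \<bar>a - b\<bar> powr s \<in> ?S" using that by (intro CollectI exI[of _ a] exI[of _ b]) auto
    then have "\<bar>f a - f b\<bar> / \<bar>a - b\<bar> powr s \<le> holder_seminorm s a b f"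
      unfolding holder_seminorm_def by (rule cSup_upper[OF _ bdd])
    ultimately show ?thesis by linarith
  qed
qed

text \<open>The suprema in the norm are genuine bounds because continuous functions on a compact
  interval are bounded; all summands being nonnegative, each is at most the norm.\<close>

lemma Cr_norm_bounds:
  assumes f: "f \<in> Cr_on r a b" and ab: "a < b"
  shows "\<And>j x. j \<le> nat \<lfloor>r\<rfloor> \<Longrightarrow> x \<in> {a..b} \<Longrightarrow> \<bar>nth_deriv a b j f x\<bar> \<le> Cr_norm r a b f"
    and "\<And>x y. r \<notin> \<int> \<Longrightarrow> x \<in> {a..b} \<Longrightarrow> y \<in> {a..b} \<Longrightarrow>
      \<bar>nth_deriv a b (nat \<lfloor>r\<rfloor>) f x - nth_deriv a b (nat \<lfloor>r\<rfloor>) f y\<bar> \<le> Cr_norm r a b f * \<bar>x - y\<bar> powr frac r"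
proof -
  let ?k = "nat \<lfloor>r\<rfloor>"
  let ?s = "\<lambda>j. Sup ((\<lambda>x. \<bar>nth_deriv a b j f x\<bar>) ` {a..b})"
  let ?h = "if r \<in> \<int> then 0 else holder_seminorm (frac r) a b (nth_deriv a b ?k f)"
  have fk: "f \<in> Ck_on ?k a b" and fh: "r \<notin> \<int> \<Longrightarrow> holder_on (frac r) a b (nth_deriv a b ?k f)"
    using f by (auto simp: Cr_on_def)
  have up: "\<bar>nth_deriv a b j f x\<bar> \<le> ?s j" if "j \<le> ?k" "x \<in> {a..b}" for j x
  proof (rule cSup_upper)
    have "compact ((\<lambda>x. \<bar>nth_deriv a b j f x\<bar>) ` {a..b})"
      using Ck_on_continuous[OF fk that(1)] by (intro compact_continuous_image continuous_intros) auto
    then show "bdd_above ((\<lambda>x. \<bar>nth_deriv a b j f x\<bar>) ` {a..b})"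
      by (intro bounded_imp_bdd_above compact_imp_bounded)
  qed (use that in auto)
  have s0: "0 \<le> ?s j" if "j \<le> ?k" for j using up[OF that, of a] ab by force
  have h0: "0 \<le> ?h" using holder_seminorm_props(2)[OF fh ab] by auto
  show "\<bar>nth_deriv a b j f x\<bar> \<le> Cr_norm r a b f" if "j \<le> ?k" "x \<in> {a..b}" for j x
  proof -
    have "?s j \<le> (\<Sum>j\<le>?k. ?s j)" using that s0 by (intro member_le_sum[where f = ?s]) auto
    then show ?thesis using up[OF that] h0 unfolding Cr_norm_def by linarith
  qed
  show "\<bar>nth_deriv a b ?k f x - nth_deriv a b ?k f y\<bar> \<le> Cr_norm r a b f * \<bar>x - y\<bar> powr frac r"
    if "r \<notin> \<int>" "x \<in> {a..b}" "y \<in> {a..b}" for x y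
  proof -
    have "?h \<le> Cr_norm r a b f" unfolding Cr_norm_def using sum_nonneg[of "{..?k}" ?s] s0 by auto
    then have "holder_seminorm (frac r) a b (nth_deriv a b ?k f) * \<bar>x - y\<bar> powr frac r \<le> Cr_norm r a b f * \<bar>x - y\<bar> powr frac r"
      using that(1) by (intro mult_right_mono) auto
    then show ?thesis using holder_seminorm_props(1)[OF fh[OF that(1)] that(2,3)] by linarith
  qed
qed

lemma Cr_on_deriv:
  assumes f: "f \<in> Cr_on r a b" and ab: "a < b" and r: "1 < r" and x: "x \<in> {a..b}"
  shows "(f has_real_derivative nth_deriv a b 1 f x) (at x within {a..b})"
    and "\<bar>nth_deriv a b 1 f x\<bar> \<le> Cr_norm r a b f"
    and "\<And>y. y \<in> {a..b} \<Longrightarrow> \<bar>nth_deriv a b 1 f x - nth_deriv a b 1 f y\<bar> \<le> Cr_norm r a b f * \<bar>x - y\<bar> powr min (r - 1) 1"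
proof -
  have k: "1 \<le> nat \<lfloor>r\<rfloor>" using r by linarith
  have fk: "f \<in> Ck_on (nat \<lfloor>r\<rfloor>) a b" using f by (simp add: Cr_on_def)
  have der: "(nth_deriv a b j f has_real_derivative nth_deriv a b (Suc j) f x) (at x within {a..b})"
    if "j < nat \<lfloor>r\<rfloor>" "x \<in> {a..b}" for j x using fk that unfolding Ck_on_def by blast
  show "(f has_real_derivative nth_deriv a b 1 f x) (at x within {a..b})"
    using der[of 0 x] r x by simp
  show "\<bar>nth_deriv a b 1 f x\<bar> \<le> Cr_norm r a b f" using Cr_norm_bounds(1)[OF f ab k x] .
  show "\<bar>nth_deriv a b 1 f x - nth_deriv a b 1 f y\<bar> \<le> Cr_norm r a b f * \<bar>x - y\<bar> powr min (r - 1) 1"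
    if y: "y \<in> {a..b}" for y
  proof (cases "2 \<le> r")
    case True
    then have k2: "2 \<le> nat \<lfloor>r\<rfloor>" by linarith
    have "norm (nth_deriv a b 1 f x - nth_deriv a b 1 f y) \<le> Cr_norm r a b f * norm (x - y)"
      using der[of 1] True k2 Cr_norm_bounds(1)[OF f ab, of 2] x y
      by (intro field_differentiable_bound[where S = "{a..b}" and f' = "nth_deriv a b 2 f"])
         (auto simp: numeral_2_eq_2)
    then show ?thesis using True by simp
  next
    case False
    then have fl: "\<lfloor>r\<rfloor> = 1" using r by linarith
    have "frac r = r - 1" by (simp add: frac_def fl)
    moreover have "r \<notin> \<int>" using \<open>frac r = r - 1\<close> r by (metis diff_gt_0_iff_gt frac_eq_0_iff less_irrefl)
    ultimately show ?thesis using Cr_norm_bounds(2)[OF f ab _ x y] False fl by simp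
  qed
qed

text \<open>Families are indexed by positions, the algorithm works with letters; these equations
  translate between the two.\<close>

lemma top_letter_props:
  assumes T: "good T" and a: "\<alpha> \<in> alphabet T"
  shows "pi_t T \<alpha> \<in> {1..nsym T}" "top_letter T (pi_t T \<alpha>) = \<alpha>" "u_pt T (pi_t T \<alpha> - 1) = top_left T \<alpha>"
    "u_pt T (pi_t T \<alpha>) = top_left T \<alpha> + width T \<alpha>"
proof -
  let ?A = "alphabet T" and ?l = "top_left T"
  note g = good_facts[OF T]
  have sep: "?l x \<noteq> ?l y" if "x \<in> ?A" "y \<in> ?A" "x \<noteq> y" for x y
    using interval_partition_separated[OF g(4,3) that(1,2)] g(3) that by force
  have inj: "inj_on (pi_t T) ?A"
  proof (rule inj_onI)
    fix x y assume *: "x \<in> ?A" "y \<in> ?A" "pi_t T x = pi_t T y"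
    then have "?l x = ?l y"
      using position_less[OF g(1), of x y ?l] position_less[OF g(1), of y x ?l] unfolding pi_t_def by fastforce
    then show "x = y" using sep * by blast
  qed
  have tl: "top_letter T (pi_t T x) = x" if "x \<in> ?A" for x
    unfolding top_letter_def using inv_into_f_f[OF inj that] .
  show "top_letter T (pi_t T \<alpha>) = \<alpha>" by (rule tl[OF a])
  have p1: "1 \<le> pi_t T x" "pi_t T x \<le> nsym T" if "x \<in> ?A" for x
  proof -
    have "{x} \<subseteq> {y \<in> ?A. ?l y \<le> ?l x}" using that by auto
    then have "card {x} \<le> pi_t T x" unfolding pi_t_def position_def using g(1) by (intro card_mono) auto
    then show "1 \<le> pi_t T x" by simp
    show "pi_t T x \<le> nsym T" unfolding pi_t_def position_def using g(1) by (intro card_mono) auto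
  qed
  show "pi_t T \<alpha> \<in> {1..nsym T}" using p1[OF a] by simp
  have "pi_t T \<alpha> - 1 < nsym T" "Suc (pi_t T \<alpha> - 1) = pi_t T \<alpha>" using p1[OF a] by linarith+
  then show "u_pt T (pi_t T \<alpha> - 1) = ?l \<alpha>" using tl[OF a] unfolding u_pt_def by (simp only: if_True)
  show "u_pt T (pi_t T \<alpha>) = ?l \<alpha> + width T \<alpha>"
  proof (cases "?l \<alpha> + width T \<alpha> = right_end T")
    case True
    have "{y \<in> ?A. ?l y \<le> ?l \<alpha>} = ?A"
    proof -
      have "?l y \<le> ?l \<alpha>" if y: "y \<in> ?A" for y
      proof (rule ccontr)
        assume "\<not> ?thesis"
        then have "?l \<alpha> + width T \<alpha> \<le> ?l y" using interval_partition_separated[OF g(4,3) a y] by force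
        then show False using interval_partition_right[OF g(4) y] g(3) y True by force
      qed
      then show ?thesis by auto
    qed
    then have "pi_t T \<alpha> = nsym T" by (simp add: pi_t_def position_def)
    then show ?thesis using True by (simp add: u_pt_def)
  next
    case False
    obtain \<beta> where be: "\<beta> \<in> ?A" "?l \<beta> = ?l \<alpha> + width T \<alpha>" by (rule interval_partition_next[OF g(1,4,3) a False])
    have wa: "0 < width T \<alpha>" using g(3) a by blast
    have nb: "y = \<beta>" if y: "y \<in> ?A" "?l \<alpha> < ?l y" "?l y \<le> ?l \<beta>" for y
    proof -
      have "?l \<beta> \<le> ?l y" using interval_partition_separated[OF g(4,3) a y(1)] y(2) be(2) by force
      then show ?thesis using sep[OF y(1) be(1)] y(3) by force
    qed
    have ab: "?l \<alpha> \<le> ?l \<beta>" using be(2) wa by simp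
    have "?l y \<le> ?l \<beta> \<longleftrightarrow> y = \<beta> \<or> ?l y \<le> ?l \<alpha>" if "y \<in> ?A" for y
      using nb[OF that] ab by (meson not_le order_refl order_trans)
    then have "{y \<in> ?A. ?l y \<le> ?l \<beta>} = insert \<beta> {y \<in> ?A. ?l y \<le> ?l \<alpha>}" using be(1) by blast
    moreover have "\<beta> \<notin> {y \<in> ?A. ?l y \<le> ?l \<alpha>}" using be wa by simp
    ultimately have pb: "pi_t T \<beta> = Suc (pi_t T \<alpha>)" using g(1) by (simp add: pi_t_def position_def)
    then have "pi_t T \<alpha> < nsym T" using p1[OF be(1)] by simp
    then show ?thesis using tl[OF be(1)] pb be(2) by (simp add: u_pt_def)
  qed
qed

text \<open>Subtracting the constant \<xi> \<alpha> does not affect derivatives, so the norm of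
  \<phi> alone controls \<open>G'\<close>.\<close>

lemma coboundary_dataI:
  assumes T: "good T" and r: "1 < r" and phi: "\<phi> \<in> Cr_u T r" and coh: "cohomological_eq T \<phi> \<xi> \<psi>"
    and cont: "continuous_on {left_end T..right_end T} \<psi>" and M: "\<And>x. x \<in> {left_end T..right_end T} \<Longrightarrow> \<bar>\<psi> x\<bar> \<le> M"
      "Cr_u_norm T r \<phi> \<le> M"
  shows "coboundary_data T (min (r - 1) 1) M \<psi> (\<lambda>\<alpha> x. \<phi> (pi_t T \<alpha>) x - \<xi> \<alpha>)
    (\<lambda>\<alpha>. nth_deriv (top_left T \<alpha>) (top_left T \<alpha> + width T \<alpha>) 1 (\<phi> (pi_t T \<alpha>)))"
  unfolding coboundary_data_def
proof (intro conjI ballI cont M(1))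
  fix \<alpha> x assume a: "\<alpha> \<in> alphabet T" and x: "x \<in> cell T \<alpha>"
  note p = top_letter_props[OF T a]
  let ?a = "top_left T \<alpha>" and ?b = "top_left T \<alpha> + width T \<alpha>" and ?i = "pi_t T \<alpha>"
  have ab: "?a < ?b" using good_facts(3)[OF T] a by auto
  have "\<phi> ?i \<in> Cr_on r (u_pt T (?i - 1)) (u_pt T ?i)" using phi p(1) unfolding Cr_u_def by blast
  then have f: "\<phi> ?i \<in> Cr_on r ?a ?b" by (simp only: p(3,4))
  have "Cr_norm r ?a ?b (\<phi> ?i) \<le> Cr_u_norm T r \<phi>"
    unfolding Cr_u_norm_def by (intro Max_ge finite_imageI image_eqI[OF _ p(1)]) (simp_all only: p(3,4) finite_atLeastAtMost)
  then have nM: "Cr_norm r ?a ?b (\<phi> ?i) \<le> M" using M(2) by linarith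
  have x': "x \<in> {?a..?b}" using x by (simp add: cell_def)
  show "\<phi> ?i x - \<xi> \<alpha> = \<psi> (x + shift T \<alpha>) - \<psi> x"
  proof -
    have "x \<in> {u_pt T (?i - 1)..u_pt T ?i}" unfolding p(3,4) by (rule x')
    then have "\<phi> ?i x = const_family T \<xi> ?i x + \<psi> (x + shift T (top_letter T ?i)) - \<psi> x"
      using coh p(1) unfolding cohomological_eq_def by blast
    then show ?thesis unfolding const_family_def p(2) by simp
  qed
  note D = Cr_on_deriv[OF f ab r x']
  have "((\<lambda>x. \<phi> ?i x - \<xi> \<alpha>) has_real_derivative nth_deriv ?a ?b 1 (\<phi> ?i) x - 0) (at x within {?a..?b})"
    by (intro DERIV_diff D(1) DERIV_const)
  then show "((\<lambda>x. \<phi> ?i x - \<xi> \<alpha>) has_real_derivative nth_deriv ?a ?b 1 (\<phi> ?i) x) (at x within cell T \<alpha>)"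
    by (simp add: cell_def)
  show "\<bar>nth_deriv ?a ?b 1 (\<phi> ?i) x\<bar> \<le> M" using D(2) nM by linarith
  fix y assume "y \<in> cell T \<alpha>"
  then have "\<bar>nth_deriv ?a ?b 1 (\<phi> ?i) x - nth_deriv ?a ?b 1 (\<phi> ?i) y\<bar> \<le> Cr_norm r ?a ?b (\<phi> ?i) * \<bar>x - y\<bar> powr min (r - 1) 1"
    by (intro D(3)) (simp add: cell_def)
  also have "\<dots> \<le> M * \<bar>x - y\<bar> powr min (r - 1) 1" using nM by (intro mult_right_mono) auto
  finally show "\<bar>nth_deriv ?a ?b 1 (\<phi> ?i) x - nth_deriv ?a ?b 1 (\<phi> ?i) y\<bar> \<le> M * \<bar>x - y\<bar> powr min (r - 1) 1" .
qed

lemma Cr_u_norm_nonneg: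
  assumes T: "good T" and phi: "\<phi> \<in> Cr_u T r"
  shows "0 \<le> Cr_u_norm T r \<phi>"
proof -
  obtain \<alpha> where a: "\<alpha> \<in> alphabet T" using good_facts(6)[OF T] by blast
  note p = top_letter_props[OF T a]
  let ?a = "top_left T \<alpha>" and ?b = "top_left T \<alpha> + width T \<alpha>" and ?i = "pi_t T \<alpha>"
  have ab: "?a < ?b" using good_facts(3)[OF T] a by auto
  have "\<phi> ?i \<in> Cr_on r (u_pt T (?i - 1)) (u_pt T ?i)" using phi p(1) unfolding Cr_u_def by blast
  then have f: "\<phi> ?i \<in> Cr_on r ?a ?b" by (simp only: p(3,4))
  have "0 \<le> Cr_norm r ?a ?b (\<phi> ?i)" using Cr_norm_bounds(1)[OF f ab, of 0 ?a] ab by auto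
  also have "\<dots> \<le> Cr_u_norm T r \<phi>"
    unfolding Cr_u_norm_def by (intro Max_ge finite_imageI image_eqI[OF _ p(1)]) (simp_all only: p(3,4) finite_atLeastAtMost)
  finally show ?thesis .
qed

lemma holder_Cr_on:
  assumes del: "0 < \<delta>" "\<delta> < 1" and ab: "a < b" and f: "f \<in> Cr_on 0 a b" "Cr_norm 0 a b f \<le> K"
    and h: "\<And>x y. x \<in> {a..b} \<Longrightarrow> y \<in> {a..b} \<Longrightarrow> \<bar>f x - f y\<bar> \<le> H * \<bar>x - y\<bar> powr \<delta>"
  shows "f \<in> Cr_on \<delta> a b" "Cr_norm \<delta> a b f \<le> K + H"
proof -
  have fl: "\<lfloor>\<delta>\<rfloor> = 0" using del by linarith
  have fr: "frac \<delta> = \<delta>" by (simp add: frac_def fl)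
  have nI: "\<delta> \<notin> \<int>" using fr del by (metis frac_eq_0_iff less_irrefl)
  show "f \<in> Cr_on \<delta> a b" using f(1) h by (auto simp: Cr_on_def fl fr holder_on_def intro!: exI[of _ H])
  have "holder_seminorm \<delta> a b f \<le> H"
    unfolding holder_seminorm_def
  proof (rule cSup_least)
    show "{\<bar>f x - f y\<bar> / \<bar>x - y\<bar> powr \<delta> |x y. x \<in> {a..b} \<and> y \<in> {a..b} \<and> x \<noteq> y} \<noteq> {}"
    proof -
      have "\<bar>f a - f b\<bar> / \<bar>a - b\<bar> powr \<delta> \<in>
          {\<bar>f x - f y\<bar> / \<bar>x - y\<bar> powr \<delta> |x y. x \<in> {a..b} \<and> y \<in> {a..b} \<and> x \<noteq> y}"
        using ab by (intro CollectI exI[of _ a] exI[of _ b]) auto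
      then show ?thesis by blast
    qed
    fix z assume "z \<in> {\<bar>f x - f y\<bar> / \<bar>x - y\<bar> powr \<delta> |x y. x \<in> {a..b} \<and> y \<in> {a..b} \<and> x \<noteq> y}"
    then obtain x y where "x \<in> {a..b}" "y \<in> {a..b}" "x \<noteq> y" "z = \<bar>f x - f y\<bar> / \<bar>x - y\<bar> powr \<delta>" by blast
    then show "z \<le> H" using h[of x y] by (simp add: divide_le_eq)
  qed
  then show "Cr_norm \<delta> a b f \<le> K + H" using f(2) nI by (simp add: Cr_norm_def fl fr)
qed

theorem theorem3p10:
  fixes r \<theta> \<sigma> :: real
  assumes "r > 1" and "\<theta> > 0" and "\<sigma> > 0"
  shows "\<exists>\<delta>>0. \<forall>(T :: 'a iem) \<Gamma>\<^sub>u L\<^sub>0 L\<^sub>1.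
    restricted_Roth T \<and> theta_const T \<theta> \<and> sigma_const T \<sigma> \<and>
    fvec.subspace \<Gamma>\<^sub>u \<and> direct_sum (Gam_bd T) (Gam_s T) \<Gamma>\<^sub>u \<and>
    bounded_op (Cr_0 T r) (Cr_u_norm T r)
      {left_end T..right_end T} (Cr_on 0 (left_end T) (right_end T))
      (Cr_norm 0 (left_end T) (right_end T)) L\<^sub>0 \<and>
    bounded_op (Cr_0 T r) (Cr_u_norm T r) (alphabet T) \<Gamma>\<^sub>u (vnorm (alphabet T)) L\<^sub>1 \<and>
    (\<forall>\<phi>\<in>Cr_0 T r. cohomological_eq T \<phi> (L\<^sub>1 \<phi>) (L\<^sub>0 \<phi>) \<and>
       integral {left_end T..right_end T} (L\<^sub>0 \<phi>) = 0)
    \<longrightarrow>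
    bounded_op (Cr_0 T r) (Cr_u_norm T r)
      {left_end T..right_end T} (Cr_on \<delta> (left_end T) (right_end T))
      (Cr_norm \<delta> (left_end T) (right_end T)) L\<^sub>0"
proof -
  define \<rho> where "\<rho> = min (r - 1) 1"
  \<comment> \<open>The factor with 24 is the gain of \<open>deriv_bound\<close>, 256 comes from
    \<open>bsum_bound\<close> and 8 from \<open>holder_estimate\<close>. The exponent is fixed
    before \<open>T\<close> is introduced.\<close>
  define \<delta> where "\<delta> = min \<sigma> 1 * (\<rho> * min \<theta> 1 / 24) / 256 / 8"
  have rho: "0 < \<rho>" "\<rho> \<le> 1" using assms by (auto simp: \<rho>_def)
  have "\<rho> * min \<theta> 1 \<le> 1 * 1" using rho assms by (intro mult_mono) auto
  then have "min \<sigma> 1 * (\<rho> * min \<theta> 1) \<le> 1 * 1" using rho assms by (intro mult_mono) auto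
  then have del: "0 < \<delta>" "\<delta> < 1" using rho assms by (auto simp: \<delta>_def)
  show ?thesis
  proof (intro exI[of _ \<delta>] conjI del(1) allI impI; elim conjE)
    fix T :: "'a iem" and \<Gamma>\<^sub>u L\<^sub>0 L\<^sub>1
    let ?a = "left_end T" and ?b = "right_end T"
    assume R: "restricted_Roth T" "theta_const T \<theta>" "sigma_const T \<sigma>"
      and L0: "bounded_op (Cr_0 T r) (Cr_u_norm T r) {?a..?b} (Cr_on 0 ?a ?b) (Cr_norm 0 ?a ?b) L\<^sub>0"
      and coh: "\<forall>\<phi>\<in>Cr_0 T r. cohomological_eq T \<phi> (L\<^sub>1 \<phi>) (L\<^sub>0 \<phi>) \<and> integral {?a..?b} (L\<^sub>0 \<phi>) = 0"
    interpret roth T \<theta> \<sigma> using R by (rule roth.intro)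
    have ab: "?a < ?b" using good_facts(7)[OF good_T] .
    obtain K where K: "\<And>\<phi>. \<phi> \<in> Cr_0 T r \<Longrightarrow> Cr_norm 0 ?a ?b (L\<^sub>0 \<phi>) \<le> K * Cr_u_norm T r \<phi>"
      using L0 unfolding bounded_op_def by blast
    obtain C where C: "C > 0" "\<And>M \<psi> G G' x y. coboundary_data T \<rho> M \<psi> G G' \<Longrightarrow> x \<in> {?a..?b} \<Longrightarrow> y \<in> {?a..?b} \<Longrightarrow>
      \<bar>\<psi> x - \<psi> y\<bar> \<le> C * M * \<bar>x - y\<bar> powr \<delta>"
      using holder_estimate[OF rho] unfolding \<delta>_def by blast
    have main: "L\<^sub>0 \<phi> \<in> Cr_on \<delta> ?a ?b \<and> Cr_norm \<delta> ?a ?b (L\<^sub>0 \<phi>) \<le> (max K 1 + C * max K 1) * Cr_u_norm T r \<phi>"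
      if phi: "\<phi> \<in> Cr_0 T r" for \<phi>
    proof -
      \<comment> \<open>With the maximum, \<open>M\<close> dominates both the supremum of \<psi> and
        the norm of \<phi>, and it stays proportional to the latter.\<close>
      define M where "M = max K 1 * Cr_u_norm T r \<phi>"
      have phi': "\<phi> \<in> Cr_u T r" using phi by (simp add: Cr_0_def)
      have n0: "0 \<le> Cr_u_norm T r \<phi>" by (rule Cr_u_norm_nonneg[OF good_T phi'])
      have f: "L\<^sub>0 \<phi> \<in> Cr_on 0 ?a ?b" using L0 phi unfolding bounded_op_def by blast
      have "K * Cr_u_norm T r \<phi> \<le> M" unfolding M_def using n0 by (intro mult_right_mono) auto
      then have fM: "Cr_norm 0 ?a ?b (L\<^sub>0 \<phi>) \<le> M" using K[OF phi] by linarith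
      have "1 * Cr_u_norm T r \<phi> \<le> M" unfolding M_def using n0 by (intro mult_right_mono) auto
      then have nM: "Cr_u_norm T r \<phi> \<le> M" by simp
      have cont: "continuous_on {?a..?b} (L\<^sub>0 \<phi>)" using f by (simp add: Cr_on_def Ck_on_def)
      have bnd: "\<bar>L\<^sub>0 \<phi> x\<bar> \<le> M" if "x \<in> {?a..?b}" for x
        using Cr_norm_bounds(1)[OF f ab, of 0 x] that fM by simp
      have eq: "cohomological_eq T \<phi> (L\<^sub>1 \<phi>) (L\<^sub>0 \<phi>)" using coh phi by blast
      note cd = coboundary_dataI[OF good_T assms(1) phi' eq cont bnd nM, folded \<rho>_def]
      note H = holder_Cr_on[OF del ab f fM C(2)[OF cd]]
      show ?thesis using H by (simp add: M_def algebra_simps)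
    qed
    show "bounded_op (Cr_0 T r) (Cr_u_norm T r) {?a..?b} (Cr_on \<delta> ?a ?b) (Cr_norm \<delta> ?a ?b) L\<^sub>0"
      unfolding bounded_op_def
    proof (intro conjI)
      show "\<forall>\<phi>\<in>Cr_0 T r. L\<^sub>0 \<phi> \<in> Cr_on \<delta> ?a ?b" using main by blast
      show "\<forall>\<phi>\<in>Cr_0 T r. \<forall>\<phi>'\<in>Cr_0 T r. \<forall>a b. \<forall>p\<in>{?a..?b}.
        L\<^sub>0 (\<lambda>i x. a * \<phi> i x + b * \<phi>' i x) p = a * L\<^sub>0 \<phi> p + b * L\<^sub>0 \<phi>' p"
        using L0 unfolding bounded_op_def by blast
      show "\<exists>K. \<forall>\<phi>\<in>Cr_0 T r. Cr_norm \<delta> ?a ?b (L\<^sub>0 \<phi>) \<le> K * Cr_u_norm T r \<phi>" using main by blast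
    qed
  qed
qed

end
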